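(* Let $\underline{A}_2$ be the root lattice $A_2$ and let $S:=M_*(\varepsilon^* )=\mathbb{C}[E_4,E_6,\eta]$. Then $$J_{\mathrm{odd},\underline{A}_2}(\varepsilon^* )=S\,\vartheta_{\underline{A}_2},\qquad J_{\mathrm{even},\underline{A}_2}(\varepsilon^* )=S\,\mathcal{E}_{2,8}+S\,\mathcal{E}_{4,8}+S\,\mathcal{E}_{4,0}+S\,\mathcal{E}_{6,0}.$$ For the $S$-module $J_{\mathrm{even},\underline{A}_2}(\varepsilon^* )$ one has the exact sequence $$S^4\xrightarrow{\ \times B\ }S^4\xrightarrow{\ \times E\ }J_{\mathrm{even},\underline{A}_2}(\varepsilon^* )\longrightarrow0,$$ where $$B=\begin{pmatrix} E_6 & E_4 & -\eta^8 & 0 \\ {E_4^2} & E_6 & 0 & -\eta^8 \\ 12^3\eta^{16} & 0 & E_6 & -E_4 \\ 0 & 12^3\eta^{16} & -E_4^2 & E_6 \end{pmatrix},\qquad E=\begin{pmatrix} \mathcal{E}_{2,8} \\ \mathcal{E}_{4,8} \\ \mathcal{E}_{4,0} \\ \mathcal{E}_{6,0} \end{pmatrix},$$ and $\times M$ denotes the map $x=(x_1,\dots,x_4)\mapsto x_1m_1+\cdots+x_4m_4$ with $m_j$ the $j$-th row of $M$.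
   Context: Notation: $e(x)=e^{2\pi i x}$, $\mathbb{H}$ is the upper half plane, $q^a=e(a\tau)$ for $\tau\in\mathbb{H}$. $G=\mathrm{Mp}(2,\mathbb{Z})$ is the group of pairs $(A,w)$ with $A=\begin{pmatrix} a & b \\ c & d \end{pmatrix}\in\mathrm{SL}(2,\mathbb{Z})$ and $w$ a holomorphic function on $\mathbb{H}$ with $w(\tau)^2=c\tau+d$, with product $(A,w)(B,v)=(AB,\,w(B\tau)v(\tau))$. With $\eta(\tau)=q^{1/24}\prod_{m\ge1}(1-q^m)$, the linear character $\varepsilon$ of $G$, of order $24$, is $\varepsilon(A,w)=\eta(A\tau)/(\eta(\tau)w(\tau))$ (a constant). For an integral positive definite lattice $\underline{L}=(L,\beta)$ ($L$ free $\mathbb{Z}$-module of finite rank, $\beta$ a $\mathbb{Z}$-valued symmetric bilinear form, extended bilinearly to $R\otimes L$), put $\beta(x)=\frac12\beta(x,x)$ and $L^\bullet=\{r\in\mathbb{Q}\otimes L:\beta(r,x)\equiv\beta(x)\bmod\mathbb{Z}\text{ for all }x\in L\}$. $J_{k,\underline{L}}(\varepsilon^h)$ ($k\in\frac12\mathbb{Z}$, $h\in\mathbb{Z}$) is the space of holomorphic functions $\phi(\tau,z)$ on $\mathbb{H}\times(\mathbb{C}\otimes L)$ such that: (i) for all $\alpha=(A,w)\in G$ with $A=\begin{pmatrix} a & b \\ c & d \end{pmatrix}$: $\phi\bigl(A\tau,\frac{z}{c\tau+d}\bigr)e\bigl(\frac{-c\beta(z)}{c\tau+d}\bigr)w(\tau)^{-2k}=\varepsilon^h(\alpha)\phi(\tau,z)$;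 (ii) for all $x,y\in L$: $\phi(\tau,z+x\tau+y)\,e(\tau\beta(x)+\beta(x,z))=e(\beta(x+y))\,\phi(\tau,z)$; (iii) $\phi$ has a Fourier expansion $\phi=\sum_{m\in\frac h{24}+\mathbb{Z}}\sum_{r\in L^\bullet,\,m\ge\beta(r)}c(m,r)\,q^m e(\beta(z,r))$. $J_{\mathrm{even},\underline{L}}(\varepsilon^h)$ (resp. $J_{\mathrm{odd},\underline{L}}(\varepsilon^h)$) is the direct sum of all $J_{k,\underline{L}}(\varepsilon^h)$ with $k\in\frac12\mathbb{Z}$ and $k-\frac h2$ an even (resp. odd) integer; $J_{\mathrm{parity},\underline{L}}(\varepsilon^* )=\bigoplus_{h\bmod24}J_{\mathrm{parity},\underline{L}}(\varepsilon^h)$. $E_2=1-24\sum_{m\ge1}\sigma_1(m)q^m$, $E_4=1+240\sum_{m\ge1}\sigma_3(m)q^m$, $E_6=1-504\sum_{m\ge1}\sigma_5(m)q^m$. $M_*(\varepsilon^* )=\bigoplus_{0\le h\le23}\eta^h\,\mathbb{C}[E_4,E_6]=\mathbb{C}[E_4,E_6,\eta]$, acting by multiplication. $\underline{A}_2=(A_2,\beta)$ with $A_2=\mathbb{Z}^2$ (row vectors), $\beta(x,y)=xFy^t$, $F=\begin{pmatrix} 2 & 1 \\ 1 & 2 \end{pmatrix}$; its dual is $A_2^\sharp=\mathbb{Z}^2F^{-1}$. Identify $A_2^\sharp/A_2$ with $\mathbb{Z}/3\mathbb{Z}$ and let $\bigl(\frac r3\bigr)$, $r\in A_2^\sharp$,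 be the Legendre symbol modulo $3$ composed with the projection $A_2^\sharp\to A_2^\sharp/A_2\cong\mathbb{Z}/3\mathbb{Z}$. For $s\in A_2^\sharp$ let $A_2(s)$ be $1$ if $s\in A_2$ and $0$ otherwise, and $A_2^{\rm c}(s)=1-A_2(s)$. Put $\kappa(s,r)=A_2(s)A_2^{\rm c}(r)-A_2^{\rm c}(s)A_2(r)$. Define, for $\tau\in\mathbb{H}$, $z\in\mathbb{C}\otimes A_2$: $\vartheta_{\underline{A}_2}(\tau,z)=\sum_{r\in A_2^\sharp}\bigl(\frac r3\bigr)q^{\beta(r)}e(\beta(r,z))$; $\mathcal{E}_{2,8}(\tau,z)=\sum_{s,r\in A_2^\sharp}\kappa(s,r)\,q^{\beta(s)+\beta(r)}e(\beta(r,z))$; $\mathcal{E}_{4,8}(\tau,z)=-E_2(\tau)\mathcal{E}_{2,8}(\tau,z)+12\sum_{s,r\in A_2^\sharp}\kappa(s,r)\,\beta(s)\,q^{\beta(s)+\beta(r)}e(\beta(r,z))$; $\mathcal{E}_{4,0}=(E_6\,\mathcal{E}_{2,8}+E_4\,\mathcal{E}_{4,8})/\eta^8$; $\mathcal{E}_{6,0}=(E_4^2\,\mathcal{E}_{2,8}+E_6\,\mathcal{E}_{4,8})/\eta^8$. *)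

theory Defs
  imports
    "HOL-Analysis.Analysis"
    "HOL-Number_Theory.Residues"
    "HOL-Library.Function_Algebras"
begin

section \<open>The upper half plane and the metaplectic group\<close>

text \<open>
  The upper half plane is a type of its own, so that functions on it form a commutative ring under
  the pointwise operations of \<^theory>\<open>HOL-Library.Function_Algebras\<close>; in particular numerals,
  products and powers of functions below are pointwise.
\<close>

typedef uhp = "{t :: complex. Im t > 0}"
  morphisms of_uhp to_uhp
  by (rule exI[of _ \<i>]) simp

definition ee :: "complex \<Rightarrow> complex" where
  "ee x = exp (2 * of_real pi * \<i> * x)"

definition qpow :: "complex \<Rightarrow> uhp \<Rightarrow> complex" where
  "qpow a \<tau> = ee (a * of_uhp \<tau>)"

definition aut_factor :: "int^2^2 \<Rightarrow> uhp \<Rightarrow> complex" where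
  "aut_factor A \<tau> = of_int (A$2$1) * of_uhp \<tau> + of_int (A$2$2)"

text \<open>Only meaningful for determinant \<open>1\<close>, see \<open>of_uhp_moebius\<close>.\<close>

definition moebius :: "int^2^2 \<Rightarrow> uhp \<Rightarrow> uhp" where
  "moebius A \<tau> = to_uhp ((of_int (A$1$1) * of_uhp \<tau> + of_int (A$1$2)) / aut_factor A \<tau>)"

lemma of_uhp_moebius:
  assumes "det A = 1"
  shows "of_uhp (moebius A \<tau>) = (of_int (A$1$1) * of_uhp \<tau> + of_int (A$1$2)) / aut_factor A \<tau>"
proof -
  define t where "t = of_uhp \<tau>"
  have t: "Im t > 0"
    using of_uhp[of \<tau>] by (simp add: t_def)
  let ?a = "A$1$1" and ?b = "A$1$2" and ?c = "A$2$1" and ?d = "A$2$2"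
  have d: "?a * ?d - ?b * ?c = 1"
    using assms by (simp add: det_2)
  then have d': "real_of_int ?a * of_int ?d - of_int ?b * of_int ?c = 1"
    by (metis of_int_1 of_int_diff of_int_mult)
  let ?D = "of_int ?c * t + of_int ?d :: complex"
  have "?D \<noteq> 0"
  proof
    assume D: "?D = 0"
    then have "Im ?D = 0" "Re ?D = 0"
      by simp_all
    then have "?c = 0" "?d = 0"
      using t by auto
    then show False
      using d by simp
  qed
  then have pos: "(Re ?D)\<^sup>2 + (Im ?D)\<^sup>2 > 0"
    using complex_eq_iff sum_power2_gt_zero_iff by fastforce
  have "Im ((of_int ?a * t + of_int ?b) / ?D)
      = (of_int ?a * of_int ?d - of_int ?b * of_int ?c) * Im t / ((Re ?D)\<^sup>2 + (Im ?D)\<^sup>2)"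
    by (simp add: Im_divide) (simp add: algebra_simps)
  also have "\<dots> > 0"
    using t pos d' by simp
  finally show ?thesis
    by (simp add: moebius_def aut_factor_def to_uhp_inverse t_def)
qed

text \<open>The underlying set of \<open>Mp(2,\<int>)\<close>.\<close>

definition Mp2Z :: "((int^2^2) \<times> (uhp \<Rightarrow> complex)) set" where
  "Mp2Z = {(A, w). det A = 1 \<and> (\<lambda>t. w (to_uhp t)) holomorphic_on {t. Im t > 0} \<and>
                   (\<forall>\<tau>. (w \<tau>)\<^sup>2 = aut_factor A \<tau>)}"

section \<open>Modular forms\<close>

definition eta :: "uhp \<Rightarrow> complex" where
  "eta \<tau> = qpow (1/24) \<tau> * prodinf (\<lambda>m. 1 - qpow (of_nat (Suc m)) \<tau>)"

text \<open>The character \<open>\<epsilon>\<close>; the quotient below is independent of \<open>\<tau>\<close>.\<close>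

definition eps :: "(int^2^2) \<times> (uhp \<Rightarrow> complex) \<Rightarrow> complex" where
  "eps = (\<lambda>(A, w). THE c. \<forall>\<tau>. eta (moebius A \<tau>) / (eta \<tau> * w \<tau>) = c)"

definition divisor_sigma :: "nat \<Rightarrow> nat \<Rightarrow> nat" where
  "divisor_sigma k m = (\<Sum>d | d dvd m. d ^ k)"

definition sigma_series :: "nat \<Rightarrow> uhp \<Rightarrow> complex" where
  "sigma_series k \<tau> = (\<Sum>m. of_nat (divisor_sigma k (Suc m)) * qpow (of_nat (Suc m)) \<tau>)"

definition E2 :: "uhp \<Rightarrow> complex" where
  "E2 \<tau> = 1 - 24 * sigma_series 1 \<tau>"

definition E4 :: "uhp \<Rightarrow> complex" where
  "E4 \<tau> = 1 + 240 * sigma_series 3 \<tau>"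

definition E6 :: "uhp \<Rightarrow> complex" where
  "E6 \<tau> = 1 - 504 * sigma_series 5 \<tau>"

text \<open>The \<open>\<complex>\<close>-algebra of functions generated by a set of functions.\<close>

inductive_set generated_algebra :: "('a \<Rightarrow> complex) set \<Rightarrow> ('a \<Rightarrow> complex) set"
  for X :: "('a \<Rightarrow> complex) set"
where
  const: "(\<lambda>_. c) \<in> generated_algebra X"
| gen: "f \<in> X \<Longrightarrow> f \<in> generated_algebra X"
| add: "f \<in> generated_algebra X \<Longrightarrow> g \<in> generated_algebra X \<Longrightarrow> f + g \<in> generated_algebra X"
| mult: "f \<in> generated_algebra X \<Longrightarrow> g \<in> generated_algebra X \<Longrightarrow> f * g \<in> generated_algebra X"

text \<open>\<open>M\<^sub>*(\<epsilon>\<^sup>*) = \<complex>[E\<^sub>4, E\<^sub>6, \<eta>]\<close>.\<close>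

definition modular_ring :: "(uhp \<Rightarrow> complex) set" where
  "modular_ring = generated_algebra {E4, E6, eta}"

section \<open>Lattices\<close>

text \<open>
  A lattice of rank \<open>n\<close> is given by its Gram matrix \<open>F\<close> with respect to a basis: \<open>L = \<int>\<^sup>n\<close>, and
  \<open>R \<otimes> L = R\<^sup>n\<close> for \<open>R = \<rat>, \<complex>\<close>, with \<open>\<beta>(x, y) = x F y\<^sup>t\<close>. The definitions are meant for \<open>F\<close> symmetric
  and positive definite.
\<close>

definition bil :: "int^'n^'n \<Rightarrow> 'a::comm_ring_1^'n \<Rightarrow> 'a^'n \<Rightarrow> 'a" where
  "bil F x y = (\<Sum>i\<in>UNIV. \<Sum>j\<in>UNIV. x$i * of_int (F$i$j) * y$j)"

definition half_norm :: "int^'n^'n \<Rightarrow> 'a::field_char_0^'n \<Rightarrow> 'a" where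
  "half_norm F x = bil F x x / 2"

definition of_int_vec :: "int^'n \<Rightarrow> 'a::ring_1^'n" where
  "of_int_vec x = (\<chi> i. of_int (x$i))"

definition of_rat_vec :: "rat^'n \<Rightarrow> 'a::field_char_0^'n" where
  "of_rat_vec x = (\<chi> i. of_rat (x$i))"

definition lattice_points :: "(rat^'n) set" where
  "lattice_points = range of_int_vec"

definition dual_lattice :: "int^'n^'n \<Rightarrow> (rat^'n) set" where
  "dual_lattice F = {r. \<forall>x \<in> lattice_points. bil F r x \<in> \<int>}"

text \<open>The set \<open>L\<^sup>\<bullet>\<close>, which is the dual lattice if \<open>L\<close> is even.\<close>

definition shadow :: "int^'n^'n \<Rightarrow> (rat^'n) set" where
  "shadow F = {r. \<forall>x \<in> lattice_points. bil F r x - half_norm F x \<in> \<int>}"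

section \<open>Jacobi forms\<close>

text \<open>
  Holomorphy in several variables: complex differentiability at every point, i.e. real
  differentiability with a \<open>\<complex>\<close>-linear derivative.
\<close>

definition holomorphic_uhp :: "(uhp \<times> (complex^'n) \<Rightarrow> complex) \<Rightarrow> bool" where
  "holomorphic_uhp \<phi> \<longleftrightarrow>
     (\<forall>\<tau> z. \<exists>D. ((\<lambda>(t, v). \<phi> (to_uhp t, v)) has_derivative D) (at (of_uhp \<tau>, z)) \<and>
                (\<forall>c t v. D (c * t, c *s v) = c * D (t, v)))"

text \<open>
  The space \<open>J\<^bsub>k,L\<^esub>(\<epsilon>\<^sup>h)\<close>. The weight \<open>k\<close> is a half integer, so \<open>w(\<tau>)\<^bsup>-2k\<^esup>\<close> is an integral power.
\<close>

definition jacobi_forms ::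
    "int^'n^'n \<Rightarrow> rat \<Rightarrow> int \<Rightarrow> (uhp \<times> (complex^'n) \<Rightarrow> complex) set" where
  "jacobi_forms F k h = {\<phi>. 2 * k \<in> \<int> \<and> holomorphic_uhp \<phi> \<and>
     (\<forall>(A, w) \<in> Mp2Z. \<forall>\<tau> z.
        \<phi> (moebius A \<tau>, (1 / aut_factor A \<tau>) *s z) *
          ee (- of_int (A$2$1) * half_norm F z / aut_factor A \<tau>) * (w \<tau> powi (- \<lfloor>2 * k\<rfloor>)) =
        (eps (A, w) powi h) * \<phi> (\<tau>, z)) \<and>
     (\<forall>(x :: int^'n) (y :: int^'n) \<tau> z.
        \<phi> (\<tau>, z + of_uhp \<tau> *s of_int_vec x + of_int_vec y) *
          ee (of_uhp \<tau> * half_norm F (of_int_vec x) + bil F (of_int_vec x) z) =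
        ee (half_norm F (of_int_vec (x + y))) * \<phi> (\<tau>, z)) \<and>
     (\<exists>c :: rat \<Rightarrow> rat^'n \<Rightarrow> complex. \<forall>\<tau> z.
        ((\<lambda>(m, r). c m r * qpow (of_rat m) \<tau> * ee (bil F z (of_rat_vec r))) has_sum \<phi> (\<tau>, z))
          {(m, r). m - of_int h / 24 \<in> \<int> \<and> r \<in> shadow F \<and> m \<ge> half_norm F r})}"

text \<open>The complex linear span of a set of functions.\<close>

definition cscale :: "complex \<Rightarrow> ('a \<Rightarrow> complex) \<Rightarrow> 'a \<Rightarrow> complex" where
  "cscale c f = (\<lambda>x. c * f x)"

interpretation cfun: vector_space cscale
  by unfold_locales (simp_all add: cscale_def fun_eq_iff algebra_simps)

text \<open>
  The direct sums over weights and characters are taken inside the space of all functions on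
  \<open>\<H> \<times> (\<complex> \<otimes> L)\<close>, where the spaces of Jacobi forms are linearly independent. The argument \<open>P\<close> is the
  parity (\<open>even\<close> or \<open>odd\<close>) imposed on \<open>k - h/2\<close>.
\<close>

definition jacobi_parity_char ::
    "(int \<Rightarrow> bool) \<Rightarrow> int^'n^'n \<Rightarrow> int \<Rightarrow> (uhp \<times> (complex^'n) \<Rightarrow> complex) set" where
  "jacobi_parity_char P F h =
     cfun.span (\<Union>{jacobi_forms F k h | k. \<exists>m. k - of_int h / 2 = of_int m \<and> P m})"

definition jacobi_parity ::
    "(int \<Rightarrow> bool) \<Rightarrow> int^'n^'n \<Rightarrow> (uhp \<times> (complex^'n) \<Rightarrow> complex) set" where
  "jacobi_parity P F = cfun.span (\<Union>h\<in>{0..23}. jacobi_parity_char P F h)"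

text \<open>Multiplication of a function of \<open>(\<tau>, z)\<close> by a function of \<open>\<tau>\<close>.\<close>

definition act :: "(uhp \<Rightarrow> complex) \<Rightarrow> (uhp \<times> 'v \<Rightarrow> complex) \<Rightarrow> uhp \<times> 'v \<Rightarrow> complex"
  (infixr \<open>\<odot>\<close> 75) where
  "f \<odot> \<phi> = (\<lambda>(\<tau>, z). f \<tau> * \<phi> (\<tau>, z))"

section \<open>The lattice \<open>A\<^sub>2\<close>\<close>

definition A2 :: "int^2^2" where
  "A2 = vector [vector [2, 1], vector [1, 2]]"

definition A2_dual :: "(rat^2) set" where
  "A2_dual = dual_lattice A2"

lemma bil_A2:
  "bil A2 x y = 2 * (x$1 * y$1) + x$1 * y$2 + x$2 * y$1 + 2 * (x$2 * y$2)"
  by (simp add: bil_def A2_def sum_2 algebra_simps)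

lemma mem_A2_dual: "r \<in> A2_dual \<longleftrightarrow> 2 * r$1 + r$2 \<in> \<int> \<and> r$1 + 2 * r$2 \<in> \<int>"
proof
  assume r: "r \<in> A2_dual"
  have 1: "bil A2 r (of_int_vec x) \<in> \<int>" for x
    using r by (auto simp: A2_dual_def dual_lattice_def lattice_points_def)
  show "2 * r$1 + r$2 \<in> \<int> \<and> r$1 + 2 * r$2 \<in> \<int>"
    using 1[of "vector [1, 0]"] 1[of "vector [0, 1]"] by (simp add: bil_A2 of_int_vec_def)
next
  assume r: "2 * r$1 + r$2 \<in> \<int> \<and> r$1 + 2 * r$2 \<in> \<int>"
  have "bil A2 r (of_int_vec x) = (2 * r$1 + r$2) * of_int (x$1) + (r$1 + 2 * r$2) * of_int (x$2)"
    for x :: "int^2"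
    by (simp add: bil_A2 of_int_vec_def algebra_simps)
  then show "r \<in> A2_dual"
    using r by (auto simp: A2_dual_def dual_lattice_def lattice_points_def)
qed

lemma A2_dual_eq:
  "A2_dual = {of_int_vec x v* matrix_inv ((\<chi> i j. of_int (A2$i$j)) :: rat^2^2) | x. True}"
proof -
  let ?F = "(\<chi> i j. of_int (A2$i$j)) :: rat^2^2"
  have "det ?F \<noteq> 0"
    by (simp add: det_2 A2_def)
  then have "\<exists>G. ?F ** G = mat 1 \<and> G ** ?F = mat 1"
    unfolding invertible_det_nz[symmetric] invertible_def .
  from someI_ex[OF this]
  have inv: "?F ** matrix_inv ?F = mat 1" "matrix_inv ?F ** ?F = mat 1"
    unfolding matrix_inv_def by blast+
  have F: "r v* ?F = vector [2 * r$1 + r$2, r$1 + 2 * r$2]" for r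
    by (simp add: vec_eq_iff forall_2 vector_matrix_mult_def sum_2 A2_def algebra_simps)
  have "r \<in> A2_dual \<longleftrightarrow> (\<exists>x. r = of_int_vec x v* matrix_inv ?F)" for r
  proof -
    have "r = of_int_vec x v* matrix_inv ?F \<longleftrightarrow> r v* ?F = of_int_vec x" for x :: "int^2"
    proof
      assume "r = of_int_vec x v* matrix_inv ?F"
      then show "r v* ?F = of_int_vec x"
        by (simp only: vector_matrix_mul_assoc inv vector_matrix_mul_rid)
    next
      assume "r v* ?F = of_int_vec x"
      then have "of_int_vec x v* matrix_inv ?F = r v* ?F v* matrix_inv ?F"
        by simp
      also have "\<dots> = r"
        by (simp only: vector_matrix_mul_assoc inv vector_matrix_mul_rid)
      finally show "r = of_int_vec x v* matrix_inv ?F" ..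
    qed
    moreover have "r \<in> A2_dual \<longleftrightarrow> (\<exists>x :: int^2. r v* ?F = of_int_vec x)"
    proof
      assume "r \<in> A2_dual"
      then obtain m n where mn: "2 * r$1 + r$2 = of_int m" "r$1 + 2 * r$2 = of_int n"
        unfolding mem_A2_dual by (meson Ints_cases)
      have "r v* ?F = of_int_vec (vector [m, n])"
        unfolding F mn by (simp add: vec_eq_iff forall_2 of_int_vec_def)
      then show "\<exists>x :: int^2. r v* ?F = of_int_vec x" ..
    next
      assume "\<exists>x :: int^2. r v* ?F = of_int_vec x"
      then obtain x :: "int^2" where x: "r v* ?F = of_int_vec x" ..
      have "2 * r$1 + r$2 = of_int (x$1)" "r$1 + 2 * r$2 = of_int (x$2)"
        using arg_cong[OF x, of "\<lambda>v. v$1"] arg_cong[OF x, of "\<lambda>v. v$2"]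
        unfolding F by (simp_all add: of_int_vec_def)
      then show "r \<in> A2_dual"
        unfolding mem_A2_dual by simp
    qed
    ultimately show ?thesis
      by blast
  qed
  then show ?thesis
    by blast
qed

text \<open>
  There are two identifications of \<open>A\<^sub>2\<^sup>\<sharp>/A\<^sub>2\<close> with \<open>\<int>/3\<int>\<close>, differing by a sign. They are represented by
  functions \<open>\<psi>\<close> on \<open>A\<^sub>2\<^sup>\<sharp>\<close> which, read modulo \<open>3\<close>, are surjective homomorphisms with kernel \<open>A\<^sub>2\<close>.
\<close>

definition A2_identification :: "(rat^2 \<Rightarrow> int) \<Rightarrow> bool" where
  "A2_identification \<psi> \<longleftrightarrow>
     (\<forall>r \<in> A2_dual. \<forall>s \<in> A2_dual. [\<psi> (r + s) = \<psi> r + \<psi> s] (mod 3)) \<and>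
     (\<forall>r \<in> A2_dual. [\<psi> r = 0] (mod 3) \<longleftrightarrow> r \<in> lattice_points) \<and>
     (\<forall>j. \<exists>r \<in> A2_dual. [\<psi> r = j] (mod 3))"

lemma A2_identification_exists: "A2_identification (\<lambda>r. \<lfloor>3 * r$1\<rfloor>)"
  unfolding A2_identification_def
proof (intro conjI ballI allI)
  have dual: "\<exists>m n :: int. 3 * r$1 = of_int n \<and> r$2 = of_int m - 2 * r$1" if "r \<in> A2_dual" for r
  proof -
    obtain m k where "2 * r$1 + r$2 = of_int m" "r$1 + 2 * r$2 = of_int k"
      using \<open>r \<in> A2_dual\<close> by (auto simp: mem_A2_dual elim!: Ints_cases)
    then have "3 * r$1 = of_int (2 * m - k)" "r$2 = of_int m - 2 * r$1"
      unfolding of_int_diff of_int_mult of_int_numeral by linarith+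
    then show ?thesis
      by blast
  qed
  show "[\<lfloor>3 * (r + s)$1\<rfloor> = \<lfloor>3 * r$1\<rfloor> + \<lfloor>3 * s$1\<rfloor>] (mod 3)" if r: "r \<in> A2_dual" and s: "s \<in> A2_dual" for r s
  proof -
    obtain m n where "3 * r$1 = of_int m" "3 * s$1 = of_int n"
      using dual[OF r] dual[OF s] by blast
    moreover from this have "3 * (r + s)$1 = of_int (m + n)"
      by (simp add: distrib_left)
    ultimately show ?thesis
      by (simp only: floor_of_int cong_refl)
  qed
  show "[\<lfloor>3 * r$1\<rfloor> = 0] (mod 3) \<longleftrightarrow> r \<in> lattice_points" if r: "r \<in> A2_dual" for r
  proof
    assume "[\<lfloor>3 * r$1\<rfloor> = 0] (mod 3)"
    moreover obtain m n where mn: "3 * r$1 = of_int n" "r$2 = of_int m - 2 * r$1"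
      using dual[OF r] by blast
    ultimately obtain j where "n = 3 * j"
      by (auto simp: cong_0_iff)
    then have 1: "r$1 = of_int j"
      using mn(1) by simp
    then have "r$2 = of_int (m - 2 * j)"
      using mn(2) by simp
    with 1 have "r = of_int_vec (vector [j, m - 2 * j])"
      by (simp add: vec_eq_iff forall_2 of_int_vec_def)
    then show "r \<in> lattice_points"
      by (auto simp: lattice_points_def)
  next
    assume "r \<in> lattice_points"
    then obtain j where "r$1 = of_int j"
      by (auto simp: lattice_points_def of_int_vec_def)
    then have "3 * r$1 = of_int (3 * j)"
      by simp
    then have "\<lfloor>3 * r$1\<rfloor> = 3 * j"
      by (simp only: floor_of_int)
    then show "[\<lfloor>3 * r$1\<rfloor> = 0] (mod 3)"
      by (simp add: cong_0_iff)
  qed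
  show "\<exists>r \<in> A2_dual. [\<lfloor>3 * r$1\<rfloor> = j] (mod 3)" for j
  proof
    let ?r = "vector [of_int j / 3, of_int j / 3] :: rat^2"
    show "[\<lfloor>3 * ?r$1\<rfloor> = j] (mod 3)"
      by simp
    show "?r \<in> A2_dual"
      by (simp add: mem_A2_dual)
  qed
qed

definition theta_A2 :: "(rat^2 \<Rightarrow> int) \<Rightarrow> uhp \<times> (complex^2) \<Rightarrow> complex" where
  "theta_A2 \<psi> = (\<lambda>(\<tau>, z). \<Sum>\<^sub>\<infinity>r\<in>A2_dual.
     of_int (Legendre (\<psi> r) 3) * qpow (of_rat (half_norm A2 r)) \<tau> * ee (bil A2 (of_rat_vec r) z))"

definition kappa :: "rat^2 \<Rightarrow> rat^2 \<Rightarrow> complex" where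
  "kappa s r = of_bool (s \<in> lattice_points) * of_bool (r \<notin> lattice_points)
             - of_bool (s \<notin> lattice_points) * of_bool (r \<in> lattice_points)"

definition E28 :: "uhp \<times> (complex^2) \<Rightarrow> complex" where
  "E28 = (\<lambda>(\<tau>, z). \<Sum>\<^sub>\<infinity>(s, r)\<in>A2_dual \<times> A2_dual.
     kappa s r * qpow (of_rat (half_norm A2 s + half_norm A2 r)) \<tau> * ee (bil A2 (of_rat_vec r) z))"

definition E48 :: "uhp \<times> (complex^2) \<Rightarrow> complex" where
  "E48 = (\<lambda>(\<tau>, z). - E2 \<tau> * E28 (\<tau>, z) + 12 * (\<Sum>\<^sub>\<infinity>(s, r)\<in>A2_dual \<times> A2_dual.
     kappa s r * of_rat (half_norm A2 s) *
       qpow (of_rat (half_norm A2 s + half_norm A2 r)) \<tau> * ee (bil A2 (of_rat_vec r) z)))"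

definition E40 :: "uhp \<times> (complex^2) \<Rightarrow> complex" where
  "E40 = (\<lambda>(\<tau>, z). (E6 \<tau> * E28 (\<tau>, z) + E4 \<tau> * E48 (\<tau>, z)) / eta \<tau> ^ 8)"

definition E60 :: "uhp \<times> (complex^2) \<Rightarrow> complex" where
  "E60 = (\<lambda>(\<tau>, z). ((E4 \<tau>)\<^sup>2 * E28 (\<tau>, z) + E6 \<tau> * E48 (\<tau>, z)) / eta \<tau> ^ 8)"

section \<open>The presentation\<close>

definition B_matrix :: "(uhp \<Rightarrow> complex)^4^4" where
  "B_matrix = vector
     [vector [E6,            E4,            - (eta ^ 8), 0],
      vector [E4 ^ 2,        E6,            0,           - (eta ^ 8)],
      vector [12^3 * eta^16, 0,             E6,          - E4],
      vector [0,             12^3 * eta^16, - (E4 ^ 2),  E6]]"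

definition E_column :: "(uhp \<times> (complex^2) \<Rightarrow> complex)^4" where
  "E_column = vector [E28, E48, E40, E60]"

definition modular_ring4 :: "((uhp \<Rightarrow> complex)^4) set" where
  "modular_ring4 = {x. \<forall>i. x$i \<in> modular_ring}"

definition times_B :: "(uhp \<Rightarrow> complex)^4 \<Rightarrow> (uhp \<Rightarrow> complex)^4" where
  "times_B x = x v* B_matrix"

definition times_E :: "(uhp \<Rightarrow> complex)^4 \<Rightarrow> uhp \<times> (complex^2) \<Rightarrow> complex" where
  "times_E x = (\<Sum>i\<in>UNIV. x$i \<odot> E_column$i)"

text \<open>Exactness of \<open>M \<rightarrow> N \<rightarrow> P\<close> at \<open>N\<close>.\<close>

definition exact_at ::
    "'a set \<Rightarrow> ('a \<Rightarrow> 'b) \<Rightarrow> 'b set \<Rightarrow> ('b \<Rightarrow> 'c::zero) \<Rightarrow> 'c set \<Rightarrow> bool" where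
  "exact_at M f N g P \<longleftrightarrow> f \<in> M \<rightarrow> N \<and> g \<in> N \<rightarrow> P \<and> f ` M = {y \<in> N. g y = 0}"

end

theory Submission
  imports Defs "HOL-Complex_Analysis.Complex_Analysis"
begin

text \<open>
  The elliptic law makes the Fourier coefficients of a Jacobi form depend, up to an exponential factor,
  only on the class of the index modulo \<open>A\<^sub>2\<close>. So a Jacobi form is a combination of the theta series of
  the three classes, with power series in \<open>q\<close> as coefficients (\<open>theta_decomposition\<close>). Since \<open>- 1\<close> acts
  on the variable \<open>z\<close> by the parity, an odd form is a multiple of the odd theta series \<open>ThN\<close>, and an even
  form is a combination \<open>h0 Th0 + h1 ThP\<close>, where \<open>Th0\<close> sums over the lattice and \<open>ThP\<close> over the rest of
  its dual. After division by a power of \<open>eta\<close> the metaplectic group and the character disappear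
  (\<open>jacobi_law_metaplectic\<close>), and only the inversion \<open>t \<mapsto> - 1 / t\<close> and translations matter. Under the
  inversion the theta series are multiplied by explicit matrices.

  In the odd case the coefficient of \<open>ThN\<close> is therefore a power of \<open>eta\<close> times a form of level one. In the
  even case \<open>E28\<close> and \<open>E48\<close> form another basis, whose determinant is a multiple of \<open>eta ^ 8\<close>
  (\<open>wronskian\<close>), and Cramer's rule gives \<open>\<phi> = eta ^ (h - 8) (F E28 + G E48)\<close> with forms \<open>F\<close>, \<open>G\<close> of level
  one and of weights \<open>m + 2\<close>, \<open>m\<close>. For \<open>h \<ge> 8\<close> nothing else is needed. For \<open>h < 8\<close> the expansion of \<open>\<phi>\<close>
  forces \<open>F\<close> and \<open>G\<close> to have the same constant term. Then \<open>(F, G)\<close> is a combination of \<open>(E6, E4)\<close> and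
  \<open>(E4\<^sup>2, E6)\<close> modulo the discriminant \<open>eta ^ 24\<close> (\<open>mform_pair\<close>), and these two pairs are \<open>E40\<close> and \<open>E60\<close>.

  As \<open>E28\<close> and \<open>E48\<close> are independent, a relation between the four generators amounts to two equations
  over the ring (\<open>times_E_zero_iff\<close>). The ring is free over \<open>\<complex>[E4, E6]\<close> with basis \<open>1, eta, \<dots>, eta ^ 23\<close>,
  and comparison of components shows that the rows of \<open>B\<close> generate all relations (\<open>times_B_exact\<close>).
\<close>

no_notation fps_nth (infixl "$" 75)

abbreviation (input) i2pi :: complex where
  "i2pi \<equiv> 2 * of_real pi * \<i>"

section \<open>Exponential sums\<close>

lemma has_sum_minus:
  fixes f g :: "'i \<Rightarrow> 'a::real_normed_field"
  assumes "(f has_sum a) I" "(g has_sum b) I"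
  shows "((\<lambda>i. f i - g i) has_sum (a - b)) I"
  using has_sum_add[OF assms(1) has_sum_uminusI[OF assms(2)]] by simp

lemma ee_0 [simp]: "ee 0 = 1" by (simp add: ee_def)

lemma ee_add: "ee (x + y) = ee x * ee y" by (simp add: ee_def exp_add ring_distribs)

lemma ee_minus: "ee (- x) = inverse (ee x)" by (simp add: ee_def exp_minus)

lemma ee_diff: "ee (x - y) = ee x / ee y" by (simp add: ee_def exp_diff ring_distribs)

lemma ee_nonzero [simp]: "ee x \<noteq> 0" by (simp add: ee_def)

lemma ee_of_int [simp]: "ee (of_int n) = 1" unfolding ee_def exp_eq_1 by auto

lemma ee_Ints: "x \<in> \<int> \<Longrightarrow> ee x = 1" by (auto elim!: Ints_cases)

lemma ee_of_nat [simp]: "ee (of_nat n) = 1" using ee_of_int[of "int n"] by simp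

lemma ee_1 [simp]: "ee 1 = 1" using ee_of_nat[of 1] by simp

lemma ee_mult_of_nat: "ee (of_nat n * x) = ee x ^ n" by (induction n) (simp_all add: ring_distribs ee_add)

lemma norm_ee: "norm (ee x) = exp (- (2 * pi * Im x))" by (simp add: ee_def)

lemma norm_ee_less_1: "Im t > 0 \<Longrightarrow> norm (ee t) < 1" by (simp add: norm_ee)

lemma ee_surj:
  assumes "w \<noteq> 0"
  obtains t where "ee t = w"
proof
  show "ee (Ln w / (i2pi)) = w" using assms by (simp add: ee_def)
qed

lemma ee_surj_disc:
  assumes "w \<noteq> 0" "norm w < 1"
  obtains t where "Im t > 0" "ee t = w"
proof -
  obtain t where t: "ee t = w" using ee_surj assms(1) by blast
  with assms(2) have "exp (- (2 * pi * Im t)) < 1" by (metis norm_ee)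
  then have "Im t > 0" by (simp add: zero_less_mult_iff)
  with t show thesis using that by blast
qed

lemma DERIV_ee [derivative_intros]:
  assumes "(f has_field_derivative D) (at x within S)"
  shows "((\<lambda>x. ee (f x)) has_field_derivative (i2pi * D * ee (f x))) (at x within S)"
  unfolding ee_def by (rule derivative_eq_intros assms refl | simp)+

lemma holomorphic_on_ee [holomorphic_intros]:
  "f holomorphic_on S \<Longrightarrow> (\<lambda>x. ee (f x)) holomorphic_on S"
  unfolding ee_def by (intro holomorphic_intros)

lemma norm_ee_remainder:
  "norm (ee u - 1 - i2pi * u) \<le> exp (2 * pi * norm u) * (2 * pi * norm u)\<^sup>2"
proof -
  have "norm (i2pi * u) = 2 * pi * norm u" by (simp add: norm_mult)
  then show ?thesis using Taylor_exp_field[of "i2pi * u" 1]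
    by (simp add: ee_def power2_eq_square algebra_simps)
qed

lemma sq_mult_exp_le:
  fixes c d :: real
  assumes "c \<ge> 0" "d > 0"
  shows "(2 * pi * c)\<^sup>2 * exp (c * d / 2) \<le> (4 * pi / d)\<^sup>2 * 2 * exp (c * d)"
proof -
  have "x\<^sup>2 \<le> 2 * exp x" if "x \<ge> 0" for x :: real
    using exp_lower_Taylor_quadratic[OF that] that by (simp add: power2_eq_square)
  then have "(c * d / 2)\<^sup>2 \<le> 2 * exp (c * d / 2)" using assms by simp
  then have "(4 * pi / d)\<^sup>2 * (c * d / 2)\<^sup>2 \<le> (4 * pi / d)\<^sup>2 * (2 * exp (c * d / 2))"
    by (intro mult_left_mono) auto
  moreover have "(4 * pi / d)\<^sup>2 * (c * d / 2)\<^sup>2 = (2 * pi * c)\<^sup>2"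
    using assms by (simp add: field_simps power2_eq_square)
  ultimately have "(2 * pi * c)\<^sup>2 \<le> (4 * pi / d)\<^sup>2 * (2 * exp (c * d / 2))" by simp
  then have "(2 * pi * c)\<^sup>2 * exp (c * d / 2) \<le> (4 * pi / d)\<^sup>2 * (2 * exp (c * d / 2)) * exp (c * d / 2)"
    by (intro mult_right_mono) auto
  also have "\<dots> = (4 * pi / d)\<^sup>2 * 2 * (exp (c * d / 2) * exp (c * d / 2))" by simp
  also have "exp (c * d / 2) * exp (c * d / 2) = exp (c * d)" by (simp flip: exp_add)
  finally show ?thesis .
qed

text \<open>
  All series below are sums of exponentials of linear forms. Such a sum may be differentiated term
  by term as soon as it still converges after its terms are enlarged by \<open>exp (d * c i)\<close>, where \<open>c i\<close>
  bounds the \<open>i\<close>-th form: the second order remainders of the single terms then add up.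
\<close>

lemma exponential_sum:
  fixes \<Lambda> :: "'i \<Rightarrow> 'a::real_normed_vector \<Rightarrow> complex"
  assumes lin: "\<And>i. i \<in> I \<Longrightarrow> bounded_linear (\<Lambda> i)"
    and bnd: "\<And>i h. i \<in> I \<Longrightarrow> norm (\<Lambda> i h) \<le> c i * norm h"
    and c: "\<And>i. i \<in> I \<Longrightarrow> c i \<ge> 0" and d: "d > 0"
    and sm: "(\<lambda>i. norm (a i * ee (\<Lambda> i x)) * exp (d * c i)) summable_on I"
  shows has_derivative_exponential_sum:
      "((\<lambda>y. \<Sum>\<^sub>\<infinity>i\<in>I. a i * ee (\<Lambda> i y)) has_derivative
         (\<lambda>h. \<Sum>\<^sub>\<infinity>i\<in>I. i2pi * \<Lambda> i h * (a i * ee (\<Lambda> i x)))) (at x)"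
    and summable_exponential_sum_deriv:
      "(\<lambda>i. i2pi * \<Lambda> i h * (a i * ee (\<Lambda> i x))) summable_on I"
    and summable_exponential_sum:
      "(\<lambda>i. a i * ee (\<Lambda> i x)) summable_on I"
proof -
  define b where "b i = norm (a i * ee (\<Lambda> i x))" for i
  have b0: "b i \<ge> 0" for i
    by (simp add: b_def)
  have 1: "(\<lambda>i. b i * exp (d * c i)) summable_on I" using sm by (simp add: b_def)
  define K where "K = (4 * pi / d)\<^sup>2 * 2"
  have 2: "(\<lambda>i. b i * ((2 * pi * c i)\<^sup>2 * exp (c i * d / 2))) summable_on I"
  proof (rule summable_on_comparison_test)
    show "(\<lambda>i. K * (b i * exp (d * c i))) summable_on I" by (intro summable_on_cmult_right 1)
    show "b i * ((2 * pi * c i)\<^sup>2 * exp (c i * d / 2)) \<le> K * (b i * exp (d * c i))" if "i \<in> I" for i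
      using mult_left_mono[OF sq_mult_exp_le[OF c[OF that] d] b0[of i]] by (simp add: K_def algebra_simps)
  qed (use b0 in auto)
  have 3: "(\<lambda>i. b i) summable_on I"
  proof (rule summable_on_comparison_test[OF 1])
    show "b i \<le> b i * exp (d * c i)" if "i \<in> I" for i
      using mult_left_mono[of 1 "exp (d * c i)" "b i"] b0[of i] c[OF that] d by simp
  qed (use b0 in auto)
  have 4: "(\<lambda>i. b i * (2 * pi * c i)) summable_on I"
  proof (rule summable_on_comparison_test)
    show "(\<lambda>i. b i + b i * ((2 * pi * c i)\<^sup>2 * exp (c i * d / 2))) summable_on I"
      by (intro summable_on_add 2 3)
    fix i assume i: "i \<in> I"
    have "x \<le> 1 + x\<^sup>2" for x :: real
      using zero_le_power2[of "x - 1/2"] by (simp add: power2_eq_square algebra_simps)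
    also have "1 + (2 * pi * c i)\<^sup>2 \<le> 1 + (2 * pi * c i)\<^sup>2 * exp (c i * d / 2)"
      using mult_left_mono[of 1 "exp (c i * d / 2)" "(2 * pi * c i)\<^sup>2"] c[OF i] d by simp
    finally have "2 * pi * c i \<le> 1 + (2 * pi * c i)\<^sup>2 * exp (c i * d / 2)" .
    from mult_left_mono[OF this b0[of i]]
    show "b i * (2 * pi * c i) \<le> b i + b i * ((2 * pi * c i)\<^sup>2 * exp (c i * d / 2))"
      by (simp add: ring_distribs)
  qed (use b0 c in auto)
  let ?T = "\<lambda>y i. a i * ee (\<Lambda> i y)"
  let ?D = "\<lambda>h i. i2pi * \<Lambda> i h * (a i * ee (\<Lambda> i x))"
  have D_le: "norm (?D h i) \<le> b i * (2 * pi * c i) * norm h" if "i \<in> I" for h i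
    using mult_left_mono[OF bnd[OF that, of h], of "2 * pi * b i"] b0[of i]
    by (simp add: norm_mult b_def algebra_simps)
  have D_abs: "(\<lambda>i. norm (?D h i)) summable_on I" for h
    by (rule summable_on_comparison_test[OF summable_on_cmult_left[OF 4, of "norm h"]])
       (use D_le in auto)
  then have D: "(\<lambda>i. ?D h i) summable_on I" for h
    by (rule abs_summable_summable)
  then show "(\<lambda>i. ?D h i) summable_on I" .
  have T0: "(\<lambda>i. ?T x i) summable_on I"
    by (rule abs_summable_summable) (use 3 in \<open>simp add: b_def\<close>)
  then show "(\<lambda>i. ?T x i) summable_on I" .
  define r where "r = d / (4 * pi)"
  have r: "r > 0" using d by (simp add: r_def)
  define M where "M = (\<Sum>\<^sub>\<infinity>i\<in>I. b i * ((2 * pi * c i)\<^sup>2 * exp (c i * d / 2)))"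
  have rem: "norm (?T (x + h) i - ?T x i - ?D h i)
      \<le> (b i * ((2 * pi * c i)\<^sup>2 * exp (c i * d / 2))) * (norm h)\<^sup>2"
    if i: "i \<in> I" and h: "norm h \<le> r" for i h
  proof -
    interpret bounded_linear "\<Lambda> i"
      by (rule lin[OF i])
    have "?T (x + h) i - ?T x i - ?D h i
        = (a i * ee (\<Lambda> i x)) * (ee (\<Lambda> i h) - 1 - i2pi * \<Lambda> i h)"
      by (simp add: add ee_add algebra_simps)
    then have "norm (?T (x + h) i - ?T x i - ?D h i)
        = b i * norm (ee (\<Lambda> i h) - 1 - i2pi * \<Lambda> i h)"
      by (simp add: norm_mult b_def)
    also have "\<dots> \<le> b i * (exp (2 * pi * norm (\<Lambda> i h)) * (2 * pi * norm (\<Lambda> i h))\<^sup>2)"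
      by (intro mult_left_mono norm_ee_remainder b0)
    also have "\<dots> \<le> b i * (exp (c i * d / 2) * (2 * pi * (c i * norm h))\<^sup>2)"
    proof (intro mult_left_mono mult_mono power_mono)
      have "norm (\<Lambda> i h) \<le> c i * norm h" by (rule bnd[OF i])
      also have "\<dots> \<le> c i * r" by (intro mult_left_mono h c i)
      finally have "2 * pi * norm (\<Lambda> i h) \<le> 2 * pi * (c i * r)" by simp
      also have "\<dots> = c i * d / 2" by (simp add: r_def)
      finally show "exp (2 * pi * norm (\<Lambda> i h)) \<le> exp (c i * d / 2)" by simp
    qed (use b0 bnd[OF i] in auto)
    finally show ?thesis by (simp add: power_mult_distrib algebra_simps)
  qed
  have rem_sum: "(\<lambda>i. (b i * ((2 * pi * c i)\<^sup>2 * exp (c i * d / 2))) * (norm h)\<^sup>2) summable_on I" for h :: 'a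
    by (intro summable_on_cmult_left 2)
  have T: "(\<lambda>i. ?T (x + h) i) summable_on I" if h: "norm h \<le> r" for h
  proof -
    have "(\<lambda>i. norm (?T (x + h) i - ?T x i - ?D h i)) summable_on I"
      by (rule summable_on_comparison_test[OF rem_sum[of h]]) (use rem h in auto)
    then have "(\<lambda>i. ?T (x + h) i - ?T x i - ?D h i) summable_on I" by (rule abs_summable_summable)
    then have "(\<lambda>i. (?T (x + h) i - ?T x i - ?D h i) + (?T x i + ?D h i)) summable_on I"
      by (intro summable_on_add T0 D)
    then show ?thesis by simp
  qed
  let ?F = "\<lambda>y. infsum (?T y) I" and ?F' = "\<lambda>h. infsum (?D h) I"
  have quad: "norm (?F (x + h) - ?F x - ?F' h) \<le> M * (norm h)\<^sup>2" if h: "norm h \<le> r" for h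
  proof -
    have "((\<lambda>i. ?T (x + h) i - ?T x i - ?D h i) has_sum (?F (x + h) - ?F x - ?F' h)) I" using T[OF h] T0 D
      by (intro has_sum_minus has_sum_infsum) auto
    moreover have "((\<lambda>i. (b i * ((2 * pi * c i)\<^sup>2 * exp (c i * d / 2))) * (norm h)\<^sup>2) has_sum M * (norm h)\<^sup>2) I"
      unfolding M_def by (intro has_sum_cmult_left has_sum_infsum 2)
    ultimately show ?thesis by (rule norm_infsum_le) (use rem h in auto)
  qed
  have "bounded_linear ?F'"
  proof (rule bounded_linear_intro)
    fix h k :: 'a and s :: real
    have "?F' (h + k) = (\<Sum>\<^sub>\<infinity>i\<in>I. ?D h i + ?D k i)"
      by (intro infsum_cong) (simp add: linear_add[OF bounded_linear.linear[OF lin]] algebra_simps)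
    also have "\<dots> = ?F' h + ?F' k" by (intro infsum_add D)
    finally show "?F' (h + k) = ?F' h + ?F' k" .
    have "?F' (s *\<^sub>R h) = (\<Sum>\<^sub>\<infinity>i\<in>I. of_real s * ?D h i)"
      by (intro infsum_cong) (simp add: linear_cmul[OF bounded_linear.linear[OF lin]] scaleR_conv_of_real algebra_simps)
    also have "\<dots> = of_real s * ?F' h" by (intro infsum_cmult_right) (use D in auto)
    finally show "?F' (s *\<^sub>R h) = s *\<^sub>R ?F' h" by (simp add: scaleR_conv_of_real)
    show "norm (?F' h) \<le> norm h * (\<Sum>\<^sub>\<infinity>i\<in>I. b i * (2 * pi * c i))"
    proof (rule norm_infsum_le)
      show "((\<lambda>i. ?D h i) has_sum ?F' h) I" by (intro has_sum_infsum D)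
      show "((\<lambda>i. norm h * (b i * (2 * pi * c i))) has_sum norm h * (\<Sum>\<^sub>\<infinity>i\<in>I. b i * (2 * pi * c i))) I"
        by (intro has_sum_cmult_right has_sum_infsum 4)
    qed (use D_le in \<open>auto simp: algebra_simps\<close>)
  qed
  moreover have "(\<lambda>h. norm (?F (x + h) - ?F x - ?F' h) / norm h) \<midarrow>0\<rightarrow> 0"
  proof (rule Lim_null_comparison)
    show "\<forall>\<^sub>F h in at 0. norm (norm (?F (x + h) - ?F x - ?F' h) / norm h) \<le> M * norm h"
    proof (rule eventually_mono)
      show "\<forall>\<^sub>F h :: 'a in at 0. h \<noteq> 0 \<and> dist h 0 < r" using r by (auto simp: eventually_at)
      show "norm (norm (?F (x + h) - ?F x - ?F' h) / norm h) \<le> M * norm h"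
        if "h \<noteq> 0 \<and> dist h 0 < r" for h
        using quad[of h] that by (simp add: divide_simps power2_eq_square mult.assoc)
    qed
    show "((\<lambda>h :: 'a. M * norm h) \<longlongrightarrow> 0) (at 0)" by (auto intro!: tendsto_eq_intros)
  qed
  ultimately show "(?F has_derivative ?F') (at x)" by (simp add: has_derivative_at)
qed

text \<open>The same in one complex variable, for exponents \<open>l i * t\<close>.\<close>

lemma
  fixes l :: "'i \<Rightarrow> complex"
  assumes d: "d > 0" and sm: "(\<lambda>i. norm (a i * ee (l i * t)) * exp (d * norm (l i))) summable_on I"
  shows DERIV_exponential_sum:
      "((\<lambda>t. \<Sum>\<^sub>\<infinity>i\<in>I. a i * ee (l i * t)) has_field_derivative
         (\<Sum>\<^sub>\<infinity>i\<in>I. i2pi * l i * (a i * ee (l i * t)))) (at t)"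
    and summable_exponential_sum_deriv1:
      "(\<lambda>i. i2pi * l i * (a i * ee (l i * t))) summable_on I"
    and summable_exponential_sum1: "(\<lambda>i. a i * ee (l i * t)) summable_on I"
proof -
  have lin: "bounded_linear (\<lambda>t. l i * t)" for i
    by (rule bounded_linear_mult_right)
  note * = exponential_sum[of I "\<lambda>i t. l i * t" "\<lambda>i. norm (l i)" d a t, OF lin _ _ d sm]
  have S: "(\<lambda>i. i2pi * (l i * h) * (a i * ee (l i * t))) summable_on I" for h
    by (rule *(2)) (auto simp: norm_mult)
  then show S1: "(\<lambda>i. i2pi * l i * (a i * ee (l i * t))) summable_on I" using S[of 1] by simp
  show "(\<lambda>i. a i * ee (l i * t)) summable_on I" by (rule *(3)) (auto simp: norm_mult)
  have "((\<lambda>t. \<Sum>\<^sub>\<infinity>i\<in>I. a i * ee (l i * t)) has_derivative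
      (\<lambda>h. \<Sum>\<^sub>\<infinity>i\<in>I. i2pi * (l i * h) * (a i * ee (l i * t)))) (at t)"
    by (rule *(1)) (auto simp: norm_mult)
  moreover have "(\<Sum>\<^sub>\<infinity>i\<in>I. i2pi * (l i * h) * (a i * ee (l i * t)))
      = (\<Sum>\<^sub>\<infinity>i\<in>I. i2pi * l i * (a i * ee (l i * t))) * h" for h
    by (subst infsum_cmult_left[symmetric]) (use S1 in \<open>auto simp: algebra_simps\<close>)
  ultimately show "((\<lambda>t. \<Sum>\<^sub>\<infinity>i\<in>I. a i * ee (l i * t)) has_field_derivative
         (\<Sum>\<^sub>\<infinity>i\<in>I. i2pi * l i * (a i * ee (l i * t)))) (at t)"
    by (simp add: has_field_derivative_def)
qed

section \<open>Power series in \<open>q\<close>\<close>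

lemma power_family_holomorphic:
  fixes c :: "'i \<Rightarrow> complex" and n :: "'i \<Rightarrow> nat"
  assumes sm: "\<And>w. w \<noteq> 0 \<Longrightarrow> norm w < 1 \<Longrightarrow> (\<lambda>i. c i * w ^ n i) summable_on I"
  shows "(\<lambda>w. \<Sum>\<^sub>\<infinity>i\<in>I. c i * w ^ n i) holomorphic_on ball 0 1"
proof -
  define C where "C k = (\<Sum>\<^sub>\<infinity>i\<in>{i\<in>I. n i = k}. c i)" for k
  have sm0: "c summable_on {i\<in>I. n i = k}" for k
  proof -
    have "(\<lambda>i. c i * (1/2) ^ n i) summable_on {i\<in>I. n i = k}" by (rule summable_on_subset[OF sm]) auto
    also have "?this \<longleftrightarrow> (\<lambda>i. c i * (1/2) ^ k) summable_on {i\<in>I. n i = k}"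
      by (rule summable_on_cong) auto
    finally have "(\<lambda>i. c i * (1/2) ^ k) summable_on {i\<in>I. n i = k}" .
    then have "(\<lambda>i. c i * (1/2) ^ k * 2 ^ k) summable_on {i\<in>I. n i = k}" by (rule summable_on_cmult_left)
    then show ?thesis by (simp add: power_one_over field_simps)
  qed
  have "(\<lambda>k. C k * (w - 0) ^ k) sums (\<Sum>\<^sub>\<infinity>i\<in>I. c i * w ^ n i)" if "w \<in> ball 0 1" for w
  proof (cases "w = 0")
    case True
    have "(\<Sum>\<^sub>\<infinity>i\<in>I. c i * w ^ n i) = (\<Sum>\<^sub>\<infinity>i\<in>{i\<in>I. n i = 0}. c i)"
      by (rule infsum_cong_neutral) (auto simp: True)
    then show ?thesis using powser_sums_zero[of C] by (simp add: True C_def)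
  next
    case False
    let ?S = "SIGMA k:UNIV. {i\<in>I. n i = k}"
    have "bij_betw snd ?S I" by (rule bij_betwI[of _ _ _ "\<lambda>i. (n i, i)"]) auto
    then have "((\<lambda>x. c (snd x) * w ^ n (snd x)) has_sum (\<Sum>\<^sub>\<infinity>i\<in>I. c i * w ^ n i)) ?S"
      using has_sum_reindex_bij_betw[of snd ?S I "\<lambda>i. c i * w ^ n i"] sm[of w] False that by auto
    moreover have "((\<lambda>i. c i * w ^ n i) has_sum C k * w ^ k) {i\<in>I. n i = k}" for k
    proof -
      have "((\<lambda>i. c i * w ^ k) has_sum C k * w ^ k) {i\<in>I. n i = k}"
        unfolding C_def by (intro has_sum_cmult_left has_sum_infsum sm0)
      also have "?this \<longleftrightarrow> ?thesis" by (rule has_sum_cong) auto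
      finally show ?thesis .
    qed
    ultimately have "((\<lambda>k. C k * w ^ k) has_sum (\<Sum>\<^sub>\<infinity>i\<in>I. c i * w ^ n i)) UNIV"
      by (intro has_sum_SigmaD[where g = "\<lambda>k. C k * w ^ k"]) auto
    then show ?thesis by (simp add: has_sum_imp_sums)
  qed
  then show ?thesis by (rule power_series_holomorphic)
qed

text \<open>
  A function on the upper half plane of the form \<open>q\<^bsup>x\<^esup> P(q)\<close> with \<open>P\<close> holomorphic on the unit disc; the
  value \<open>P 0\<close> is its leading coefficient.
\<close>

definition q_series :: "real \<Rightarrow> (complex \<Rightarrow> complex) \<Rightarrow> (complex \<Rightarrow> complex) \<Rightarrow> bool" where
  "q_series x P f \<longleftrightarrow> P holomorphic_on ball 0 1 \<and> (\<forall>t. Im t > 0 \<longrightarrow> f t = ee (of_real x * t) * P (ee t))"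

lemma q_series_add:
  "q_series x P f \<Longrightarrow> q_series x Q g \<Longrightarrow> q_series x (\<lambda>w. P w + Q w) (\<lambda>t. f t + g t)"
  by (auto simp: q_series_def ring_distribs intro!: holomorphic_intros)

lemma q_series_diff:
  "q_series x P f \<Longrightarrow> q_series x Q g \<Longrightarrow> q_series x (\<lambda>w. P w - Q w) (\<lambda>t. f t - g t)"
  by (auto simp: q_series_def ring_distribs intro!: holomorphic_intros)

lemma q_series_cmult: "q_series x P f \<Longrightarrow> q_series x (\<lambda>w. c * P w) (\<lambda>t. c * f t)"
  by (auto simp: q_series_def intro!: holomorphic_intros)

lemma q_series_mult:
  "q_series x P f \<Longrightarrow> q_series y Q g \<Longrightarrow> q_series (x + y) (\<lambda>w. P w * Q w) (\<lambda>t. f t * g t)"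
  by (auto simp: q_series_def ring_distribs ee_add intro!: holomorphic_intros)

lemma q_series_power: "q_series x P f \<Longrightarrow> q_series (of_nat n * x) (\<lambda>w. P w ^ n) (\<lambda>t. f t ^ n)"
  by (auto simp: q_series_def power_mult_distrib mult.assoc ee_mult_of_nat intro!: holomorphic_intros)

lemma q_series_inverse:
  "q_series x P f \<Longrightarrow> (\<And>w. norm w < 1 \<Longrightarrow> P w \<noteq> 0) \<Longrightarrow> q_series (- x) (\<lambda>w. inverse (P w)) (\<lambda>t. inverse (f t))"
  by (auto simp: q_series_def ee_minus field_simps intro!: holomorphic_intros)

lemma q_series_const: "q_series 0 (\<lambda>_. c) (\<lambda>_. c)" by (auto simp: q_series_def)

lemma q_series_shift:
  "q_series x P f \<Longrightarrow> q_series (x - of_nat n) (\<lambda>w. w ^ n * P w) f"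
  by (auto simp: q_series_def ring_distribs ee_diff ee_mult_of_nat intro!: holomorphic_intros)

lemma q_series_Suc:
  assumes "q_series x P f" "P 0 = 0"
  obtains Q where "q_series (x + 1) Q f" "\<And>w. norm w < 1 \<Longrightarrow> P w = w * Q w" "Q 0 = deriv P 0"
proof -
  have P: "P holomorphic_on ball 0 1" using assms by (simp add: q_series_def)
  define Q where "Q w = (if w = 0 then deriv P 0 else P w / w)" for w
  have "(P has_field_derivative deriv P 0) (at 0)" using P by (intro holomorphic_derivI[of _ "ball 0 1"]) auto
  then have "(\<lambda>w. P w / w) \<midarrow>0\<rightarrow> deriv P 0"
    using assms(2) by (simp add: has_field_derivative_iff)
  then have "Q holomorphic_on ball 0 1" unfolding Q_def using P
    by (intro removable_singularity) (auto intro!: holomorphic_intros intro: holomorphic_on_subset)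
  moreover have PQ: "P w = w * Q w" for w
    using assms(2) by (simp add: Q_def)
  ultimately have "q_series (x + 1) Q f" using assms(1) by (simp add: q_series_def PQ ring_distribs ee_add)
  then show thesis using that PQ by (metis Q_def)
qed

lemma q_series_translate: "q_series x P f \<Longrightarrow> Im t > 0 \<Longrightarrow> f (t + 1) = ee (of_real x) * f t"
  by (auto simp: q_series_def ring_distribs ee_add)

lemma q_series_holomorphic:
  assumes "q_series x P f"
  shows "f holomorphic_on {t. Im t > 0}"
proof -
  have "(P \<circ> ee) holomorphic_on {t. Im t > 0}" using assms unfolding q_series_def
    by (intro holomorphic_on_compose_gen[of _ _ _ "ball 0 1"])
       (auto intro!: holomorphic_intros norm_ee_less_1)
  then have "(\<lambda>t. ee (of_real x * t) * (P \<circ> ee) t) holomorphic_on {t. Im t > 0}"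
    by (intro holomorphic_intros)
  then show ?thesis by (rule holomorphic_transform) (use assms in \<open>auto simp: q_series_def\<close>)
qed

lemma q_series_has_sum:
  assumes "q_series x P f" "Im t > 0"
  shows "((\<lambda>n. (deriv ^^ n) P 0 / fact n * ee ((of_real x + of_nat n) * t)) has_sum f t) UNIV"
proof -
  have P: "P holomorphic_on ball 0 1" using assms by (simp add: q_series_def)
  define A where "A n = (deriv ^^ n) P 0 / fact n" for n
  have sums: "(\<lambda>n. A n * w ^ n) sums P w" if "norm w < 1" for w
    using holomorphic_power_series[OF P, of w] that by (simp add: A_def)
  have "summable (\<lambda>n. norm (A n * w ^ n))" if w: "norm w < 1" for w
  proof -
    obtain r where r: "norm w < r" "r < 1" using w dense by blast
    moreover have "summable (\<lambda>n. A n * of_real r ^ n)"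
      using sums[of "of_real r"] r norm_ge_zero[of w] by (intro sums_summable) auto
    ultimately show ?thesis using powser_insidea[of A "of_real r" w] by auto
  qed
  from this[OF norm_ee_less_1[OF assms(2)]] have "((\<lambda>n. A n * ee t ^ n) has_sum P (ee t)) UNIV"
    by (intro norm_summable_imp_has_sum sums norm_ee_less_1[OF assms(2)])
  then have "((\<lambda>n. ee (of_real x * t) * (A n * ee t ^ n)) has_sum ee (of_real x * t) * P (ee t)) UNIV"
    by (rule has_sum_cmult_right)
  also have "(\<lambda>n. ee (of_real x * t) * (A n * ee t ^ n)) = (\<lambda>n. A n * ee ((of_real x + of_nat n) * t))"
    using ee_mult_of_nat[of _ t] by (simp add: fun_eq_iff ring_distribs ee_add mult_ac)
  also have "ee (of_real x * t) * P (ee t) = f t" using assms by (simp add: q_series_def)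
  finally show ?thesis unfolding A_def .
qed

lemma q_series_family:
  fixes c :: "'i \<Rightarrow> complex" and n :: "'i \<Rightarrow> nat"
  assumes "\<And>t. Im t > 0 \<Longrightarrow> ((\<lambda>i. c i * ee ((of_real x + of_nat (n i)) * t)) has_sum f t) I"
  shows "q_series x (\<lambda>w. \<Sum>\<^sub>\<infinity>i\<in>I. c i * w ^ n i) f"
  unfolding q_series_def
proof (intro conjI allI impI power_family_holomorphic)
  have *: "((\<lambda>i. c i * ee t ^ n i) has_sum (f t / ee (of_real x * t))) I" if "Im t > 0" for t
    using has_sum_divide_const[OF assms[OF that], of "ee (of_real x * t)"]
    by (simp add: ring_distribs ee_add ee_mult_of_nat)
  show "(\<lambda>i. c i * w ^ n i) summable_on I" if "w \<noteq> 0" "norm w < 1" for w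
    by (rule ee_surj_disc[OF that]) (use * in \<open>auto simp: summable_on_def\<close>)
  show "f t = ee (of_real x * t) * (\<Sum>\<^sub>\<infinity>i\<in>I. c i * ee t ^ n i)" if "Im t > 0" for t
    using infsumI[OF *[OF that]] by simp
qed

section \<open>Fourier series\<close>

lemma summable_exp_abs_int:
  assumes "c > 0"
  shows "(\<lambda>k::int. exp (- (c * \<bar>of_int k\<bar>)) :: real) summable_on UNIV"
proof -
  have "summable (\<lambda>n. exp (- c) ^ n)" using assms by (intro summable_geometric) simp
  then have s: "(\<lambda>n::nat. exp (- c) ^ n) summable_on UNIV" by (simp add: summable_on_UNIV_nonneg_real_iff)
  have e: "exp (- (c * \<bar>real n\<bar>)) = exp (- c) ^ n" for n :: nat
    by (simp add: exp_of_nat_mult[symmetric] mult_ac)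
  have s: "(\<lambda>n::nat. exp (- (c * real n))) summable_on UNIV" using s e by simp
  have "(\<lambda>k::int. exp (- (c * \<bar>of_int k\<bar>)) :: real) summable_on (range int)"
    using s by (subst summable_on_reindex) (auto simp: o_def e)
  moreover have "(\<lambda>k::int. exp (- (c * \<bar>of_int k\<bar>)) :: real) summable_on (range (\<lambda>n. - int n))"
    using s by (subst summable_on_reindex) (auto simp: o_def e inj_on_def)
  ultimately have "(\<lambda>k::int. exp (- (c * \<bar>of_int k\<bar>)) :: real) summable_on (range int \<union> range (\<lambda>n. - int n))"
    by (rule summable_on_union)
  moreover have "range int \<union> range (\<lambda>n. - int n) = UNIV" by (auto intro: int_cases2)
  ultimately show ?thesis by simp
qed

lemma summable_on_product_real:
  fixes f :: "'i \<Rightarrow> real" and g :: "'j \<Rightarrow> real"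
  assumes "f summable_on A" "g summable_on B" "\<And>x. x \<in> A \<Longrightarrow> f x \<ge> 0" "\<And>y. y \<in> B \<Longrightarrow> g y \<ge> 0"
  shows "(\<lambda>(x, y). f x * g y) summable_on A \<times> B"
proof (rule summable_on_SigmaI[where g = "\<lambda>x. f x * infsum g B"])
  show "((\<lambda>y. case (x, y) of (x, y) \<Rightarrow> f x * g y) has_sum f x * infsum g B) B" for x
    using assms(2) by (auto intro!: has_sum_cmult_right)
qed (use assms in \<open>auto intro!: summable_on_cmult_left\<close>)

lemma has_sum_product_complex:
  fixes f :: "'i \<Rightarrow> complex" and g :: "'j \<Rightarrow> complex"
  assumes "(f has_sum a) A" "(g has_sum b) B"
  shows "((\<lambda>(x, y). f x * g y) has_sum a * b) (A \<times> B)"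
proof (rule has_sum_SigmaI[where g = "\<lambda>x. f x * b"])
  show "((\<lambda>y. case (x, y) of (x, y) \<Rightarrow> f x * g y) has_sum f x * b) B" for x
    using assms(2) by (auto intro!: has_sum_cmult_right)
  show "((\<lambda>x. f x * b) has_sum a * b) A" using assms(1) by (rule has_sum_cmult_left)
  have "(\<lambda>x. norm (f x)) summable_on A" "(\<lambda>x. norm (g x)) summable_on B"
    using assms by (auto simp flip: summable_on_iff_abs_summable_on_complex simp: summable_on_def)
  then have "(\<lambda>(x, y). norm (f x) * norm (g y)) summable_on A \<times> B"
    by (rule summable_on_product_real) auto
  then show "(\<lambda>(x, y). f x * g y) summable_on A \<times> B"
    by (simp add: summable_on_iff_abs_summable_on_complex case_prod_unfold norm_mult)
qed

lemma has_sum_finite_sum: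
  fixes f :: "'j \<Rightarrow> 'i \<Rightarrow> 'a::topological_comm_monoid_add"
  assumes "finite A" "\<And>j. j \<in> A \<Longrightarrow> (f j has_sum s j) I"
  shows "((\<lambda>i. \<Sum>j\<in>A. f j i) has_sum (\<Sum>j\<in>A. s j)) I"
  using assms by (induction rule: finite_induct) (auto intro!: has_sum_add)

lemma sum_roots_of_unity:
  fixes N :: nat and k :: int
  assumes "N > 0"
  shows "(\<Sum>u<N. ee (of_int k * of_real (real u / real N))) = of_nat N * of_bool (int N dvd k)"
proof -
  define w where "w = ee (of_int k / of_nat N)"
  have *: "ee (of_int k * of_real (real u / real N)) = w ^ u" for u
    by (simp add: w_def ee_mult_of_nat[symmetric] mult_ac)
  have wN: "w ^ N = 1" using assms by (simp add: w_def ee_mult_of_nat[symmetric])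
  show ?thesis
  proof (cases "int N dvd k")
    case True
    then obtain j where "k = int N * j" ..
    then have "w = 1" using assms by (simp add: w_def)
    with True show ?thesis by (simp only: *) simp
  next
    case False
    have "w \<noteq> 1"
    proof
      assume "w = 1"
      then obtain n :: int where "2 * pi * (of_int k / of_nat N) = of_int (2 * n) * pi"
        by (auto simp: w_def ee_def exp_eq_1)
      then have "of_int k = (of_int (n * int N) :: real)" using assms by (simp add: field_simps)
      then have "k = n * int N" by (simp only: of_int_eq_iff)
      with False show False
        by simp
    qed
    then show ?thesis using False wN by (simp only: * sum_gp_strict) simp
  qed
qed

text \<open>
  Coefficients of an absolutely convergent Fourier series are recovered by averaging over the
  points \<open>u / N\<close>: this isolates the frequencies divisible by \<open>N\<close>, and all of these except \<open>0\<close>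
  disappear in the limit.
\<close>

lemma fourier_unique_zero:
  fixes a :: "int \<Rightarrow> complex"
  assumes sum: "\<And>x::real. ((\<lambda>k. a k * ee (of_int k * of_real x)) has_sum 0) UNIV"
  shows "a 0 = 0"
proof -
  have "a summable_on UNIV" using sum[of 0] by (simp add: summable_on_def) blast
  then have abs: "(\<lambda>k. norm (a k)) summable_on UNIV" by (simp add: summable_on_iff_abs_summable_on_complex)
  have "norm (a 0) \<le> e" if e: "e > 0" for e
  proof -
    define S where "S = (\<Sum>\<^sub>\<infinity>k. norm (a k))"
    have "((\<lambda>k. norm (a k)) has_sum S) UNIV" unfolding S_def using abs by (rule has_sum_infsum)
    then have "\<forall>\<^sub>F G in finite_subsets_at_top UNIV. dist (\<Sum>k\<in>G. norm (a k)) S < e"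
      unfolding has_sum_def by (rule tendstoD) fact
    then obtain F where F: "finite F" "\<And>G. finite G \<Longrightarrow> F \<subseteq> G \<Longrightarrow> dist (\<Sum>k\<in>G. norm (a k)) S < e"
      unfolding eventually_finite_subsets_at_top by auto
    define N where "N = Suc (nat (Max (insert 0 (abs ` F))))"
    have N0: "N > 0" by (simp add: N_def)
    have FN: "\<not> int N dvd k" if "k \<in> F" "k \<noteq> 0" for k
    proof
      assume "int N dvd k"
      then have "int N \<le> \<bar>k\<bar>" using that dvd_imp_le_int[of k "int N"] by simp
      moreover have "\<bar>k\<bar> \<le> Max (insert 0 (abs ` F))" using F(1) that by (intro Max_ge) auto
      moreover have "0 \<le> Max (insert 0 (abs ` F))" using F(1) by (intro Max_ge) auto
      ultimately show False
        by (simp add: N_def)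
    qed
    have "((\<lambda>k. \<Sum>u<N. a k * ee (of_int k * of_real (real u / real N))) has_sum (\<Sum>u<N. 0)) UNIV"
      by (intro has_sum_finite_sum sum) auto
    then have "((\<lambda>k. a k * (of_nat N * of_bool (int N dvd k))) has_sum 0) UNIV"
      by (simp only: sum_distrib_left[symmetric] sum_roots_of_unity[OF N0]) simp
    then have "((\<lambda>k. a k * (of_nat N * of_bool (int N dvd k)) / of_nat N) has_sum 0 / of_nat N) UNIV"
      by (rule has_sum_divide_const)
    then have "((\<lambda>k. a k * of_bool (int N dvd k)) has_sum 0) UNIV" using N0 by simp
    also have "?this \<longleftrightarrow> (a has_sum 0) {k. int N dvd k}" by (rule has_sum_cong_neutral) auto
    finally have 0: "(a has_sum 0) {k. int N dvd k}" .
    have "(a has_sum a 0) {0}" using has_sum_finite[of "{0}" a] by simp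
    then have "(a has_sum (0 - a 0)) ({k. int N dvd k} - {0})" by (rule has_sum_Diff[OF 0]) auto
    then have "norm (0 - a 0) \<le> (\<Sum>\<^sub>\<infinity>k\<in>{k. int N dvd k} - {0}. norm (a k))"
      by (intro norm_has_sum_bound[OF has_sum_infsum] summable_on_subset[OF abs]) auto
    also have "\<dots> \<le> (\<Sum>\<^sub>\<infinity>k\<in>UNIV - insert 0 F. norm (a k))"
      using FN by (intro infsum_mono2 summable_on_subset[OF abs]) auto
    also have "\<dots> = S - (\<Sum>k\<in>insert 0 F. norm (a k))"
      using has_sum_Diff[OF has_sum_infsum[OF abs] has_sum_finite[of "insert 0 F" "\<lambda>k. norm (a k)"]] F(1)
      by (intro infsumI) (simp add: S_def)
    also have "\<dots> \<le> e"
      using F(2)[of "insert 0 F"] F(1) by (simp only: dist_real_def finite_insert) (smt (verit) subset_insertI)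
    finally show ?thesis by simp
  qed
  then show ?thesis using field_le_epsilon[of "norm (a 0)" 0] by simp
qed

lemma fourier_unique:
  fixes a :: "int \<Rightarrow> complex"
  assumes sum: "\<And>x::real. ((\<lambda>k. a k * ee (of_int k * of_real x)) has_sum 0) UNIV"
  shows "a n = 0"
proof -
  have "((\<lambda>k. a (k + n) * ee (of_int k * of_real x)) has_sum 0) UNIV" for x
  proof -
    have "((\<lambda>k. ee (- of_int n * of_real x) * (a k * ee (of_int k * of_real x))) has_sum ee (- of_int n * of_real x) * 0) UNIV"
      by (intro has_sum_cmult_right sum)
    also have "(\<lambda>k. ee (- of_int n * of_real x) * (a k * ee (of_int k * of_real x)))
        = (\<lambda>k. a k * ee (of_int (k - n) * of_real x))"
      by (simp add: fun_eq_iff ring_distribs ee_diff ee_minus field_simps)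
    finally have "((\<lambda>k. a k * ee (of_int (k - n) * of_real x)) has_sum 0) UNIV" by simp
    then show ?thesis
      by (subst (asm) has_sum_reindex_bij_witness[where i = "\<lambda>k. k + n" and j = "\<lambda>k. k - n" and T = UNIV
          and h = "\<lambda>k. a (k + n) * ee (of_int k * of_real x)" and s' = 0]) auto
  qed
  then show ?thesis using fourier_unique_zero[of "\<lambda>k. a (k + n)"] by simp
qed

text \<open>The uniqueness in one variable is applied to each variable in turn.\<close>

lemma fourier_unique2:
  fixes a :: "int \<times> int \<Rightarrow> complex"
  assumes sum: "\<And>x y::real. ((\<lambda>(k, l). a (k, l) * ee (of_int k * of_real x + of_int l * of_real y)) has_sum 0) UNIV"
  shows "a (m, n) = 0"
proof -
  have "((\<lambda>l. a (k, l) * ee (of_int l * of_real y)) has_sum 0) UNIV" for k y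
  proof -
    let ?c = "\<lambda>k. \<Sum>\<^sub>\<infinity>l. a (k, l) * ee (of_int l * of_real y)"
    have "(\<lambda>(k, l). a (k, l) * ee (of_int l * of_real y)) summable_on UNIV \<times> UNIV"
      using sum[of 0 y] by (simp add: summable_on_def) blast
    then have s: "(\<lambda>l. a (k, l) * ee (of_int l * of_real y)) summable_on UNIV" for k
      by (rule summable_on_SigmaD1) auto
    have "?c k = 0" for k
    proof (rule fourier_unique)
      fix x :: real
      show "((\<lambda>k. ?c k * ee (of_int k * of_real x)) has_sum 0) UNIV"
      proof (rule has_sum_SigmaD)
        show "((\<lambda>(k, l). a (k, l) * ee (of_int k * of_real x + of_int l * of_real y)) has_sum 0) (UNIV \<times> UNIV)"
          using sum[of x y] by simp
        fix k
        have "((\<lambda>l. a (k, l) * ee (of_int l * of_real y) * ee (of_int k * of_real x))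
            has_sum ?c k * ee (of_int k * of_real x)) UNIV"
          by (intro has_sum_cmult_left has_sum_infsum s)
        then show "((\<lambda>l. case (k, l) of (k, l) \<Rightarrow> a (k, l) * ee (of_int k * of_real x + of_int l * of_real y))
            has_sum ?c k * ee (of_int k * of_real x)) UNIV"
          by (simp add: ee_add mult_ac)
      qed
    qed
    then show ?thesis using has_sum_infsum[OF s[of k]] by simp
  qed
  then show ?thesis using fourier_unique[of "\<lambda>l. a (m, l)"] by simp
qed

section \<open>Entire periodic functions\<close>

definition mean :: "(complex \<Rightarrow> complex) \<Rightarrow> complex" where
  "mean G = contour_integral (linepath 0 1) G"

lemma mean_primitive:
  assumes "\<And>z. (P has_field_derivative G z) (at z)"
  shows "contour_integral (linepath a b) G = P b - P a"
  using contour_integral_primitive[of UNIV P G "linepath a b"] assms by (intro contour_integral_unique) auto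

lemma entire_primitive:
  fixes G :: "complex \<Rightarrow> complex"
  assumes "G holomorphic_on UNIV"
  shows "\<exists>P. \<forall>z. (P has_field_derivative G z) (at z)"
  using holomorphic_convex_primitive'[OF convex_UNIV open_UNIV assms] by (metis UNIV_I)

lemma entire_integrable: "G holomorphic_on UNIV \<Longrightarrow> G contour_integrable_on (linepath a b)"
  by (auto intro!: contour_integrable_continuous_linepath holomorphic_on_imp_continuous_on
      intro: holomorphic_on_subset)

lemma mean_diff: "G holomorphic_on UNIV \<Longrightarrow> H holomorphic_on UNIV \<Longrightarrow> mean (\<lambda>z. G z - H z) = mean G - mean H"
  unfolding mean_def by (intro contour_integral_diff entire_integrable)

lemma mean_cmult: "G holomorphic_on UNIV \<Longrightarrow> mean (\<lambda>z. c * G z) = c * mean G"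
  unfolding mean_def by (intro contour_integral_lmul entire_integrable)

lemma integral_period:
  assumes "G holomorphic_on UNIV" "\<And>z. G (z + 1) = G z"
  shows "contour_integral (linepath a (a + 1)) G = mean G"
proof -
  obtain P where "\<forall>z. (P has_field_derivative G z) (at z)" using entire_primitive[OF assms(1)] ..
  note P = this[rule_format]
  have P1: "((\<lambda>z. P (z + 1)) has_field_derivative G z) (at z)" for z
    using DERIV_shift[of P "G z" z 1] P[of "z + 1"] assms(2) by simp
  have "((\<lambda>z. P (z + 1) - P z) has_field_derivative 0) (at z)" for z
    using DERIV_diff[OF P1 P, of z] by simp
  then have "\<exists>c. \<forall>z\<in>UNIV. P (z + 1) - P z = c" by (intro has_field_derivative_zero_constant) auto
  then have "P (a + 1) - P a = P (0 + 1) - P 0" by (metis UNIV_I)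
  then show ?thesis by (simp add: mean_def mean_primitive[OF P])
qed

lemma mean_shift:
  assumes "G holomorphic_on UNIV" "\<And>z. G (z + 1) = G z"
  shows "mean (\<lambda>z. G (z + a)) = mean G"
proof -
  obtain P where "\<forall>z. (P has_field_derivative G z) (at z)" using entire_primitive[OF assms(1)] ..
  note P = this[rule_format]
  have "((\<lambda>z. P (z + a)) has_field_derivative G (z + a)) (at z)" for z
    using DERIV_shift[of P _ z a] P[of "z + a"] by simp
  then have "mean (\<lambda>z. G (z + a)) = P (1 + a) - P (0 + a)" unfolding mean_def by (rule mean_primitive)
  also have "\<dots> = contour_integral (linepath a (a + 1)) G" by (simp add: mean_primitive[OF P] add.commute)
  finally show ?thesis using integral_period[OF assms] by simp
qed

lemma mean_ee: "mean (\<lambda>z. ee (of_int k * z)) = of_bool (k = 0)"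
proof (cases "k = 0")
  case True
  then show ?thesis by (simp add: mean_def)
next
  case False
  have "((\<lambda>z. ee (of_int k * z) / (i2pi * of_int k)) has_field_derivative ee (of_int k * z)) (at z)" for z
    using False by (auto intro!: derivative_eq_intros)
  from mean_primitive[OF this, of 0 1] False show ?thesis
    by (simp add: mean_def)
qed

lemma ee_eq_1_iff: "ee z = 1 \<longleftrightarrow> z \<in> \<int>"
proof
  assume "ee z = 1"
  then obtain n :: int where "Im z = 0" "2 * pi * Re z = of_int (2 * n) * pi" by (auto simp: ee_def exp_eq_1)
  then have "z = of_int n" by (simp add: complex_eq_iff)
  then show "z \<in> \<int>" by simp
qed (rule ee_Ints)

text \<open>
  Chernoff's trick. If the mean values of \<open>H\<close> against all exponentials vanish, then dividing
  \<open>H - H 0\<close> by \<open>ee - 1\<close> gives an entire periodic function whose Fourier coefficients are constant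
  on the nonnegative and on the negative integers, with a jump of \<open>H 0\<close> in between. Shifting the line
  of integration shows that they decay.
\<close>

lemma entire_fourier_zero_at_0:
  assumes H: "H holomorphic_on UNIV" and per: "\<And>z. H (z + 1) = H z"
    and coeff: "\<And>k :: int. mean (\<lambda>z. H z * ee (of_int k * z)) = 0"
  shows "H 0 = 0"
proof -
  define G where "G z = (if z \<in> \<int> then deriv H 0 / (i2pi) else (H z - H 0) / (ee z - 1))" for z
  have perG: "G (z + 1) = G z" for z
    by (simp add: G_def per ee_add)
  have HZ: "H (of_int n) = H 0" for n
  proof (induction n rule: int_induct[where k = 0])
    case (step1 i)
    then show ?case using per[of "of_int i"] by simp
  next
    case (step2 i)
    then show ?case using per[of "of_int i - 1"] by simp
  qed simp
  have G0: "H z - H 0 = G z * (ee z - 1)" for z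
    using HZ by (auto simp: G_def ee_Ints ee_eq_1_iff elim!: Ints_cases)
  have "G holomorphic_on ball 0 1"
  proof -
    have Z: "z \<notin> \<int>" if "z \<in> ball 0 1 - {0}" for z :: complex
    proof
      assume "z \<in> \<int>"
      then obtain n where "z = of_int n" by (auto elim!: Ints_cases)
      with that show False
        by (cases "n = 0") auto
    qed
    have "((\<lambda>z. (H z - H 0) / z) \<longlongrightarrow> deriv H 0) (at 0)"
      using holomorphic_derivI[OF H open_UNIV, of 0] by (simp add: has_field_derivative_iff)
    moreover have "(ee has_field_derivative i2pi) (at 0)" by (auto intro!: derivative_eq_intros)
    then have "((\<lambda>z. (ee z - 1) / z) \<longlongrightarrow> i2pi) (at 0)"
      by (simp add: has_field_derivative_iff)
    ultimately have "((\<lambda>z. ((H z - H 0) / z) / ((ee z - 1) / z)) \<longlongrightarrow> deriv H 0 / (i2pi)) (at 0)"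
      by (intro tendsto_divide) auto
    moreover have "\<forall>\<^sub>F z in at 0. ((H z - H 0) / z) / ((ee z - 1) / z) = (H z - H 0) / (ee z - 1)"
      by (auto simp: eventually_at_filter)
    ultimately have "((\<lambda>z. (H z - H 0) / (ee z - 1)) \<longlongrightarrow> deriv H 0 / (i2pi)) (at 0)"
      by (rule Lim_transform_eventually)
    then have "(\<lambda>z. if z = 0 then deriv H 0 / (i2pi) else (H z - H 0) / (ee z - 1)) holomorphic_on ball 0 1"
      using Z by (intro removable_singularity)
        (auto intro!: holomorphic_intros holomorphic_on_subset[OF H] simp: ee_eq_1_iff)
    then show ?thesis by (rule holomorphic_transform) (use Z in \<open>auto simp: G_def\<close>)
  qed
  then have near0: "G field_differentiable at z" if "norm z < 1" for z
    using that by (auto intro!: holomorphic_on_imp_differentiable_at)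
  have perGn: "G (z + of_int n) = G z" for z n
  proof (induction n rule: int_induct[where k = 0])
    case (step1 i)
    then show ?case using perG[of "z + of_int i"] by (simp add: add.assoc)
  next
    case (step2 i)
    then show ?case using perG[of "z + of_int i - 1"] by (simp add: algebra_simps)
  qed simp
  have "G field_differentiable at z" for z
  proof (cases "z \<in> \<int>")
    case True
    then obtain n where n: "z = of_int n" by (auto elim!: Ints_cases)
    obtain D where "(G has_field_derivative D) (at (z + of_int (- n)))"
      using near0[of 0] n by (auto simp: field_differentiable_def)
    then have "(\<lambda>w. G (w + of_int (- n))) field_differentiable at z"
      unfolding field_differentiable_def DERIV_shift by blast
    moreover have "(\<lambda>w. G (w + of_int (- n))) = G" using perGn by blast
    ultimately show ?thesis by simp
  next
    case False
    have "(\<lambda>z. (H z - H 0) / (ee z - 1)) holomorphic_on - \<int>"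
      by (auto intro!: holomorphic_intros holomorphic_on_subset[OF H] simp: ee_eq_1_iff)
    then have "G holomorphic_on - \<int>" by (rule holomorphic_transform) (auto simp: G_def)
    then show ?thesis
      using False closed_Ints[where 'a = complex] by (auto intro: holomorphic_on_imp_differentiable_at simp: open_Compl)
  qed
  then have G: "G holomorphic_on UNIV" by (auto simp: holomorphic_on_def field_differentiable_at_within)
  define d where "d k = mean (\<lambda>z. G z * ee (of_int k * z))" for k :: int
  have Gk: "(\<lambda>z. G z * ee (of_int k * z)) holomorphic_on UNIV" for k :: int
    by (rule holomorphic_on_mult[OF G]) (intro holomorphic_intros)
  have Hk: "(\<lambda>z. H z * ee (of_int k * z)) holomorphic_on UNIV" for k :: int
    by (rule holomorphic_on_mult[OF H]) (intro holomorphic_intros)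
  have ek: "(\<lambda>z. ee (of_int k * z)) holomorphic_on UNIV" for k :: int
    by (intro holomorphic_intros)
  have d: "d (k + 1) - d k = - H 0 * of_bool (k = 0)" for k
  proof -
    have "d (k + 1) - d k = mean (\<lambda>z. G z * ee (of_int (k + 1) * z) - G z * ee (of_int k * z))"
      unfolding d_def by (intro mean_diff[symmetric] Gk)
    also have "(\<lambda>z. G z * ee (of_int (k + 1) * z) - G z * ee (of_int k * z))
        = (\<lambda>z. (H z - H 0) * ee (of_int k * z))"
      by (simp add: G0 ring_distribs ee_add) (simp add: algebra_simps)
    also have "\<dots> = (\<lambda>z. H z * ee (of_int k * z) - H 0 * ee (of_int k * z))" by (simp add: algebra_simps)
    also have "mean \<dots> = mean (\<lambda>z. H z * ee (of_int k * z)) - mean (\<lambda>z. H 0 * ee (of_int k * z))"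
      by (intro mean_diff Hk holomorphic_on_mult[OF holomorphic_on_const ek])
    also have "mean (\<lambda>z. H 0 * ee (of_int k * z)) = H 0 * mean (\<lambda>z. ee (of_int k * z))"
      by (rule mean_cmult[OF ek])
    finally show ?thesis by (simp add: coeff mean_ee)
  qed
  have "continuous_on UNIV G" using G by (rule holomorphic_on_imp_continuous_on)
  have bnd: "\<exists>B. \<forall>k :: int. norm (d k) \<le> B * exp (- (2 * pi * s * of_int k))" for s :: real
  proof -
    let ?a = "of_real s * \<i>"
    have "compact (G ` closed_segment ?a (?a + 1))"
      by (rule compact_continuous_image[OF continuous_on_subset[OF \<open>continuous_on UNIV G\<close> subset_UNIV]]) simp
    then have "bounded (G ` closed_segment ?a (?a + 1))" by (rule compact_imp_bounded)
    then obtain B where "\<forall>x \<in> G ` closed_segment ?a (?a + 1). norm x \<le> B" unfolding bounded_iff ..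
    then have B: "norm (G z) \<le> B" if "z \<in> closed_segment ?a (?a + 1)" for z
      using that by blast
    have im: "Im z = s" if "z \<in> closed_segment ?a (?a + 1)" for z
      using that by (auto simp: closed_segment_def algebra_simps)
    have "norm (d k) \<le> B * exp (- (2 * pi * s * of_int k)) * norm (?a + 1 - ?a)" for k :: int
    proof -
      have "d k = contour_integral (linepath ?a (?a + 1)) (\<lambda>z. G z * ee (of_int k * z))"
        unfolding d_def by (rule integral_period[symmetric, OF Gk]) (simp add: perG ring_distribs ee_add)
      also have "norm \<dots> \<le> B * exp (- (2 * pi * s * of_int k)) * norm (?a + 1 - ?a)"
      proof (rule contour_integral_bound_linepath[OF entire_integrable[OF Gk]])
        show "0 \<le> B * exp (- (2 * pi * s * of_int k))"
          using order_trans[OF norm_ge_zero B[of ?a]] by (intro mult_nonneg_nonneg) auto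
        show "norm (G z * ee (of_int k * z)) \<le> B * exp (- (2 * pi * s * of_int k))"
          if "z \<in> closed_segment ?a (?a + 1)" for z
          using B[OF that] im[OF that] by (simp add: norm_mult norm_ee mult_ac)
      qed
      finally show ?thesis .
    qed
    then show ?thesis by auto
  qed
  have lim: "(\<lambda>n. B * exp (- (2 * pi * real n))) \<longlonglongrightarrow> 0" for B
  proof -
    have "(\<lambda>n. exp (- (2 * pi)) ^ n) \<longlonglongrightarrow> 0" by (rule LIMSEQ_realpow_zero) auto
    then have "(\<lambda>n. B * exp (- (2 * pi)) ^ n) \<longlonglongrightarrow> 0" by (rule tendsto_mult_right_zero)
    moreover have "exp (- (2 * pi * real n)) = exp (- (2 * pi)) ^ n" for n
      by (simp add: exp_of_nat_mult[symmetric] mult_ac)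
    ultimately show ?thesis by simp
  qed
  have d1: "d 1 = 0"
  proof -
    have c: "d (int n + 1) = d 1" for n
    proof (induction n)
      case (Suc n)
      then show ?case using d[of "int n + 1"] by (simp add: add.commute)
    qed simp
    obtain B where B: "\<And>k :: int. norm (d k) \<le> B * exp (- (2 * pi * 1 * of_int k))" using bnd[of 1] by blast
    have "norm (d 1) \<le> B * exp (- (2 * pi * real (Suc n)))" for n
      using B[of "int n + 1"] c[of n] by (simp add: add.commute)
    then have "norm (d 1) \<le> 0" by (intro LIMSEQ_le_const[OF filterlim_compose[OF lim filterlim_Suc]]) auto
    then show ?thesis by simp
  qed
  have d0: "d 0 = 0"
  proof -
    have c: "d (- int n) = d 0" for n
    proof (induction n)
      case (Suc n)
      have "- int (Suc n) = - int n - 1" by simp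
      then show ?case using d[of "- int n - 1"] Suc by (simp only: diff_add_cancel) simp
    qed simp
    obtain B where B: "\<And>k :: int. norm (d k) \<le> B * exp (- (2 * pi * (-1) * of_int k))"
      using bnd[of "-1"] by blast
    have "norm (d 0) \<le> B * exp (- (2 * pi * real n))" for n
      using B[of "- int n"] c[of n] by simp
    then have "norm (d 0) \<le> 0" by (intro LIMSEQ_le_const[OF lim]) auto
    then show ?thesis by simp
  qed
  show ?thesis using d[of 0] d0 d1 by simp
qed

lemma entire_fourier_zero:
  assumes H: "H holomorphic_on UNIV" and per: "\<And>z. H (z + 1) = H z"
    and coeff: "\<And>k :: int. mean (\<lambda>z. H z * ee (of_int k * z)) = 0"
  shows "H z = 0"
proof -
  define Hz where "Hz w = H (w + z)" for w
  have "(\<lambda>w. w + z) holomorphic_on UNIV" by (intro holomorphic_intros)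
  from holomorphic_on_compose[OF this holomorphic_on_subset[OF H subset_UNIV]]
  have Hz: "Hz holomorphic_on UNIV" by (simp add: o_def Hz_def[abs_def])
  have perz: "Hz (w + 1) = Hz w" for w
  proof -
    have 1: "w + 1 + z = (w + z) + 1" by simp
    show ?thesis unfolding Hz_def 1 by (rule per)
  qed
  have coeffz: "mean (\<lambda>w. Hz w * ee (of_int k * w)) = 0" for k :: int
  proof -
    define K where "K w = H w * ee (of_int k * w)" for w
    have K: "K holomorphic_on UNIV"
      unfolding K_def[abs_def] by (rule holomorphic_on_mult[OF H]) (intro holomorphic_intros)
    have perK: "K (w + 1) = K w" for w
      by (simp add: K_def per ring_distribs ee_add)
    have Kz: "(\<lambda>w. K (w + z)) holomorphic_on UNIV"
      using holomorphic_on_compose[OF \<open>(\<lambda>w. w + z) holomorphic_on UNIV\<close> holomorphic_on_subset[OF K subset_UNIV]]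
      by (simp add: o_def)
    have "(\<lambda>w. Hz w * ee (of_int k * w)) = (\<lambda>w. ee (- (of_int k * z)) * K (w + z))"
    proof
      fix w
      have "ee (- (of_int k * z)) * ee (of_int k * (w + z)) = ee (of_int k * w)"
        unfolding ee_add[symmetric] by (simp add: distrib_left)
      then show "Hz w * ee (of_int k * w) = ee (- (of_int k * z)) * K (w + z)" by (simp add: Hz_def K_def)
    qed
    then have 1: "mean (\<lambda>w. Hz w * ee (of_int k * w)) = ee (- (of_int k * z)) * mean (\<lambda>w. K (w + z))"
      by (simp only: mean_cmult[OF Kz])
    have 2: "mean (\<lambda>w. K (w + z)) = mean K" by (rule mean_shift[OF K perK])
    have 3: "mean K = 0" unfolding K_def[abs_def] by (rule coeff)
    show ?thesis unfolding 1 2 3 by (rule mult_zero_right)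
  qed
  have "Hz 0 = 0" by (rule entire_fourier_zero_at_0[OF Hz perz coeffz])
  then show ?thesis by (simp add: Hz_def)
qed

section \<open>The inversion formula for the classical theta series\<close>

definition tame :: "(int \<Rightarrow> complex) \<Rightarrow> bool" where
  "tame a \<longleftrightarrow> (\<exists>C b. C \<ge> 0 \<and> b \<ge> 0 \<and> (\<forall>k. norm (a k) \<le> C * exp (b * \<bar>of_int k\<bar>)))"

lemma tame_const: "tame (\<lambda>_. c)" unfolding tame_def by (rule exI[of _ "norm c"], rule exI[of _ 0]) simp

lemma tame_mult:
  assumes "tame a" "tame a'"
  shows "tame (\<lambda>k. a k * a' k)"
proof -
  obtain C b where C: "C \<ge> 0" "b \<ge> 0" "\<And>k. norm (a k) \<le> C * exp (b * \<bar>of_int k\<bar>)"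
    using assms(1) unfolding tame_def by blast
  obtain C' b' where C': "C' \<ge> 0" "b' \<ge> 0" "\<And>k. norm (a' k) \<le> C' * exp (b' * \<bar>of_int k\<bar>)"
    using assms(2) unfolding tame_def by blast
  have "norm (a k * a' k) \<le> (C * C') * exp ((b + b') * \<bar>of_int k\<bar>)" for k
    using mult_mono[OF C(3)[of k] C'(3)[of k]] C C' by (simp add: norm_mult ring_distribs exp_add mult_ac)
  then show ?thesis unfolding tame_def using C(1,2) C'(1,2) by (meson add_nonneg_nonneg mult_nonneg_nonneg)
qed

lemma tame_of_int: "tame of_int"
proof -
  have "norm (of_int k :: complex) \<le> 1 * exp (1 * \<bar>of_int k\<bar>)" for k
    using exp_ge_add_one_self[of "\<bar>of_int k\<bar>"] by (simp del: exp_ge_add_one_self)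
  then show ?thesis unfolding tame_def by (intro exI[of _ 1]) auto
qed

text \<open>The coefficients \<open>a\<close> make the derivatives, whose terms carry powers of the frequencies, series of the same kind.\<close>

definition theta1 :: "(int \<Rightarrow> complex) \<Rightarrow> complex \<Rightarrow> complex \<Rightarrow> complex" where
  "theta1 a s z = (\<Sum>\<^sub>\<infinity>k. a k * ee ((of_int k)\<^sup>2 / 2 * s + of_int k * z))"

text \<open>Completing the square, the quadratic decay of the terms beats every exponential growth.\<close>

lemma gauss_le:
  fixes x :: real
  assumes "\<alpha> > 0"
  shows "exp (\<beta> * x - \<alpha> * x\<^sup>2) \<le> exp ((\<beta> + 1)\<^sup>2 / (4 * \<alpha>)) * exp (- x)"
proof -
  have "0 \<le> (2 * \<alpha> * x - (\<beta> + 1))\<^sup>2 / (4 * \<alpha>)" using assms by simp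
  also have "\<dots> = \<alpha> * x\<^sup>2 - (\<beta> + 1) * x + (\<beta> + 1)\<^sup>2 / (4 * \<alpha>)"
    using assms by (simp add: field_simps power2_eq_square)
  finally have "\<beta> * x - \<alpha> * x\<^sup>2 \<le> (\<beta> + 1)\<^sup>2 / (4 * \<alpha>) + - x"
    by (simp add: algebra_simps)
  then show ?thesis unfolding exp_add[symmetric] by simp
qed

lemma summable_gauss:
  fixes \<alpha> \<beta> :: real
  assumes "\<alpha> > 0"
  shows "(\<lambda>k::int. exp (\<beta> * \<bar>of_int k\<bar> - \<alpha> * (of_int k)\<^sup>2)) summable_on UNIV"
proof (rule summable_on_comparison_test)
  show "(\<lambda>k::int. exp ((\<beta> + 1)\<^sup>2 / (4 * \<alpha>)) * exp (- (1 * \<bar>of_int k\<bar>))) summable_on UNIV"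
    by (intro summable_on_cmult_right summable_exp_abs_int) simp
  show "exp (\<beta> * \<bar>of_int k\<bar> - \<alpha> * (of_int k)\<^sup>2) \<le> exp ((\<beta> + 1)\<^sup>2 / (4 * \<alpha>)) * exp (- (1 * \<bar>of_int k\<bar>))"
    for k :: int
    using gauss_le[OF assms, of \<beta> "\<bar>of_int k\<bar>"] by simp
qed simp

lemma theta1_exponential_sum:
  assumes "tame a" "Im s > 0"
  shows "(\<lambda>k. norm (a k * ee ((of_int k)\<^sup>2 / 2 * s + of_int k * z)) * exp (pi * Im s / 8 * (2 * (of_int k)\<^sup>2)))
    summable_on UNIV"
proof -
  obtain C b where C: "C \<ge> 0" "b \<ge> 0" "\<And>k. norm (a k) \<le> C * exp (b * \<bar>of_int k\<bar>)"
    using assms(1) unfolding tame_def by blast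
  define \<beta> where "\<beta> = b + 2 * pi * \<bar>Im z\<bar>"
  define \<alpha> where "\<alpha> = pi * Im s * 3 / 4"
  have "(\<lambda>k::int. C * exp (\<beta> * \<bar>of_int k\<bar> - \<alpha> * (of_int k)\<^sup>2)) summable_on UNIV"
    using assms(2) by (intro summable_on_cmult_right summable_gauss) (simp add: \<alpha>_def)
  then show ?thesis
  proof (rule summable_on_comparison_test)
    fix k :: int
    let ?x = "of_int k :: real"
    have k: "(of_int k :: complex)\<^sup>2 = of_real (?x\<^sup>2)" "(of_int k :: complex) = of_real ?x" by simp_all
    have "norm (ee ((of_int k)\<^sup>2 / 2 * s + of_int k * z)) = exp (- (pi * Im s * ?x\<^sup>2) - 2 * pi * (?x * Im z))"
      unfolding norm_ee k by (simp add: algebra_simps)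
    also have "- (pi * Im s * ?x\<^sup>2) - 2 * pi * (?x * Im z) \<le> - (pi * Im s * ?x\<^sup>2) + 2 * pi * (\<bar>?x\<bar> * \<bar>Im z\<bar>)"
      using mult_left_mono[OF abs_ge_minus_self[of "?x * Im z"], of "2 * pi"] by (simp add: abs_mult)
    finally have e: "norm (ee ((of_int k)\<^sup>2 / 2 * s + of_int k * z))
        \<le> exp (- (pi * Im s * ?x\<^sup>2) + 2 * pi * (\<bar>?x\<bar> * \<bar>Im z\<bar>))"
      by simp
    have "norm (a k * ee ((of_int k)\<^sup>2 / 2 * s + of_int k * z))
        \<le> (C * exp (b * \<bar>?x\<bar>)) * exp (- (pi * Im s * ?x\<^sup>2) + 2 * pi * (\<bar>?x\<bar> * \<bar>Im z\<bar>))"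
      unfolding norm_mult by (intro mult_mono C(3) e) (use C in auto)
    then have "norm (a k * ee ((of_int k)\<^sup>2 / 2 * s + of_int k * z)) * exp (pi * Im s / 8 * (2 * ?x\<^sup>2))
        \<le> (C * exp (b * \<bar>?x\<bar>)) * exp (- (pi * Im s * ?x\<^sup>2) + 2 * pi * (\<bar>?x\<bar> * \<bar>Im z\<bar>)) * exp (pi * Im s / 8 * (2 * ?x\<^sup>2))"
      by (intro mult_right_mono) auto
    also have "\<dots> = C * exp (b * \<bar>?x\<bar> + (- (pi * Im s * ?x\<^sup>2) + 2 * pi * (\<bar>?x\<bar> * \<bar>Im z\<bar>)) + pi * Im s / 8 * (2 * ?x\<^sup>2))"
      by (simp only: exp_add mult.assoc)
    also have "b * \<bar>?x\<bar> + (- (pi * Im s * ?x\<^sup>2) + 2 * pi * (\<bar>?x\<bar> * \<bar>Im z\<bar>)) + pi * Im s / 8 * (2 * ?x\<^sup>2)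
        = \<beta> * \<bar>?x\<bar> - \<alpha> * ?x\<^sup>2"
      by (simp add: \<alpha>_def \<beta>_def field_simps)
    finally show "norm (a k * ee ((of_int k)\<^sup>2 / 2 * s + of_int k * z)) * exp (pi * Im s / 8 * (2 * ?x\<^sup>2))
        \<le> C * exp (\<beta> * \<bar>?x\<bar> - \<alpha> * ?x\<^sup>2)" .
  qed simp
qed

lemma abs_int_le_square: "\<bar>of_int k\<bar> \<le> (of_int k :: real)\<^sup>2"
proof -
  have "\<bar>k\<bar> \<le> k\<^sup>2"
    using mult_left_mono[of 1 "\<bar>k\<bar>" "\<bar>k\<bar>"] by (cases "k = 0") (auto simp: power2_eq_square)
  then show ?thesis by (metis of_int_abs of_int_le_iff of_int_power)
qed

definition freq :: "(int \<Rightarrow> complex) \<Rightarrow> int \<Rightarrow> complex" where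
  "freq a = (\<lambda>k. i2pi * of_int k * a k)"

lemma tame_freq: "tame a \<Longrightarrow> tame (freq a)"
  unfolding freq_def by (intro tame_mult tame_const tame_of_int)

lemma
  assumes "tame a" "Im s > 0"
  shows theta1_has_sum: "((\<lambda>k. a k * ee ((of_int k)\<^sup>2 / 2 * s + of_int k * z)) has_sum theta1 a s z) UNIV"
    and theta1_has_derivative: "((\<lambda>p. theta1 a (fst p) (snd p)) has_derivative
      (\<lambda>h. theta1 (freq (freq a)) s z / (4 * of_real pi * \<i>) * fst h + theta1 (freq a) s z * snd h)) (at (s, z))"
proof -
  let ?L = "\<lambda>k (p::complex \<times> complex). (of_int k)\<^sup>2 / 2 * fst p + of_int k * snd p"
  have lin: "bounded_linear (?L k)" for k :: int
    by (intro bounded_linear_add bounded_linear_const_mult bounded_linear_fst bounded_linear_snd)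
  have bnd: "norm (?L k h) \<le> 2 * (of_int k)\<^sup>2 * norm h" for k :: int and h
  proof -
    have "norm (?L k h) \<le> (of_int k)\<^sup>2 / 2 * norm (fst h) + \<bar>of_int k\<bar> * norm (snd h)"
      by (rule order_trans[OF norm_triangle_ineq]) (simp add: norm_mult norm_divide norm_power)
    also have "\<dots> \<le> (of_int k)\<^sup>2 / 2 * norm h + (of_int k)\<^sup>2 * norm h"
      by (intro add_mono mult_mono norm_fst_le norm_snd_le abs_int_le_square)
        (auto simp: norm_fst_le[of "fst h" "snd h", simplified] norm_snd_le[of "snd h" "fst h", simplified])
    also have "\<dots> \<le> 2 * (of_int k)\<^sup>2 * norm h" by (simp add: algebra_simps)
    finally show ?thesis .
  qed
  have d: "pi * Im s / 8 > 0" using assms by simp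
  have c: "2 * (of_int k)\<^sup>2 \<ge> (0 :: real)" for k :: int
    by simp
  note * = exponential_sum[where I = UNIV and x = "(s, z)", OF lin bnd c d, unfolded fst_conv snd_conv,
      OF theta1_exponential_sum[OF _ assms(2)]]
  show "((\<lambda>k. a k * ee ((of_int k)\<^sup>2 / 2 * s + of_int k * z)) has_sum theta1 a s z) UNIV"
    unfolding theta1_def by (rule has_sum_infsum) (rule *(3)[OF assms(1)])
  have sm: "(\<lambda>k. a k * ee ((of_int k)\<^sup>2 / 2 * s + of_int k * z)) summable_on UNIV" if "tame a" for a
    by (rule *(3)[OF that])
  have "(\<Sum>\<^sub>\<infinity>k. i2pi * ?L k h * (a k * ee ((of_int k)\<^sup>2 / 2 * s + of_int k * z)))
      = theta1 (freq (freq a)) s z / (4 * of_real pi * \<i>) * fst h + theta1 (freq a) s z * snd h" for h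
  proof (rule infsumI)
    let ?E = "\<lambda>k::int. ee ((of_int k)\<^sup>2 / 2 * s + of_int k * z)"
    have "((\<lambda>k. freq (freq a) k * ?E k / (4 * of_real pi * \<i>) * fst h + freq a k * ?E k * snd h)
      has_sum (theta1 (freq (freq a)) s z / (4 * of_real pi * \<i>) * fst h + theta1 (freq a) s z * snd h)) UNIV"
      unfolding theta1_def
      by (intro has_sum_add has_sum_cmult_left has_sum_divide_const has_sum_infsum sm tame_freq assms(1))
    also have "(\<lambda>k. freq (freq a) k * ?E k / (4 * of_real pi * \<i>) * fst h + freq a k * ?E k * snd h)
        = (\<lambda>k. i2pi * ?L k h * (a k * ?E k))"
      by (simp add: freq_def fun_eq_iff field_simps power2_eq_square)
    finally show "((\<lambda>k. i2pi * ?L k h * (a k * ?E k)) has_sum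
      (theta1 (freq (freq a)) s z / (4 * of_real pi * \<i>) * fst h + theta1 (freq a) s z * snd h)) UNIV" .
  qed
  with *(1)[OF assms(1)] show "((\<lambda>p. theta1 a (fst p) (snd p)) has_derivative
      (\<lambda>h. theta1 (freq (freq a)) s z / (4 * of_real pi * \<i>) * fst h + theta1 (freq a) s z * snd h)) (at (s, z))"
    by (simp add: theta1_def)
qed

lemma DERIV_theta1:
  assumes "tame a" "Im (f x) > 0"
    and f: "(f has_field_derivative f') (at x)" and g: "(g has_field_derivative g') (at x)"
  shows "((\<lambda>x. theta1 a (f x) (g x)) has_field_derivative
     (theta1 (freq (freq a)) (f x) (g x) / (4 * of_real pi * \<i>) * f' + theta1 (freq a) (f x) (g x) * g')) (at x)"
proof -
  have "((\<lambda>x. (f x, g x)) has_derivative (\<lambda>h. (f' * h, g' * h))) (at x)"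
    using f g unfolding has_field_derivative_def by (rule has_derivative_Pair)
  from has_derivative_compose[OF this theta1_has_derivative[OF assms(1,2)]]
  show ?thesis unfolding has_field_derivative_def fst_conv snd_conv
    by (rule has_derivative_eq_rhs) (simp add: fun_eq_iff algebra_simps)
qed

lemma theta1_holomorphic:
  assumes "tame a" "Im s > 0"
  shows "(\<lambda>z. theta1 a s (c * z)) holomorphic_on UNIV"
proof (rule holomorphic_onI)
  fix z
  have "((\<lambda>z. c * z) has_field_derivative c) (at z)" by (auto intro!: derivative_eq_intros)
  from DERIV_theta1[OF assms(1) _ DERIV_const[of s] this] assms(2)
  show "(\<lambda>z. theta1 a s (c * z)) field_differentiable at z within UNIV"
    by (auto simp: field_differentiable_def)
qed

lemma theta1_period: "theta1 a s (z + of_int j) = theta1 a s z"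
proof -
  have "ee ((of_int k)\<^sup>2 / 2 * s + of_int k * (z + of_int j)) = ee ((of_int k)\<^sup>2 / 2 * s + of_int k * z)" for k :: int
  proof -
    have "(of_int k)\<^sup>2 / 2 * s + of_int k * (z + of_int j) = ((of_int k)\<^sup>2 / 2 * s + of_int k * z) + of_int (k * j)"
      by (simp add: algebra_simps)
    then show ?thesis by (simp only: ee_add ee_of_int mult_1_right)
  qed
  then show ?thesis by (simp add: theta1_def)
qed

abbreviation (input) theta0 :: "complex \<Rightarrow> complex \<Rightarrow> complex" where
  "theta0 \<equiv> theta1 (\<lambda>_. 1)"

lemma theta0_quasi_period:
  "theta0 s (z + of_int j * s) = ee (- ((of_int j)\<^sup>2 / 2 * s) - of_int j * z) * theta0 s z"
proof -
  let ?E = "\<lambda>z k. ee ((of_int k)\<^sup>2 / 2 * s + of_int k * z)"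
  have "theta0 s z = (\<Sum>\<^sub>\<infinity>k. ?E z (k + j))" unfolding theta1_def mult_1_left
    by (rule infsum_reindex_bij_betw[symmetric]) (rule bij_betwI[of _ _ _ "\<lambda>k. k - j"], auto)
  also have "\<dots> = (\<Sum>\<^sub>\<infinity>k. ?E (z + of_int j * s) k * ee ((of_int j)\<^sup>2 / 2 * s + of_int j * z))"
    unfolding ee_add[symmetric] by (intro infsum_cong arg_cong[of _ _ ee]) (simp add: power2_eq_square field_simps)
  also have "\<dots> = theta0 s (z + of_int j * s) * ee ((of_int j)\<^sup>2 / 2 * s + of_int j * z)"
    unfolding theta1_def mult_1_left by (rule infsum_cmult_left') 
  finally have "theta0 s z = theta0 s (z + of_int j * s) * ee ((of_int j)\<^sup>2 / 2 * s + of_int j * z)" .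
  moreover have "ee (- ((of_int j)\<^sup>2 / 2 * s) - of_int j * z) = inverse (ee ((of_int j)\<^sup>2 / 2 * s + of_int j * z))"
    unfolding ee_minus[symmetric] by (rule arg_cong[of _ _ ee]) (simp add: algebra_simps)
  ultimately show ?thesis by simp
qed

text \<open>
  The functions with the functional equations of the theta series form a space of dimension \<open>1\<close>: the
  equation under \<open>z + j / t\<close> relates all Fourier coefficients to the zeroth one.
\<close>

locale theta_equations =
  fixes t :: complex and X :: "complex \<Rightarrow> complex"
  assumes t: "t \<noteq> 0" and X: "X holomorphic_on UNIV" and period: "X (z + 1) = X z"
    and quasi: "X (z + of_int j / t) = ee (of_int j * z + (of_int j)\<^sup>2 / (2 * t)) * X z"
begin

lemma mean_coeff: "mean (\<lambda>z. X z * ee (of_int k * z)) = ee (- ((of_int k)\<^sup>2 / (2 * t))) * mean X"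
proof -
  define K where "K z = X z * ee (of_int k * z)" for z
  have K: "K holomorphic_on UNIV"
    unfolding K_def[abs_def] by (rule holomorphic_on_mult[OF X]) (intro holomorphic_intros)
  have perK: "K (z + 1) = K z" for z
    by (simp add: K_def period ring_distribs ee_add)
  have "K (z + of_int (- k) / t) = ee (- ((of_int k)\<^sup>2 / (2 * t))) * X z" for z
  proof -
    have "K (z + of_int (- k) / t)
        = ee ((of_int (- k) * z + (of_int (- k))\<^sup>2 / (2 * t)) + of_int k * (z + of_int (- k) / t)) * X z"
      unfolding K_def quasi ee_add by (simp only: mult_ac)
    also have "(of_int (- k) * z + (of_int (- k))\<^sup>2 / (2 * t)) + of_int k * (z + of_int (- k) / t)
        = - ((of_int k)\<^sup>2 / (2 * t))"
      using t by (simp add: field_simps power2_eq_square)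
    finally show ?thesis .
  qed
  then have "(\<lambda>z. K (z + of_int (- k) / t)) = (\<lambda>z. ee (- ((of_int k)\<^sup>2 / (2 * t))) * X z)"
    by (simp only:)
  then have "mean K = mean (\<lambda>z. ee (- ((of_int k)\<^sup>2 / (2 * t))) * X z)"
    using mean_shift[OF K perK, of "of_int (- k) / t"] by (simp only:)
  then show ?thesis by (simp only: mean_cmult[OF X] K_def[abs_def])
qed

lemma mean_zero: "mean X = 0 \<Longrightarrow> X z = 0"
  by (rule entire_fourier_zero[OF X period]) (simp add: mean_coeff)

end

lemma theta_equations_unique:
  assumes "theta_equations t X" "theta_equations t Y"
  shows "mean Y * X z = mean X * Y z"
proof -
  interpret X: theta_equations t X by fact
  interpret Y: theta_equations t Y by fact
  let ?Z = "\<lambda>z. mean Y * X z - mean X * Y z"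
  have 1: "(\<lambda>z. c * X z) holomorphic_on UNIV" "(\<lambda>z. c * Y z) holomorphic_on UNIV" for c
    by (rule holomorphic_on_mult[OF holomorphic_on_const X.X], rule holomorphic_on_mult[OF holomorphic_on_const Y.X])
  interpret Z: theta_equations t ?Z
  proof
    show "?Z holomorphic_on UNIV" by (rule holomorphic_on_diff[OF 1])
    show "?Z (z + of_int j / t) = ee (of_int j * z + (of_int j)\<^sup>2 / (2 * t)) * ?Z z" for z j
      unfolding X.quasi Y.quasi by (simp only: right_diff_distrib mult.left_commute)
  qed (use X.t X.period Y.period in simp_all)
  have "mean ?Z = mean (\<lambda>z. mean Y * X z) - mean (\<lambda>z. mean X * Y z)" by (rule mean_diff[OF 1])
  also have "\<dots> = 0" by (simp only: mean_cmult[OF X.X] mean_cmult[OF Y.X] mult.commute diff_self)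
  finally have "?Z z = 0" by (rule Z.mean_zero)
  then show ?thesis by simp
qed

definition gauss_theta :: "complex \<Rightarrow> complex \<Rightarrow> complex" where
  "gauss_theta t z = ee (t * z\<^sup>2 / 2) * theta0 t (t * z)"

lemma gauss_theta_has_sum:
  assumes "Im t > 0"
  shows "((\<lambda>n. ee (t * (of_int n + z)\<^sup>2 / 2)) has_sum gauss_theta t z) UNIV"
proof -
  have "((\<lambda>k. ee (t * z\<^sup>2 / 2) * (1 * ee ((of_int k)\<^sup>2 / 2 * t + of_int k * (t * z)))) has_sum gauss_theta t z) UNIV"
    unfolding gauss_theta_def by (intro has_sum_cmult_right theta1_has_sum assms tame_const)
  also have "(\<lambda>k. ee (t * z\<^sup>2 / 2) * (1 * ee ((of_int k)\<^sup>2 / 2 * t + of_int k * (t * z))))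
      = (\<lambda>n. ee (t * (of_int n + z)\<^sup>2 / 2))"
    by (simp add: fun_eq_iff ee_add[symmetric] power2_eq_square field_simps)
  finally show ?thesis .
qed

lemma Im_inversion: "Im t > 0 \<Longrightarrow> Im (- 1 / t) > 0"
  by (simp add: Im_divide zero_less_divide_iff sum_power2_gt_zero_iff)

lemma theta_equations_gauss_theta:
  assumes "Im t > 0"
  shows "theta_equations t (gauss_theta t)"
proof
  show t: "t \<noteq> 0" using assms by auto
  show "gauss_theta t holomorphic_on UNIV" unfolding gauss_theta_def[abs_def]
    by (rule holomorphic_on_mult[OF _ theta1_holomorphic[OF tame_const assms]]) (intro holomorphic_intros, simp)
  show "gauss_theta t (z + 1) = gauss_theta t z" for z
  proof -
    have "theta0 t (t * (z + 1)) = ee (- ((of_int 1)\<^sup>2 / 2 * t) - of_int 1 * (t * z)) * theta0 t (t * z)"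
      using theta0_quasi_period[of t "t * z" 1] by (simp add: algebra_simps)
    then have "gauss_theta t (z + 1)
        = ee (t * (z + 1)\<^sup>2 / 2 + (- ((of_int 1)\<^sup>2 / 2 * t) - of_int 1 * (t * z))) * theta0 t (t * z)"
      unfolding gauss_theta_def ee_add by simp
    also have "t * (z + 1)\<^sup>2 / 2 + (- ((of_int 1)\<^sup>2 / 2 * t) - of_int 1 * (t * z)) = t * z\<^sup>2 / 2"
      by (simp add: power2_eq_square field_simps)
    finally show ?thesis by (simp only: gauss_theta_def)
  qed
  show "gauss_theta t (z + of_int j / t) = ee (of_int j * z + (of_int j)\<^sup>2 / (2 * t)) * gauss_theta t z" for z j
  proof -
    have "t * (z + of_int j / t) = t * z + of_int j" using t by (simp add: field_simps)
    moreover have "t * (z + of_int j / t)\<^sup>2 / 2 = (of_int j * z + (of_int j)\<^sup>2 / (2 * t)) + t * z\<^sup>2 / 2"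
      using t by (simp add: field_simps power2_eq_square)
    ultimately show ?thesis by (simp only: gauss_theta_def theta1_period ee_add mult.assoc)
  qed
qed

lemma theta_equations_theta0:
  assumes "Im t > 0"
  shows "theta_equations t (theta0 (- 1 / t))"
proof
  show t: "t \<noteq> 0" using assms by auto
  show "theta0 (- 1 / t) holomorphic_on UNIV"
    using theta1_holomorphic[OF tame_const Im_inversion[OF assms], of _ 1] by simp
  show "theta0 (- 1 / t) (z + 1) = theta0 (- 1 / t) z" for z
    using theta1_period[of _ _ z 1] by simp
  show "theta0 (- 1 / t) (z + of_int j / t) = ee (of_int j * z + (of_int j)\<^sup>2 / (2 * t)) * theta0 (- 1 / t) z" for z j
  proof -
    have "z + of_int j / t = z + of_int (- j) * (- 1 / t)" by simp
    moreover have "- ((of_int (- j))\<^sup>2 / 2 * (- 1 / t)) - of_int (- j) * z = of_int j * z + (of_int j)\<^sup>2 / (2 * t)"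
      using t by (simp add: field_simps)
    ultimately show ?thesis by (simp only: theta0_quasi_period)
  qed
qed

lemma mean_theta0_nonzero:
  assumes "Im t > 0"
  shows "mean (theta0 (- 1 / t)) \<noteq> 0"
proof
  assume "mean (theta0 (- 1 / t)) = 0"
  then have 0: "theta0 (- 1 / t) z = 0" for z
    by (rule theta_equations.mean_zero[OF theta_equations_theta0[OF assms]])
  have "ee ((of_int 0)\<^sup>2 / 2 * (- 1 / t)) = 0"
  proof (rule fourier_unique[of "\<lambda>k. ee ((of_int k)\<^sup>2 / 2 * (- 1 / t))" 0])
    show "((\<lambda>k. ee ((of_int k)\<^sup>2 / 2 * (- 1 / t)) * ee (of_int k * of_real x)) has_sum 0) UNIV" for x
      using theta1_has_sum[OF tame_const[of 1] Im_inversion[OF assms], of "of_real x"] 0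
      by (simp only: mult_1_left ee_add)
  qed
  then show False
    by simp
qed

definition gauss_factor :: "complex \<Rightarrow> complex" where
  "gauss_factor t = mean (gauss_theta t) / mean (theta0 (- 1 / t))"

text \<open>Both sides satisfy the same functional equations in \<open>z\<close>.\<close>

lemma gauss_theta_inversion:
  assumes "Im t > 0"
  shows "gauss_theta t z = gauss_factor t * theta0 (- 1 / t) z"
proof -
  have *: "m * x = n * y \<Longrightarrow> m \<noteq> 0 \<Longrightarrow> x = n / m * y" for m n x y :: complex
    by (simp add: field_simps)
  show ?thesis unfolding gauss_factor_def
    by (rule *[OF theta_equations_unique mean_theta0_nonzero])
       (use assms theta_equations_gauss_theta theta_equations_theta0 in blast)+
qed

text \<open>
  The factor is determined by the heat equation, which both sides satisfy up to a lower order term.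
\<close>

lemma DERIV_gauss_factor:
  assumes t: "Im t > 0"
  shows "(gauss_factor has_field_derivative (- gauss_factor t / (2 * t))) (at t)"
proof -
  have t0: "t \<noteq> 0" using t by auto
  obtain z where z: "theta0 (- 1 / t) z \<noteq> 0"
  proof (rule ccontr)
    assume "\<not> thesis"
    with that have "theta0 (- 1 / t) = (\<lambda>_. 0)" by blast
    then have "mean (theta0 (- 1 / t)) = 0" by (simp add: mean_def)
    with mean_theta0_nonzero[OF t] show False
      by contradiction
  qed
  define a where "a = (\<lambda>_::int. 1 :: complex)"
  have a: "tame a" "tame (freq a)" using tame_const tame_freq unfolding a_def by blast+
  define U0 U1 U2 where "U0 z = theta1 a t (t * z)" and "U1 z = theta1 (freq a) t (t * z)"
    and "U2 z = theta1 (freq (freq a)) t (t * z)" for z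
  define V0 V1 V2 where "V0 z = theta1 a (- 1 / t) z" and "V1 z = theta1 (freq a) (- 1 / t) z"
    and "V2 z = theta1 (freq (freq a)) (- 1 / t) z" for z
  define P where "P = i2pi"
  have P: "P \<noteq> 0" by (simp add: P_def)
  define e where "e z = ee (t * z\<^sup>2 / 2)" for z
  have de: "(e has_field_derivative P * (t * z) * e z) (at z)" for z
    unfolding e_def[abs_def] P_def by (auto intro!: derivative_eq_intros)
  have dt: "((\<lambda>z. t * z) has_field_derivative t) (at z)" for z
    by (auto intro!: derivative_eq_intros)
  have dU0: "(U0 has_field_derivative U1 z * t) (at z)" for z
    using DERIV_theta1[OF a(1) _ DERIV_const[of t] dt, of z] t by (simp add: U0_def[abs_def] U1_def)
  have dU1: "(U1 has_field_derivative U2 z * t) (at z)" for z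
    using DERIV_theta1[OF a(2) _ DERIV_const[of t] dt, of z] t by (simp add: U1_def[abs_def] U2_def)
  have dV0: "(V0 has_field_derivative V1 z) (at z)" for z
    using DERIV_theta1[OF a(1) _ DERIV_const[of "- 1 / t"] DERIV_ident, of z] Im_inversion[OF t]
    by (simp add: V0_def[abs_def] V1_def)
  have dV1: "(V1 has_field_derivative V2 z) (at z)" for z
    using DERIV_theta1[OF a(2) _ DERIV_const[of "- 1 / t"] DERIV_ident, of z] Im_inversion[OF t]
    by (simp add: V1_def[abs_def] V2_def)
  define c where "c = gauss_factor t"
  have 0: "e z * U0 z = c * V0 z" for z
    using gauss_theta_inversion[OF t, of z] by (simp add: gauss_theta_def e_def U0_def V0_def a_def c_def)
  have 1: "P * (t * z) * e z * U0 z + e z * (U1 z * t) = c * V1 z" for z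
  proof (rule DERIV_unique)
    show "((\<lambda>z. e z * U0 z) has_field_derivative P * (t * z) * e z * U0 z + e z * (U1 z * t)) (at z)"
      using DERIV_mult[OF de dU0, of z] by (simp add: algebra_simps)
    show "((\<lambda>z. e z * U0 z) has_field_derivative c * V1 z) (at z)" unfolding 0 by (rule DERIV_cmult[OF dV0])
  qed
  have 2: "(P * t * (e z * U0 z) + P * (t * z) * (P * (t * z) * e z * U0 z + e z * (U1 z * t)))
      + (P * (t * z) * e z * (U1 z * t) + e z * (U2 z * t * t)) = c * V2 z" for z
  proof (rule DERIV_unique)
    show "((\<lambda>z. P * (t * z) * (e z * U0 z) + e z * (U1 z * t)) has_field_derivative
      ((P * t * (e z * U0 z) + P * (t * z) * (P * (t * z) * e z * U0 z + e z * (U1 z * t)))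
      + (P * (t * z) * e z * (U1 z * t) + e z * (U2 z * t * t)))) (at z)"
      by (rule derivative_eq_intros de dU0 dU1 refl | simp add: algebra_simps)+
    have "(\<lambda>z. P * (t * z) * (e z * U0 z) + e z * (U1 z * t)) = (\<lambda>z. c * V1 z)"
      using 1 by (simp only: mult.assoc)
    then show "((\<lambda>z. P * (t * z) * (e z * U0 z) + e z * (U1 z * t)) has_field_derivative c * V2 z) (at z)"
      using DERIV_cmult[OF dV1, of c z] by (simp only:)
  qed
  have dF: "((\<lambda>s. gauss_theta s z) has_field_derivative
      e z * (P * z\<^sup>2 / 2 * U0 z + U2 z / (2 * P) + U1 z * z)) (at t)"
  proof -
    have "((\<lambda>s. s * z) has_field_derivative z) (at t)" by (auto intro!: derivative_eq_intros)
    from DERIV_theta1[OF a(1) _ DERIV_ident this] t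
    have "((\<lambda>s. theta1 a s (s * z)) has_field_derivative U2 z / (2 * P) + U1 z * z) (at t)"
      by (simp add: U2_def U1_def P_def mult.assoc)
    moreover have "((\<lambda>s. ee (s * z\<^sup>2 / 2)) has_field_derivative P * z\<^sup>2 / 2 * e z) (at t)"
      unfolding e_def P_def by (auto intro!: derivative_eq_intros)
    ultimately have "((\<lambda>s. ee (s * z\<^sup>2 / 2) * theta1 a s (s * z)) has_field_derivative
        P * z\<^sup>2 / 2 * e z * theta1 a t (t * z) + (U2 z / (2 * P) + U1 z * z) * ee (t * z\<^sup>2 / 2)) (at t)"
      by (intro DERIV_mult)
    then show ?thesis by (simp add: gauss_theta_def a_def[symmetric] U0_def[symmetric] e_def[symmetric] algebra_simps)
  qed
  have dG: "((\<lambda>s. theta0 (- 1 / s) z) has_field_derivative V2 z / (2 * P) / t\<^sup>2) (at t)"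
  proof -
    have "((\<lambda>s. - 1 / s) has_field_derivative 1 / t\<^sup>2) (at t)"
      using t0 by (auto intro!: derivative_eq_intros simp: power2_eq_square)
    from DERIV_theta1[OF a(1) _ this DERIV_const[of z]] Im_inversion[OF t]
    show ?thesis by (simp add: V2_def P_def a_def mult.assoc)
  qed
  let ?D = "(e z * (P * z\<^sup>2 / 2 * U0 z + U2 z / (2 * P) + U1 z * z) * theta0 (- 1 / t) z
      - gauss_theta t z * (V2 z / (2 * P) / t\<^sup>2)) / (theta0 (- 1 / t) z * theta0 (- 1 / t) z)"
  have dq: "((\<lambda>s. gauss_theta s z / theta0 (- 1 / s) z) has_field_derivative ?D) (at t)"
    by (rule DERIV_divide[OF dF dG z])
  have "?D = - c / (2 * t)"
  proof -
    have V: "theta0 (- 1 / t) z = V0 z" and G: "gauss_theta t z = c * V0 z"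
      using gauss_theta_inversion[OF t, of z] by (simp_all add: V0_def a_def c_def)
    have V0: "V0 z \<noteq> 0" using z V by simp
    have "(e z * (P * z\<^sup>2 / 2 * U0 z + U2 z / (2 * P) + U1 z * z)) * (2 * P * t\<^sup>2)
        = P\<^sup>2 * t\<^sup>2 * z\<^sup>2 * e z * U0 z + t\<^sup>2 * e z * U2 z + 2 * P * t\<^sup>2 * z * e z * U1 z"
      using P by (simp add: field_simps power2_eq_square)
    also have "\<dots> = c * V2 z - P * t * (e z * U0 z)"
      unfolding 2[of z, symmetric] by (simp add: algebra_simps power2_eq_square)
    finally have "(e z * (P * z\<^sup>2 / 2 * U0 z + U2 z / (2 * P) + U1 z * z)) * (2 * P * t\<^sup>2)
        = c * V2 z - P * t * (c * V0 z)"
      unfolding 0 .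
    moreover have "2 * P * t\<^sup>2 \<noteq> 0" using P t0 by simp
    ultimately have "e z * (P * z\<^sup>2 / 2 * U0 z + U2 z / (2 * P) + U1 z * z) = (c * V2 z - P * t * (c * V0 z)) / (2 * P * t\<^sup>2)"
      by (metis nonzero_eq_divide_eq)
    then have "?D = ((c * V2 z - P * t * (c * V0 z)) / (2 * P * t\<^sup>2) * V0 z - c * V0 z * (V2 z / (2 * P) / t\<^sup>2)) / (V0 z * V0 z)"
      unfolding V G by (simp only:)
    also have "\<dots> = - c / (2 * t)" using P t0 V0 by (simp add: field_simps power2_eq_square)
    finally show ?thesis .
  qed
  with dq have "((\<lambda>s. gauss_theta s z / theta0 (- 1 / s) z) has_field_derivative (- c / (2 * t))) (at t)"
    by simp
  moreover have "\<forall>\<^sub>F s in nhds t. gauss_theta s z / theta0 (- 1 / s) z = gauss_factor s"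
  proof -
    have "isCont (\<lambda>s. theta0 (- 1 / s) z) t" using dG by (rule DERIV_isCont)
    then have "\<forall>\<^sub>F s in at t. theta0 (- 1 / s) z \<noteq> 0"
      using z unfolding isCont_def by (rule tendsto_imp_eventually_ne)
    then have "\<forall>\<^sub>F s in nhds t. theta0 (- 1 / s) z \<noteq> 0"
      using z by (simp add: eventually_nhds_conv_at)
    moreover have "\<forall>\<^sub>F s in nhds t. s \<in> {s. Im s > 0}"
      using t by (intro eventually_nhds_in_open open_halfspace_Im_gt) auto
    ultimately show ?thesis by eventually_elim (simp add: gauss_theta_inversion)
  qed
  ultimately show ?thesis by (subst DERIV_cong_ev[OF refl _ refl, symmetric]) (simp_all add: c_def)
qed

text \<open>On the imaginary axis all terms are positive.\<close>

lemma theta0_imaginary_pos: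
  assumes "y > 0"
  obtains r where "r > 0" "theta0 (\<i> * of_real y) 0 = of_real r"
proof -
  define f where "f k = exp (- (pi * y * (of_int k)\<^sup>2))" for k :: int
  have f: "ee ((of_int k)\<^sup>2 / 2 * (\<i> * of_real y)) = of_real (f k)" for k
  proof -
    have "i2pi * ((of_int k)\<^sup>2 / 2 * (\<i> * of_real y)) = of_real (- (pi * y * (of_int k)\<^sup>2))"
      by (simp add: algebra_simps)
    then show ?thesis unfolding ee_def f_def by (simp only: exp_of_real)
  qed
  have "((\<lambda>k. of_real (f k) :: complex) has_sum theta0 (\<i> * of_real y) 0) UNIV"
    using theta1_has_sum[OF tame_const[of 1], of "\<i> * of_real y" 0] assms by (simp add: f[symmetric])
  then have s: "((\<lambda>k. f k) has_sum Re (theta0 (\<i> * of_real y) 0)) UNIV"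
      and i: "((\<lambda>k. 0) has_sum Im (theta0 (\<i> * of_real y) 0)) (UNIV :: int set)"
    using has_sum_Re has_sum_Im by fastforce+
  have "Im (theta0 (\<i> * of_real y) 0) = 0" using i has_sum_0 has_sum_unique by (metis (no_types, lifting))
  moreover have "f 0 \<le> Re (theta0 (\<i> * of_real y) 0)"
    using has_sum_mono2[OF has_sum_finite[of "{0}" f] s] by (simp add: f_def)
  then have "Re (theta0 (\<i> * of_real y) 0) > 0" by (simp add: f_def)
  ultimately show thesis using that[of "Re (theta0 (\<i> * of_real y) 0)"] by (simp add: complex_eq_iff)
qed

lemma gauss_factor_imaginary_pos:
  assumes "y > 0"
  obtains r where "r > 0" "gauss_factor (\<i> * of_real y) = of_real r"
proof -
  obtain r where r: "r > 0" "theta0 (\<i> * of_real y) 0 = of_real r" using theta0_imaginary_pos[OF assms] .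
  obtain s where s: "s > 0" "theta0 (\<i> * of_real (1 / y)) 0 = of_real s"
    using theta0_imaginary_pos[of "1 / y"] assms by auto
  have "- 1 / (\<i> * of_real y) = \<i> * of_real (1 / y)" using assms by (simp add: field_simps)
  then have "of_real r = gauss_factor (\<i> * of_real y) * of_real s"
    using gauss_theta_inversion[of "\<i> * of_real y" 0] assms r s by (simp add: gauss_theta_def)
  then have "gauss_factor (\<i> * of_real y) = of_real (r / s)" using s by (simp add: field_simps)
  then show thesis using that[of "r / s"] r s by simp
qed

lemma gauss_factor_i: "gauss_factor \<i> = 1"
proof -
  have "theta0 \<i> 0 \<noteq> 0" by (rule theta0_imaginary_pos[of 1]) auto
  moreover have "gauss_theta \<i> 0 = theta0 \<i> 0" by (simp add: gauss_theta_def)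
  moreover have "- 1 / \<i> = \<i>" by simp
  ultimately show ?thesis using gauss_theta_inversion[of \<i> 0] by simp
qed

section \<open>Theta series of the lattice \<open>A\<^sub>2\<close>\<close>

text \<open>
  A vector \<open>r\<close> of the dual lattice is given by the integers \<open>k = 2 r\<^sub>1 + r\<^sub>2\<close> and \<open>l = r\<^sub>1 + 2 r\<^sub>2\<close>, the
  coordinates of the linear form \<open>\<beta>(r, -)\<close>. Then \<open>\<beta>(r) = (k\<^sup>2 - k l + l\<^sup>2) / 3\<close>, and the class of \<open>r\<close>
  modulo \<open>A\<^sub>2\<close> is that of \<open>k + l\<close> modulo \<open>3\<close>.
\<close>

definition qf :: "int \<times> int \<Rightarrow> int" where
  "qf p = (fst p)\<^sup>2 - fst p * snd p + (snd p)\<^sup>2"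

definition pairing :: "int \<times> int \<Rightarrow> complex^2 \<Rightarrow> complex" where
  "pairing p z = of_int (fst p) * z$1 + of_int (snd p) * z$2"

definition theta2 :: "(int \<times> int \<Rightarrow> complex) \<Rightarrow> complex \<Rightarrow> complex^2 \<Rightarrow> complex" where
  "theta2 a t z = (\<Sum>\<^sub>\<infinity>p. a p * ee (of_int (qf p) / 3 * t + pairing p z))"

definition tame2 :: "(int \<times> int \<Rightarrow> complex) \<Rightarrow> bool" where
  "tame2 a \<longleftrightarrow> (\<exists>C. C \<ge> 0 \<and> (\<forall>p. norm (a p) \<le> C * (exp (2 * \<bar>of_int (fst p)\<bar>) * exp (2 * \<bar>of_int (snd p)\<bar>))))"

definition sq_sum :: "int \<times> int \<Rightarrow> real" where
  "sq_sum p = (of_int (fst p))\<^sup>2 + (of_int (snd p))\<^sup>2"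

lemma qf_bounds: "sq_sum p / 2 \<le> of_int (qf p)" "of_int (qf p) \<le> 3 / 2 * sq_sum p"
proof -
  define x y where "x = real_of_int (fst p)" and "y = real_of_int (snd p)"
  have "of_int (qf p) = x * x - x * y + y * y" "sq_sum p = x * x + y * y"
    by (simp_all add: qf_def sq_sum_def x_def y_def power2_eq_square)
  moreover have "0 \<le> x * x - 2 * (x * y) + y * y" "0 \<le> x * x + 2 * (x * y) + y * y"
    using zero_le_power2[of "x - y"] zero_le_power2[of "x + y"] by (simp_all add: power2_eq_square algebra_simps)
  ultimately show "sq_sum p / 2 \<le> of_int (qf p)" "of_int (qf p) \<le> 3 / 2 * sq_sum p" by linarith+
qed

lemma qf_nonneg: "qf p \<ge> 0"
proof -
  have "0 \<le> sq_sum p / 2" by (simp add: sq_sum_def)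
  then have "(0::real) \<le> of_int (qf p)" using qf_bounds(1)[of p] by linarith
  then show ?thesis by simp
qed

lemma qf_eq_0_iff: "qf p = 0 \<longleftrightarrow> p = (0, 0)"
proof
  assume "qf p = 0"
  then have "sq_sum p \<le> 0" using qf_bounds(1)[of p] by simp
  then have "of_int (fst p) = (0::real) \<and> of_int (snd p) = (0::real)"
    unfolding sq_sum_def by (simp add: sum_power2_le_zero_iff)
  then show "p = (0, 0)" by (cases p) simp
qed (simp add: qf_def)

lemma tame2_bounded:
  assumes "\<And>p. norm (a p) \<le> C"
  shows "tame2 a"
proof -
  have C: "C \<ge> 0" using assms[of "(0,0)"] norm_ge_zero[of "a (0,0)"] by linarith
  have "norm (a p) \<le> C * (exp (2 * \<bar>of_int (fst p)\<bar>) * exp (2 * \<bar>of_int (snd p)\<bar>))" for p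
    using mult_left_mono[of 1 "exp (2 * \<bar>of_int (fst p)\<bar>) * exp (2 * \<bar>of_int (snd p)\<bar>)" C] assms[of p] C
    by (simp add: exp_add[symmetric] del: exp_add)
  with C show ?thesis unfolding tame2_def by blast
qed

lemma tame2_bounded_mult_le:
  assumes a: "\<And>p. norm (a p) \<le> C" and b: "\<And>p. norm (b p) \<le> 3 * sq_sum p"
  shows "tame2 (\<lambda>p. b p * a p)"
proof -
  have C: "C \<ge> 0" using a[of "(0,0)"] norm_ge_zero[of "a (0,0)"] by linarith
  have "norm (b p * a p) \<le> (6 * C) * (exp (2 * \<bar>of_int (fst p)\<bar>) * exp (2 * \<bar>of_int (snd p)\<bar>))" for p
  proof -
    define x y where "x = \<bar>real_of_int (fst p)\<bar>" and "y = \<bar>real_of_int (snd p)\<bar>"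
    have *: "v\<^sup>2 \<le> exp (2 * v)" if "v \<ge> 0" for v :: real
    proof -
      have "(2 * v)\<^sup>2 / 2 = 2 * v\<^sup>2" by (simp add: power2_eq_square)
      then show ?thesis using exp_lower_Taylor_quadratic[of "2 * v"] that zero_le_power2[of v] by linarith
    qed
    have "x\<^sup>2 \<le> exp (2 * x)" "y\<^sup>2 \<le> exp (2 * y)" by (rule *, simp add: x_def y_def)+
    moreover have "1 \<le> exp (2 * x)" "1 \<le> exp (2 * y)" by (simp_all add: x_def y_def)
    ultimately have "x\<^sup>2 * 1 \<le> exp (2 * x) * exp (2 * y)" "1 * y\<^sup>2 \<le> exp (2 * x) * exp (2 * y)"
      by (intro mult_mono; simp)+
    then have "3 * sq_sum p \<le> 6 * (exp (2 * x) * exp (2 * y))" by (simp add: sq_sum_def x_def y_def)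
    then have "norm (b p) \<le> 6 * (exp (2 * x) * exp (2 * y))" using b[of p] by linarith
    then have "norm (b p) * norm (a p) \<le> (6 * (exp (2 * x) * exp (2 * y))) * C" by (intro mult_mono a) auto
    then show ?thesis by (simp add: norm_mult x_def y_def mult_ac)
  qed
  with C show ?thesis unfolding tame2_def by (meson mult_nonneg_nonneg zero_le_numeral)
qed

lemma theta2_exponential_sum:
  assumes "tame2 a" "Im t > 0"
  shows "(\<lambda>p. norm (a p * ee (of_int (qf p) / 3 * t + pairing p z)) * exp (pi * Im t / 12 * (2 * sq_sum p)))
    summable_on UNIV"
proof -
  obtain C where C: "C \<ge> 0" "\<And>p. norm (a p) \<le> C * (exp (2 * \<bar>of_int (fst p)\<bar>) * exp (2 * \<bar>of_int (snd p)\<bar>))"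
    using assms(1) unfolding tame2_def by blast
  define \<alpha> where "\<alpha> = pi * Im t / 6"
  define g where "g v k = exp ((2 + 2 * pi * \<bar>v\<bar>) * \<bar>of_int k\<bar> - \<alpha> * (of_int k)\<^sup>2)" for v and k :: int
  have gs: "g v summable_on UNIV" for v
    unfolding g_def using assms(2) by (intro summable_gauss) (simp add: \<alpha>_def)
  have "(\<lambda>(k, l). g (Im (z$1)) k * g (Im (z$2)) l) summable_on UNIV \<times> UNIV"
    by (intro summable_on_product_real gs) (auto simp: g_def)
  then have "(\<lambda>p. C * (g (Im (z$1)) (fst p) * g (Im (z$2)) (snd p))) summable_on UNIV"
    by (intro summable_on_cmult_right) (simp add: case_prod_unfold)
  then show ?thesis
  proof (rule summable_on_comparison_test)
    fix p :: "int \<times> int"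
    define x y where "x = real_of_int (fst p)" and "y = real_of_int (snd p)"
    define v w where "v = Im (z$1)" and "w = Im (z$2)"
    have im: "Im (of_int (qf p) / 3 * t + pairing p z) = of_int (qf p) / 3 * Im t + x * v + y * w"
      by (simp add: pairing_def x_def y_def v_def w_def)
    have "- (x * v) \<le> \<bar>x\<bar> * \<bar>v\<bar>" "- (y * w) \<le> \<bar>y\<bar> * \<bar>w\<bar>"
      by (metis abs_ge_minus_self abs_mult)+
    moreover have "sq_sum p / 6 * Im t \<le> of_int (qf p) / 3 * Im t"
      using qf_bounds(1)[of p] assms(2) by (intro mult_right_mono) auto
    ultimately have "- (of_int (qf p) / 3 * Im t + x * v + y * w) \<le> - (sq_sum p / 6 * Im t) + \<bar>x\<bar> * \<bar>v\<bar> + \<bar>y\<bar> * \<bar>w\<bar>"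
      by linarith
    then have "2 * pi * (- (of_int (qf p) / 3 * Im t + x * v + y * w)) \<le> 2 * pi * (- (sq_sum p / 6 * Im t) + \<bar>x\<bar> * \<bar>v\<bar> + \<bar>y\<bar> * \<bar>w\<bar>)"
      by (rule mult_left_mono) simp
    then have "- (2 * pi * (of_int (qf p) / 3 * Im t + x * v + y * w)) \<le> 2 * pi * (- (sq_sum p / 6 * Im t) + \<bar>x\<bar> * \<bar>v\<bar> + \<bar>y\<bar> * \<bar>w\<bar>)"
      by (simp only: mult_minus_right)
    then have e: "norm (ee (of_int (qf p) / 3 * t + pairing p z)) \<le> exp (2 * pi * (- (sq_sum p / 6 * Im t) + \<bar>x\<bar> * \<bar>v\<bar> + \<bar>y\<bar> * \<bar>w\<bar>))"
      by (simp only: norm_ee im exp_le_cancel_iff)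
    have "norm (a p * ee (of_int (qf p) / 3 * t + pairing p z))
        \<le> (C * (exp (2 * \<bar>x\<bar>) * exp (2 * \<bar>y\<bar>))) * exp (2 * pi * (- (sq_sum p / 6 * Im t) + \<bar>x\<bar> * \<bar>v\<bar> + \<bar>y\<bar> * \<bar>w\<bar>))"
      unfolding norm_mult x_def y_def by (intro mult_mono C(2) e[unfolded x_def y_def]) (use C in auto)
    then have "norm (a p * ee (of_int (qf p) / 3 * t + pairing p z)) * exp (pi * Im t / 12 * (2 * sq_sum p))
        \<le> (C * (exp (2 * \<bar>x\<bar>) * exp (2 * \<bar>y\<bar>))) * exp (2 * pi * (- (sq_sum p / 6 * Im t) + \<bar>x\<bar> * \<bar>v\<bar> + \<bar>y\<bar> * \<bar>w\<bar>)) * exp (pi * Im t / 12 * (2 * sq_sum p))"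
      by (intro mult_right_mono) auto
    also have "\<dots> = C * exp (2 * \<bar>x\<bar> + 2 * \<bar>y\<bar> + 2 * pi * (- (sq_sum p / 6 * Im t) + \<bar>x\<bar> * \<bar>v\<bar> + \<bar>y\<bar> * \<bar>w\<bar>) + pi * Im t / 12 * (2 * sq_sum p))"
      by (simp only: exp_add mult.assoc)
    also have "2 * \<bar>x\<bar> + 2 * \<bar>y\<bar> + 2 * pi * (- (sq_sum p / 6 * Im t) + \<bar>x\<bar> * \<bar>v\<bar> + \<bar>y\<bar> * \<bar>w\<bar>) + pi * Im t / 12 * (2 * sq_sum p)
        = ((2 + 2 * pi * \<bar>v\<bar>) * \<bar>x\<bar> - \<alpha> * x\<^sup>2) + ((2 + 2 * pi * \<bar>w\<bar>) * \<bar>y\<bar> - \<alpha> * y\<^sup>2)"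
      by (simp add: \<alpha>_def sq_sum_def x_def y_def field_simps)
    finally show "norm (a p * ee (of_int (qf p) / 3 * t + pairing p z)) * exp (pi * Im t / 12 * (2 * sq_sum p))
        \<le> C * (g (Im (z$1)) (fst p) * g (Im (z$2)) (snd p))"
      by (simp add: g_def exp_add x_def y_def v_def w_def)
  qed simp
qed

lemma norm_pairing_le: "norm (pairing p z) \<le> sq_sum p * norm z"
proof -
  have "norm (pairing p z) \<le> \<bar>of_int (fst p)\<bar> * norm (z$1) + \<bar>of_int (snd p)\<bar> * norm (z$2)"
    unfolding pairing_def by (rule order_trans[OF norm_triangle_ineq]) (simp add: norm_mult)
  also have "\<dots> \<le> (of_int (fst p))\<^sup>2 * norm z + (of_int (snd p))\<^sup>2 * norm z"
    by (intro add_mono mult_mono abs_int_le_square Finite_Cartesian_Product.norm_nth_le) auto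
  finally show ?thesis by (simp add: sq_sum_def algebra_simps)
qed

lemma bounded_linear_pairing: "bounded_linear (pairing p)"
  unfolding pairing_def by (intro bounded_linear_add bounded_linear_const_mult bounded_linear_vec_nth)

lemma
  assumes "tame2 a" "Im t > 0"
  shows theta2_has_sum: "((\<lambda>p. a p * ee (of_int (qf p) / 3 * t + pairing p z)) has_sum theta2 a t z) UNIV"
    and theta2_has_derivative: "((\<lambda>p. theta2 a (fst p) (snd p)) has_derivative
      (\<lambda>h. \<Sum>\<^sub>\<infinity>p. i2pi * (of_int (qf p) / 3 * fst h + pairing p (snd h)) *
         (a p * ee (of_int (qf p) / 3 * t + pairing p z)))) (at (t, z))"
    and DERIV_theta2: "((\<lambda>t. theta2 a t z) has_field_derivative
      i2pi * theta2 (\<lambda>p. of_int (qf p) / 3 * a p) t z) (at t)"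
    and theta2_deriv_has_sum:
      "((\<lambda>p. of_int (qf p) / 3 * a p * ee (of_int (qf p) / 3 * t + pairing p z)) has_sum
         theta2 (\<lambda>p. of_int (qf p) / 3 * a p) t z) UNIV"
proof -
  let ?L = "\<lambda>p (h::complex \<times> (complex^2)). of_int (qf p) / 3 * fst h + pairing p (snd h)"
  have lin: "bounded_linear (?L p)" for p
    by (intro bounded_linear_add bounded_linear_const_mult bounded_linear_fst
        bounded_linear_compose[OF bounded_linear_pairing bounded_linear_snd])
  have bnd: "norm (?L p h) \<le> 2 * sq_sum p * norm h" for p h
  proof -
    have "norm (?L p h) \<le> of_int (qf p) / 3 * norm (fst h) + norm (pairing p (snd h))"
      by (rule order_trans[OF norm_triangle_ineq]) (simp add: norm_mult norm_divide qf_nonneg)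
    also have "\<dots> \<le> sq_sum p * norm h + sq_sum p * norm h"
    proof (intro add_mono)
      show "of_int (qf p) / 3 * norm (fst h) \<le> sq_sum p * norm h"
      proof (intro mult_mono)
        have "0 \<le> sq_sum p" by (simp add: sq_sum_def)
        then show "of_int (qf p) / 3 \<le> sq_sum p" using qf_bounds(2)[of p] by linarith
      qed (use norm_fst_le[of "fst h" "snd h"] in \<open>auto simp: sq_sum_def\<close>)
      have "norm (pairing p (snd h)) \<le> sq_sum p * norm (snd h)" by (rule norm_pairing_le)
      also have "\<dots> \<le> sq_sum p * norm h"
        using norm_snd_le[of "snd h" "fst h"] by (intro mult_left_mono) (auto simp: sq_sum_def)
      finally show "norm (pairing p (snd h)) \<le> sq_sum p * norm h" .
    qed
    finally show ?thesis by (simp add: mult_ac)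
  qed
  have d: "pi * Im t / 12 > 0" using assms by simp
  have c: "2 * sq_sum p \<ge> 0" for p
    by (simp add: sq_sum_def)
  note * = exponential_sum[where I = UNIV and x = "(t, z)", OF lin bnd c d, unfolded fst_conv snd_conv,
      OF theta2_exponential_sum[OF assms]]
  show "((\<lambda>p. a p * ee (of_int (qf p) / 3 * t + pairing p z)) has_sum theta2 a t z) UNIV"
    unfolding theta2_def by (rule has_sum_infsum) (rule *(3))
  show D: "((\<lambda>p. theta2 a (fst p) (snd p)) has_derivative
      (\<lambda>h. \<Sum>\<^sub>\<infinity>p. i2pi * (of_int (qf p) / 3 * fst h + pairing p (snd h)) *
         (a p * ee (of_int (qf p) / 3 * t + pairing p z)))) (at (t, z))"
    unfolding theta2_def by (rule *(1))
  have S: "(\<lambda>p. i2pi * (of_int (qf p) / 3) * (a p * ee (of_int (qf p) / 3 * t + pairing p z))) summable_on UNIV"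
    using *(2)[of "(1, 0)"] by (simp add: pairing_def)
  have "(\<lambda>p. 1 / (i2pi) * (i2pi * (of_int (qf p) / 3) * (a p * ee (of_int (qf p) / 3 * t + pairing p z)))) summable_on UNIV"
    by (rule summable_on_cmult_right[OF S])
  then have S': "(\<lambda>p. of_int (qf p) / 3 * a p * ee (of_int (qf p) / 3 * t + pairing p z)) summable_on UNIV"
    by (simp add: mult.assoc)
  then show H: "((\<lambda>p. of_int (qf p) / 3 * a p * ee (of_int (qf p) / 3 * t + pairing p z)) has_sum
         theta2 (\<lambda>p. of_int (qf p) / 3 * a p) t z) UNIV"
    unfolding theta2_def by (rule has_sum_infsum)
  have "((\<lambda>s. (s, z)) has_derivative (\<lambda>h. (h, 0))) (at t)" by (auto intro!: derivative_eq_intros)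
  from has_derivative_compose[OF this D]
  have "((\<lambda>s. theta2 a s z) has_derivative
      (\<lambda>h. \<Sum>\<^sub>\<infinity>p. i2pi * (of_int (qf p) / 3 * h + pairing p 0) *
         (a p * ee (of_int (qf p) / 3 * t + pairing p z)))) (at t)"
    by simp
  moreover have "(\<Sum>\<^sub>\<infinity>p. i2pi * (of_int (qf p) / 3 * h + pairing p 0) *
         (a p * ee (of_int (qf p) / 3 * t + pairing p z)))
      = i2pi * theta2 (\<lambda>p. of_int (qf p) / 3 * a p) t z * h" for h
  proof (rule infsumI)
    have "((\<lambda>p. i2pi * (of_int (qf p) / 3 * a p * ee (of_int (qf p) / 3 * t + pairing p z)) * h) has_sum
        i2pi * theta2 (\<lambda>p. of_int (qf p) / 3 * a p) t z * h) UNIV"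
      by (intro has_sum_cmult_left has_sum_cmult_right H)
    then show "((\<lambda>p. i2pi * (of_int (qf p) / 3 * h + pairing p 0) *
         (a p * ee (of_int (qf p) / 3 * t + pairing p z))) has_sum
        i2pi * theta2 (\<lambda>p. of_int (qf p) / 3 * a p) t z * h) UNIV"
      by (simp add: pairing_def mult_ac)
  qed
  ultimately show "((\<lambda>t. theta2 a t z) has_field_derivative
      i2pi * theta2 (\<lambda>p. of_int (qf p) / 3 * a p) t z) (at t)"
    by (simp add: has_field_derivative_def)
qed

lemma theta2_has_derivative_linear:
  assumes "tame2 a" "Im t > 0"
  shows "\<exists>D. ((\<lambda>p. theta2 a (fst p) (snd p)) has_derivative D) (at (t, z)) \<and>
    (\<forall>c t v. D (c * t, c *s v) = c * D (t, v))"
proof (intro exI conjI allI)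
  let ?D = "\<lambda>h. \<Sum>\<^sub>\<infinity>p. i2pi * (of_int (qf p) / 3 * fst h + pairing p (snd h)) *
         (a p * ee (of_int (qf p) / 3 * t + pairing p z))"
  show "((\<lambda>p. theta2 a (fst p) (snd p)) has_derivative ?D) (at (t, z))"
    by (rule theta2_has_derivative[OF assms])
  show "?D (c * s, c *s v) = c * ?D (s, v)" for c s v
    by (subst infsum_cmult_right'[symmetric]) (simp add: pairing_def algebra_simps)
qed

lemma theta2_translate:
  "theta2 a t (z + w) = theta2 (\<lambda>p. ee (pairing p w) * a p) t z"
  unfolding theta2_def by (intro infsum_cong) (simp add: pairing_def ring_distribs ee_add)

text \<open>Completing the square: a shift of the index corresponds to a translation of \<open>z\<close> by a multiple of \<open>t\<close>.\<close>

lemma theta2_shift: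
  fixes z w :: "complex^2"
  assumes w: "w$1 = of_int (2 * u - v) / 3" "w$2 = of_int (2 * v - u) / 3"
  shows "theta2 a t z = ee (of_int (qf (u, v)) / 3 * t + pairing (u, v) z) *
    theta2 (\<lambda>p. a (fst p + u, snd p + v)) t (z + t *s w)"
proof -
  let ?g = "\<lambda>p. (fst p + u, snd p + v)"
  have "theta2 a t z = (\<Sum>\<^sub>\<infinity>p. a (?g p) * ee (of_int (qf (?g p)) / 3 * t + pairing (?g p) z))"
    unfolding theta2_def
    by (rule infsum_reindex_bij_betw[symmetric]) (rule bij_betwI[of _ _ _ "\<lambda>p. (fst p - u, snd p - v)"], auto)
  also have "\<dots> = (\<Sum>\<^sub>\<infinity>p. ee (of_int (qf (u, v)) / 3 * t + pairing (u, v) z) *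
      (a (?g p) * ee (of_int (qf p) / 3 * t + pairing p (z + t *s w))))"
  proof (rule infsum_cong)
    fix p
    have "of_int (qf (?g p)) / 3 * t + pairing (?g p) z
        = (of_int (qf (u, v)) / 3 * t + pairing (u, v) z) + (of_int (qf p) / 3 * t + pairing p (z + t *s w))"
      by (simp add: qf_def pairing_def w power2_eq_square field_simps)
    then show "a (?g p) * ee (of_int (qf (?g p)) / 3 * t + pairing (?g p) z)
        = ee (of_int (qf (u, v)) / 3 * t + pairing (u, v) z) *
          (a (?g p) * ee (of_int (qf p) / 3 * t + pairing p (z + t *s w)))"
      by (simp only: ee_add mult_ac)
  qed
  also have "\<dots> = ee (of_int (qf (u, v)) / 3 * t + pairing (u, v) z) * theta2 (\<lambda>p. a (fst p + u, snd p + v)) t (z + t *s w)"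
    unfolding theta2_def by (rule infsum_cmult_right')
  finally show ?thesis .
qed

lemma theta2_uminus: "theta2 a t (- z) = theta2 (\<lambda>p. a (- fst p, - snd p)) t z"
proof -
  have "theta2 (\<lambda>p. a (- fst p, - snd p)) t z
      = (\<Sum>\<^sub>\<infinity>p. a (- fst p, - snd p) * ee (of_int (qf (- fst p, - snd p)) / 3 * t + pairing (- fst p, - snd p) (- z)))"
    unfolding theta2_def by (intro infsum_cong) (simp add: qf_def pairing_def)
  also have "\<dots> = theta2 a t (- z)" unfolding theta2_def
    by (rule infsum_reindex_bij_betw) (rule bij_betwI[of _ _ _ "\<lambda>p. (- fst p, - snd p)"], auto)
  finally show ?thesis ..
qed

lemma theta2_add:
  assumes "tame2 a" "tame2 b" "Im t > 0"
  shows "theta2 (\<lambda>p. a p + b p) t z = theta2 a t z + theta2 b t z"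
  unfolding theta2_def ring_distribs
  using theta2_has_sum[OF assms(1,3)] theta2_has_sum[OF assms(2,3)] by (intro infsum_add) (auto simp: summable_on_def)

lemma theta2_cmult: "theta2 (\<lambda>p. c * a p) t z = c * theta2 a t z"
  unfolding theta2_def mult.assoc by (rule infsum_cmult_right')

section \<open>The inversion formula for the theta series of \<open>A\<^sub>2\<close>\<close>

text \<open>The negative of the factor \<open>1 / (i sqrt 3)\<close> of the inversion formula, where \<open>3\<close> is the determinant of \<open>A\<^sub>2\<close>.\<close>

definition kap :: complex where
  "kap = \<i> / of_real (sqrt 3)"

lemma kap_square: "kap * kap = - 1 / 3"
proof -
  have "complex_of_real (sqrt 3) * of_real (sqrt 3) = 3" by (simp flip: of_real_mult)
  then show ?thesis by (simp add: kap_def)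
qed

lemma kap_nonzero: "kap \<noteq> 0" using kap_square by auto

lemma gauss_factor_product:
  assumes "Im t > 0"
  shows "t * (gauss_factor (2 * t) * gauss_factor (3 / 2 * t)) = kap"
proof -
  let ?H = "{t. Im t > 0}"
  have D: "((\<lambda>t. gauss_factor (c * t)) has_field_derivative (- gauss_factor (c * t) / (2 * t))) (at t)"
    if "c \<noteq> 0" "Im (c * t) > 0" for c t
  proof -
    have "((\<lambda>t. gauss_factor (c * t)) has_field_derivative (- gauss_factor (c * t) / (2 * (c * t)) * c)) (at t)"
      by (rule DERIV_chain2[where f = gauss_factor and g = "\<lambda>t. c * t", OF DERIV_gauss_factor[OF that(2)]]) (auto intro!: derivative_eq_intros)
    then show ?thesis using that(1) by (simp add: field_simps)
  qed
  define A where "A t = t * (gauss_factor (2 * t) * gauss_factor (3 / 2 * t))" for t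
  have "(A has_field_derivative 0) (at t within ?H)" if "t \<in> ?H" for t
  proof -
    have t0: "t \<noteq> 0" using that by auto
    have "((\<lambda>t. t * (gauss_factor (2 * t) * gauss_factor (3 / 2 * t))) has_field_derivative
      1 * (gauss_factor (2 * t) * gauss_factor (3 / 2 * t)) +
      (- gauss_factor (2 * t) / (2 * t) * gauss_factor (3 / 2 * t) + - gauss_factor (3 / 2 * t) / (2 * t) * gauss_factor (2 * t)) * t) (at t)"
      using that by (intro DERIV_mult DERIV_ident D) auto
    also have "1 * (gauss_factor (2 * t) * gauss_factor (3 / 2 * t)) +
      (- gauss_factor (2 * t) / (2 * t) * gauss_factor (3 / 2 * t) + - gauss_factor (3 / 2 * t) / (2 * t) * gauss_factor (2 * t)) * t = 0"
      using t0 by (simp add: field_simps)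
    finally show ?thesis unfolding A_def[abs_def] by (rule has_field_derivative_at_within)
  qed
  then have "\<exists>c. \<forall>t\<in>?H. A t = c"
    by (intro has_field_derivative_zero_constant convex_halfspace_Im_gt)
  then have A: "A t = A \<i>" using assms by auto
  have "((\<lambda>t. t * gauss_factor t * gauss_factor t) has_field_derivative 0) (at t within ?H)" if "t \<in> ?H" for t
  proof -
    have t0: "t \<noteq> 0" using that by auto
    have "((\<lambda>t. t * gauss_factor t * gauss_factor t) has_field_derivative
      (1 * gauss_factor t + - gauss_factor t / (2 * t) * t) * gauss_factor t + - gauss_factor t / (2 * t) * (t * gauss_factor t)) (at t)"
      using that by (intro DERIV_mult DERIV_ident DERIV_gauss_factor) auto
    also have "(1 * gauss_factor t + - gauss_factor t / (2 * t) * t) * gauss_factor t + - gauss_factor t / (2 * t) * (t * gauss_factor t) = 0"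
      using t0 by (simp add: field_simps)
    finally show ?thesis by (rule has_field_derivative_at_within)
  qed
  then have "\<exists>c. \<forall>t\<in>?H. t * gauss_factor t * gauss_factor t = c"
    by (intro has_field_derivative_zero_constant convex_halfspace_Im_gt)
  then obtain c where c: "\<forall>t\<in>?H. t * gauss_factor t * gauss_factor t = c" ..
  have "c = \<i>" using bspec[OF c, of \<i>] gauss_factor_i by simp
  then have sq: "s * (gauss_factor s * gauss_factor s) = \<i>" if "Im s > 0" for s
    using bspec[OF c, of s] that by (simp add: mult.assoc)
  obtain r1 where r1: "r1 > 0" "gauss_factor (\<i> * of_real 2) = of_real r1"
    using gauss_factor_imaginary_pos[of 2] by auto
  obtain r2 where r2: "r2 > 0" "gauss_factor (\<i> * of_real (3 / 2)) = of_real r2"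
    using gauss_factor_imaginary_pos[of "3 / 2"] by auto
  have "\<i> * of_real 2 * (of_real r1 * of_real r1) = \<i>" using sq[of "\<i> * of_real 2"] r1 by simp
  then have "of_real (2 * (r1 * r1)) = (1 :: complex)" by simp
  then have 1: "2 * (r1 * r1) = 1" unfolding of_real_eq_1_iff .
  have "\<i> * of_real (3 / 2) * (of_real r2 * of_real r2) = \<i>" using sq[of "\<i> * of_real (3 / 2)"] r2 by simp
  then have "of_real (3 / 2 * (r2 * r2)) = (1 :: complex)" by simp
  then have 2: "3 / 2 * (r2 * r2) = 1" unfolding of_real_eq_1_iff .
  have "3 * (r1 * r2)\<^sup>2 = (2 * (r1 * r1)) * (3 / 2 * (r2 * r2))" by (simp add: power2_eq_square)
  then have "(r1 * r2)\<^sup>2 = 1 / 3" unfolding 1 2 by simp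
  then have "r1 * r2 = sqrt (1 / 3)" using r1 r2 by (metis mult_pos_pos real_sqrt_unique less_imp_le)
  then have "r1 * r2 = 1 / sqrt 3" by (simp add: real_sqrt_divide)
  then have "of_real r1 * of_real r2 = 1 / complex_of_real (sqrt 3)" by (metis of_real_1 of_real_divide of_real_mult)
  then have "A \<i> = kap" using r1 r2 by (simp add: A_def kap_def mult.commute)
  with A show ?thesis by (simp add: A_def)
qed

definition bq :: "complex^2 \<Rightarrow> complex" where
  "bq z = (z$1)\<^sup>2 + z$1 * z$2 + (z$2)\<^sup>2"

lemma bq_eq_half_norm: "half_norm A2 z = bq z"
  by (simp add: half_norm_def bil_A2 bq_def power2_eq_square algebra_simps)

definition class0 :: "int \<times> int \<Rightarrow> complex" where
  "class0 p = of_bool (3 dvd fst p + snd p)"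

lemma tame2_class0: "tame2 class0" by (rule tame2_bounded[of _ 1]) (simp add: class0_def)

lemma tame2_1: "tame2 (\<lambda>_. 1)" by (rule tame2_bounded[of _ 1]) simp

text \<open>
  By completing squares, \<open>X\<^sup>2 + X Y + Y\<^sup>2 = (X + Y/2)\<^sup>2 + 3 Y\<^sup>2/4\<close>, so that the inversion formula in one
  variable applies first to the sum over \<open>X\<close> and then, after interchanging the sums, to that over \<open>Y\<close>.
\<close>

lemma theta2_class0_has_sum:
  assumes t: "Im t > 0"
  shows "((\<lambda>(x, y). ee (t * bq (vector [of_int x + w1, of_int y + w2]))) has_sum
     ee (t * bq (vector [w1, w2])) * theta2 class0 t (t *s vector [w1, w2])) UNIV"
proof -
  let ?w = "vector [w1, w2] :: complex^2"
  let ?f = "\<lambda>p. ee (t * bq ?w) * (class0 p * ee (of_int (qf p) / 3 * t + pairing p (t *s ?w)))"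
  let ?g = "\<lambda>p :: int \<times> int. (2 * fst p + snd p, fst p + 2 * snd p)"
  have "(?f has_sum ee (t * bq ?w) * theta2 class0 t (t *s ?w)) UNIV"
    by (intro has_sum_cmult_right theta2_has_sum tame2_class0 t)
  also have "?this \<longleftrightarrow> (?f has_sum ee (t * bq ?w) * theta2 class0 t (t *s ?w)) (range ?g)"
  proof (rule has_sum_cong_neutral)
    fix p assume "p \<in> UNIV - range ?g"
    have "p \<in> range ?g" if "3 dvd fst p + snd p"
    proof -
      from that obtain j where "fst p + snd p = 3 * j" ..
      then have "p = ?g (fst p - j, snd p - j)" by (simp add: prod_eq_iff)
      then show ?thesis by blast
    qed
    with \<open>p \<in> UNIV - range ?g\<close> show "?f p = 0"
      by (auto simp: class0_def)
  qed auto
  also have "\<dots> \<longleftrightarrow> ((?f \<circ> ?g) has_sum ee (t * bq ?w) * theta2 class0 t (t *s ?w)) UNIV"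
    by (rule has_sum_reindex) (auto simp: inj_on_def prod_eq_iff)
  also have "?f \<circ> ?g = (\<lambda>(x, y). ee (t * bq (vector [of_int x + w1, of_int y + w2])))"
  proof
    fix p :: "int \<times> int"
    obtain x y where p: "p = (x, y)" by (cases p)
    have "3 dvd (2 * x + y) + (x + 2 * y)" by (rule dvdI[of _ _ "x + y"]) simp
    then have c: "class0 (?g p) = 1" by (simp add: class0_def p)
    have "t * bq ?w + (of_int (qf (?g p)) / 3 * t + pairing (?g p) (t *s ?w)) = t * bq (vector [of_int x + w1, of_int y + w2])"
      by (simp add: p bq_def qf_def pairing_def power2_eq_square field_simps)
    then show "(?f \<circ> ?g) p = (case p of (x, y) \<Rightarrow> ee (t * bq (vector [of_int x + w1, of_int y + w2])))"
      unfolding o_apply c mult_1_left ee_add[symmetric] by (simp add: p)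
  qed
  finally show ?thesis .
qed

lemma theta2_inversion_aux:
  assumes t: "Im t > 0"
  shows "ee (t * bq (vector [w1, w2])) * theta2 class0 t (t *s vector [w1, w2])
    = gauss_factor (2 * t) * gauss_factor (3 / 2 * t) * theta2 (\<lambda>_. 1) (- 1 / t) (vector [w1, w2])"
proof -
  have t0: "t \<noteq> 0" using t by auto
  have t2: "Im (2 * t) > 0" and t3: "Im (3 / 2 * t) > 0" using t by simp_all
  define L where "L = ee (t * bq (vector [w1, w2])) * theta2 class0 t (t *s vector [w1, w2])"
  define T where "T y k = ee (3 / 4 * t * (of_int y + w2)\<^sup>2) * ee ((of_int k)\<^sup>2 / 2 * (- 1 / (2 * t)) + of_int k * (w1 + (of_int y + w2) / 2))"
    for y k :: int
  have inner: "((\<lambda>x. ee (t * bq (vector [of_int x + w1, of_int y + w2]))) has_sum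
      gauss_factor (2 * t) * (\<Sum>\<^sub>\<infinity>k. T y k)) UNIV" and Ts: "(\<lambda>k. T y k) summable_on UNIV" for y
  proof -
    define Y where "Y = of_int y + w2"
    have s: "((\<lambda>k. ee (3 / 4 * t * Y\<^sup>2) * (1 * ee ((of_int k)\<^sup>2 / 2 * (- 1 / (2 * t)) + of_int k * (w1 + Y / 2)))) has_sum
        ee (3 / 4 * t * Y\<^sup>2) * theta0 (- 1 / (2 * t)) (w1 + Y / 2)) UNIV"
      by (intro has_sum_cmult_right theta1_has_sum tame_const Im_inversion t2)
    then have s: "((\<lambda>k. T y k) has_sum ee (3 / 4 * t * Y\<^sup>2) * theta0 (- 1 / (2 * t)) (w1 + Y / 2)) UNIV"
      by (simp only: T_def Y_def mult_1_left)
    then show "(\<lambda>k. T y k) summable_on UNIV" by (rule has_sum_imp_summable)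
    have "((\<lambda>x. ee (3 / 4 * t * Y\<^sup>2) * ee (2 * t * (of_int x + (w1 + Y / 2))\<^sup>2 / 2)) has_sum
        ee (3 / 4 * t * Y\<^sup>2) * gauss_theta (2 * t) (w1 + Y / 2)) UNIV"
      by (intro has_sum_cmult_right gauss_theta_has_sum t2)
    also have "(\<lambda>x. ee (3 / 4 * t * Y\<^sup>2) * ee (2 * t * (of_int x + (w1 + Y / 2))\<^sup>2 / 2))
        = (\<lambda>x. ee (t * bq (vector [of_int x + w1, of_int y + w2])))"
      unfolding ee_add[symmetric] Y_def bq_def
      by (intro ext arg_cong[of _ _ ee]) (simp add: power2_eq_square field_simps)
    also have "ee (3 / 4 * t * Y\<^sup>2) * gauss_theta (2 * t) (w1 + Y / 2) = gauss_factor (2 * t) * (\<Sum>\<^sub>\<infinity>k. T y k)"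
      unfolding infsumI[OF s] gauss_theta_inversion[OF t2] by (simp only: mult_ac)
    finally show "((\<lambda>x. ee (t * bq (vector [of_int x + w1, of_int y + w2]))) has_sum
      gauss_factor (2 * t) * (\<Sum>\<^sub>\<infinity>k. T y k)) UNIV" .
  qed
  have "((\<lambda>(x, y). ee (t * bq (vector [of_int x + w1, of_int y + w2]))) has_sum L) (UNIV \<times> UNIV)"
    using theta2_class0_has_sum[OF t, of w1 w2] by (simp add: L_def)
  then have "((\<lambda>(y, x). ee (t * bq (vector [of_int x + w1, of_int y + w2]))) has_sum L) (UNIV \<times> UNIV)"
    by (subst has_sum_swap) (simp add: case_prod_unfold)
  then have L: "((\<lambda>y. gauss_factor (2 * t) * (\<Sum>\<^sub>\<infinity>k. T y k)) has_sum L) UNIV"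
    by (rule has_sum_SigmaD) (simp only: prod.case inner)
  define U where "U k m = ee ((of_int k)\<^sup>2 / 2 * (- 1 / (2 * t)) + of_int k * w1) * ee (- ((of_int k)\<^sup>2 / (12 * t))) *
      ee ((of_int m)\<^sup>2 / 2 * (- 1 / (3 / 2 * t)) + of_int m * (w2 + of_int k / (3 * t)))" for k m :: int
  have outer: "((\<lambda>y. T y k) has_sum gauss_factor (3 / 2 * t) * (\<Sum>\<^sub>\<infinity>m. U k m)) UNIV" for k
  proof -
    define e where "e = ee ((of_int k)\<^sup>2 / 2 * (- 1 / (2 * t)) + of_int k * w1) * ee (- ((of_int k)\<^sup>2 / (12 * t)))"
    define c where "c = w2 + of_int k / (3 * t)"
    have "((\<lambda>m. e * (1 * ee ((of_int m)\<^sup>2 / 2 * (- 1 / (3 / 2 * t)) + of_int m * c))) has_sum e * theta0 (- 1 / (3 / 2 * t)) c) UNIV"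
      by (intro has_sum_cmult_right theta1_has_sum tame_const Im_inversion t3)
    then have s: "((\<lambda>m. U k m) has_sum e * theta0 (- 1 / (3 / 2 * t)) c) UNIV"
      by (simp only: U_def e_def c_def mult_1_left)
    have "((\<lambda>y. e * ee (3 / 2 * t * (of_int y + c)\<^sup>2 / 2)) has_sum e * gauss_theta (3 / 2 * t) c) UNIV"
      by (intro has_sum_cmult_right gauss_theta_has_sum t3)
    also have "(\<lambda>y. e * ee (3 / 2 * t * (of_int y + c)\<^sup>2 / 2)) = (\<lambda>y. T y k)"
      unfolding T_def e_def ee_add[symmetric] c_def
      by (intro ext arg_cong[of _ _ ee]) (use t0 in \<open>simp add: power2_eq_square field_simps\<close>)
    also have "e * gauss_theta (3 / 2 * t) c = gauss_factor (3 / 2 * t) * (\<Sum>\<^sub>\<infinity>m. U k m)"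
      unfolding infsumI[OF s] gauss_theta_inversion[OF t3] by (simp only: mult_ac)
    finally show ?thesis .
  qed
  have Tsum: "(\<lambda>(y, k). T y k) summable_on UNIV \<times> UNIV"
  proof -
    have "((\<lambda>x. ee (3 / 2 * t * (of_int x + w2)\<^sup>2 / 2)) has_sum gauss_theta (3 / 2 * t) w2) UNIV"
      by (rule gauss_theta_has_sum[OF t3])
    then have s1: "(\<lambda>y::int. norm (ee (3 / 4 * t * (of_int y + w2)\<^sup>2))) summable_on UNIV"
      unfolding summable_on_iff_abs_summable_on_complex[symmetric] by (auto simp: summable_on_def)
    have "((\<lambda>k. 1 * ee ((of_int k)\<^sup>2 / 2 * (- 1 / (2 * t)) + of_int k * (w1 + w2 / 2))) has_sum theta0 (- 1 / (2 * t)) (w1 + w2 / 2)) UNIV"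
      by (intro theta1_has_sum tame_const Im_inversion t2)
    then have s2: "(\<lambda>k::int. norm (ee ((of_int k)\<^sup>2 / 2 * (- 1 / (2 * t)) + of_int k * (w1 + w2 / 2)))) summable_on UNIV"
      unfolding summable_on_iff_abs_summable_on_complex[symmetric] by (auto simp: summable_on_def)
    have "norm (ee ((of_int k)\<^sup>2 / 2 * (- 1 / (2 * t)) + of_int k * (w1 + (of_int y + w2) / 2)))
        = norm (ee ((of_int k)\<^sup>2 / 2 * (- 1 / (2 * t)) + of_int k * (w1 + w2 / 2)))" for k y :: int
      unfolding norm_ee by (simp add: algebra_simps)
    with summable_on_product_real[OF s1 s2] show ?thesis
      by (subst summable_on_iff_abs_summable_on_complex) (simp add: T_def norm_mult case_prod_unfold)
  qed
  have U: "((\<lambda>(k, m). U k m) has_sum theta2 (\<lambda>_. 1) (- 1 / t) (vector [w1, w2])) (UNIV \<times> UNIV)"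
  proof -
    have "(\<lambda>p. 1 * ee (of_int (qf p) / 3 * (- 1 / t) + pairing p (vector [w1, w2]))) = (\<lambda>(k, m). U k m)"
      unfolding U_def ee_add[symmetric] mult_1_left case_prod_unfold
      by (intro ext arg_cong[of _ _ ee]) (use t0 in \<open>simp add: qf_def pairing_def power2_eq_square field_simps\<close>)
    with theta2_has_sum[OF tame2_1 Im_inversion[OF t], of "vector [w1, w2]"] show ?thesis
      by simp
  qed
  have Us: "(\<lambda>m. U k m) summable_on UNIV" for k
    using has_sum_imp_summable[OF U] by (rule summable_on_SigmaD1) auto
  have U': "((\<lambda>k. \<Sum>\<^sub>\<infinity>m. U k m) has_sum theta2 (\<lambda>_. 1) (- 1 / t) (vector [w1, w2])) UNIV"
    by (rule has_sum_SigmaD[OF U]) (simp add: has_sum_infsum Us)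
  obtain S where S: "((\<lambda>(y, k). T y k) has_sum S) (UNIV \<times> UNIV)"
    using Tsum by (auto simp: summable_on_def)
  have "((\<lambda>y. \<Sum>\<^sub>\<infinity>k. T y k) has_sum S) UNIV"
    by (rule has_sum_SigmaD[OF S]) (simp add: has_sum_infsum Ts)
  then have "((\<lambda>y. gauss_factor (2 * t) * (\<Sum>\<^sub>\<infinity>k. T y k)) has_sum gauss_factor (2 * t) * S) UNIV"
    by (rule has_sum_cmult_right)
  with L have 1: "L = gauss_factor (2 * t) * S" by (rule has_sum_unique)
  have "((\<lambda>(k, y). T y k) has_sum S) (UNIV \<times> UNIV)"
    using S by (subst has_sum_swap) (simp add: case_prod_unfold)
  then have "((\<lambda>k. gauss_factor (3 / 2 * t) * (\<Sum>\<^sub>\<infinity>m. U k m)) has_sum S) UNIV"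
    by (rule has_sum_SigmaD) (simp only: prod.case outer)
  moreover have "((\<lambda>k. gauss_factor (3 / 2 * t) * (\<Sum>\<^sub>\<infinity>m. U k m)) has_sum
      gauss_factor (3 / 2 * t) * theta2 (\<lambda>_. 1) (- 1 / t) (vector [w1, w2])) UNIV"
    by (rule has_sum_cmult_right[OF U'])
  ultimately have "S = gauss_factor (3 / 2 * t) * theta2 (\<lambda>_. 1) (- 1 / t) (vector [w1, w2])"
    by (rule has_sum_unique)
  with 1 show ?thesis by (simp add: L_def)
qed

definition classP :: "int \<times> int \<Rightarrow> complex" where
  "classP p = of_bool (\<not> 3 dvd fst p + snd p)"

definition classN :: "int \<times> int \<Rightarrow> complex" where
  "classN p = (if (fst p + snd p) mod 3 = 0 then 0 else if (fst p + snd p) mod 3 = 1 then 1 else - 1)"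

abbreviation "Th0 \<equiv> theta2 class0"
abbreviation "ThP \<equiv> theta2 classP"
abbreviation "ThN \<equiv> theta2 classN"

lemma tame2_classP: "tame2 classP" by (rule tame2_bounded[of _ 1]) (simp add: classP_def)

lemma tame2_classN: "tame2 classN" by (rule tame2_bounded[of _ 1]) (simp add: classN_def)

lemma theta2_1_eq: "Im t > 0 \<Longrightarrow> theta2 (\<lambda>_. 1) t z = Th0 t z + ThP t z"
  by (subst theta2_add[symmetric, OF tame2_class0 tame2_classP])
     (auto simp: theta2_def class0_def classP_def intro!: infsum_cong)

text \<open>The inversion interchanges the sums over the lattice and over its dual, and \<open>ThP\<close> is their difference.\<close>

lemma theta2_1_inversion:
  assumes t: "Im t > 0"
  shows "theta2 (\<lambda>_. 1) (- 1 / t) ((1 / t) *s z) = ee (bq z / t) * (t / kap) * Th0 t z"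
proof -
  have t0: "t \<noteq> 0" using t by auto
  define w where "w = (1 / t) *s z"
  have w: "vector [w$1, w$2] = w" by (simp add: vec_eq_iff forall_2)
  have z: "t *s w = z" using t0 by (simp add: w_def vec_eq_iff)
  have b: "t * bq w = bq z / t" using t0 by (simp add: w_def bq_def power2_eq_square field_simps)
  have "ee (bq z / t) * Th0 t z = gauss_factor (2 * t) * gauss_factor (3 / 2 * t) * theta2 (\<lambda>_. 1) (- 1 / t) w"
    using theta2_inversion_aux[OF t, of "w$1" "w$2"] unfolding w z b .
  then have "t * (ee (bq z / t) * Th0 t z) = t * (gauss_factor (2 * t) * gauss_factor (3 / 2 * t)) * theta2 (\<lambda>_. 1) (- 1 / t) w"
    by (simp only: mult.assoc)
  then have "t * (ee (bq z / t) * Th0 t z) = kap * theta2 (\<lambda>_. 1) (- 1 / t) w"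
    by (simp only: gauss_factor_product[OF t])
  then show ?thesis using kap_nonzero by (simp add: w_def field_simps)
qed

lemma Th0_inversion:
  assumes t: "Im t > 0"
  shows "Th0 (- 1 / t) ((1 / t) *s z) = ee (bq z / t) * (- kap * t) * (Th0 t z + ThP t z)"
proof -
  have t0: "t \<noteq> 0" using t by auto
  define t' w where "t' = - 1 / t" and "w = (1 / t) *s z"
  have t': "Im t' > 0" unfolding t'_def by (rule Im_inversion[OF t])
  have 1: "- 1 / t' = t" "(1 / t') *s w = - z" "bq w / t' = - (bq z / t)"
    using t0 by (simp_all add: t'_def w_def vec_eq_iff bq_def power2_eq_square field_simps)
  have "theta2 (\<lambda>_. 1) t (- z) = ee (- (bq z / t)) * (t' / kap) * Th0 t' w"
    using theta2_1_inversion[OF t', of w] unfolding 1 .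
  then have "Th0 t z + ThP t z = ee (- (bq z / t)) * (- 1 / (t * kap)) * Th0 t' w"
    by (simp add: theta2_uminus theta2_1_eq[OF t] t'_def)
  then show ?thesis
    unfolding t'_def[symmetric] w_def[symmetric] using t0 kap_nonzero by (simp add: ee_minus field_simps)
qed

lemma ThP_inversion:
  assumes t: "Im t > 0"
  shows "ThP (- 1 / t) ((1 / t) *s z) = ee (bq z / t) * (kap * t) * (ThP t z - 2 * Th0 t z)"
proof -
  have "- 3 * kap * t * kap = - 3 * (kap * kap) * t" by (simp only: mult_ac)
  also have "\<dots> = t" by (simp add: kap_square)
  finally have k: "t / kap = - 3 * kap * t" using kap_nonzero by (metis nonzero_divide_eq_eq)
  have "ThP (- 1 / t) ((1 / t) *s z) = theta2 (\<lambda>_. 1) (- 1 / t) ((1 / t) *s z) - Th0 (- 1 / t) ((1 / t) *s z)"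
    by (simp only: theta2_1_eq[OF Im_inversion[OF t]] add_diff_cancel_left')
  also have "\<dots> = ee (bq z / t) * (kap * t) * (ThP t z - 2 * Th0 t z)"
    unfolding theta2_1_inversion[OF t] Th0_inversion[OF t] k by (simp add: algebra_simps)
  finally show ?thesis .
qed

text \<open>
  The odd combination is obtained from the sum over the whole dual lattice by translating the
  argument by the cube root of unity characters; \<open>i * sqrt 3\<close> is the Gauss sum modulo \<open>3\<close>.
\<close>

lemma ee_third: "ee (1 / 3) - ee (- (1 / 3)) = \<i> * of_real (sqrt 3)"
proof -
  have e: "ee (of_real x) = of_real (cos (2 * pi * x)) + \<i> * of_real (sin (2 * pi * x))" for x
  proof -
    have "i2pi * of_real x = \<i> * complex_of_real (2 * pi * x)" by simp
    then show ?thesis unfolding ee_def by (simp only: cis_conv_exp[symmetric] cis.code complex_eq Complex_eq)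
  qed
  have a: "2 * pi * (1 / 3) = pi - pi / 3" by simp
  have c: "cos (2 * pi * (1 / 3)) = - (1 / 2)" "sin (2 * pi * (1 / 3)) = sqrt 3 / 2"
    unfolding a by (simp_all only: cos_pi_minus sin_pi_minus cos_60 sin_60)
  have m: "2 * pi * (- (1 / 3)) = - (2 * pi * (1 / 3))" by simp
  have "ee (of_real (1 / 3)) - ee (of_real (- (1 / 3))) = \<i> * of_real (sqrt 3)"
    unfolding e m cos_minus sin_minus c by simp
  then show ?thesis by simp
qed

lemma classN_eq: "classN p = (ee (of_int (fst p + snd p) / 3) - ee (- (of_int (fst p + snd p) / 3))) / (\<i> * of_real (sqrt 3))"
proof -
  define n where "n = fst p + snd p"
  have n: "of_int n / 3 = of_int (n mod 3) / 3 + (of_int (n div 3) :: complex)"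
    using div_mult_mod_eq[of n 3] by (metis (no_types, opaque_lifting) add.commute add_divide_distrib nonzero_mult_div_cancel_right of_int_add of_int_mult of_int_numeral zero_neq_numeral)
  have e: "ee (of_int n / 3) = ee (of_int (n mod 3) / 3)" "ee (- (of_int n / 3)) = ee (- (of_int (n mod 3) / 3))"
    unfolding n by (simp_all add: ee_add ee_diff ee_minus)
  have s: "\<i> * complex_of_real (sqrt 3) \<noteq> 0" by simp
  have "ee (2 / 3) = ee (- (1 / 3) + 1)" "ee (- (2 / 3)) = ee (1 / 3 - 1)" by simp_all
  then have t: "ee (2 / 3) = ee (- (1 / 3))" "ee (- (2 / 3)) = ee (1 / 3)"
    by (simp_all only: ee_add ee_diff ee_1 mult_1_right div_by_1)
  consider "n mod 3 = 0" | "n mod 3 = 1" | "n mod 3 = 2"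
    by linarith
  then show ?thesis
  proof cases
    case 1
    then show ?thesis by (simp add: classN_def n_def[symmetric] e)
  next
    case 2
    then show ?thesis using ee_third s by (simp add: classN_def n_def[symmetric] e)
  next
    case 3
    have "ee (2 / 3) - ee (- (2 / 3)) = - (\<i> * of_real (sqrt 3))" unfolding t ee_third[symmetric] by simp
    with 3 s show ?thesis
      by (simp add: classN_def n_def[symmetric] e)
  qed
qed

lemma ThN_inversion:
  assumes t: "Im t > 0"
  shows "ThN (- 1 / t) ((1 / t) *s z) = ee (bq z / t) * t * ThN t z"
proof -
  have t0: "t \<noteq> 0" using t by auto
  define \<rho> :: "complex^2" where "\<rho> = vector [1 / 3, 1 / 3]"
  have \<rho>: "\<rho>$1 = 1 / 3" "\<rho>$2 = 1 / 3" by (simp_all add: \<rho>_def)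
  define cl where "cl j p = (of_bool ((fst p + snd p) mod 3 = j) :: complex)" for j :: int and p :: "int \<times> int"
  have tame: "tame2 (cl j)" for j
    by (rule tame2_bounded[of _ 1]) (simp add: cl_def)
  have main: "theta2 (\<lambda>p. ee (pairing p (e *s \<rho>)) * 1) (- 1 / t) ((1 / t) *s z) = ee (bq z / t) * (t / kap) * theta2 (cl j) t z"
    if ej: "e = of_int j'" "j' * 2 mod 3 = j" "j' = 1 \<or> j' = - 1" for e j j'
  proof -
    have sq: "e * e = 1" using ej by auto
    have "theta2 (\<lambda>p. ee (pairing p (e *s \<rho>)) * 1) (- 1 / t) ((1 / t) *s z) = theta2 (\<lambda>_. 1) (- 1 / t) ((1 / t) *s z + e *s \<rho>)"
      by (rule theta2_translate[symmetric])
    also have "(1 / t) *s z + e *s \<rho> = (1 / t) *s (z + t *s (e *s \<rho>))" using t0 by (simp add: vec_eq_iff)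
    also have "theta2 (\<lambda>_. 1) (- 1 / t) \<dots> = ee (bq (z + t *s (e *s \<rho>)) / t) * (t / kap) * Th0 t (z + t *s (e *s \<rho>))"
      by (rule theta2_1_inversion[OF t])
    also have "bq (z + t *s (e *s \<rho>)) / t = bq z / t + (of_int (qf (j', j')) / 3 * t + pairing (j', j') z)"
    proof -
      have 1: "bq (z + t *s (e *s \<rho>)) = bq z + t * e * (z$1 + z$2) + t * t * (e * e) / 3"
        by (simp add: bq_def \<rho> power2_eq_square field_simps)
      have 2: "of_int (qf (j', j')) / 3 * t + pairing (j', j') z = t / 3 + e * (z$1 + z$2)"
        using ej by (auto simp: qf_def pairing_def algebra_simps)
      show ?thesis unfolding 1 2 sq using t0 by (simp add: field_simps)
    qed
    also have "ee \<dots> * (t / kap) * Th0 t (z + t *s (e *s \<rho>))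
        = ee (bq z / t) * (t / kap) * (ee (of_int (qf (j', j')) / 3 * t + pairing (j', j') z) * Th0 t (z + t *s (e *s \<rho>)))"
      by (simp only: ee_add mult_ac)
    also have "ee (of_int (qf (j', j')) / 3 * t + pairing (j', j') z) * Th0 t (z + t *s (e *s \<rho>)) = theta2 (cl j) t z"
    proof -
      have "class0 = (\<lambda>p. cl j (fst p + j', snd p + j'))"
        using ej by (auto simp: fun_eq_iff cl_def class0_def) presburger+
      moreover have "(e *s \<rho>)$1 = of_int (2 * j' - j') / 3" "(e *s \<rho>)$2 = of_int (2 * j' - j') / 3"
        using ej by (simp_all add: \<rho>)
      ultimately show ?thesis using theta2_shift[of "e *s \<rho>" j' j' "cl j" t z] by simp
    qed
    finally show ?thesis .
  qed
  have m1: "theta2 (\<lambda>p. ee (pairing p (1 *s \<rho>)) * 1) (- 1 / t) ((1 / t) *s z) = ee (bq z / t) * (t / kap) * theta2 (cl 2) t z"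
    by (rule main[of 1 1]) simp_all
  have m2: "theta2 (\<lambda>p. ee (pairing p ((- 1) *s \<rho>)) * 1) (- 1 / t) ((1 / t) *s z) = ee (bq z / t) * (t / kap) * theta2 (cl 1) t z"
    by (rule main[of "- 1" "- 1"]) simp_all
  let ?s = "\<i> * complex_of_real (sqrt 3)"
  have "classN = (\<lambda>p. 1 / ?s * (ee (pairing p (1 *s \<rho>)) * 1) + (- 1 / ?s) * (ee (pairing p ((- 1) *s \<rho>)) * 1))"
    unfolding classN_eq by (simp add: fun_eq_iff pairing_def \<rho> ee_add ee_diff ee_minus add_divide_distrib diff_divide_distrib)
  then have eq: "ThN (- 1 / t) ((1 / t) *s z)
      = theta2 (\<lambda>p. 1 / ?s * (ee (pairing p (1 *s \<rho>)) * 1) + (- 1 / ?s) * (ee (pairing p ((- 1) *s \<rho>)) * 1)) (- 1 / t) ((1 / t) *s z)"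
    by simp
  have n: "norm (ee (pairing p (of_real c *s \<rho>))) = 1" for p and c :: real
    by (simp add: norm_ee pairing_def \<rho>)
  have A: "tame2 (\<lambda>p. 1 / ?s * (ee (pairing p (1 *s \<rho>)) * 1))" "tame2 (\<lambda>p. (- 1 / ?s) * (ee (pairing p ((- 1) *s \<rho>)) * 1))"
    using n[of _ 1] n[of _ "-1"] by (auto intro!: tame2_bounded[of _ "norm (1 / ?s)"] simp: norm_mult norm_divide)
  note eq
  also have "theta2 (\<lambda>p. 1 / ?s * (ee (pairing p (1 *s \<rho>)) * 1) + (- 1 / ?s) * (ee (pairing p ((- 1) *s \<rho>)) * 1)) (- 1 / t) ((1 / t) *s z)
      = 1 / ?s * theta2 (\<lambda>p. ee (pairing p (1 *s \<rho>)) * 1) (- 1 / t) ((1 / t) *s z)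
      + (- 1 / ?s) * theta2 (\<lambda>p. ee (pairing p ((- 1) *s \<rho>)) * 1) (- 1 / t) ((1 / t) *s z)"
    by (simp only: theta2_add[OF A Im_inversion[OF t]] theta2_cmult)
  also have "\<dots> = ee (bq z / t) * (t / (kap * ?s)) * (theta2 (cl 2) t z - theta2 (cl 1) t z)"
    unfolding m1 m2 using kap_nonzero by (simp add: field_simps)
  also have "theta2 (cl 2) t z - theta2 (cl 1) t z = - ThN t z"
  proof -
    have "cl 1 = (\<lambda>p. classN p + cl 2 p)" by (auto simp: fun_eq_iff cl_def classN_def)
    then have "theta2 (cl 1) t z = ThN t z + theta2 (cl 2) t z" using theta2_add[OF tame2_classN tame t] by metis
    then show ?thesis by simp
  qed
  also have "kap * ?s = - 1" by (simp add: kap_def)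
  finally show ?thesis by simp
qed

text \<open>The phase is a cube root of unity because \<open>qf p\<close> modulo \<open>3\<close> depends only on the class of \<open>p\<close>.\<close>

lemma theta2_translate_t:
  assumes "\<And>p. a p \<noteq> 0 \<Longrightarrow> [qf p = c] (mod 3)"
  shows "theta2 a (t + 1) z = ee (of_int c / 3) * theta2 a t z"
proof -
  have "a p * ee (of_int (qf p) / 3 * (t + 1) + pairing p z) = ee (of_int c / 3) * (a p * ee (of_int (qf p) / 3 * t + pairing p z))" for p
  proof (cases "a p = 0")
    case False
    from assms[OF this] obtain j where "qf p = c + 3 * j"
      by (metis cong_iff_lin cong_sym mult.commute)
    then have q: "(of_int (qf p) :: complex) = of_int c + 3 * of_int j" by simp
    have "of_int (qf p) / 3 * (t + 1) + pairing p z = of_int c / 3 + (of_int (qf p) / 3 * t + pairing p z) + of_int j"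
      unfolding q by (simp add: field_simps)
    then show ?thesis by (simp only: ee_add ee_of_int mult_1_left mult_1_right mult_ac)
  qed simp
  then show ?thesis unfolding theta2_def by (simp only: infsum_cmult_right')
qed

lemma qf_mod_3: "[qf p = (fst p + snd p)\<^sup>2] (mod 3)"
proof -
  have "qf p = (fst p + snd p)\<^sup>2 - 3 * (fst p * snd p)" by (simp add: qf_def power2_eq_square algebra_simps)
  then show ?thesis by (simp add: cong_iff_dvd_diff)
qed

lemma square_mod_3: "n mod 3 \<noteq> 0 \<Longrightarrow> [n\<^sup>2 = 1] (mod 3)" for n :: int
proof -
  assume "n mod 3 \<noteq> 0"
  then have "n mod 3 = 1 \<or> n mod 3 = 2" by presburger
  then have "(n mod 3)\<^sup>2 mod 3 = 1 mod 3" by auto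
  then show ?thesis by (simp add: cong_def power_mod)
qed

lemma qf_class0: "class0 p \<noteq> 0 \<Longrightarrow> [qf p = 0] (mod 3)"
  using qf_mod_3[of p] by (auto simp: class0_def cong_def power2_eq_square split: if_splits)

lemma qf_class1: "(fst p + snd p) mod 3 \<noteq> 0 \<Longrightarrow> [qf p = 1] (mod 3)"
  using cong_trans[OF qf_mod_3 square_mod_3] by blast

lemma Th0_translate: "Th0 (t + 1) z = Th0 t z" using theta2_translate_t[of class0 0, OF qf_class0] by simp

lemma ThP_translate: "ThP (t + 1) z = ee (1 / 3) * ThP t z"
  using theta2_translate_t[of classP 1, OF qf_class1] by (simp add: classP_def dvd_eq_mod_eq_0)

lemma ThN_translate: "ThN (t + 1) z = ee (1 / 3) * ThN t z"
proof -
  have "[qf p = 1] (mod 3)" if "classN p \<noteq> 0" for p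
    using that qf_class1[of p] by (auto simp: classN_def split: if_splits)
  then show ?thesis using theta2_translate_t[of classN 1] by simp
qed

text \<open>Translating \<open>z\<close> by \<open>x t + y\<close> shifts the index by a lattice point, to which periodic coefficients are blind.\<close>

lemma theta2_elliptic:
  fixes x y :: "int^2" and z :: "complex^2"
  assumes a: "\<And>p u v. 3 dvd u + v \<Longrightarrow> a (fst p + u, snd p + v) = a p"
  shows "theta2 a t (z + t *s of_int_vec x + of_int_vec y) * ee (t * half_norm A2 (of_int_vec x) + bil A2 (of_int_vec x) z)
    = theta2 a t z"
proof -
  define u v where "u = 2 * x$1 + x$2" and "v = x$1 + 2 * x$2"
  have "3 dvd u + v" by (rule dvdI[of _ _ "x$1 + x$2"]) (simp add: u_def v_def)
  then have "theta2 a t z = ee (of_int (qf (u, v)) / 3 * t + pairing (u, v) z) * theta2 a t (z + t *s of_int_vec x)"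
    using theta2_shift[of "of_int_vec x :: complex^2" u v a t z] a[of u v] by (simp add: of_int_vec_def u_def v_def)
  also have "theta2 a t (z + t *s of_int_vec x) = theta2 a t (z + t *s of_int_vec x + of_int_vec y)"
  proof -
    have "pairing p (of_int_vec y) = of_int (fst p * y$1 + snd p * y$2)" for p
      by (simp add: pairing_def of_int_vec_def)
    then show ?thesis unfolding theta2_translate[of a t "z + t *s of_int_vec x"] by (simp only: ee_of_int mult_1_left)
  qed
  also have "of_int (qf (u, v)) / 3 * t + pairing (u, v) z = t * half_norm A2 (of_int_vec x) + bil A2 (of_int_vec x) z"
    by (simp add: bq_eq_half_norm bq_def bil_A2 of_int_vec_def qf_def pairing_def u_def v_def power2_eq_square field_simps)
  finally show ?thesis by (simp add: mult.commute)
qed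

lemma class_periodic:
  assumes "3 dvd u + v"
  shows "class0 (fst p + u, snd p + v) = class0 p" "classP (fst p + u, snd p + v) = classP p"
    "classN (fst p + u, snd p + v) = classN p"
proof -
  from assms obtain j where "u + v = 3 * j" ..
  then have e: "(fst p + u) + (snd p + v) = (fst p + snd p) + 3 * j" by simp
  show "class0 (fst p + u, snd p + v) = class0 p" "classP (fst p + u, snd p + v) = classP p"
    "classN (fst p + u, snd p + v) = classN p"
    by (simp_all add: class0_def classP_def classN_def e dvd_eq_mod_eq_0)
qed

section \<open>Eisenstein series\<close>

text \<open>
  The transformation behaviour of all three Eisenstein series is read off from one function, the
  quasi-elliptic function
  \<open>J(t, z) = \<pi> cot(\<pi> z) + 4 \<pi> \<Sum> sin(2 \<pi> m z) q\<^bsup>m n\<^esup>\<close>, whose Taylor coefficients in \<open>z\<close> at \<open>0\<close> they are.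
  The series \<open>jser\<close> below is the second summand, up to the factor \<open>- 2 \<pi> i\<close>.
\<close>

definition jser :: "complex \<Rightarrow> complex \<Rightarrow> complex" where
  "jser t z = (\<Sum>\<^sub>\<infinity>(m, n)\<in>{1..} \<times> {1..}. ee (of_nat (m * n) * t) * (ee (of_nat m * z) - ee (- (of_nat m * z))))"

lemma summable_double_geometric:
  fixes x y :: real
  assumes "0 \<le> x" "x < 1" "0 \<le> y" "x * y < 1"
  shows "(\<lambda>(m::nat, n::nat). x ^ (m * n) * y ^ m) summable_on {1..} \<times> {1..}"
proof (rule summable_on_SigmaI[where g = "\<lambda>m. y ^ m * (x ^ m / (1 - x ^ m))"])
  fix m :: nat assume m: "m \<in> {1..}"
  have xm: "x ^ m < 1" using assms m by (simp add: power_less_one_iff)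
  have "((\<lambda>n. (x ^ m) ^ n) has_sum (x ^ m / (1 - x ^ m))) {1..}"
    using assms xm by (intro has_sum_geometric_from_1) (simp add: power_abs)
  then have "((\<lambda>n. y ^ m * (x ^ m) ^ n) has_sum (y ^ m * (x ^ m / (1 - x ^ m)))) {1..}"
    by (rule has_sum_cmult_right)
  then show "((\<lambda>n. case (m, n) of (m, n) \<Rightarrow> x ^ (m * n) * y ^ m) has_sum y ^ m * (x ^ m / (1 - x ^ m))) {1..}"
    by (simp add: power_mult mult.commute)
next
  have "((\<lambda>m. (x * y) ^ m) has_sum (x * y / (1 - x * y))) {1..}"
    using assms by (intro has_sum_geometric_from_1) simp
  then have "(\<lambda>m. 1 / (1 - x) * (x * y) ^ m) summable_on {1..}"
    by (intro summable_on_cmult_right) (auto simp: summable_on_def)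
  then show "(\<lambda>m. y ^ m * (x ^ m / (1 - x ^ m))) summable_on {1..}"
  proof (rule summable_on_comparison_test)
    fix m :: nat assume m: "m \<in> {1..}"
    have "x ^ m \<le> x" using power_decreasing[of 1 m x] assms m by simp
    then have "x ^ m / (1 - x ^ m) \<le> x ^ m / (1 - x)" using assms by (intro divide_left_mono) auto
    then have "y ^ m * (x ^ m / (1 - x ^ m)) \<le> y ^ m * (x ^ m / (1 - x))"
      using assms by (intro mult_left_mono) auto
    then show "y ^ m * (x ^ m / (1 - x ^ m)) \<le> 1 / (1 - x) * (x * y) ^ m"
      by (simp add: power_mult_distrib mult_ac)
    show "0 \<le> y ^ m * (x ^ m / (1 - x ^ m))" using \<open>x ^ m \<le> x\<close> assms by auto
  qed
qed (use assms in auto)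

lemma Im_strip_bound: "\<bar>Im z\<bar> < Im t \<longleftrightarrow> norm (ee t) * exp (2 * pi * \<bar>Im z\<bar>) < 1"
proof -
  have "norm (ee t) * exp (2 * pi * \<bar>Im z\<bar>) = exp (2 * pi * (\<bar>Im z\<bar> - Im t))"
    unfolding norm_ee exp_add[symmetric] by (simp add: algebra_simps)
  then show ?thesis by (simp add: mult_less_0_iff)
qed

lemma summable_jser_abs:
  assumes "\<bar>Im z\<bar> < Im t"
  shows "(\<lambda>(m::nat, n::nat). norm (ee t) ^ (m * n) * exp (2 * pi * \<bar>Im z\<bar>) ^ m) summable_on {1..} \<times> {1..}"
  using assms Im_strip_bound[of z t] norm_ee_less_1[of t] by (intro summable_double_geometric) auto

text \<open>The two exponential parts of \<open>jser\<close>, with enlarged terms for differentiation in \<open>z\<close>.\<close>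

lemma jser_part_exponential_sum:
  fixes e :: complex
  assumes "\<bar>Im z\<bar> < Im t" and e: "e = 1 \<or> e = - 1"
  obtains d where "d > 0"
    "(\<lambda>(m, n). norm (ee (of_nat (m * n) * t) * ee (e * of_nat m * z)) * exp (d * norm (e * of_nat m))) summable_on {1..} \<times> {1..}"
proof -
  obtain y where y: "\<bar>Im z\<bar> < y" "y < Im t" using assms(1) dense by blast
  define d where "d = 2 * pi * (y - \<bar>Im z\<bar>)"
  have ey: "exp (2 * pi * \<bar>Im z\<bar>) * exp d = exp (2 * pi * y)"
    unfolding exp_add[symmetric] by (simp add: d_def algebra_simps)
  have "\<bar>Im (\<i> * of_real y)\<bar> < Im t" using y by simp
  from summable_jser_abs[OF this] have s: "(\<lambda>(m::nat, n::nat). norm (ee t) ^ (m * n) * exp (2 * pi * y) ^ m) summable_on {1..} \<times> {1..}"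
    using y by simp
  show thesis
  proof (rule that[of d])
    show "d > 0" using y by (simp add: d_def)
    show "(\<lambda>(m, n). norm (ee (of_nat (m * n) * t) * ee (e * of_nat m * z)) * exp (d * norm (e * of_nat m))) summable_on {1..} \<times> {1..}"
    proof (rule summable_on_comparison_test[OF s], clarify)
      fix m n :: nat
      have "norm (ee (e * of_nat m * z)) \<le> exp (2 * pi * \<bar>Im z\<bar>) ^ m"
      proof -
        have "ee (e * of_nat m * z) = ee (e * z) ^ m" unfolding ee_mult_of_nat[symmetric] by (simp only: mult_ac)
        moreover have "norm (ee (e * z)) \<le> exp (2 * pi * \<bar>Im z\<bar>)"
          using e mult_left_mono[OF abs_ge_minus_self[of "Im z"], of pi] mult_left_mono[OF abs_ge_self[of "Im z"], of pi]
          by (auto simp: norm_ee)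
        ultimately show ?thesis by (simp add: norm_power power_mono)
      qed
      then have "norm (ee t) ^ (m * n) * norm (ee (e * of_nat m * z)) * exp d ^ m \<le> norm (ee t) ^ (m * n) * exp (2 * pi * \<bar>Im z\<bar>) ^ m * exp d ^ m"
        by (intro mult_right_mono mult_left_mono) auto
      also have "\<dots> = norm (ee t) ^ (m * n) * exp (2 * pi * y) ^ m"
        unfolding ey[symmetric] by (simp add: power_mult_distrib)
      also have "norm (ee t) ^ (m * n) = norm (ee (of_nat (m * n) * t))" by (simp only: ee_mult_of_nat norm_power)
      also have "exp d ^ m = exp (d * norm (e * of_nat m))"
        using e by (auto simp: norm_mult exp_of_nat_mult[symmetric] mult.commute)
      finally show "norm (ee (of_nat (m * n) * t) * ee (e * of_nat m * z)) * exp (d * norm (e * of_nat m)) \<le> norm (ee t) ^ (m * n) * exp (2 * pi * y) ^ m"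
        by (simp only: norm_mult ee_mult_of_nat norm_power)
    qed auto
  qed
qed

lemma
  assumes "\<bar>Im z\<bar> < Im t"
  shows jser_has_sum: "((\<lambda>(m, n). ee (of_nat (m * n) * t) * (ee (of_nat m * z) - ee (- (of_nat m * z)))) has_sum jser t z) ({1..} \<times> {1..})"
    and jser_field_differentiable: "(\<lambda>z. jser t z) field_differentiable (at z)"
proof -
  let ?I = "{1..} \<times> {1..} :: (nat \<times> nat) set"
  let ?a = "\<lambda>p. ee (of_nat (fst p * snd p) * t)"
  let ?F = "\<lambda>e z. \<Sum>\<^sub>\<infinity>p\<in>?I. ?a p * ee (e * of_nat (fst p) * z)"
  have 1: "(\<lambda>p. ?a p * ee (e * of_nat (fst p) * z)) summable_on ?I" "?F e field_differentiable at z"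
    if e: "e = 1 \<or> e = - 1" and z: "\<bar>Im z\<bar> < Im t" for e z
  proof -
    obtain d where d: "d > 0" "(\<lambda>(m, n). norm (ee (of_nat (m * n) * t) * ee (e * of_nat m * z)) * exp (d * norm (e * of_nat m))) summable_on ?I"
      using jser_part_exponential_sum[OF z e] .
    have s: "(\<lambda>p. norm (?a p * ee (e * of_nat (fst p) * z)) * exp (d * norm (e * of_nat (fst p)))) summable_on ?I"
      using d(2) by (simp add: case_prod_unfold)
    show "(\<lambda>p. ?a p * ee (e * of_nat (fst p) * z)) summable_on ?I"
      by (rule summable_exponential_sum1[OF d(1) s])
    show "?F e field_differentiable at z"
      using DERIV_exponential_sum[OF d(1) s] unfolding field_differentiable_def by blast
  qed
  have eq: "jser t z = ?F 1 z - ?F (- 1) z" and sum: "((\<lambda>p. ?a p * ee (1 * of_nat (fst p) * z) - ?a p * ee (- 1 * of_nat (fst p) * z)) has_sum jser t z) ?I"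
    if "\<bar>Im z\<bar> < Im t" for z
  proof -
    have s: "((\<lambda>p. ?a p * ee (1 * of_nat (fst p) * z) - ?a p * ee (- 1 * of_nat (fst p) * z)) has_sum (?F 1 z - ?F (- 1) z)) ?I"
      using that by (intro has_sum_minus has_sum_infsum 1) auto
    then show "jser t z = ?F 1 z - ?F (- 1) z"
      unfolding jser_def by (intro infsumI) (simp add: case_prod_unfold algebra_simps)
    with s show "((\<lambda>p. ?a p * ee (1 * of_nat (fst p) * z) - ?a p * ee (- 1 * of_nat (fst p) * z)) has_sum jser t z) ?I"
      by simp
  qed
  show "((\<lambda>(m, n). ee (of_nat (m * n) * t) * (ee (of_nat m * z) - ee (- (of_nat m * z)))) has_sum jser t z) ?I"
    using sum[OF assms] by (simp add: case_prod_unfold algebra_simps)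
  have "(\<lambda>z. ?F 1 z - ?F (- 1) z) field_differentiable at z"
    by (intro field_differentiable_diff 1(2) assms) auto
  moreover have "\<forall>\<^sub>F w in nhds z. ?F 1 w - ?F (- 1) w = jser t w"
  proof -
    have "open {w. \<bar>Im w\<bar> < Im t}" by (intro open_Collect_less continuous_intros)
    then have "\<forall>\<^sub>F w in nhds z. w \<in> {w. \<bar>Im w\<bar> < Im t}"
      using assms by (intro eventually_nhds_in_open) auto
    then show ?thesis by eventually_elim (simp add: eq)
  qed
  ultimately show "jser t field_differentiable at z"
    unfolding field_differentiable_def by (simp only: DERIV_cong_ev[OF refl _ refl])
qed

definition pcot :: "complex \<Rightarrow> complex" where
  "pcot z = of_real pi * \<i> * (ee z + 1) / (ee z - 1)"

definition Jfun :: "complex \<Rightarrow> complex \<Rightarrow> complex" where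
  "Jfun t z = pcot z - i2pi * jser t z"

lemma jser_minus: "jser t (- z) = - jser t z"
  unfolding jser_def infsum_uminus[symmetric] by (intro infsum_cong) (auto simp: algebra_simps)

lemma pcot_minus: "pcot (- z) = - pcot z"
proof (cases "ee z = 1")
  case True
  then show ?thesis by (simp add: pcot_def ee_minus)
next
  case False
  have "(inverse (ee z) + 1) / (inverse (ee z) - 1) = - ((ee z + 1) / (ee z - 1))"
    using False by (simp add: divide_simps) (simp add: algebra_simps)?
  then show ?thesis unfolding pcot_def ee_minus by (simp only: times_divide_eq_right[symmetric] mult_minus_right)
qed

lemma Jfun_minus: "Jfun t (- z) = - Jfun t z" by (simp add: Jfun_def jser_minus pcot_minus)

lemma Jfun_period1: "Jfun t (z + 1) = Jfun t z"
proof -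
  have "jser t (z + 1) = jser t z" unfolding jser_def
    by (intro infsum_cong) (auto simp: ring_distribs ee_add ee_diff ee_minus)
  then show ?thesis by (simp add: Jfun_def pcot_def ee_add)
qed

lemma Jfun_period_t:
  assumes "- Im t < Im z" "Im z < 0"
  shows "Jfun t (z + t) = Jfun t z - i2pi"
proof -
  have z1: "\<bar>Im z\<bar> < Im t" and z2: "\<bar>Im (z + t)\<bar> < Im t" using assms by auto
  have Im: "Im t > 0" using assms by linarith
  define q w where "q = ee t" and "w = ee z"
  have nz: "q \<noteq> 0" "w \<noteq> 0" by (simp_all add: q_def w_def)
  have nw: "norm w > 1" using assms by (simp add: w_def norm_ee mult_less_0_iff)
  have nqw: "norm (q * w) < 1" using norm_ee_less_1[of "t + z"] assms by (simp add: w_def q_def ee_add)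
  have nq: "norm q < 1" using norm_ee_less_1[OF Im] by (simp add: q_def)
  have e: "ee (of_nat (m * n) * t) = (q ^ m) ^ n" "ee (of_nat m * z) = w ^ m" "ee (- (of_nat m * z)) = inverse (w ^ m)"
      "ee (of_nat m * (z + t)) = w ^ m * q ^ m" "ee (- (of_nat m * (z + t))) = inverse (w ^ m * q ^ m)" for m n
    by (simp_all add: q_def w_def ee_mult_of_nat ring_distribs ee_add ee_diff ee_minus power_mult[symmetric] divide_inverse del: of_nat_mult)
  let ?G = "\<lambda>m. q ^ m / (1 - q ^ m)"
  have qm: "norm (q ^ m) < 1" if "m \<ge> 1" for m
    using nq that by (simp add: norm_power power_less_one_iff)
  have geo: "((\<lambda>n. (q ^ m) ^ n) has_sum ?G m) {1..}" if "m \<ge> 1" for m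
    by (rule has_sum_geometric_from_1) (rule qm[OF that])
  have "((\<lambda>m. (w ^ m - inverse (w ^ m)) * ?G m) has_sum jser t z) {1..}"
  proof (rule has_sum_SigmaD[OF jser_has_sum[OF z1]])
    fix m :: nat assume "m \<in> {1..}"
    then have "((\<lambda>n. (w ^ m - inverse (w ^ m)) * (q ^ m) ^ n) has_sum (w ^ m - inverse (w ^ m)) * ?G m) {1..}"
      by (intro has_sum_cmult_right geo) simp
    then show "((\<lambda>y. case (m, y) of (m, n) \<Rightarrow> ee (of_nat (m * n) * t) * (ee (of_nat m * z) - ee (- (of_nat m * z)))) has_sum
         (w ^ m - inverse (w ^ m)) * ?G m) {1..}"
      by (simp only: prod.case e) (simp only: mult.commute)
  qed
  moreover have "((\<lambda>m. (w ^ m * q ^ m - inverse (w ^ m * q ^ m)) * ?G m) has_sum jser t (z + t)) {1..}"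
  proof (rule has_sum_SigmaD[OF jser_has_sum[OF z2]])
    fix m :: nat assume "m \<in> {1..}"
    then have "((\<lambda>n. (w ^ m * q ^ m - inverse (w ^ m * q ^ m)) * (q ^ m) ^ n) has_sum (w ^ m * q ^ m - inverse (w ^ m * q ^ m)) * ?G m) {1..}"
      by (intro has_sum_cmult_right geo) simp
    then show "((\<lambda>y. case (m, y) of (m, n) \<Rightarrow> ee (of_nat (m * n) * t) * (ee (of_nat m * (z + t)) - ee (- (of_nat m * (z + t))))) has_sum
         (w ^ m * q ^ m - inverse (w ^ m * q ^ m)) * ?G m) {1..}"
      by (simp only: prod.case e) (simp only: mult.commute)
  qed
  ultimately have "((\<lambda>m. (w ^ m * q ^ m - inverse (w ^ m * q ^ m)) * ?G m - (w ^ m - inverse (w ^ m)) * ?G m) has_sum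
      (jser t (z + t) - jser t z)) {1..}"
    by (intro has_sum_minus)
  moreover have "((\<lambda>m. - ((q * w) ^ m) - (inverse w) ^ m) has_sum (- ((q * w) / (1 - q * w)) - inverse w / (1 - inverse w))) {1..}"
    using nqw nw by (intro has_sum_minus has_sum_uminusI has_sum_geometric_from_1) (auto simp: norm_inverse inverse_less_1_iff)
  moreover have "(w ^ m * q ^ m - inverse (w ^ m * q ^ m)) * ?G m - (w ^ m - inverse (w ^ m)) * ?G m = - ((q * w) ^ m) - (inverse w) ^ m"
    if "m \<in> {1..}" for m
  proof -
    have "1 - q ^ m \<noteq> 0" using qm[of m] that by auto
    then show ?thesis using nz by (simp add: power_mult_distrib power_inverse divide_simps) (simp add: algebra_simps)
  qed
  ultimately have d: "jser t (z + t) - jser t z = - ((q * w) / (1 - q * w)) - inverse w / (1 - inverse w)"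
    by (metis (no_types, lifting) has_sum_cong has_sum_unique)
  have ne: "1 - q * w \<noteq> 0" "w - 1 \<noteq> 0" "q * w - 1 \<noteq> 0" using nqw nw by auto
  have "(w * q + 1) / (w * q - 1) - (w + 1) / (w - 1) - 2 * (- ((q * w) / (1 - q * w)) - inverse w / (1 - inverse w)) = - 2"
  proof -
    have "inverse w / (1 - inverse w) = 1 / (w - 1)" using nz ne by (simp add: field_simps)
    moreover have "(q * w) / (1 - q * w) = - (1 + 1 / (q * w - 1))" using ne by (simp add: field_simps)
    moreover have "(w * q + 1) / (w * q - 1) = 1 + 2 / (q * w - 1)" "(w + 1) / (w - 1) = 1 + 2 / (w - 1)"
      using ne by (simp_all add: field_simps)
    ultimately show ?thesis by simp
  qed
  then have k: "of_real pi * \<i> * ((w * q + 1) / (w * q - 1) - (w + 1) / (w - 1) - 2 * (jser t (z + t) - jser t z)) = of_real pi * \<i> * (- 2)"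
    unfolding d by (simp only:)
  have "Jfun t (z + t) - Jfun t z = of_real pi * \<i> * ((w * q + 1) / (w * q - 1) - (w + 1) / (w - 1) - 2 * (jser t (z + t) - jser t z))"
    unfolding Jfun_def pcot_def ee_add q_def[symmetric] w_def[symmetric] by (simp add: algebra_simps)
  then have "Jfun t (z + t) - Jfun t z = of_real pi * \<i> * (- 2)" using k by (rule trans)
  then show ?thesis by (simp add: algebra_simps)
qed

lemma ee_quotient_limit: "((\<lambda>z. (ee z - 1) / z) \<longlongrightarrow> i2pi) (at 0)"
proof -
  have "(ee has_field_derivative i2pi) (at 0)" by (auto intro!: derivative_eq_intros)
  then show ?thesis by (simp add: has_field_derivative_iff)
qed

lemma z_pcot_limit: "((\<lambda>z. z * pcot z) \<longlongrightarrow> 1) (at 0)"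
proof -
  have "((\<lambda>z. ee z + 1) \<longlongrightarrow> ee 0 + 1) (at 0)"
    by (intro tendsto_intros isContD DERIV_isCont[of _ "i2pi * 1 * ee 0"]) (auto intro!: derivative_eq_intros)
  then have "((\<lambda>z. of_real pi * \<i> * (ee z + 1) / ((ee z - 1) / z)) \<longlongrightarrow> of_real pi * \<i> * (ee 0 + 1) / (i2pi)) (at 0)"
    by (intro tendsto_divide tendsto_mult tendsto_const ee_quotient_limit) auto
  then show ?thesis by (simp add: pcot_def mult_ac)
qed

text \<open>
  The difference of the two sides of the inversion formula is doubly periodic and has no pole, so that
  it is constant by the maximum modulus principle; as it is odd, it vanishes. The series
  converge in a neighbourhood of a period parallelogram, which suffices.
\<close>

lemma Jfun_inversion:
  assumes t: "Im t > 0" and z: "z \<noteq> 0" "\<bar>Im z\<bar> < Im t" "\<bar>Im (z / t)\<bar> < Im (- 1 / t)"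
  shows "Jfun t z - Jfun (- 1 / t) (z / t) / t + i2pi * z / t = 0"
proof -
  define t' where "t' = - 1 / t"
  have t': "Im t' > 0" unfolding t'_def by (rule Im_inversion[OF t])
  have t0: "t \<noteq> 0" and it: "1 / t = - t'" using t by (auto simp: t'_def)
  \<comment> \<open>real coordinates \<open>z = a z + b z * t\<close>; the hypotheses on \<open>z\<close> bound both by \<open>1\<close>\<close>
  define b where "b z = Im z / Im t" for z
  define a where "a z = - Im (z / t) / Im t'" for z
  have Imb: "Im z = b z * Im t" and Ima: "Im (z / t) = - (a z * Im t')" for z
    using t t' by (simp_all add: a_def b_def)
  have b_add: "b (z + w) = b z + b w" and a_add: "a (z + w) = a z + a w" for z w
    using t t' by (simp_all add: a_def b_def add_divide_distrib diff_divide_distrib)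
  have b1: "b 1 = 0" "b t = 1" "a 1 = 1" "a t = 0" using t t' t0 by (simp_all add: a_def b_def it)
  have b_m: "b (- z) = - b z" "a (- z) = - a z" for z
    by (simp_all add: a_def b_def)
  have bR: "b (of_real x * z) = x * b z" "a (of_real x * z) = x * a z" for x z
    by (simp_all add: a_def b_def times_divide_eq_right[symmetric] del: times_divide_eq_right)
  have ab: "z = of_real (a z) + of_real (b z) * t" for z
  proof -
    define w where "w = z - of_real (b z) * t"
    have "b w = 0" "a w = a z"
      using b_add[of z "- (of_real (b z) * t)"] a_add[of z "- (of_real (b z) * t)"] b_m bR b1 by (simp_all add: w_def)
    then have "Im w = 0" using Imb[of w] by simp
    then have w: "w = of_real (Re w)" by (simp add: complex_eq_iff)
    then have "a w = Re w" using bR(2)[of "Re w" 1] b1 by simp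
    then have "w = of_real (a z)" using w \<open>a w = a z\<close> by simp
    then show ?thesis by (simp add: w_def algebra_simps)
  qed
  have zero: "z = 0" if "a z = 0" "b z = 0" for z
    using ab[of z] that by simp
  define U where "U = {z. \<bar>a z\<bar> < 1 \<and> \<bar>b z\<bar> < 1}"
  have U1: "\<bar>Im z\<bar> < Im t" "\<bar>Im (z / t)\<bar> < Im t'" if "z \<in> U" for z
    using that t t' unfolding Imb[of z] Ima[of z] U_def by (simp_all add: abs_mult)
  have cont: "continuous_on UNIV a" "continuous_on UNIV b"
    unfolding a_def b_def using t t' t0 by (auto intro!: continuous_intros)
  have openU: "open U" unfolding U_def by (intro open_Collect_conj open_Collect_less continuous_intros cont)
  have "convex U"
  proof (rule convexI)
    fix x y :: complex and u v :: real
    assume *: "x \<in> U" "y \<in> U" "0 \<le> u" "0 \<le> v" "u + v = 1"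
    have "\<bar>u * c + v * d\<bar> < 1" if "\<bar>c\<bar> < 1" "\<bar>d\<bar> < 1" for c d :: real
      using convex_bound_lt[of c 1 d u v] convex_bound_lt[of "- c" 1 "- d" u v] that * by (auto simp: abs_less_iff)
    then show "u *\<^sub>R x + v *\<^sub>R y \<in> U" using * by (auto simp: U_def a_add b_add scaleR_conv_of_real bR)
  qed
  then have conU: "connected U" by (rule convex_connected)
  define D where "D z = Jfun t z - Jfun t' (z / t) / t + i2pi * z / t" for z
  have noint: "ee z \<noteq> 1" "ee (z / t) \<noteq> 1" if "z \<in> U - {0}" for z
  proof -
    show "ee z \<noteq> 1"
    proof
      assume "ee z = 1"
      then obtain n where n: "z = of_int n" by (auto simp: ee_eq_1_iff elim!: Ints_cases)
      then have "a z = of_int n" using bR(2)[of "of_int n" 1] b1 by simp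
      then show False
        using that n by (cases "n = 0") (auto simp: U_def)
    qed
    show "ee (z / t) \<noteq> 1"
    proof
      assume "ee (z / t) = 1"
      then obtain n where n: "z / t = of_int n" by (auto simp: ee_eq_1_iff elim!: Ints_cases)
      then have z: "z = of_real (of_int n) * t" using t0 by (simp add: field_simps)
      then have "b z = of_int n" using bR(1)[of "of_int n" t] b1 by simp
      then show False
        using that z by (cases "n = 0") (auto simp: U_def)
    qed
  qed
  have jd: "(\<lambda>z. jser t z) field_differentiable at z" "(\<lambda>z. jser t' (z / t)) field_differentiable at z" if "z \<in> U" for z
  proof -
    show "(\<lambda>z. jser t z) field_differentiable at z" by (rule jser_field_differentiable[OF U1(1)[OF that]])
    have "(jser t' \<circ> (\<lambda>z. z / t)) field_differentiable at z"
      using t0 by (intro field_differentiable_compose jser_field_differentiable U1(2)[OF that]) (auto intro!: derivative_intros)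
    then show "(\<lambda>z. jser t' (z / t)) field_differentiable at z" by (simp add: o_def)
  qed
  have jh: "(\<lambda>z. jser t z) holomorphic_on U" "(\<lambda>z. jser t' (z / t)) holomorphic_on U"
    by (auto simp: holomorphic_on_def intro!: field_differentiable_at_within jd)
  have "D holomorphic_on U - {0}" unfolding D_def[abs_def] Jfun_def pcot_def using noint t0
    by (intro holomorphic_intros holomorphic_on_subset[OF jh(1)] holomorphic_on_subset[OF jh(2)]) auto
  moreover have "((\<lambda>z. (z - 0) * D z) \<longlongrightarrow> 0) (at 0)"
  proof -
    have 1: "((\<lambda>z. (z / t) * pcot (z / t)) \<longlongrightarrow> 1) (at 0)"
    proof -
      have "((\<lambda>z. z / t) \<longlongrightarrow> 0 / t) (at 0)" using t0 by (intro tendsto_intros) auto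
      then have "filterlim (\<lambda>z. z / t) (at 0) (at 0)"
        using t0 by (auto simp: filterlim_at eventually_at_filter)
      from filterlim_compose[OF z_pcot_limit this] show ?thesis .
    qed
    have 0: "0 \<in> U" using b1 bR[of 0 0] by (simp add: U_def)
    have "isCont (\<lambda>z. jser t z) 0" "isCont (\<lambda>z. jser t' (z / t)) 0"
      using jd[OF 0] by (auto intro: field_differentiable_imp_continuous_at)
    then have 2: "((\<lambda>z. jser t z) \<longlongrightarrow> jser t 0) (at 0)" "((\<lambda>z. jser t' (z / t)) \<longlongrightarrow> jser t' 0) (at 0)"
      by (auto simp: isCont_def)
    have "((\<lambda>z. z * pcot z - (z / t) * pcot (z / t) + z * (i2pi) * (jser t' (z / t) / t - jser t z) + i2pi * z * z / t)
        \<longlongrightarrow> 1 - 1 + 0 * (i2pi) * (jser t' 0 / t - jser t 0) + i2pi * 0 * 0 / t) (at 0)"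
      using t0 by (intro tendsto_intros z_pcot_limit 1 2) auto
    then show ?thesis by (simp add: D_def Jfun_def algebra_simps diff_divide_distrib)
  qed
  moreover have "0 \<in> interior U" using openU b1 bR[of 0 0] by (simp add: interior_open U_def)
  ultimately obtain G where G: "G holomorphic_on U" "\<And>z. z \<in> U - {0} \<Longrightarrow> G z = D z"
    using holomorphic_on_extend_lim[of D U 0] by (metis mult.commute)
  have per_t: "D (z + t) = D z" if "- 1 < b z" "b z < 0" for z
  proof -
    have "- Im t < Im z" "Im z < 0"
      using that t unfolding Imb[of z] by (simp_all add: mult_less_0_iff) (metis mult_strict_right_mono mult_minus1)
    then have "Jfun t (z + t) = Jfun t z - i2pi" by (rule Jfun_period_t)
    moreover have "(z + t) / t = z / t + 1" using t0 by (simp add: field_simps)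
    moreover have "i2pi * (z + t) / t = i2pi * z / t + i2pi"
      using t0 by (simp add: field_simps)
    ultimately show ?thesis by (simp add: D_def Jfun_period1)
  qed
  have per_1: "D (z + 1) = D z" if "- 1 < a z" "a z < 0" for z
  proof -
    have "a (z + 1) = a z + 1" using a_add b1 by simp
    then have "Im ((z + 1) / t) = - ((a z + 1) * Im t')" using Ima[of "z + 1"] by simp
    moreover have "0 < (a z + 1) * Im t'" "(a z + 1) * Im t' < 1 * Im t'"
      using that t' by (auto intro!: mult_pos_pos mult_strict_right_mono)
    ultimately have "- Im t' < Im ((z + 1) / t)" "Im ((z + 1) / t) < 0" by linarith+
    then have "Jfun t' ((z + 1) / t + t') = Jfun t' ((z + 1) / t) - i2pi" by (rule Jfun_period_t)
    moreover have "(z + 1) / t + t' = z / t" using it by (simp add: add_divide_distrib)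
    ultimately have "Jfun t' ((z + 1) / t) = Jfun t' (z / t) + i2pi" by simp
    then show ?thesis by (simp add: D_def Jfun_period1 add_divide_distrib ring_distribs)
  qed
  have G_t: "G (z + t) = G z" if "z \<in> U" "z + t \<in> U" "b z < 0" for z
  proof -
    have "z \<noteq> 0" "z + t \<noteq> 0" "- 1 < b z" using that bR[of 0 0] b_add[of z t] b1 by (auto simp: U_def)
    then show ?thesis using G(2) that per_t by simp
  qed
  have G_1: "G (z + 1) = G z" if "z \<in> U" "z + 1 \<in> U" "a z < 0" for z
  proof -
    have "z \<noteq> 0" "z + 1 \<noteq> 0" "- 1 < a z" using that bR[of 0 0] a_add[of z 1] b1 by (auto simp: U_def)
    then show ?thesis using G(2) that per_1 by simp
  qed
  define P where "P = (\<lambda>(x, y). of_real x + of_real y * t) ` ({- 1 / 2..1 / 2} \<times> {- 1 / 2..1 / 2::real})"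
  have abP: "a (of_real x + of_real y * t) = x" "b (of_real x + of_real y * t) = y" for x y
    using a_add[of "of_real x" "of_real y * t"] b_add[of "of_real x" "of_real y * t"] bR[of x 1] bR[of y t] b1
    by simp_all
  have P: "z \<in> P" if "\<bar>a z\<bar> \<le> 1 / 2" "\<bar>b z\<bar> \<le> 1 / 2" for z
    unfolding P_def using ab[of z] that by (intro image_eqI[of _ _ "(a z, b z)"]) auto
  have PU: "P \<subseteq> U" by (auto simp: P_def U_def abP)
  have "compact P"
    unfolding P_def by (intro compact_continuous_image compact_Times) (auto intro!: continuous_intros simp: case_prod_unfold)
  moreover have "continuous_on P (\<lambda>z. norm (G z))"
    using holomorphic_on_imp_continuous_on[OF G(1)] PU by (intro continuous_intros) (rule continuous_on_subset)
  moreover have "P \<noteq> {}" by (auto simp: P_def)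
  ultimately obtain \<xi> where \<xi>: "\<xi> \<in> P" "\<And>z. z \<in> P \<Longrightarrow> norm (G z) \<le> norm (G \<xi>)"
    using continuous_attains_sup[of P "\<lambda>z. norm (G z)"] by blast
  have step_b: "\<exists>w. w \<in> U \<and> a w = a z \<and> \<bar>b w\<bar> \<le> 1 / 2 \<and> G w = G z" if "z \<in> U" for z
  proof -
    consider "\<bar>b z\<bar> \<le> 1 / 2" | "b z > 1 / 2" | "b z < - 1 / 2"
      by linarith
    then show ?thesis
    proof cases
      case 2
      have "b (z - t) = b z - 1" "a (z - t) = a z" using b_add[of "z - t" t] a_add[of "z - t" t] b1 by simp_all
      with 2 that show ?thesis
        using G_t[of "z - t"] by (intro exI[of _ "z - t"]) (auto simp: U_def)
    next
      case 3
      have "b (z + t) = b z + 1" "a (z + t) = a z" using b_add[of z t] a_add[of z t] b1 by simp_all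
      with 3 that show ?thesis
        using G_t[of z] by (intro exI[of _ "z + t"]) (auto simp: U_def)
    qed (use that in auto)
  qed
  have step_a: "\<exists>w. w \<in> U \<and> b w = b z \<and> \<bar>a w\<bar> \<le> 1 / 2 \<and> G w = G z" if "z \<in> U" for z
  proof -
    consider "\<bar>a z\<bar> \<le> 1 / 2" | "a z > 1 / 2" | "a z < - 1 / 2"
      by linarith
    then show ?thesis
    proof cases
      case 2
      have "b (z - 1) = b z" "a (z - 1) = a z - 1" using b_add[of "z - 1" 1] a_add[of "z - 1" 1] b1 by simp_all
      with 2 that show ?thesis
        using G_1[of "z - 1"] by (intro exI[of _ "z - 1"]) (auto simp: U_def)
    next
      case 3
      have "b (z + 1) = b z" "a (z + 1) = a z + 1" using b_add[of z 1] a_add[of z 1] b1 by simp_all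
      with 3 that show ?thesis
        using G_1[of z] by (intro exI[of _ "z + 1"]) (auto simp: U_def)
    qed (use that in auto)
  qed
  have max: "norm (G z) \<le> norm (G \<xi>)" if "z \<in> U" for z
  proof -
    obtain w where w: "w \<in> U" "\<bar>b w\<bar> \<le> 1 / 2" "G w = G z"
      using step_b[of z] \<open>z \<in> U\<close> by blast
    obtain v where v: "v \<in> U" "b v = b w" "\<bar>a v\<bar> \<le> 1 / 2" "G v = G w" using step_a[OF w(1)] by blast
    have "v \<in> P" using v w by (intro P) auto
    then show ?thesis using \<xi>(2) v w by metis
  qed
  have "G constant_on U"
    using \<xi>(1) PU by (intro maximum_modulus_principle[OF G(1) openU conU openU order_refl _ max]) auto
  then obtain c where c: "\<And>z. z \<in> U \<Longrightarrow> G z = c" by (auto simp: constant_on_def)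
  have zU: "z \<in> U" using z t t' unfolding t'_def[symmetric] Imb[of z] Ima[of z] by (simp add: U_def abs_mult)
  then have "- z \<in> U" by (simp add: U_def b_m)
  then have "D (- z) = c" using G(2)[of "- z"] c[of "- z"] z(1) by simp
  moreover have "D z = c" using G(2)[of z] c[of z] zU z(1) by simp
  moreover have "D (- z) = - D z" by (simp add: D_def Jfun_minus)
  ultimately have "c = - c" and "D z = c" by simp_all
  then have "D z = 0" by simp
  then show ?thesis by (simp add: D_def t'_def)
qed

lemma exponential_sum_deriv_step:
  fixes l :: "'i \<Rightarrow> complex"
  assumes "d > 0" "(\<lambda>i. norm (a i * ee (l i * z)) * exp (d * norm (l i))) summable_on I"
  shows "(\<lambda>i. norm ((i2pi * l i) * a i * ee (l i * z)) * exp (d / 2 * norm (l i))) summable_on I"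
proof (rule summable_on_comparison_test)
  show "(\<lambda>i. (4 * pi / d) * (norm (a i * ee (l i * z)) * exp (d * norm (l i)))) summable_on I"
    by (rule summable_on_cmult_right[OF assms(2)])
  fix i
  have "d / 2 * norm (l i) \<le> exp (d / 2 * norm (l i))"
    using exp_ge_add_one_self[of "d / 2 * norm (l i)"] by linarith
  then have "norm (l i) \<le> 2 / d * exp (d / 2 * norm (l i))" using assms(1) by (simp add: field_simps)
  then have "2 * pi * norm (l i) * exp (d / 2 * norm (l i)) \<le> 2 * pi * (2 / d * exp (d / 2 * norm (l i))) * exp (d / 2 * norm (l i))"
    by (intro mult_right_mono mult_left_mono) auto
  also have "\<dots> = 4 * pi / d * (exp (d / 2 * norm (l i)) * exp (d / 2 * norm (l i)))" by simp
  also have "exp (d / 2 * norm (l i)) * exp (d / 2 * norm (l i)) = exp (d * norm (l i))"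
    unfolding exp_add[symmetric] by simp
  finally have "norm (a i * ee (l i * z)) * (2 * pi * norm (l i) * exp (d / 2 * norm (l i)))
      \<le> norm (a i * ee (l i * z)) * (4 * pi / d * exp (d * norm (l i)))"
    by (rule mult_left_mono) simp
  then show "norm ((i2pi * l i) * a i * ee (l i * z)) * exp (d / 2 * norm (l i))
      \<le> (4 * pi / d) * (norm (a i * ee (l i * z)) * exp (d * norm (l i)))"
    by (simp add: norm_mult mult_ac)
qed auto

lemma higher_deriv_exponential_sum:
  fixes l :: "'i \<Rightarrow> complex"
  assumes S: "open S" "z \<in> S"
    and sm: "\<And>z. z \<in> S \<Longrightarrow> \<exists>d>0. (\<lambda>i. norm (a i * ee (l i * z)) * exp (d * norm (l i))) summable_on I"
  shows "((\<lambda>i. (i2pi * l i) ^ n * a i * ee (l i * z)) has_sum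
      (deriv ^^ n) (\<lambda>z. \<Sum>\<^sub>\<infinity>i\<in>I. a i * ee (l i * z)) z) I"
  using S(2) sm
proof (induction n arbitrary: a z)
  case 0
  then show ?case using summable_exponential_sum1 by (fastforce simp: has_sum_infsum)
next
  case (Suc n)
  let ?a = "\<lambda>i. (i2pi * l i) * a i"
  have "\<forall>\<^sub>F w in nhds z. w \<in> S" using S(1) Suc.prems(1) by (rule eventually_nhds_in_open)
  then have "\<forall>\<^sub>F w in nhds z. deriv (\<lambda>z. \<Sum>\<^sub>\<infinity>i\<in>I. a i * ee (l i * z)) w = (\<Sum>\<^sub>\<infinity>i\<in>I. ?a i * ee (l i * w))"
  proof eventually_elim
    case (elim w)
    from Suc.prems(2)[OF this] obtain d where d: "d > 0" "(\<lambda>i. norm (a i * ee (l i * w)) * exp (d * norm (l i))) summable_on I"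
      by blast
    from DERIV_imp_deriv[OF DERIV_exponential_sum[OF d]] show ?case
      by (simp add: mult.assoc)
  qed
  then have "(deriv ^^ n) (deriv (\<lambda>z. \<Sum>\<^sub>\<infinity>i\<in>I. a i * ee (l i * z))) z = (deriv ^^ n) (\<lambda>w. \<Sum>\<^sub>\<infinity>i\<in>I. ?a i * ee (l i * w)) z"
    by (intro higher_deriv_cong_ev) auto
  moreover have "((\<lambda>i. (i2pi * l i) ^ n * ?a i * ee (l i * z)) has_sum
      (deriv ^^ n) (\<lambda>z. \<Sum>\<^sub>\<infinity>i\<in>I. ?a i * ee (l i * z)) z) I"
  proof (rule Suc.IH[OF Suc.prems(1)])
    fix w assume "w \<in> S"
    from Suc.prems(2)[OF this] obtain d where "d > 0" "(\<lambda>i. norm (a i * ee (l i * w)) * exp (d * norm (l i))) summable_on I"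
      by blast
    from exponential_sum_deriv_step[OF this] \<open>d > 0\<close>
    show "\<exists>d>0. (\<lambda>i. norm (?a i * ee (l i * w)) * exp (d * norm (l i))) summable_on I"
      by (intro exI[of _ "d / 2"]) simp
  qed
  ultimately show ?case by (simp add: funpow_Suc_right mult_ac del: funpow.simps)
qed

definition sig :: "nat \<Rightarrow> complex \<Rightarrow> complex" where
  "sig k t = (\<Sum>\<^sub>\<infinity>(m, n)\<in>{1..} \<times> {1..}. of_nat m ^ k * ee (of_nat (m * n) * t))"

lemma sig_deriv_has_sum:
  fixes e :: complex
  assumes t: "Im t > 0" and e: "e = 1 \<or> e = - 1"
  shows "((\<lambda>p. (i2pi * (e * of_nat (fst p))) ^ k * ee (of_nat (fst p * snd p) * t)) has_sum
     (deriv ^^ k) (\<lambda>z. \<Sum>\<^sub>\<infinity>p\<in>{1..} \<times> {1..}. ee (of_nat (fst p * snd p) * t) * ee (e * of_nat (fst p) * z)) 0) ({1..} \<times> {1..})"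
proof -
  have o: "open {w. \<bar>Im w\<bar> < Im t}" by (intro open_Collect_less continuous_intros)
  have "\<exists>d>0. (\<lambda>p. norm (ee (of_nat (fst p * snd p) * t) * ee (e * of_nat (fst p) * z)) * exp (d * norm (e * of_nat (fst p)))) summable_on {1..} \<times> {1..}"
    if "z \<in> {w. \<bar>Im w\<bar> < Im t}" for z
  proof -
    have "\<bar>Im z\<bar> < Im t" using that by simp
    then obtain d where "d > 0" "(\<lambda>(m, n). norm (ee (of_nat (m * n) * t) * ee (e * of_nat m * z)) * exp (d * norm (e * of_nat m))) summable_on {1..} \<times> {1..}"
      using jser_part_exponential_sum[OF _ e] by blast
    then show ?thesis by (auto simp: case_prod_unfold)
  qed
  from higher_deriv_exponential_sum[OF o _ this, of 0 k] t show ?thesis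
    by simp
qed

lemma sig_has_sum:
  assumes "Im t > 0"
  shows "((\<lambda>(m, n). of_nat m ^ k * ee (of_nat (m * n) * t)) has_sum sig k t) ({1..} \<times> {1..})"
proof -
  have "((\<lambda>p. 1 / (i2pi) ^ k * ((i2pi * (1 * of_nat (fst p))) ^ k * ee (of_nat (fst p * snd p) * t))) has_sum
      1 / (i2pi) ^ k * (deriv ^^ k) (\<lambda>z. \<Sum>\<^sub>\<infinity>p\<in>{1..} \<times> {1..}. ee (of_nat (fst p * snd p) * t) * ee (1 * of_nat (fst p) * z)) 0) ({1..} \<times> {1..})"
    by (intro has_sum_cmult_right sig_deriv_has_sum assms) simp
  also have "(\<lambda>p. 1 / (i2pi) ^ k * ((i2pi * (1 * of_nat (fst p))) ^ k * ee (of_nat (fst p * snd p) * t)))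
      = (\<lambda>(m, n). of_nat m ^ k * ee (of_nat (m * n) * t))"
    by (simp add: fun_eq_iff power_mult_distrib)
  finally show ?thesis unfolding sig_def by (intro has_sum_infsum) (auto simp: summable_on_def)
qed

lemma jser_split:
  assumes "\<bar>Im z\<bar> < Im t"
  shows "jser t z = (\<Sum>\<^sub>\<infinity>p\<in>{1..} \<times> {1..}. ee (of_nat (fst p * snd p) * t) * ee (1 * of_nat (fst p) * z))
     - (\<Sum>\<^sub>\<infinity>p\<in>{1..} \<times> {1..}. ee (of_nat (fst p * snd p) * t) * ee (- 1 * of_nat (fst p) * z))"
proof -
  have s: "(\<lambda>p. ee (of_nat (fst p * snd p) * t) * ee (e * of_nat (fst p) * z)) summable_on {1..} \<times> {1..}"
    if e: "e = 1 \<or> e = - 1" for e :: complex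
  proof -
    obtain d where d: "d > 0" "(\<lambda>(m, n). norm (ee (of_nat (m * n) * t) * ee (e * of_nat m * z)) * exp (d * norm (e * of_nat m))) summable_on {1..} \<times> {1..}"
      using jser_part_exponential_sum[OF assms e] .
    show ?thesis by (rule summable_exponential_sum1[OF d(1)]) (use d(2) in \<open>simp add: case_prod_unfold\<close>)
  qed
  show ?thesis unfolding jser_def
    by (rule infsumI, rule has_sum_cong[THEN iffD1, OF _ has_sum_minus[OF has_sum_infsum[OF s] has_sum_infsum[OF s]]])
       (auto simp: algebra_simps)
qed

lemma higher_deriv_jser:
  assumes t: "Im t > 0" and k: "odd k"
  shows "(deriv ^^ k) (jser t) 0 = 2 * (i2pi) ^ k * sig k t"
proof -
  let ?u = "i2pi :: complex"
  let ?I = "{1..} \<times> {1..} :: (nat \<times> nat) set"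
  let ?F = "\<lambda>e z. \<Sum>\<^sub>\<infinity>p\<in>?I. ee (of_nat (fst p * snd p) * t) * ee (e * of_nat (fst p) * z)"
  let ?S = "{w. \<bar>Im w\<bar> < Im t}"
  have o: "open ?S" by (intro open_Collect_less continuous_intros)
  have 0: "0 \<in> ?S" using t by simp
  have hol: "?F e holomorphic_on ?S" if e: "e = 1 \<or> e = - 1" for e
  proof (rule holomorphic_onI)
    fix z assume "z \<in> ?S"
    then have z: "\<bar>Im z\<bar> < Im t" by simp
    obtain d where d: "d > 0" "(\<lambda>(m, n). norm (ee (of_nat (m * n) * t) * ee (e * of_nat m * z)) * exp (d * norm (e * of_nat m))) summable_on ?I"
      using jser_part_exponential_sum[OF z e] .
    have "(\<lambda>p. norm (ee (of_nat (fst p * snd p) * t) * ee (e * of_nat (fst p) * z)) * exp (d * norm (e * of_nat (fst p)))) summable_on ?I"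
      using d(2) by (simp add: case_prod_unfold)
    from DERIV_exponential_sum[OF d(1) this] show "?F e field_differentiable at z within ?S"
      unfolding field_differentiable_def by (blast intro: has_field_derivative_at_within)
  qed
  have "\<forall>\<^sub>F z in nhds 0. z \<in> ?S" by (rule eventually_nhds_in_open[OF o 0])
  then have "\<forall>\<^sub>F z in nhds 0. jser t z = ?F 1 z - ?F (- 1) z" by eventually_elim (rule jser_split, simp)
  then have "(deriv ^^ k) (jser t) 0 = (deriv ^^ k) (\<lambda>z. ?F 1 z - ?F (- 1) z) 0"
    by (intro higher_deriv_cong_ev) auto
  also have "\<dots> = (deriv ^^ k) (?F 1) 0 - (deriv ^^ k) (?F (- 1)) 0"
    by (intro higher_deriv_diff[OF hol hol o 0]) auto
  also have "(deriv ^^ k) (?F 1) 0 = ?u ^ k * sig k t"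
  proof -
    have "((\<lambda>p. (?u * (1 * of_nat (fst p))) ^ k * ee (of_nat (fst p * snd p) * t)) has_sum (deriv ^^ k) (?F 1) 0) ?I"
      by (rule sig_deriv_has_sum[OF t]) simp
    moreover have "((\<lambda>p. ?u ^ k * (case p of (m, n) \<Rightarrow> of_nat m ^ k * ee (of_nat (m * n) * t))) has_sum ?u ^ k * sig k t) ?I"
      by (intro has_sum_cmult_right sig_has_sum t)
    ultimately show ?thesis by (simp add: case_prod_unfold power_mult_distrib mult.assoc has_sum_unique)
  qed
  also have "(deriv ^^ k) (?F (- 1)) 0 = - (?u ^ k * sig k t)"
  proof -
    have "((\<lambda>p. (?u * (- 1 * of_nat (fst p))) ^ k * ee (of_nat (fst p * snd p) * t)) has_sum (deriv ^^ k) (?F (- 1)) 0) ?I"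
      by (rule sig_deriv_has_sum[OF t]) simp
    moreover have "((\<lambda>p. - (?u ^ k * (case p of (m, n) \<Rightarrow> of_nat m ^ k * ee (of_nat (m * n) * t)))) has_sum - (?u ^ k * sig k t)) ?I"
      by (intro has_sum_uminusI has_sum_cmult_right sig_has_sum t)
    ultimately show ?thesis
      using k by (simp add: case_prod_unfold power_mult_distrib mult.assoc has_sum_unique power_minus_odd)
  qed
  finally show ?thesis by simp
qed

text \<open>
  The Laurent coefficients of \<open>pcot\<close> at \<open>0\<close>, up to the fifth order, are found by comparing
  coefficients in \<open>pcot z * (ee z - 1) = \<pi> i (ee z + 1)\<close>.
\<close>

lemma pcot_expansion:
  obtains p where "p has_fps_expansion fps_expansion p 0"
    and "\<forall>z. z \<noteq> 0 \<longrightarrow> ee z \<noteq> 1 \<longrightarrow> p z = pcot z - 1 / z" and "p 0 = 0"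
    and "(deriv ^^ 1) p 0 = (i2pi) ^ 2 / 12"
    and "(deriv ^^ 3) p 0 = - ((i2pi) ^ 4) / 120"
    and "(deriv ^^ 5) p 0 = (i2pi) ^ 6 / 252"
proof -
  define u :: complex where "u = i2pi"
  have u: "u \<noteq> 0" by (simp add: u_def)
  have E: "ee has_fps_expansion fps_exp u" using has_fps_expansion_exp[of u] by (simp add: ee_def[abs_def] u_def)
  define H where "H = fps_shift 1 (fps_exp u - 1)"
  define h where "h z = (if z = 0 then u else (ee z - 1) / z ^ 1)" for z
  have Hn: "fps_nth H n = u ^ (n + 1) / fact (n + 1)" for n
    by (simp add: H_def ring_distribs)
  have hs: "h has_fps_expansion H" unfolding h_def[abs_def] H_def
  proof (rule has_fps_expansion_shift)
    show "(\<lambda>z. ee z - 1) has_fps_expansion fps_exp u - 1" by (intro fps_expansion_intros E)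
    have "fps_nth (fps_exp u - 1) 1 \<noteq> 0" using u by simp
    then have "fps_exp u - 1 \<noteq> 0" by (metis fps_zero_nth)
    then show "1 \<le> subdegree (fps_exp u - 1)" by (intro subdegree_geI) auto
  qed simp
  define R where "R = fps_const (u / 2) * (fps_exp u + 1) - H"
  define Q where "Q = R * inverse H"
  define k where "k z = (u / 2 * (ee z + 1) - h z) * inverse (h z)" for z
  have H0: "fps_nth H 0 \<noteq> 0" using u by (simp add: Hn)
  have ks: "k has_fps_expansion Q" unfolding k_def[abs_def] Q_def R_def by (intro fps_expansion_intros E hs H0)
  have QH: "Q * H = R" unfolding Q_def using inverse_mult_eq_1[OF H0] by (simp add: mult.assoc)
  have R: "fps_nth R n = u / 2 * (u ^ n / fact n + of_bool (n = 0)) - u ^ (n + 1) / fact (n + 1)" for n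
    by (simp add: R_def Hn)
  have "fps_nth R 2 \<noteq> 0" using u by (simp add: R fact_numeral eval_nat_numeral field_simps)
  then have "Q \<noteq> 0" using QH by auto
  moreover have Q0: "fps_nth Q 0 = 0"
  proof -
    have "fps_nth R 0 = 0" by (simp add: R)
    then show ?thesis using H0 unfolding QH[symmetric] by simp
  qed
  ultimately have sub: "1 \<le> subdegree Q" by (intro subdegree_geI) auto
  define P where "P = fps_shift 1 Q"
  define p where "p z = (if z = 0 then fps_nth Q 1 else k z / z ^ 1)" for z
  have ps: "p has_fps_expansion P" unfolding p_def[abs_def] P_def by (rule has_fps_expansion_shift[OF ks sub]) simp
  have PH: "fps_nth (P * H) n = fps_nth R (n + 1)" for n
  proof -
    have "Q = fps_X * P" using Q0 by (simp add: P_def fps_eq_iff)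
    then have "R = fps_X * (P * H)" using QH by (simp add: mult.assoc)
    then show ?thesis by simp
  qed
  have rec: "(\<Sum>i=0..n. fps_nth P i * (u ^ (n - i + 1) / fact (n - i + 1))) = u / 2 * (u ^ (n + 1) / fact (n + 1)) - u ^ (n + 2) / fact (n + 2)" for n
    using PH[of n] by (simp add: fps_mult_nth Hn R)
  note ev = fact_numeral eval_nat_numeral sum.atLeast0_atMost_Suc
  have P0: "fps_nth P 0 = 0" using rec[of 0] u by (simp add: ev field_simps)
  have P1: "fps_nth P 1 = u ^ 2 / 12" using rec[of 1] u by (simp add: ev P0 field_simps)
  have P2: "fps_nth P 2 = 0" using rec[of 2] u by (simp add: ev P0 P1[unfolded One_nat_def] field_simps)
  have "u * (8 * u ^ 4 + 5760 * fps_nth P 3) = 0"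
    using rec[of 3] u by (simp add: ev P0 P1[unfolded One_nat_def] P2[simplified eval_nat_numeral BitM.simps One_nat_def] field_simps)
  then have "8 * u ^ 4 + 5760 * fps_nth P 3 = 0" using u by simp
  then have "fps_nth P 3 = - (8 * u ^ 4) / 5760" by (simp add: add_eq_0_iff2 field_simps)
  then have P3: "fps_nth P 3 = - (u ^ 4) / 720" by simp
  have P4: "fps_nth P 4 = 0"
    using rec[of 4] u by (simp add: ev P0 P1[unfolded One_nat_def] P2[simplified eval_nat_numeral BitM.simps One_nat_def] P3[simplified eval_nat_numeral BitM.simps One_nat_def] field_simps)
  have P5: "fps_nth P 5 = u ^ 6 / 30240"
    using rec[of 5] u by (simp add: ev P0 P1[unfolded One_nat_def] P2[simplified eval_nat_numeral BitM.simps One_nat_def] P3[simplified eval_nat_numeral BitM.simps One_nat_def] P4[simplified eval_nat_numeral BitM.simps One_nat_def] field_simps)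
  have d: "(deriv ^^ n) p 0 = fact n * fps_nth P n" for n
    using fps_nth_fps_expansion[OF ps, of n] by simp
  show thesis
  proof (rule that[of p])
    show "p has_fps_expansion fps_expansion p 0" using ps fps_expansion_eqI[OF ps] by simp
    show "p 0 = 0" using P0 by (simp add: p_def P_def)
    show "\<forall>z. z \<noteq> 0 \<longrightarrow> ee z \<noteq> 1 \<longrightarrow> p z = pcot z - 1 / z"
      by (simp add: p_def k_def h_def pcot_def u_def field_simps)
    show "(deriv ^^ 1) p 0 = (i2pi) ^ 2 / 12" "(deriv ^^ 3) p 0 = - ((i2pi) ^ 4) / 120"
      "(deriv ^^ 5) p 0 = (i2pi) ^ 6 / 252"
      unfolding d P1 P3 P5 u_def[symmetric] by (simp_all add: fact_numeral)
  qed
qed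


definition cE2 :: "complex \<Rightarrow> complex" where "cE2 t = 1 - 24 * sig 1 t"
definition cE4 :: "complex \<Rightarrow> complex" where "cE4 t = 1 + 240 * sig 3 t"
definition cE6 :: "complex \<Rightarrow> complex" where "cE6 t = 1 - 504 * sig 5 t"

text \<open>
  The coefficients of \<open>z\<close>, \<open>z ^ 3\<close> and \<open>z ^ 5\<close> in the inversion formula of \<open>Jfun\<close>. The extra term for
  weight \<open>2\<close> stems from the term \<open>2 \<pi> i z / t\<close> of that formula.
\<close>

lemma eisenstein_inversion:
  assumes t: "Im t > 0"
  shows cE2_inversion: "cE2 (- 1 / t) = t\<^sup>2 * cE2 t + 6 * t / (of_real pi * \<i>)"
    and cE4_inversion: "cE4 (- 1 / t) = t ^ 4 * cE4 t"
    and cE6_inversion: "cE6 (- 1 / t) = t ^ 6 * cE6 t"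
proof -
  have t0: "t \<noteq> 0" using t by auto
  define t' where "t' = - 1 / t"
  have t': "Im t' > 0" unfolding t'_def by (rule Im_inversion[OF t])
  define u :: complex where "u = i2pi"
  have u: "u \<noteq> 0" by (simp add: u_def)
  obtain p where p: "p has_fps_expansion fps_expansion p 0" "\<forall>z. z \<noteq> 0 \<longrightarrow> ee z \<noteq> 1 \<longrightarrow> p z = pcot z - 1 / z" "p 0 = 0"
    "(deriv ^^ 1) p 0 = u ^ 2 / 12" "(deriv ^^ 3) p 0 = - (u ^ 4) / 120" "(deriv ^^ 5) p 0 = u ^ 6 / 252"
    unfolding u_def by (rule pcot_expansion)
  obtain s where s: "open s" "0 \<in> s" "p holomorphic_on s"
  proof (rule has_fps_expansion_imp_holomorphic[OF p(1)])
    fix s assume "open s" "0 \<in> s" "p holomorphic_on s"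
    then show thesis by (rule that)
  qed
  define g where "g \<tau> z = p z - u * jser \<tau> z" for \<tau> z
  define S where "S \<tau> = s \<inter> {w. \<bar>Im w\<bar> < Im \<tau>}" for \<tau>
  have oS: "open (S \<tau>)" for \<tau>
    unfolding S_def by (intro open_Int s open_Collect_less continuous_intros)
  have 0: "0 \<in> S t" "0 \<in> S t'" using s t t' by (auto simp: S_def)
  have jh: "jser \<tau> holomorphic_on S \<tau>" for \<tau>
    by (auto simp: S_def holomorphic_on_def intro!: field_differentiable_at_within jser_field_differentiable)
  have ph: "p holomorphic_on S \<tau>" for \<tau>
    by (rule holomorphic_on_subset[OF s(3)]) (auto simp: S_def)
  have gh: "g \<tau> holomorphic_on S \<tau>" for \<tau>
    unfolding g_def[abs_def] by (intro holomorphic_intros ph jh)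
  have dg: "(deriv ^^ k) (g \<tau>) 0 = (deriv ^^ k) p 0 - 2 * u ^ (k + 1) * sig k \<tau>" if "odd k" "Im \<tau> > 0" for k \<tau>
  proof -
    have 0: "0 \<in> S \<tau>" using s that by (simp add: S_def)
    have "(deriv ^^ k) (g \<tau>) 0 = (deriv ^^ k) p 0 - (deriv ^^ k) (\<lambda>z. u * jser \<tau> z) 0"
      unfolding g_def[abs_def] by (rule higher_deriv_diff[OF ph _ oS 0]) (intro holomorphic_intros jh)
    also have "(deriv ^^ k) (\<lambda>z. u * jser \<tau> z) 0 = u * (deriv ^^ k) (jser \<tau>) 0"
      by (rule higher_deriv_cmult[OF jh 0 oS])
    finally show ?thesis by (simp add: higher_deriv_jser[OF that(2,1)] u_def)
  qed
  have j0: "jser \<tau> 0 = 0" for \<tau>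
    using jser_minus[of \<tau> 0] by simp
  define V where "V = S t \<inter> {z. z / t \<in> S t'} \<inter> ball 0 1 \<inter> {z. z / t \<in> ball 0 1}"
  have vim: "{z. z / t \<in> A} = (\<lambda>z. z / t) -` A" for A
    by auto
  have oV: "open V" unfolding V_def vim using t0 by (intro open_Int oS open_ball open_vimage continuous_intros) auto
  have 0: "0 \<in> V" using 0 by (simp add: V_def)
  have noint: "ee z \<noteq> 1" if "norm z < 1" "z \<noteq> 0" for z
  proof
    assume "ee z = 1"
    then obtain n where "z = of_int n" by (auto simp: ee_eq_1_iff elim!: Ints_cases)
    with that show False
      by (cases "n = 0") auto
  qed
  have eq: "g t z = (1 / t) * g t' ((1 / t) * z) - (u / t) * z" if "z \<in> V" for z
  proof (cases "z = 0")
    case True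
    then show ?thesis by (simp add: g_def p j0)
  next
    case False
    have "ee z \<noteq> 1" "ee (z / t) \<noteq> 1"
      using that False t0 noint[of z] noint[of "z / t"] by (auto simp: V_def)
    then have 1: "p z = pcot z - 1 / z" "p (z / t) = pcot (z / t) - t / z"
      using False t0 p(2)[rule_format, of z] p(2)[rule_format, of "z / t"] by simp_all
    have "Jfun t z - Jfun t' (z / t) / t + u * z / t = 0"
      unfolding t'_def u_def using that False by (intro Jfun_inversion t) (auto simp: V_def S_def t'_def)
    then have "pcot z - u * jser t z - (pcot (z / t) - u * jser t' (z / t)) / t + u * z / t = 0"
      by (simp only: Jfun_def u_def)
    then have "pcot z - u * jser t z = (pcot (z / t) - u * jser t' (z / t)) / t - u * z / t"
      by (simp add: algebra_simps)
    moreover have "g t z = (pcot z - u * jser t z) - 1 / z" by (simp add: g_def 1)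
    moreover have "(1 / t) * g t' ((1 / t) * z) = (pcot (z / t) - u * jser t' (z / t)) / t - 1 / z"
      using t0 False by (simp add: g_def 1 diff_divide_distrib)
    ultimately show ?thesis by simp
  qed
  have main: "(deriv ^^ k) (g t) 0 = (1 / t) ^ (k + 1) * (deriv ^^ k) (g t') 0 - (u / t) * of_bool (k = 1)" if "k \<ge> 1" for k
  proof -
    have "\<forall>\<^sub>F z in nhds 0. z \<in> V" by (rule eventually_nhds_in_open[OF oV 0])
    then have "\<forall>\<^sub>F z in nhds 0. g t z = (1 / t) * g t' ((1 / t) * z) - (u / t) * z"
      by eventually_elim (rule eq)
    then have "(deriv ^^ k) (g t) 0 = (deriv ^^ k) (\<lambda>z. (1 / t) * g t' ((1 / t) * z) - (u / t) * z) 0"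
      by (intro higher_deriv_cong_ev) auto
    also have "\<dots> = (deriv ^^ k) (\<lambda>z. (1 / t) * g t' ((1 / t) * z)) 0 - (deriv ^^ k) (\<lambda>z. (u / t) * z) 0"
    proof (rule higher_deriv_diff[OF _ _ oV 0])
      have "(g t' \<circ> (\<lambda>z. (1 / t) * z)) holomorphic_on V"
        by (rule holomorphic_on_compose_gen[OF _ gh]) (auto intro!: holomorphic_intros simp: V_def)
      then show "(\<lambda>z. (1 / t) * g t' ((1 / t) * z)) holomorphic_on V"
        by (intro holomorphic_intros) (simp add: o_def)
    qed (intro holomorphic_intros)
    also have "(deriv ^^ k) (\<lambda>z. (1 / t) * g t' ((1 / t) * z)) 0 = (1 / t) * (deriv ^^ k) (\<lambda>z. g t' ((1 / t) * z)) 0"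
    proof (rule higher_deriv_cmult[OF _ 0 oV])
      have "(g t' \<circ> (\<lambda>z. (1 / t) * z)) holomorphic_on V"
        by (rule holomorphic_on_compose_gen[OF _ gh]) (auto intro!: holomorphic_intros simp: V_def)
      then show "(\<lambda>z. g t' ((1 / t) * z)) holomorphic_on V" by (simp add: o_def)
    qed
    also have "(deriv ^^ k) (\<lambda>z. g t' ((1 / t) * z)) 0 = (1 / t) ^ k * (deriv ^^ k) (g t') ((1 / t) * 0)"
      by (rule higher_deriv_compose_linear[OF gh oV oS 0]) (simp add: V_def)
    also have "(deriv ^^ k) (\<lambda>z. (u / t) * z) 0 = (u / t) * of_bool (k = 1)"
    proof -
      have "deriv (\<lambda>z. (u / t) * z) = (\<lambda>_. u / t)" by (intro ext DERIV_imp_deriv DERIV_cmult_Id)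
      moreover obtain j where "k = Suc j" using \<open>k \<ge> 1\<close> by (cases k) auto
      ultimately show ?thesis by (simp add: funpow_Suc_right del: funpow.simps)
    qed
    finally show ?thesis by simp
  qed
  have t2: "(1 / t) ^ n * x = y \<Longrightarrow> x = t ^ n * y" for n x y
    using t0 by (simp add: power_one_over field_simps)
  have "(deriv ^^ 1) (g \<tau>) 0 = u ^ 2 / 12 * cE2 \<tau>" if "Im \<tau> > 0" for \<tau>
    by (simp only: dg[OF odd_one that] p(4) cE2_def) (simp add: algebra_simps power2_eq_square)
  then have "u ^ 2 / 12 * cE2 t = (1 / t) ^ 2 * (u ^ 2 / 12 * cE2 t') - u / t"
    using main[OF order_refl] t t' by (simp only: one_add_one) simp
  then have "(1 / t) ^ 2 * (u ^ 2 / 12 * cE2 t') = u ^ 2 / 12 * cE2 t + u / t" by (simp add: algebra_simps)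
  then have "u ^ 2 / 12 * cE2 t' = t ^ 2 * (u ^ 2 / 12 * cE2 t + u / t)" by (rule t2)
  also have "\<dots> = u ^ 2 / 12 * (t\<^sup>2 * cE2 t + 12 * t / u)"
    using u t0 by (simp add: field_simps power2_eq_square)
  finally have "cE2 t' = t\<^sup>2 * cE2 t + 12 * t / u" using u by simp
  then show "cE2 (- 1 / t) = t\<^sup>2 * cE2 t + 6 * t / (of_real pi * \<i>)" by (simp add: t'_def u_def)
  have o: "odd (3::nat)" "odd (5::nat)" by simp_all
  have "(deriv ^^ 3) (g t) 0 = (1 / t) ^ 4 * (deriv ^^ 3) (g t') 0" using main[of 3] by simp
  then have "- (u ^ 4) / 120 * cE4 t = (1 / t) ^ 4 * (- (u ^ 4) / 120 * cE4 t')"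
    by (simp only: dg[OF o(1) t] dg[OF o(1) t'] p(5) cE4_def) (simp add: algebra_simps)
  then have "- (u ^ 4) / 120 * cE4 t' = t ^ 4 * (- (u ^ 4) / 120 * cE4 t)" by (rule t2[OF sym])
  then show "cE4 (- 1 / t) = t ^ 4 * cE4 t" using u by (simp add: t'_def)
  have "(deriv ^^ 5) (g t) 0 = (1 / t) ^ 6 * (deriv ^^ 5) (g t') 0" using main[of 5] by simp
  then have "u ^ 6 / 252 * cE6 t = (1 / t) ^ 6 * (u ^ 6 / 252 * cE6 t')"
    by (simp only: dg[OF o(2) t] dg[OF o(2) t'] p(6) cE6_def) (simp add: algebra_simps)
  then have "u ^ 6 / 252 * cE6 t' = t ^ 6 * (u ^ 6 / 252 * cE6 t)" by (rule t2[OF sym])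
  then show "cE6 (- 1 / t) = t ^ 6 * cE6 t" using u by (simp add: t'_def)
qed

lemma sig_eq_sigma_series: "sigma_series k \<tau> = sig k (of_uhp \<tau>)"
proof -
  define t where "t = of_uhp \<tau>"
  have t: "Im t > 0" using of_uhp[of \<tau>] by (simp add: t_def)
  let ?f = "\<lambda>(m, n). of_nat m ^ k * ee (of_nat (m * n) * t)"
  let ?g = "\<lambda>N. of_nat (divisor_sigma k N) * ee (of_nat N * t)"
  let ?S = "SIGMA N:{1..}. {d::nat. d dvd N}"
  have "bij_betw (\<lambda>(N, d). (d, N div d)) ?S ({1..} \<times> {1::nat..})"
    by (rule bij_betwI[of _ _ _ "\<lambda>(m, n). (m * n, m)"])
       (auto simp: Suc_le_eq dvd_div_eq_0_iff intro: Nat.gr0I dvd_pos_nat)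
  from has_sum_reindex_bij_betw[OF this, of ?f] sig_has_sum[OF t, of k]
  have "((\<lambda>x. ?f (case x of (N, d) \<Rightarrow> (d, N div d))) has_sum sig k t) ?S" by simp
  then have "(?g has_sum sig k t) {1..}"
  proof (rule has_sum_SigmaD)
    fix N :: nat assume N: "N \<in> {1..}"
    then have "finite {d. d dvd N}" by simp
    from has_sum_finite[OF this, of "\<lambda>d. of_nat d ^ k * ee (of_nat N * t)"]
    have "((\<lambda>d. of_nat d ^ k * ee (of_nat N * t)) has_sum ?g N) {d. d dvd N}"
      by (simp add: divisor_sigma_def sum_distrib_right)
    also have "?this \<longleftrightarrow> ((\<lambda>d. ?f (case (N, d) of (N, d) \<Rightarrow> (d, N div d))) has_sum ?g N) {d. d dvd N}"
      by (rule has_sum_cong) (auto simp del: of_nat_mult)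
    finally show "((\<lambda>d. ?f (case (N, d) of (N, d) \<Rightarrow> (d, N div d))) has_sum ?g N) {d. d dvd N}" .
  qed
  moreover have "bij_betw Suc UNIV {1..}" by (rule bij_betwI[of _ _ _ "\<lambda>n. n - 1"]) auto
  ultimately have "((\<lambda>m. ?g (Suc m)) has_sum sig k t) UNIV"
    using has_sum_reindex_bij_betw[of Suc UNIV "{1..}" ?g] by simp
  from has_sum_imp_sums[OF this] show ?thesis
    by (simp only: sigma_series_def qpow_def t_def[symmetric] sums_iff)
qed

lemma E2_eq: "E2 \<tau> = cE2 (of_uhp \<tau>)" and E4_eq: "E4 \<tau> = cE4 (of_uhp \<tau>)" and E6_eq: "E6 \<tau> = cE6 (of_uhp \<tau>)"
  by (simp_all add: E2_def E4_def E6_def cE2_def cE4_def cE6_def sig_eq_sigma_series)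

lemma q_series_sig:
  obtains Q where "q_series 1 Q (sig k)" "Q 0 = 1"
proof -
  let ?I = "{1..} \<times> {1..} :: (nat \<times> nat) set"
  define Q where "Q w = (\<Sum>\<^sub>\<infinity>p\<in>?I. of_nat (fst p) ^ k * w ^ (fst p * snd p - 1))" for w :: complex
  have "q_series 1 Q (sig k)" unfolding Q_def[abs_def]
  proof (rule q_series_family)
    fix t :: complex assume t: "Im t > 0"
    have "((\<lambda>p. of_nat (fst p) ^ k * ee ((of_real 1 + of_nat (fst p * snd p - 1)) * t)) has_sum sig k t) ?I
        \<longleftrightarrow> ((\<lambda>(m, n). of_nat m ^ k * ee (of_nat (m * n) * t)) has_sum sig k t) ?I"
    proof (rule has_sum_cong)
      fix p assume "p \<in> ?I"
      then have "fst p * snd p \<ge> 1" by (cases p) (simp add: Suc_le_eq)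
      then have "(1 :: complex) + of_nat (fst p * snd p - 1) = of_nat (fst p * snd p)" by (simp add: of_nat_diff)
      then show "of_nat (fst p) ^ k * ee ((of_real 1 + of_nat (fst p * snd p - 1)) * t)
          = (case p of (m, n) \<Rightarrow> of_nat m ^ k * ee (of_nat (m * n) * t))"
        by (simp only: of_real_1 case_prod_unfold)
    qed
    then show "((\<lambda>p. of_nat (fst p) ^ k * ee ((of_real 1 + of_nat (fst p * snd p - 1)) * t)) has_sum sig k t) ?I"
      using sig_has_sum[OF t, of k] by simp
  qed
  moreover have "Q 0 = (\<Sum>\<^sub>\<infinity>p\<in>{(1, 1)}. of_nat (fst p) ^ k * 0 ^ (fst p * snd p - 1))"
    unfolding Q_def
  proof (rule infsum_cong_neutral)
    fix p assume p: "p \<in> ?I - {(1, 1)}"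
    have "fst p * snd p \<noteq> 0" "fst p * snd p \<noteq> 1" using p by (cases p; auto)+
    then have "fst p * snd p - 1 \<noteq> 0" by linarith
    then show "of_nat (fst p) ^ k * 0 ^ (fst p * snd p - 1) = (0 :: complex)"
      by (simp only: power_0_left if_False mult_zero_right)
  qed auto
  then have "Q 0 = 1" by simp
  ultimately show thesis by (rule that)
qed

lemma q_series_one_plus:
  assumes "q_series 1 Q f"
  shows "q_series 0 (\<lambda>w. 1 + c * (w * Q w)) (\<lambda>t. 1 + c * f t)"
proof -
  have "q_series 0 (\<lambda>w. w ^ 1 * Q w) f" using q_series_shift[OF assms, of 1] by simp
  from q_series_add[OF q_series_const[of 1] q_series_cmult[OF this, of c]] show ?thesis
    by simp
qed

lemma q_series_eisenstein:
  obtains Q1 Q3 Q5 where "Q1 0 = 1" "Q3 0 = 1" "Q5 0 = 1"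
    "Q1 holomorphic_on ball 0 1" "Q3 holomorphic_on ball 0 1" "Q5 holomorphic_on ball 0 1"
    "q_series 0 (\<lambda>w. 1 - 24 * (w * Q1 w)) cE2" "q_series 0 (\<lambda>w. 1 + 240 * (w * Q3 w)) cE4"
    "q_series 0 (\<lambda>w. 1 - 504 * (w * Q5 w)) cE6"
proof -
  obtain Q1 where Q1: "q_series 1 Q1 (sig 1)" "Q1 0 = 1" by (rule q_series_sig)
  obtain Q3 where Q3: "q_series 1 Q3 (sig 3)" "Q3 0 = 1" by (rule q_series_sig)
  obtain Q5 where Q5: "q_series 1 Q5 (sig 5)" "Q5 0 = 1" by (rule q_series_sig)
  show thesis
  proof (rule that[of Q1 Q3 Q5])
    show "q_series 0 (\<lambda>w. 1 - 24 * (w * Q1 w)) cE2"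
      using q_series_one_plus[OF Q1(1), of "- 24"] by (simp add: cE2_def[abs_def])
    show "q_series 0 (\<lambda>w. 1 + 240 * (w * Q3 w)) cE4"
      using q_series_one_plus[OF Q3(1), of 240] by (simp add: cE4_def[abs_def])
    show "q_series 0 (\<lambda>w. 1 - 504 * (w * Q5 w)) cE6"
      using q_series_one_plus[OF Q5(1), of "- 504"] by (simp add: cE6_def[abs_def])
  qed (use Q1 Q3 Q5 in \<open>auto simp: q_series_def\<close>)
qed

section \<open>The Dedekind eta function\<close>

text \<open>The double series of \<open>- ln (\<Prod>n. 1 - q ^ n)\<close>; its derivative is the series in \<open>E2\<close>.\<close>

definition log_eta :: "complex \<Rightarrow> complex" where
  "log_eta t = (\<Sum>\<^sub>\<infinity>p\<in>{1..} \<times> {1..}. 1 / of_nat (fst p) * ee (of_nat (fst p * snd p) * t))"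

definition ceta :: "complex \<Rightarrow> complex" where
  "ceta t = ee (t / 24) * exp (- log_eta t)"

lemma ceta_nonzero [simp]: "ceta t \<noteq> 0" by (simp add: ceta_def)

lemma
  assumes t: "Im t > 0"
  shows log_eta_has_sum: "((\<lambda>p. 1 / of_nat (fst p) * ee (of_nat (fst p * snd p) * t)) has_sum log_eta t) ({1..} \<times> {1..})"
    and DERIV_log_eta: "(log_eta has_field_derivative i2pi * sig 1 t) (at t)"
proof -
  let ?I = "{1..} \<times> {1..} :: (nat \<times> nat) set"
  define d where "d = pi * Im t"
  have d: "d > 0" using t by (simp add: d_def)
  have "(\<lambda>p. norm (ee (of_nat (fst p * snd p) * (\<i> * of_real (Im t / 2))))) summable_on ?I"
  proof -
    have "Im (\<i> * of_real (Im t / 2)) > 0" using t by simp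
    from sig_has_sum[OF this, of 0] show ?thesis
      by (simp add: summable_on_iff_abs_summable_on_complex[symmetric] case_prod_unfold) (auto simp: summable_on_def)
  qed
  then have s: "(\<lambda>p. norm (1 / of_nat (fst p) * ee (of_nat (fst p * snd p) * t)) * exp (d * norm (of_nat (fst p * snd p) :: complex))) summable_on ?I"
  proof (rule summable_on_comparison_test)
    fix p assume "p \<in> ?I"
    then have "fst p \<ge> 1" by auto
    then have 1: "norm (1 / of_nat (fst p) :: complex) \<le> 1" by (simp add: norm_divide)
    have e: "norm (ee (of_nat (fst p * snd p) * t)) * exp (d * norm (of_nat (fst p * snd p) :: complex))
        = norm (ee (of_nat (fst p * snd p) * (\<i> * of_real (Im t / 2))))"
      unfolding norm_ee exp_add[symmetric] norm_of_nat by (rule arg_cong[of _ _ exp]) (simp add: d_def field_simps)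
    show "norm (1 / of_nat (fst p) * ee (of_nat (fst p * snd p) * t)) * exp (d * norm (of_nat (fst p * snd p) :: complex))
        \<le> norm (ee (of_nat (fst p * snd p) * (\<i> * of_real (Im t / 2))))"
      unfolding norm_mult mult.assoc e[symmetric] using mult_right_mono[OF 1] by simp
  qed auto
  show "((\<lambda>p. 1 / of_nat (fst p) * ee (of_nat (fst p * snd p) * t)) has_sum log_eta t) ?I"
    unfolding log_eta_def by (rule has_sum_infsum) (rule summable_exponential_sum1[OF d s])
  have "(log_eta has_field_derivative (\<Sum>\<^sub>\<infinity>p\<in>?I. i2pi * of_nat (fst p * snd p) * (1 / of_nat (fst p) * ee (of_nat (fst p * snd p) * t)))) (at t)"
    unfolding log_eta_def[abs_def] by (rule DERIV_exponential_sum[OF d s])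
  also have "(\<Sum>\<^sub>\<infinity>p\<in>?I. i2pi * of_nat (fst p * snd p) * (1 / of_nat (fst p) * ee (of_nat (fst p * snd p) * t)))
      = i2pi * sig 1 t"
  proof (rule infsumI)
    have "((\<lambda>(m, n). of_nat n ^ 1 * ee (of_nat (n * m) * t)) has_sum sig 1 t) ?I"
      using sig_has_sum[OF t, of 1] by (subst has_sum_swap) (simp add: case_prod_unfold)
    then have "((\<lambda>p. i2pi * (case p of (m, n) \<Rightarrow> of_nat n ^ 1 * ee (of_nat (n * m) * t))) has_sum i2pi * sig 1 t) ?I"
      by (rule has_sum_cmult_right)
    also have "?this \<longleftrightarrow> ((\<lambda>p. i2pi * of_nat (fst p * snd p) * (1 / of_nat (fst p) * ee (of_nat (fst p * snd p) * t))) has_sum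
        i2pi * sig 1 t) ?I"
      by (rule has_sum_cong) (auto simp: mult_ac)
    finally show "((\<lambda>p. i2pi * of_nat (fst p * snd p) * (1 / of_nat (fst p) * ee (of_nat (fst p * snd p) * t))) has_sum
        i2pi * sig 1 t) ?I" .
  qed
  finally show "(log_eta has_field_derivative i2pi * sig 1 t) (at t)" .
qed

lemma eta_eq: "eta \<tau> = ceta (of_uhp \<tau>)"
proof -
  define t where "t = of_uhp \<tau>"
  have t: "Im t > 0" using of_uhp[of \<tau>] by (simp add: t_def)
  let ?I = "{1..} \<times> {1..} :: (nat \<times> nat) set"
  let ?h = "\<lambda>(n, m). 1 / of_nat m * ee (of_nat (m * n) * t)"
  have swap: "(?h has_sum log_eta t) ?I"
    using log_eta_has_sum[OF t] by (subst has_sum_swap) (simp add: case_prod_unfold)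
  have inner: "((\<lambda>m. 1 / of_nat m * ee (of_nat (m * n) * t)) has_sum - ln (1 - ee (of_nat n * t))) {1..}" if n: "n \<ge> 1" for n
  proof -
    have "norm (ee (of_nat n * t)) < 1" using t n by (intro norm_ee_less_1) simp
    from Ln_series'[of "- ee (of_nat n * t)"] this
    have "(\<lambda>m. - (ee (of_nat n * t) ^ m) / of_nat m) sums ln (1 - ee (of_nat n * t))" by simp
    from sums_minus[OF this] have S: "(\<lambda>m. 1 / of_nat m * ee (of_nat (m * n) * t)) sums - ln (1 - ee (of_nat n * t))"
      by (simp add: ee_mult_of_nat[symmetric] mult.assoc)
    have "(\<lambda>m. 1 / of_nat m * ee (of_nat (m * n) * t)) summable_on {1..}"
      using summable_on_SigmaD1[of "\<lambda>n m. 1 / of_nat m * ee (of_nat (m * n) * t)" "{1..}" "\<lambda>_. {1..}" n] swap n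
      by (auto simp: summable_on_def)
    then obtain s where s: "((\<lambda>m. 1 / of_nat m * ee (of_nat (m * n) * t)) has_sum s) {1..}"
      by (auto simp: summable_on_def)
    also have "?this \<longleftrightarrow> ((\<lambda>m. 1 / of_nat m * ee (of_nat (m * n) * t)) has_sum s) UNIV"
      by (rule has_sum_cong_neutral) auto
    finally have "(\<lambda>m. 1 / of_nat m * ee (of_nat (m * n) * t)) sums s" by (rule has_sum_imp_sums)
    with S s show ?thesis
      using sums_unique2 by blast
  qed
  have "((\<lambda>n. - ln (1 - ee (of_nat n * t))) has_sum log_eta t) {1..}"
    by (rule has_sum_SigmaD[OF swap]) (simp only: prod.case, rule inner, simp)
  moreover have "bij_betw Suc UNIV {1..}" by (rule bij_betwI[of _ _ _ "\<lambda>n. n - 1"]) auto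
  ultimately have "((\<lambda>m. - ln (1 - ee (of_nat (Suc m) * t))) has_sum log_eta t) UNIV"
    using has_sum_reindex_bij_betw[of Suc UNIV "{1..}" "\<lambda>n. - ln (1 - ee (of_nat n * t))"] by simp
  from sums_minus[OF has_sum_imp_sums[OF this]]
  have S: "(\<lambda>m. ln (1 - ee (of_nat (Suc m) * t))) sums - log_eta t" by simp
  have "1 - ee (of_nat (Suc m) * t) \<noteq> 0" for m
    using t norm_ee_less_1[of "of_nat (Suc m) * t"] by auto
  then have "(\<lambda>m. 1 - ee (of_nat (Suc m) * t)) = (\<lambda>m. exp (ln (1 - ee (of_nat (Suc m) * t))))"
    by (simp only: exp_Ln not_False_eq_True)
  then have "prodinf (\<lambda>m. 1 - ee (of_nat (Suc m) * t)) = exp (- log_eta t)"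
    using prodinf_exp[OF sums_summable[OF S]] sums_unique[OF S] by simp
  then show ?thesis by (simp add: eta_def ceta_def qpow_def t_def)
qed

lemma DERIV_ceta:
  assumes "Im t > 0"
  shows "(ceta has_field_derivative i2pi / 24 * cE2 t * ceta t) (at t)"
  unfolding ceta_def[abs_def] cE2_def
  by (rule derivative_eq_intros DERIV_log_eta assms refl | simp)+ (simp add: algebra_simps)

text \<open>
  Since \<open>E2\<close> is the logarithmic derivative of \<open>eta\<close>, its inversion formula says that the quotient of
  the two sides below is constant; the constant is found at \<open>t = i\<close>.
\<close>

lemma ceta_inversion:
  assumes t: "Im t > 0"
  shows "ceta (- 1 / t) ^ 8 = t ^ 4 * ceta t ^ 8"
proof -
  let ?H = "{t. Im t > 0}"
  define F where "F t = ceta (- 1 / t) ^ 8 / (t ^ 4 * ceta t ^ 8)" for t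
  have "(F has_field_derivative 0) (at t within ?H)" if "t \<in> ?H" for t
  proof -
    have t: "Im t > 0" and t0: "t \<noteq> 0" using that by auto
    let ?u = "i2pi / 24 :: complex"
    have "((\<lambda>s. - 1 / s) has_field_derivative 1 / t\<^sup>2) (at t)"
      using t0 by (auto intro!: derivative_eq_intros simp: power2_eq_square)
    from DERIV_chain2[OF DERIV_ceta[OF Im_inversion[OF t]] this]
    have d1: "((\<lambda>s. ceta (- 1 / s)) has_field_derivative ?u * cE2 (- 1 / t) * ceta (- 1 / t) * (1 / t\<^sup>2)) (at t)" .
    have e: "?u * cE2 (- 1 / t) * ceta (- 1 / t) * (1 / t\<^sup>2) = (?u * cE2 t + 1 / (2 * t)) * ceta (- 1 / t)"
      using t0 unfolding cE2_inversion[OF t] by (simp add: field_simps power2_eq_square)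
    have d2: "((\<lambda>s. ceta (- 1 / s) ^ 8) has_field_derivative 8 * ((?u * cE2 t + 1 / (2 * t)) * ceta (- 1 / t)) * ceta (- 1 / t) ^ 7) (at t)"
      using DERIV_power[OF d1, of 8] unfolding e by (simp add: mult_ac)
    have d3: "((\<lambda>s. s ^ 4 * ceta s ^ 8) has_field_derivative 4 * t ^ 3 * ceta t ^ 8 + 8 * (?u * cE2 t * ceta t) * ceta t ^ 7 * t ^ 4) (at t)"
      using DERIV_mult[OF DERIV_power[OF DERIV_ident, of 4] DERIV_power[OF DERIV_ceta[OF t], of 8]] by (simp add: mult_ac)
    have "(F has_field_derivative
      (8 * ((?u * cE2 t + 1 / (2 * t)) * ceta (- 1 / t)) * ceta (- 1 / t) ^ 7 * (t ^ 4 * ceta t ^ 8)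
        - ceta (- 1 / t) ^ 8 * (4 * t ^ 3 * ceta t ^ 8 + 8 * (?u * cE2 t * ceta t) * ceta t ^ 7 * t ^ 4))
      / (t ^ 4 * ceta t ^ 8 * (t ^ 4 * ceta t ^ 8))) (at t)"
      unfolding F_def[abs_def] by (rule DERIV_divide[OF d2 d3]) (use t0 in simp)
    also have "8 * ((?u * cE2 t + 1 / (2 * t)) * ceta (- 1 / t)) * ceta (- 1 / t) ^ 7 * (t ^ 4 * ceta t ^ 8)
        - ceta (- 1 / t) ^ 8 * (4 * t ^ 3 * ceta t ^ 8 + 8 * (?u * cE2 t * ceta t) * ceta t ^ 7 * t ^ 4) = 0"
      using t0 by (simp add: eval_nat_numeral field_simps)
    finally show ?thesis by (simp add: has_field_derivative_at_within)
  qed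
  then have "\<exists>c. \<forall>t\<in>?H. F t = c"
    by (intro has_field_derivative_zero_constant convex_halfspace_Im_gt)
  then have "F t = F \<i>" using t by auto
  also have "F \<i> = 1" by (simp add: F_def)
  finally show ?thesis using t by (auto simp: F_def field_simps)
qed

lemma q_series_ceta:
  obtains P where "q_series (1 / 24) P ceta" "P 0 = 1" "\<forall>w. P w \<noteq> 0"
proof -
  let ?I = "{1..} \<times> {1..} :: (nat \<times> nat) set"
  define L where "L w = (\<Sum>\<^sub>\<infinity>p\<in>?I. 1 / of_nat (fst p) * w ^ (fst p * snd p))" for w :: complex
  have L: "q_series 0 L log_eta" unfolding L_def[abs_def] by (rule q_series_family) (use log_eta_has_sum in simp)
  define P where "P w = exp (- L w)" for w
  have "L holomorphic_on ball 0 1" using L by (simp add: q_series_def)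
  then have "P holomorphic_on ball 0 1" unfolding P_def by (intro holomorphic_intros)
  then have "q_series (1 / 24) P ceta" using L by (simp add: q_series_def ceta_def P_def)
  moreover have "L 0 = 0" unfolding L_def by (rule infsum_0) auto
  then have "P 0 = 1" by (simp add: P_def)
  ultimately show thesis by (rule that) (simp add: P_def)
qed

section \<open>Modular forms\<close>

definition weight :: "int \<Rightarrow> (complex \<Rightarrow> complex) \<Rightarrow> bool" where
  "weight m f \<longleftrightarrow> (\<forall>t. Im t > 0 \<longrightarrow> f (- 1 / t) = t powi m * f t)"

text \<open>
  Invariance under translation is part of being a power series in \<open>q\<close>. The function \<open>P\<close> on the
  unit disc is carried along, because the constant term is \<open>P 0\<close>.
\<close>

definition mform :: "int \<Rightarrow> (complex \<Rightarrow> complex) \<Rightarrow> (complex \<Rightarrow> complex) \<Rightarrow> bool" where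
  "mform m P f \<longleftrightarrow> q_series 0 P f \<and> weight m f"

lemma weightD: "weight m f \<Longrightarrow> Im t > 0 \<Longrightarrow> f (- 1 / t) = t powi m * f t"
  by (simp add: weight_def)

lemma weight_mult: "weight m f \<Longrightarrow> weight n g \<Longrightarrow> weight (m + n) (\<lambda>t. f t * g t)"
  unfolding weight_def
proof (intro allI impI)
  fix t :: complex
  assume *: "\<forall>t. Im t > 0 \<longrightarrow> f (- 1 / t) = t powi m * f t" "\<forall>t. Im t > 0 \<longrightarrow> g (- 1 / t) = t powi n * g t" "Im t > 0"
  have "t \<noteq> 0" using *(3) by auto
  then have "t powi (m + n) = t powi m * t powi n" by (simp add: power_int_add)
  then show "f (- 1 / t) * g (- 1 / t) = t powi (m + n) * (f t * g t)" using * by simp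
qed

lemma weight_diff: "weight m f \<Longrightarrow> weight m g \<Longrightarrow> weight m (\<lambda>t. f t - g t)"
  by (auto simp: weight_def ring_distribs)

lemma weight_cmult: "weight m f \<Longrightarrow> weight m (\<lambda>t. c * f t)" by (auto simp: weight_def)

lemma weight_inverse: "weight m f \<Longrightarrow> weight (- m) (\<lambda>t. inverse (f t))"
  by (simp add: weight_def power_int_minus)

lemma weight_power: "weight m f \<Longrightarrow> weight (int n * m) (\<lambda>t. f t ^ n)"
  by (auto simp: weight_def power_mult_distrib power_int_mult[of _ m "int n"] mult.commute[of "int n"])

lemma mform_mult: "mform m P f \<Longrightarrow> mform n Q g \<Longrightarrow> mform (m + n) (\<lambda>w. P w * Q w) (\<lambda>t. f t * g t)"
  using q_series_mult[of 0 P f 0 Q g] by (simp add: mform_def weight_mult)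

lemma mform_diff: "mform m P f \<Longrightarrow> mform m Q g \<Longrightarrow> mform m (\<lambda>w. P w - Q w) (\<lambda>t. f t - g t)"
  by (simp add: mform_def weight_diff q_series_diff)

lemma mform_cmult: "mform m P f \<Longrightarrow> mform m (\<lambda>w. c * P w) (\<lambda>t. c * f t)"
  by (simp add: mform_def weight_cmult q_series_cmult)

lemma mform_power: "mform m P f \<Longrightarrow> mform (int n * m) (\<lambda>w. P w ^ n) (\<lambda>t. f t ^ n)"
  using q_series_power[of 0 P f n] by (simp add: mform_def weight_power)

lemma translate_of_int:
  assumes "\<And>t. Im t > 0 \<Longrightarrow> f (t + 1) = f t" "Im t > 0"
  shows "f (t + of_int n) = f t"
proof (induction n rule: int_induct[where k = 0])
  case (step1 i)
  then show ?case using assms(1)[of "t + of_int i"] assms(2) by (simp add: add.assoc)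
next
  case (step2 i)
  have "t + of_int (i - 1) + 1 = t + of_int i" by simp
  then show ?case using step2 assms(1)[of "t + of_int (i - 1)"] assms(2) by (simp only:) simp
qed simp

text \<open>
  As long as \<open>Im t < 1/2\<close>, moving \<open>Re t\<close> into \<open>[-1/2, 1/2]\<close> and inverting at least doubles the imaginary part.
\<close>

lemma invariant_reduction:
  assumes per: "\<And>t. Im t > 0 \<Longrightarrow> f (t + 1) = f t" and inv: "\<And>t. Im t > 0 \<Longrightarrow> f (- 1 / t) = f t"
    and "Im t > 0"
  shows "\<exists>s. Im s \<ge> 1 / 2 \<and> f s = f t"
proof -
  have "\<exists>s. Im s \<ge> 1 / 2 \<and> f s = f t" if "Im t > 0" "Im t * 2 ^ n \<ge> 1 / 2" for n t
    using that
  proof (induction n arbitrary: t)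
    case 0
    then show ?case by auto
  next
    case (Suc n)
    show ?case
    proof (cases "Im t \<ge> 1 / 2")
      case False
      define s where "s = t + of_int (- round (Re t))"
      have s: "Im s = Im t" "\<bar>Re s\<bar> \<le> 1 / 2"
        using of_int_round_abs_le[of "Re t"] by (auto simp: s_def abs_minus_commute)
      have "(Re s)\<^sup>2 \<le> (1 / 2)\<^sup>2" "(Im s)\<^sup>2 \<le> (1 / 2)\<^sup>2"
        using s False Suc.prems by (auto simp: abs_le_square_iff[symmetric])
      then have n: "(Re s)\<^sup>2 + (Im s)\<^sup>2 \<le> 1 / 2" by (simp add: power2_eq_square)
      have n0: "(Re s)\<^sup>2 + (Im s)\<^sup>2 > 0" using s Suc.prems by (simp add: sum_power2_gt_zero_iff)
      have "Im (- 1 / s) = Im s / ((Re s)\<^sup>2 + (Im s)\<^sup>2)" by (simp add: Im_divide)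
      also have "\<dots> \<ge> Im s / (1 / 2)" using n n0 s Suc.prems by (intro divide_left_mono) auto
      finally have i: "Im (- 1 / s) \<ge> 2 * Im t" using s by simp
      have "2 * Im t * 2 ^ n \<ge> 1 / 2" using Suc.prems by simp
      also have "2 * Im t * 2 ^ n \<le> Im (- 1 / s) * 2 ^ n" using i by (intro mult_right_mono) auto
      finally obtain r where "Im r \<ge> 1 / 2" "f r = f (- 1 / s)" using Suc.IH[of "- 1 / s"] i Suc.prems by auto
      moreover have "f (- 1 / s) = f t"
        using inv[of s] translate_of_int[of f t "- round (Re t)", OF per] s Suc.prems by (simp add: s_def)
      ultimately show ?thesis by auto
    qed auto
  qed
  moreover obtain n where "(1 / 2) / Im t < 2 ^ n" using real_arch_pow[of 2 "(1 / 2) / Im t"] by auto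
  then have "Im t * 2 ^ n \<ge> 1 / 2" using assms(3) by (simp add: field_simps)
  ultimately show ?thesis using assms(3) by blast
qed

text \<open>
  Every value is taken at a point with \<open>Im t \<ge> 1/2\<close>, that is, on a compact disc in the variable \<open>q\<close>, so
  that the maximum modulus principle applies.
\<close>

lemma mform_0_const:
  assumes "mform 0 P f"
  shows "norm w < 1 \<Longrightarrow> P w = P 0" and "Im t > 0 \<Longrightarrow> f t = P 0"
proof -
  have P: "P holomorphic_on ball 0 1" and f: "\<And>t. Im t > 0 \<Longrightarrow> f t = P (ee t)"
    and inv: "\<And>t. Im t > 0 \<Longrightarrow> f (- 1 / t) = f t"
    using assms by (auto simp: mform_def q_series_def weight_def)
  have per: "f (t + 1) = f t" if "Im t > 0" for t
    using f[of t] f[of "t + 1"] that by (simp add: ee_add)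
  let ?K = "cball 0 (exp (- pi)) :: complex set"
  have K: "?K \<subseteq> ball 0 1"
  proof
    fix x :: complex assume "x \<in> ?K"
    then have "norm x \<le> exp (- pi)" by simp
    also have "\<dots> < 1" by simp
    finally show "x \<in> ball 0 1" by simp
  qed
  then have "continuous_on ?K (\<lambda>w. norm (P w))"
    using holomorphic_on_imp_continuous_on[OF P] by (intro continuous_intros) (rule continuous_on_subset)
  then obtain \<xi> where \<xi>: "\<xi> \<in> ?K" "\<And>w. w \<in> ?K \<Longrightarrow> norm (P w) \<le> norm (P \<xi>)"
    using continuous_attains_sup[of ?K "\<lambda>w. norm (P w)"] by auto
  have max: "norm (P w) \<le> norm (P \<xi>)" if "w \<in> ball 0 1" for w
  proof (cases "w \<in> ?K")
    case False
    then have "w \<noteq> 0" "norm w < 1" using that by auto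
    then obtain t where t: "Im t > 0" "ee t = w" using ee_surj_disc by blast
    obtain s where s: "Im s \<ge> 1 / 2" "f s = f t" using invariant_reduction[of f t] per inv t(1) by blast
    have "norm (ee s) \<le> exp (- pi)" using s(1) by (simp add: norm_ee)
    then have "norm (P (ee s)) \<le> norm (P \<xi>)" by (intro \<xi>(2)) simp
    then show ?thesis using f[of s] f[of t] s t by simp
  qed (use \<xi> in auto)
  have "P constant_on ball 0 1"
    using \<xi>(1) K by (intro maximum_modulus_principle[OF P open_ball connected_ball open_ball order_refl _ max]) auto
  then obtain c where "\<And>w. w \<in> ball 0 1 \<Longrightarrow> P w = c" by (auto simp: constant_on_def)
  then show P0: "P w = P 0" if "norm w < 1" for w
    using that by simp
  show "f t = P 0" if "Im t > 0" for t
    using f[OF that] P0[OF norm_ee_less_1[OF that]] by simp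
qed

definition cDelta :: "complex \<Rightarrow> complex" where
  "cDelta t = ceta t ^ 24"

lemma cDelta_nonzero [simp]: "cDelta t \<noteq> 0" by (simp add: cDelta_def)

lemma weight_ceta8: "weight 4 (\<lambda>t. ceta t ^ 8)" using ceta_inversion by (simp add: weight_def power_int_def)

lemma weight_cDelta: "weight 12 cDelta"
  using weight_power[OF weight_ceta8, of 3] by (simp add: cDelta_def[abs_def] power_mult[symmetric])

lemma mform_divide_cDelta:
  assumes "q_series 1 Q f" "weight m f"
  obtains R where "mform (m - 12) R (\<lambda>t. f t / cDelta t)" "R 0 = Q 0"
proof -
  obtain E where E: "q_series (1 / 24) E ceta" "E 0 = 1" "\<forall>w. E w \<noteq> 0" by (rule q_series_ceta)
  have "q_series 1 (\<lambda>w. E w ^ 24) cDelta"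
    using q_series_power[OF E(1), of 24] by (simp add: cDelta_def[abs_def])
  then have "q_series (- 1) (\<lambda>w. inverse (E w ^ 24)) (\<lambda>t. inverse (cDelta t))"
    by (rule q_series_inverse) (simp add: E)
  from q_series_mult[OF assms(1) this] weight_mult[OF assms(2) weight_inverse[OF weight_cDelta]]
  have "mform (m - 12) (\<lambda>w. Q w * inverse (E w ^ 24)) (\<lambda>t. f t / cDelta t)"
    by (simp add: mform_def divide_inverse)
  then show thesis by (rule that) (simp add: E)
qed

lemma mform_cusp:
  assumes "mform m P f" "P 0 = 0"
  obtains R where "mform (m - 12) R (\<lambda>t. f t / cDelta t)"
proof -
  obtain Q where "q_series (0 + 1) Q f" using assms by (auto simp: mform_def elim: q_series_Suc)
  then show thesis using mform_divide_cDelta[of Q f m] assms that by (auto simp: mform_def)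
qed

lemma mform_cDelta:
  obtains P where "mform 12 P cDelta" "P 0 = 0"
proof -
  obtain E where E: "q_series (1 / 24) E ceta" "E 0 = 1" "\<forall>w. E w \<noteq> 0" by (rule q_series_ceta)
  have "q_series 1 (\<lambda>w. E w ^ 24) cDelta"
    using q_series_power[OF E(1), of 24] by (simp add: cDelta_def[abs_def])
  from q_series_shift[OF this, of 1] have "mform 12 (\<lambda>w. w ^ 1 * E w ^ 24) cDelta"
    by (simp add: mform_def weight_cDelta)
  then show thesis by (rule that) simp
qed

text \<open>The product of \<open>f ^ 12\<close> and a power of the discriminant has weight \<open>0\<close> and vanishes at infinity.\<close>

lemma mform_negative:
  assumes "mform m P f" "m < 0" "Im t > 0"
  shows "f t = 0"
proof -
  obtain D where D: "mform 12 D cDelta" "D 0 = 0" by (rule mform_cDelta)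
  have "mform (int 12 * m + int (nat (- m)) * 12) (\<lambda>w. P w ^ 12 * D w ^ nat (- m)) (\<lambda>t. f t ^ 12 * cDelta t ^ nat (- m))"
    by (intro mform_mult mform_power assms(1) D(1))
  then have "mform 0 (\<lambda>w. P w ^ 12 * D w ^ nat (- m)) (\<lambda>t. f t ^ 12 * cDelta t ^ nat (- m))"
    using assms(2) by simp
  from mform_0_const(2)[OF this assms(3)] have "f t ^ 12 * cDelta t ^ nat (- m) = 0"
    using assms(2) by (simp add: D)
  then show ?thesis by simp
qed

lemma mform_eisenstein:
  obtains P4 P6 where "mform 4 P4 cE4" "P4 0 = 1" "mform 6 P6 cE6" "P6 0 = 1"
proof (rule q_series_eisenstein)
  fix Q1 Q3 Q5 :: "complex \<Rightarrow> complex"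
  assume "q_series 0 (\<lambda>w. 1 + 240 * (w * Q3 w)) cE4" "q_series 0 (\<lambda>w. 1 - 504 * (w * Q5 w)) cE6"
  then show thesis using cE4_inversion cE6_inversion
    by (intro that[of "\<lambda>w. 1 + 240 * (w * Q3 w)" "\<lambda>w. 1 - 504 * (w * Q5 w)"])
       (auto simp: mform_def weight_def power_int_def)
qed

text \<open>Both sides have a simple zero at infinity, so that the quotient is a form of weight \<open>0\<close>.\<close>

lemma discriminant:
  assumes "Im t > 0"
  shows "cE4 t ^ 3 - cE6 t ^ 2 = 1728 * cDelta t"
proof (rule q_series_eisenstein)
  fix Q1 Q3 Q5 :: "complex \<Rightarrow> complex"
  assume Q: "Q3 0 = 1" "Q5 0 = 1" "Q3 holomorphic_on ball 0 1" "Q5 holomorphic_on ball 0 1"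
    and q: "q_series 0 (\<lambda>w. 1 + 240 * (w * Q3 w)) cE4" "q_series 0 (\<lambda>w. 1 - 504 * (w * Q5 w)) cE6"
  let ?f = "\<lambda>t. cE4 t ^ 3 - cE6 t ^ 2"
  let ?Q = "\<lambda>w. 720 * Q3 w + 3 * 240\<^sup>2 * w * Q3 w ^ 2 + 240 ^ 3 * w\<^sup>2 * Q3 w ^ 3 + 1008 * Q5 w - 504\<^sup>2 * w * Q5 w ^ 2"
  have "q_series 0 (\<lambda>w. (1 + 240 * (w * Q3 w)) ^ 3 - (1 - 504 * (w * Q5 w)) ^ 2) ?f"
    using q_series_diff[OF q_series_power[OF q(1), of 3, simplified] q_series_power[OF q(2), of 2, simplified]] .
  moreover have "(1 + 240 * (w * Q3 w)) ^ 3 - (1 - 504 * (w * Q5 w)) ^ 2 = w * ?Q w" for w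
    by (simp add: power2_eq_square power3_eq_cube algebra_simps)
  moreover have "?Q holomorphic_on ball 0 1" by (intro holomorphic_intros Q)
  ultimately have "q_series 1 ?Q ?f" by (simp add: q_series_def)
  moreover have "weight 12 ?f" using cE4_inversion cE6_inversion
    by (auto simp: weight_def power_int_def power_mult_distrib power_mult[symmetric] right_diff_distrib)
  ultimately obtain R where R: "mform (12 - 12) R (\<lambda>t. ?f t / cDelta t)" "R 0 = ?Q 0"
    by (rule mform_divide_cDelta)
  have "mform 0 R (\<lambda>t. ?f t / cDelta t)" using R(1) by simp
  then have "?f t / cDelta t = R 0" using assms by (rule mform_0_const(2))
  also have "R 0 = 1728" unfolding R(2) by (simp add: Q)
  finally show "?f t = 1728 * cDelta t" by (simp add: divide_eq_eq)
qed

text \<open>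
  The square and the cube are multiples of \<open>E4\<close> and \<open>E6\<close>. Unless they vanish, \<open>E4\<^sup>3\<close> and \<open>E6\<^sup>2\<close> are
  proportional, against \<open>discriminant\<close>.
\<close>

lemma mform_2_zero:
  assumes f: "mform 2 P f" and t: "Im t > 0"
  shows "f t = 0" "P 0 = 0"
proof -
  obtain P4 P6 where E: "mform 4 P4 cE4" "P4 0 = 1" "mform 6 P6 cE6" "P6 0 = 1" by (rule mform_eisenstein)
  have z: "g t = c * h t" if g: "mform m Pg g" "mform m Ph h" "Pg 0 = c" "Ph 0 = 1" "m < 12" for m g h c Pg Ph
  proof -
    have "mform m (\<lambda>w. Pg w - c * Ph w) (\<lambda>t. g t - c * h t)" by (intro mform_diff mform_cmult g)
    then obtain R where "mform (m - 12) R (\<lambda>t. (g t - c * h t) / cDelta t)" by (rule mform_cusp) (simp add: g)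
    then have "(g t - c * h t) / cDelta t = 0" by (rule mform_negative) (use that t in auto)
    then show ?thesis by simp
  qed
  define a where "a = P 0"
  have "f t ^ 2 = a ^ 2 * cE4 t" by (rule z[OF mform_power[OF f, of 2, simplified] E(1)]) (simp_all add: a_def E)
  moreover have "f t ^ 3 = a ^ 3 * cE6 t"
    by (rule z[OF mform_power[OF f, of 3, simplified] E(3)]) (simp_all add: a_def E)
  ultimately have "(a ^ 2 * cE4 t) ^ 3 = (a ^ 3 * cE6 t) ^ 2" by (metis mult.commute power_mult)
  then have "a ^ 6 * (cE4 t ^ 3 - cE6 t ^ 2) = 0"
    by (simp add: power_mult_distrib power_mult[symmetric] right_diff_distrib)
  then have a: "a = 0" using discriminant[OF t] by simp
  then show "P 0 = 0" by (simp add: a_def)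
  show "f t = 0" using \<open>f t ^ 2 = a ^ 2 * cE4 t\<close> a by simp
qed

text \<open>The ring \<open>\<complex>[E4, E6]\<close>, as functions on the upper half plane.\<close>

abbreviation (input) level_one :: "(uhp \<Rightarrow> complex) set" where
  "level_one \<equiv> generated_algebra {E4, E6}"

lemma Im_of_uhp [simp]: "Im (of_uhp \<tau>) > 0" using of_uhp[of \<tau>] by simp

lemma generated_algebra_cmult: "f \<in> generated_algebra X \<Longrightarrow> (\<lambda>x. c * f x) \<in> generated_algebra X"
  using generated_algebra.mult[OF generated_algebra.const[of c X], of f] by (simp add: times_fun_def)

lemma generated_algebra_power: "f \<in> generated_algebra X \<Longrightarrow> f ^ n \<in> generated_algebra X"
proof (induction n)
  case 0
  then show ?case using generated_algebra.const[of 1 X] by (simp add: one_fun_def)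
qed (auto intro: generated_algebra.mult)

lemma generated_algebra_zero: "0 \<in> generated_algebra X"
  using generated_algebra.const[of 0 X] by (simp add: zero_fun_def)

lemma generated_algebra_uminus: "f \<in> generated_algebra X \<Longrightarrow> - f \<in> generated_algebra X"
  using generated_algebra_cmult[of f X "- 1"] by (simp add: fun_Compl_def)

lemma generated_algebra_diff: "f \<in> generated_algebra X \<Longrightarrow> g \<in> generated_algebra X \<Longrightarrow> f - g \<in> generated_algebra X"
  using generated_algebra.add[OF _ generated_algebra_uminus, of f X g] by simp

lemma fun_power_apply: "(f ^ n) x = f x ^ n" for f :: "'a \<Rightarrow> complex"
  by (induction n) (simp_all add: one_fun_def)

lemma eta_24: "eta \<tau> ^ 24 = cDelta (of_uhp \<tau>)" by (simp add: eta_eq cDelta_def)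

lemma E4_E6_discriminant: "E4 ^ 3 - E6 ^ 2 = 1728 * eta ^ 24"
proof
  fix \<tau>
  show "(E4 ^ 3 - E6 ^ 2) \<tau> = (1728 * eta ^ 24) \<tau>"
    using discriminant[of "of_uhp \<tau>"] by (simp add: fun_power_apply numeral_fun_apply E4_eq E6_eq eta_24)
qed

lemma eisenstein_monomial:
  assumes "even m" "m \<ge> 0" "m \<noteq> 2"
  obtains P e where "mform m P e" "P 0 = 1" "(\<lambda>\<tau>. e (of_uhp \<tau>)) \<in> level_one"
proof -
  obtain P4 P6 where E: "mform 4 P4 cE4" "P4 0 = 1" "mform 6 P6 cE6" "P6 0 = 1" by (rule mform_eisenstein)
  have "\<exists>i j :: nat. m = int i * 4 + int j * 6"
  proof (cases "m mod 4 = 0")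
    case True
    then show ?thesis by (rule_tac exI[of _ "nat (m div 4)"], rule_tac exI[of _ 0]) (use assms in auto)
  next
    case False
    have "m = ((m - 6) div 4) * 4 + 6" "(m - 6) div 4 \<ge> 0" using False assms by presburger+
    then show ?thesis by (rule_tac exI[of _ "nat ((m - 6) div 4)"], rule_tac exI[of _ 1]) simp
  qed
  then obtain i j :: nat where ij: "m = int i * 4 + int j * 6" by blast
  show thesis
  proof (rule that)
    show "mform m (\<lambda>w. P4 w ^ i * P6 w ^ j) (\<lambda>t. cE4 t ^ i * cE6 t ^ j)"
      unfolding ij by (intro mform_mult mform_power E)
    have "E4 ^ i * E6 ^ j \<in> level_one"
      by (intro generated_algebra.mult generated_algebra_power generated_algebra.gen) auto
    also have "E4 ^ i * E6 ^ j = (\<lambda>\<tau>. cE4 (of_uhp \<tau>) ^ i * cE6 (of_uhp \<tau>) ^ j)"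
      by (simp add: fun_eq_iff fun_power_apply E4_eq E6_eq)
    finally show "(\<lambda>\<tau>. cE4 (of_uhp \<tau>) ^ i * cE6 (of_uhp \<tau>) ^ j) \<in> level_one" .
  qed (simp add: E)
qed

lemma Delta_in_level_one: "eta ^ 24 \<in> level_one"
proof -
  have "(\<lambda>\<tau>. 1 / 1728 * (E4 ^ 3 - E6 ^ 2) \<tau>) \<in> level_one"
    by (intro generated_algebra_cmult generated_algebra_diff generated_algebra_power generated_algebra.gen) auto
  also have "(\<lambda>\<tau>. 1 / 1728 * (E4 ^ 3 - E6 ^ 2) \<tau>) = eta ^ 24"
    by (simp add: E4_E6_discriminant fun_eq_iff numeral_fun_apply)
  finally show ?thesis .
qed

text \<open>Subtracting a multiple of a monomial in \<open>E4\<close>, \<open>E6\<close> leaves a cusp form, which is divisible by the discriminant.\<close>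

lemma mform_in_level_one:
  assumes "mform m P f" "even m"
  shows "(\<lambda>\<tau>. f (of_uhp \<tau>)) \<in> level_one"
  using assms
proof (induction "nat m" arbitrary: m P f rule: less_induct)
  case less
  consider "m < 0" | "m = 0" | "m = 2" | "m > 2"
    using less.prems(2) by fastforce
  then show ?case
  proof cases
    case 1
    then have "(\<lambda>\<tau>. f (of_uhp \<tau>)) = 0"
      using mform_negative[OF less.prems(1)] by (auto simp: fun_eq_iff)
    then show ?thesis by (simp only: generated_algebra_zero)
  next
    case 2
    then have "(\<lambda>\<tau>. f (of_uhp \<tau>)) = (\<lambda>_. P 0)"
      using mform_0_const(2)[of P f] less.prems(1) by (auto simp: fun_eq_iff)
    then show ?thesis by (simp only: generated_algebra.const)
  next
    case 3
    then have "(\<lambda>\<tau>. f (of_uhp \<tau>)) = 0"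
      using mform_2_zero(1)[of P f] less.prems(1) by (auto simp: fun_eq_iff)
    then show ?thesis by (simp only: generated_algebra_zero)
  next
    case 4
    then obtain Q e where e: "mform m Q e" "Q 0 = 1" "(\<lambda>\<tau>. e (of_uhp \<tau>)) \<in> level_one"
      using eisenstein_monomial[of m] less.prems(2) by auto
    have "mform m (\<lambda>w. P w - P 0 * Q w) (\<lambda>t. f t - P 0 * e t)"
      by (intro mform_diff mform_cmult e less.prems)
    then obtain R where R: "mform (m - 12) R (\<lambda>t. (f t - P 0 * e t) / cDelta t)"
      by (rule mform_cusp) (simp add: e)
    have "(\<lambda>\<tau>. (f (of_uhp \<tau>) - P 0 * e (of_uhp \<tau>)) / cDelta (of_uhp \<tau>)) \<in> level_one"
      by (rule less.hyps[OF _ R]) (use 4 less.prems(2) in auto)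
    then have "(\<lambda>\<tau>. P 0 * e (of_uhp \<tau>)) + eta ^ 24 * (\<lambda>\<tau>. (f (of_uhp \<tau>) - P 0 * e (of_uhp \<tau>)) / cDelta (of_uhp \<tau>)) \<in> level_one"
      by (intro generated_algebra.add generated_algebra.mult generated_algebra_cmult e Delta_in_level_one)
    also have "(\<lambda>\<tau>. P 0 * e (of_uhp \<tau>)) + eta ^ 24 * (\<lambda>\<tau>. (f (of_uhp \<tau>) - P 0 * e (of_uhp \<tau>)) / cDelta (of_uhp \<tau>))
        = (\<lambda>\<tau>. f (of_uhp \<tau>))"
      by (simp add: fun_eq_iff fun_power_apply eta_24)
    finally show ?thesis .
  qed
qed

text \<open>
  Two forms of weights \<open>m + 2\<close> and \<open>m\<close> with equal constant terms: up to a multiple of \<open>(E6, E4)\<close> or,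
  for \<open>m = 6\<close>, of \<open>(E4^2, E6)\<close>, both are cusp forms.
\<close>

lemma mform_pair:
  assumes F: "mform (m + 2) P F" and G: "mform m Q G" and m: "even m" and eq: "P 0 = Q 0"
  shows "\<exists>u v f g. u \<in> level_one \<and> v \<in> level_one \<and> f \<in> level_one \<and> g \<in> level_one \<and>
    (\<lambda>\<tau>. F (of_uhp \<tau>)) = u * E6 + v * E4 ^ 2 + eta ^ 24 * f \<and>
    (\<lambda>\<tau>. G (of_uhp \<tau>)) = u * E4 + v * E6 + eta ^ 24 * g"
proof -
  obtain P4 P6 where E: "mform 4 P4 cE4" "P4 0 = 1" "mform 6 P6 cE6" "P6 0 = 1" by (rule mform_eisenstein)
  define a where "a = P 0"
  have main: ?thesis
    if 1: "mform (m + 2) P1 F1" "P1 0 = a" and 2: "mform m Q1 G1" "Q1 0 = a" and uv: "u \<in> level_one" "v \<in> level_one"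
      and F1: "\<And>\<tau>. F1 (of_uhp \<tau>) = (u * E6 + v * E4 ^ 2) \<tau>" and G1: "\<And>\<tau>. G1 (of_uhp \<tau>) = (u * E4 + v * E6) \<tau>"
    for P1 F1 Q1 G1 u v
  proof -
    obtain R1 where R1: "mform (m + 2 - 12) R1 (\<lambda>t. (F t - F1 t) / cDelta t)"
      by (rule mform_cusp[OF mform_diff[OF F 1(1)]]) (simp add: a_def 1)
    obtain R2 where R2: "mform (m - 12) R2 (\<lambda>t. (G t - G1 t) / cDelta t)"
      by (rule mform_cusp[OF mform_diff[OF G 2(1)]]) (simp add: a_def eq 2)
    let ?f = "\<lambda>\<tau>. (F (of_uhp \<tau>) - F1 (of_uhp \<tau>)) / cDelta (of_uhp \<tau>)"
    let ?g = "\<lambda>\<tau>. (G (of_uhp \<tau>) - G1 (of_uhp \<tau>)) / cDelta (of_uhp \<tau>)"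
    have "?f \<in> level_one" by (rule mform_in_level_one[OF R1]) (use m in simp)
    moreover have "?g \<in> level_one" by (rule mform_in_level_one[OF R2]) (use m in simp)
    moreover have "(\<lambda>\<tau>. F (of_uhp \<tau>)) = u * E6 + v * E4 ^ 2 + eta ^ 24 * ?f"
      using F1 by (simp add: fun_eq_iff fun_power_apply eta_24)
    moreover have "(\<lambda>\<tau>. G (of_uhp \<tau>)) = u * E4 + v * E6 + eta ^ 24 * ?g"
      using G1 by (simp add: fun_eq_iff fun_power_apply eta_24)
    ultimately show ?thesis using uv by blast
  qed
  consider "a = 0" | "a \<noteq> 0" "m = 6" | "a \<noteq> 0" "m \<ge> 4" "m \<noteq> 6" | "a \<noteq> 0" "m < 4"
    by linarith
  then show ?thesis
  proof cases
    case 1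
    have "mform k (\<lambda>_. 0) (\<lambda>_. 0)" for k
      by (simp add: mform_def q_series_def weight_def)
    from main[OF this _ this] show ?thesis
      using 1 generated_algebra_zero by fastforce
  next
    case 2
    show ?thesis
    proof (rule main[where u = 0 and v = "\<lambda>_. a"])
      show "mform (m + 2) (\<lambda>w. a * P4 w ^ 2) (\<lambda>t. a * cE4 t ^ 2)"
        using mform_cmult[OF mform_power[OF E(1), of 2], of a] 2 by simp
      show "mform m (\<lambda>w. a * P6 w) (\<lambda>t. a * cE6 t)" using mform_cmult[OF E(3), of a] 2 by simp
    qed (simp_all add: E generated_algebra_zero generated_algebra.const E4_eq E6_eq fun_power_apply)
  next
    case 3
    then have "even (m - 4)" "m - 4 \<ge> 0" "m - 4 \<noteq> 2" using m by auto
    then obtain S e where e: "mform (m - 4) S e" "S 0 = 1" "(\<lambda>\<tau>. e (of_uhp \<tau>)) \<in> level_one"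
      by (rule eisenstein_monomial)
    show ?thesis
    proof (rule main[where u = "\<lambda>\<tau>. a * e (of_uhp \<tau>)" and v = 0])
      show "mform (m + 2) (\<lambda>w. a * (P6 w * S w)) (\<lambda>t. a * (cE6 t * e t))"
        using mform_cmult[OF mform_mult[OF E(3) e(1)], of a] by (simp add: add.commute)
      show "mform m (\<lambda>w. a * (P4 w * S w)) (\<lambda>t. a * (cE4 t * e t))"
        using mform_cmult[OF mform_mult[OF E(1) e(1)], of a] by simp
    qed (simp_all add: E e generated_algebra_zero generated_algebra_cmult E4_eq E6_eq)
  next
    case 4
    consider "m < 0" | "m = 0" | "m = 2"
      using 4 m by fastforce
    then have "a = 0"
    proof cases
      case 1
      have G0: "G t = 0" if "Im t > 0" for t
        using mform_negative[OF G 1 that] .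
      have "Q w = 0" if "w \<noteq> 0" "norm w < 1" for w
      proof -
        obtain t where "Im t > 0" "ee t = w"
          using ee_surj_disc[OF \<open>w \<noteq> 0\<close> \<open>norm w < 1\<close>] by blast
        then show ?thesis using G G0[of t] by (auto simp: mform_def q_series_def)
      qed
      moreover have "isCont Q 0"
        using G by (auto simp: mform_def q_series_def intro!: holomorphic_on_imp_continuous_on[THEN continuous_on_interior])
      then have "(Q \<longlongrightarrow> Q 0) (at 0)" by (simp add: isCont_def)
      moreover have "\<forall>\<^sub>F w in at 0. Q w = 0"
        using calculation(1) unfolding eventually_at by (intro exI[of _ 1]) auto
      then have "(Q \<longlongrightarrow> 0) (at 0)" by (rule tendsto_eventually)
      ultimately have "Q 0 = 0" by (intro tendsto_unique[of "at 0" Q]) auto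
      then show ?thesis using eq by (simp add: a_def)
    next
      case 2
      then show ?thesis using mform_2_zero(2)[of P F \<i>] F by (simp add: a_def)
    next
      case 3
      then show ?thesis using mform_2_zero(2)[of Q G \<i>] G eq by (simp add: a_def)
    qed
    with 4 show ?thesis by simp
  qed
qed

section \<open>The modular group\<close>

definition T_mat :: "int \<Rightarrow> int^2^2" where
  "T_mat n = vector [vector [1, n], vector [0, 1]]"

definition S_mat :: "int^2^2" where
  "S_mat = vector [vector [0, - 1], vector [1, 0]]"

lemma T_mat_nth [simp]: "T_mat n$1$1 = 1" "T_mat n$1$2 = n" "T_mat n$2$1 = 0" "T_mat n$2$2 = 1"
  by (simp_all add: T_mat_def)

lemma S_mat_nth [simp]: "S_mat$1$1 = 0" "S_mat$1$2 = - 1" "S_mat$2$1 = 1" "S_mat$2$2 = 0" by (simp_all add: S_mat_def)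

lemma mat_mult_nth: "(A ** B)$i$j = A$i$1 * B$1$j + A$i$2 * B$2$j" for A B :: "int^2^2"
  by (simp add: matrix_matrix_mult_def sum_2)

lemma det_S [simp]: "det S_mat = 1" and det_T [simp]: "det (T_mat n) = 1" by (simp_all add: det_2)

lemma mat2_eqI: "A$1$1 = B$1$1 \<Longrightarrow> A$1$2 = B$1$2 \<Longrightarrow> A$2$1 = B$2$1 \<Longrightarrow> A$2$2 = B$2$2 \<Longrightarrow> A = B" for A B :: "int^2^2"
  by (simp add: vec_eq_iff forall_2)

text \<open>
  The Euclidean algorithm on the first column \<open>(a, c)\<close>: a translation reduces \<open>a\<close> modulo \<open>c\<close>, then \<open>S\<close>
  exchanges the two entries up to sign.
\<close>

lemma modular_group_induct [consumes 1, case_names S T mult]: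
  assumes "det A = 1" and S: "Q S_mat" and T: "\<And>n. Q (T_mat n)"
    and mult: "\<And>A B. det A = 1 \<Longrightarrow> det B = 1 \<Longrightarrow> Q A \<Longrightarrow> Q B \<Longrightarrow> Q (A ** B)"
  shows "Q A"
  using assms(1)
proof (induction "nat \<bar>A$2$1\<bar>" arbitrary: A rule: less_induct)
  case less
  have dA: "A$1$1 * A$2$2 - A$1$2 * A$2$1 = 1" using less.prems by (simp add: det_2)
  have S2: "Q (S_mat ** S_mat)" using mult[of S_mat S_mat] S by simp
  have S3: "Q (S_mat ** S_mat ** S_mat)" "det (S_mat ** S_mat ** S_mat) = 1"
    using mult[of "S_mat ** S_mat" S_mat] S S2 by (simp_all add: det_mul)
  show ?case
  proof (cases "A$2$1 = 0")
    case True
    then have "A$1$1 * A$2$2 = 1" using dA by simp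
    then consider "A$1$1 = 1" "A$2$2 = 1" | "A$1$1 = - 1" "A$2$2 = - 1"
      by (auto simp: zmult_eq_1_iff)
    then show ?thesis
    proof cases
      case 1
      then have "A = T_mat (A$1$2)" using True by (intro mat2_eqI) auto
      then show ?thesis using T by metis
    next
      case 2
      then have "A = S_mat ** S_mat ** T_mat (- (A$1$2))" using True by (intro mat2_eqI) (auto simp: mat_mult_nth)
      moreover have "Q (S_mat ** S_mat ** T_mat (- (A$1$2)))"
        using mult[of "S_mat ** S_mat" "T_mat (- (A$1$2))"] S2 T by (simp add: det_mul)
      ultimately show ?thesis by simp
    qed
  next
    case False
    define q where "q = A$1$1 div A$2$1"
    define B where "B = S_mat ** (T_mat (- q) ** A)"
    have "B$2$1 = A$1$1 mod A$2$1" by (simp add: B_def mat_mult_nth q_def minus_div_mult_eq_mod[symmetric])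
    then have "nat \<bar>B$2$1\<bar> < nat \<bar>A$2$1\<bar>" using False by (simp add: abs_mod_less)
    moreover have dB: "det B = 1" by (simp add: B_def det_mul less.prems)
    ultimately have "Q B" by (rule less.hyps)
    have "A = T_mat q ** ((S_mat ** S_mat ** S_mat) ** B)"
      by (intro mat2_eqI) (simp_all add: B_def mat_mult_nth algebra_simps)
    moreover have "Q (T_mat q ** ((S_mat ** S_mat ** S_mat) ** B))"
      using mult[of "T_mat q" "(S_mat ** S_mat ** S_mat) ** B"] mult[of "S_mat ** S_mat ** S_mat" B] T S3 \<open>Q B\<close> dB
      by (simp add: det_mul)
    ultimately show ?thesis by simp
  qed
qed

lemma of_uhp_eqD: "of_uhp s = of_uhp t \<Longrightarrow> s = t" by (simp add: of_uhp_inject)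

lemma aut_factor_nonzero [simp]:
  assumes "det A = 1"
  shows "aut_factor A \<tau> \<noteq> 0"
proof
  assume "aut_factor A \<tau> = 0"
  then have "of_uhp (moebius A \<tau>) = 0" using of_uhp_moebius[OF assms, of \<tau>] by simp
  then show False
    using Im_of_uhp[of "moebius A \<tau>"] by simp
qed

lemma det_real: "det A = 1 \<Longrightarrow> (of_int (A$1$1) * of_int (A$2$2) :: complex) = 1 + of_int (A$1$2) * of_int (A$2$1)" for A :: "int^2^2"
proof -
  assume "det A = 1"
  then have "A$1$1 * A$2$2 = 1 + A$1$2 * A$2$1" by (simp add: det_2)
  then show ?thesis by (simp flip: of_int_mult)
qed

lemma aut_factor_mult:
  assumes "det A = 1" "det B = 1"
  shows "aut_factor (A ** B) \<tau> = aut_factor A (moebius B \<tau>) * aut_factor B \<tau>"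
  using aut_factor_nonzero[OF assms(2), of \<tau>]
  by (simp add: aut_factor_def[of A] of_uhp_moebius[OF assms(2)] field_simps)
     (simp add: aut_factor_def mat_mult_nth algebra_simps)

lemma moebius_mult:
  assumes "det A = 1" "det B = 1"
  shows "moebius (A ** B) \<tau> = moebius A (moebius B \<tau>)"
proof (rule of_uhp_eqD)
  have AB: "det (A ** B) = 1" using assms by (simp add: det_mul)
  have "of_uhp (moebius A (moebius B \<tau>))
      = (of_int (A$1$1) * of_uhp (moebius B \<tau>) + of_int (A$1$2)) * aut_factor B \<tau> / (aut_factor A (moebius B \<tau>) * aut_factor B \<tau>)"
    using aut_factor_nonzero[OF assms(2), of \<tau>] by (simp add: of_uhp_moebius[OF assms(1)])
  also have "(of_int (A$1$1) * of_uhp (moebius B \<tau>) + of_int (A$1$2)) * aut_factor B \<tau>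
      = of_int ((A ** B)$1$1) * of_uhp \<tau> + of_int ((A ** B)$1$2)"
    using aut_factor_nonzero[OF assms(2), of \<tau>]
    by (simp add: of_uhp_moebius[OF assms(2)] field_simps) (simp add: aut_factor_def mat_mult_nth algebra_simps)
  finally show "of_uhp (moebius (A ** B) \<tau>) = of_uhp (moebius A (moebius B \<tau>))"
    by (simp add: of_uhp_moebius[OF AB] aut_factor_mult[OF assms])
qed

lemma moebius_S: "of_uhp (moebius S_mat \<tau>) = - 1 / of_uhp \<tau>" "aut_factor S_mat \<tau> = of_uhp \<tau>"
  by (simp_all add: of_uhp_moebius aut_factor_def)

lemma moebius_T: "of_uhp (moebius (T_mat n) \<tau>) = of_uhp \<tau> + of_int n" "aut_factor (T_mat n) \<tau> = 1"
  by (simp_all add: of_uhp_moebius aut_factor_def)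

lemma of_uhp_to_uhp: "Im t > 0 \<Longrightarrow> of_uhp (to_uhp t) = t" by (simp add: to_uhp_inverse)

lemma ceta_translate: "Im t > 0 \<Longrightarrow> ceta (t + 1) = ee (1 / 24) * ceta t"
proof -
  assume "Im t > 0"
  obtain E where "q_series (1 / 24) E ceta" by (rule q_series_ceta)
  from q_series_translate[OF this \<open>Im t > 0\<close>] show ?thesis
    by simp
qed

lemma eta_nonzero [simp]: "eta \<tau> \<noteq> 0" by (simp add: eta_eq)

lemma eta_24_moebius:
  assumes "det A = 1"
  shows "eta (moebius A \<tau>) ^ 24 = aut_factor A \<tau> ^ 12 * eta \<tau> ^ 24"
  using assms
proof (induction A arbitrary: \<tau> rule: modular_group_induct)
  case S
  then show ?case using weightD[OF weight_cDelta, of "of_uhp \<tau>"] by (simp add: eta_24 moebius_S power_int_def)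
next
  case (T n)
  have "cDelta (t + 1) = cDelta t" if "Im t > 0" for t
  proof -
    have "ee (1 / 24) ^ 24 = 1" unfolding ee_mult_of_nat[of 24 "1 / 24", symmetric, simplified] by simp
    then show ?thesis using that by (simp add: cDelta_def ceta_translate power_mult_distrib)
  qed
  from translate_of_int[of cDelta, OF this, of "of_uhp \<tau>" n] show ?case
    by (simp add: eta_24 moebius_T)
next
  case (mult A B)
  then show ?case by (simp add: moebius_mult aut_factor_mult power_mult_distrib)
qed

text \<open>The defining quotient of \<open>eps\<close> is continuous with values in the \<open>24\<close>-th roots of unity, hence constant.\<close>

lemma eps_eq:
  assumes "(A, w) \<in> Mp2Z"
  shows "eps (A, w) = eta (moebius A \<tau>) / (eta \<tau> * w \<tau>)"
proof -
  let ?H = "{t. Im t > 0}"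
  have A: "det A = 1" and w: "(\<lambda>t. w (to_uhp t)) holomorphic_on ?H" and w2: "\<And>\<tau>. w \<tau> ^ 2 = aut_factor A \<tau>"
    using assms by (auto simp: Mp2Z_def)
  have w0: "w \<tau> \<noteq> 0" for \<tau>
    using w2[of \<tau>] aut_factor_nonzero[OF A, of \<tau>] by auto
  define g where "g \<tau> = eta (moebius A \<tau>) / (eta \<tau> * w \<tau>)" for \<tau>
  have g24: "g \<tau> ^ 24 = 1" for \<tau>
  proof -
    have "w \<tau> ^ 24 = (w \<tau> ^ 2) ^ 12" by (simp flip: power_mult)
    then show ?thesis
      using aut_factor_nonzero[OF A, of \<tau>] by (simp add: g_def power_divide power_mult_distrib eta_24_moebius[OF A] w2)
  qed
  let ?M = "\<lambda>t. (of_int (A$1$1) * t + of_int (A$1$2)) / (of_int (A$2$1) * t + of_int (A$2$2)) :: complex"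
  have M: "of_uhp (moebius A (to_uhp t)) = ?M t" "of_int (A$2$1) * t + of_int (A$2$2) \<noteq> 0" if "t \<in> ?H" for t
    using that of_uhp_moebius[OF A, of "to_uhp t"] aut_factor_nonzero[OF A, of "to_uhp t"]
    by (simp_all add: aut_factor_def of_uhp_to_uhp)
  have MH: "?M t \<in> ?H" if "t \<in> ?H" for t
    using M(1)[OF that] Im_of_uhp[of "moebius A (to_uhp t)"] by simp
  have "ceta holomorphic_on ?H"
  proof (rule holomorphic_onI)
    fix t assume "t \<in> ?H"
    then have "Im t > 0" by simp
    from DERIV_ceta[OF this] show "ceta field_differentiable at t within ?H"
      unfolding field_differentiable_def by (blast intro: has_field_derivative_at_within)
  qed
  then have c: "continuous_on ?H ceta" by (rule holomorphic_on_imp_continuous_on)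
  have "continuous_on ?H (\<lambda>t. ceta (?M t))"
    by (rule continuous_on_compose2[OF c]) (use M(2) MH in \<open>auto intro!: continuous_intros\<close>)
  then have "continuous_on ?H (\<lambda>t. ceta (?M t) / (ceta t * w (to_uhp t)))"
    using c holomorphic_on_imp_continuous_on[OF w] w0 by (intro continuous_intros) auto
  also have "?this \<longleftrightarrow> continuous_on ?H (\<lambda>t. g (to_uhp t))"
    by (rule continuous_on_cong) (auto simp: g_def eta_eq M of_uhp_to_uhp)
  finally have "continuous_on ?H (\<lambda>t. g (to_uhp t))" .
  moreover have "finite {z::complex. z ^ 24 = 1}" using finite_roots_unity[of 24] by simp
  then have "finite ((\<lambda>t. g (to_uhp t)) ` ?H)" by (rule finite_subset[rotated]) (use g24 in auto)
  ultimately have "(\<lambda>t. g (to_uhp t)) constant_on ?H"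
    by (intro continuous_finite_range_constant convex_connected convex_halfspace_Im_gt)
  then obtain c where "\<And>t. Im t > 0 \<Longrightarrow> g (to_uhp t) = c" by (auto simp: constant_on_def)
  from this[of "of_uhp \<tau>" for \<tau>] have c: "g \<tau> = c" for \<tau>
    by (simp add: of_uhp_inverse)
  have "eps (A, w) = c" unfolding eps_def by (simp add: g_def[symmetric] c)
  then show ?thesis using c[of \<tau>] by (simp add: g_def)
qed

section \<open>Jacobi forms in terms of theta series\<close>

text \<open>
  The pair \<open>(k, l)\<close> of integers stands for the point of the dual lattice whose products with the basis are
  \<open>k\<close> and \<open>l\<close>.
\<close>

definition dual_point :: "int \<times> int \<Rightarrow> rat^2" where
  "dual_point p = vector [of_int (2 * fst p - snd p) / 3, of_int (2 * snd p - fst p) / 3]"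

lemma dual_point_nth [simp]:
  "dual_point p$1 = of_int (2 * fst p - snd p) / 3" "dual_point p$2 = of_int (2 * snd p - fst p) / 3"
  by (simp_all add: dual_point_def)

lemma bij_dual_point: "bij_betw dual_point UNIV A2_dual"
proof (rule bij_betw_imageI)
  show "inj dual_point"
  proof (rule injI)
    fix p q assume e: "dual_point p = dual_point q"
    have k: "2 * (dual_point p$1) + dual_point p$2 = of_int (fst p)" "dual_point p$1 + 2 * (dual_point p$2) = of_int (snd p)" for p
      by (simp_all add: field_simps)
    have "(of_int (fst p) :: rat) = of_int (fst q)" "(of_int (snd p) :: rat) = of_int (snd q)"
      unfolding k[of p, symmetric] k[of q, symmetric] e by (rule refl)+
    then show "p = q" by (simp add: prod_eq_iff)
  qed
  show "range dual_point = A2_dual"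
  proof (intro equalityI subsetI)
    fix r assume "r \<in> range dual_point"
    then obtain p where r: "r = dual_point p" by blast
    have "2 * (dual_point p$1) + dual_point p$2 = of_int (fst p)" "dual_point p$1 + 2 * (dual_point p$2) = of_int (snd p)"
      by (simp_all add: field_simps)
    then show "r \<in> A2_dual" by (simp add: mem_A2_dual r del: dual_point_nth)
  next
    fix r assume "r \<in> A2_dual"
    then obtain k l where kl: "2 * r$1 + r$2 = of_int k" "r$1 + 2 * r$2 = of_int l"
      unfolding mem_A2_dual by (meson Ints_cases)
    have "r$1 = of_int (2 * k - l) / 3" "r$2 = of_int (2 * l - k) / 3"
      unfolding of_int_diff of_int_mult of_int_numeral kl[symmetric] by (simp_all add: field_simps)
    then have "r = dual_point (k, l)" by (simp add: vec_eq_iff forall_2)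
    then show "r \<in> range dual_point" by blast
  qed
qed

lemma half_norm_A2: "half_norm A2 r = r$1 * r$1 + r$1 * r$2 + r$2 * r$2"
  by (simp add: half_norm_def bil_A2 field_simps)

lemma half_norm_dual_point: "half_norm A2 (dual_point p) = of_int (qf p) / 3"
  by (simp add: half_norm_A2 qf_def power2_eq_square field_simps)

lemma bil_A2_commute: "bil A2 x y = bil A2 y x" by (simp add: bil_A2 mult_ac)

lemma bil_dual_point: "bil A2 z (of_rat_vec (dual_point p)) = pairing p z"
  "bil A2 (of_rat_vec (dual_point p)) z = pairing p z"
proof -
  show "bil A2 z (of_rat_vec (dual_point p)) = pairing p z"
    by (simp add: bil_A2 of_rat_vec_def pairing_def of_rat_divide of_rat_diff of_rat_mult field_simps)
  then show "bil A2 (of_rat_vec (dual_point p)) z = pairing p z" by (simp add: bil_A2_commute)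
qed

lemma dual_point_in_lattice: "dual_point p \<in> lattice_points \<longleftrightarrow> 3 dvd fst p + snd p"
proof
  assume "dual_point p \<in> lattice_points"
  then obtain x :: "int^2" where "dual_point p = of_int_vec x" by (auto simp: lattice_points_def)
  then have "dual_point p$1 = of_int (x$1)" by (simp add: of_int_vec_def)
  then have "(of_int (2 * fst p - snd p) :: rat) = of_int (3 * x$1)" by (simp add: field_simps)
  then have "2 * fst p - snd p = 3 * x$1" by (simp only: of_int_eq_iff)
  then show "3 dvd fst p + snd p" by presburger
next
  assume "3 dvd fst p + snd p"
  then obtain j where j: "fst p + snd p = 3 * j" ..
  have "dual_point p = of_int_vec (vector [fst p - j, snd p - j])"
    using arg_cong[OF j, of "of_int :: int \<Rightarrow> rat"] by (simp add: vec_eq_iff forall_2 of_int_vec_def field_simps)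
  then show "dual_point p \<in> lattice_points" by (auto simp: lattice_points_def)
qed

lemma half_norm_of_int_vec: "half_norm A2 (of_int_vec x) \<in> \<int>" by (simp add: half_norm_A2 of_int_vec_def)

lemma shadow_A2: "shadow A2 = A2_dual"
proof -
  have "half_norm A2 x \<in> \<int>" if "x \<in> lattice_points" for x :: "rat^2"
    using that half_norm_of_int_vec by (auto simp: lattice_points_def)
  then have "bil A2 r x - half_norm A2 x \<in> \<int> \<longleftrightarrow> bil A2 r x \<in> \<int>" if "x \<in> lattice_points" for x r
    using that by simp
  then show ?thesis unfolding shadow_def A2_dual_def dual_lattice_def by blast
qed

text \<open>
  The transformation law, freed from the metaplectic group: with \<open>m = k - h/2\<close> the choice of the square
  root cancels on both sides.
\<close>

definition jacobi_law :: "int \<Rightarrow> int \<Rightarrow> (uhp \<times> (complex^2) \<Rightarrow> complex) \<Rightarrow> int^2^2 \<Rightarrow> bool" where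
  "jacobi_law m h \<phi> A \<longleftrightarrow> (\<forall>\<tau> z.
     \<phi> (moebius A \<tau>, (1 / aut_factor A \<tau>) *s z) * ee (- of_int (A$2$1) * half_norm A2 z / aut_factor A \<tau>) * eta \<tau> powi h
     = aut_factor A \<tau> powi m * eta (moebius A \<tau>) powi h * \<phi> (\<tau>, z))"

lemma half_norm_scale: "half_norm A2 (c *s z) = c ^ 2 * half_norm A2 z"
  by (simp add: half_norm_A2 power2_eq_square algebra_simps)

text \<open>For the exponential factor the cocycle relation is an instance of \<open>det B = 1\<close>.\<close>

lemma jacobi_law_mult:
  assumes d: "det A = 1" "det B = 1" and A: "jacobi_law m h \<phi> A" and B: "jacobi_law m h \<phi> B"
  shows "jacobi_law m h \<phi> (A ** B)"
  unfolding jacobi_law_def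
proof (intro allI)
  fix \<tau> and z :: "complex^2"
  define \<tau>' a b where "\<tau>' = moebius B \<tau>" and "a = aut_factor A \<tau>'" and "b = aut_factor B \<tau>"
  have n: "a \<noteq> 0" "b \<noteq> 0" using d by (simp_all add: a_def b_def)
  define z' where "z' = (1 / b) *s z"
  define H where "H = half_norm A2 z"
  have H': "half_norm A2 z' = H / b ^ 2" by (simp add: z'_def half_norm_scale H_def power_divide)
  let ?eA = "ee (- of_int (A$2$1) * (H / b ^ 2) / a)"
  let ?eB = "ee (- of_int (B$2$1) * H / b)"
  have 1: "\<phi> (moebius A \<tau>', (1 / a) *s z') * ?eA * eta \<tau>' powi h = a powi m * eta (moebius A \<tau>') powi h * \<phi> (\<tau>', z')"
    using A unfolding jacobi_law_def a_def H'[symmetric] by blast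
  have 2: "\<phi> (\<tau>', z') * ?eB * eta \<tau> powi h = b powi m * eta \<tau>' powi h * \<phi> (\<tau>, z)"
    using B unfolding jacobi_law_def b_def \<tau>'_def z'_def H_def by blast
  have AB: "aut_factor (A ** B) \<tau> = a * b" by (simp add: aut_factor_mult d a_def b_def \<tau>'_def)
  have "of_int ((A ** B)$2$1) * b = of_int (A$2$1) + of_int (B$2$1) * (a * b)"
  proof -
    have e: "(of_int (B$1$1) * of_int (B$2$2) :: complex) = 1 + of_int (B$1$2) * of_int (B$2$1)"
      by (rule det_real[OF d(2)])
    have "of_int ((A ** B)$2$1) * b = of_int (A$2$1) * (of_int (B$1$1) * of_int (B$2$2))
        + (of_int (A$2$1) * of_int (B$1$1) * of_int (B$2$1) * of_uhp \<tau> + of_int (A$2$2) * of_int (B$2$1) * b)"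
      by (simp add: mat_mult_nth b_def aut_factor_def algebra_simps)
    also have "\<dots> = of_int (A$2$1) + of_int (B$2$1) * aut_factor (A ** B) \<tau>"
      unfolding e by (simp add: aut_factor_def mat_mult_nth b_def algebra_simps)
    finally show ?thesis by (simp add: AB)
  qed
  then have c: "of_int ((A ** B)$2$1) = (of_int (A$2$1) + of_int (B$2$1) * (a * b)) / b"
    using n by (simp add: field_simps)
  have "- of_int ((A ** B)$2$1) * H / (a * b) = - of_int (A$2$1) * (H / b ^ 2) / a + - of_int (B$2$1) * H / b"
    unfolding c using n by (simp add: field_simps power2_eq_square)
  then have e: "ee (- of_int ((A ** B)$2$1) * H / (a * b)) = ?eA * ?eB" by (simp only: ee_add)
  have z: "(1 / (a * b)) *s z = (1 / a) *s z'" by (simp add: z'_def)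
  let ?X = "\<phi> (moebius A \<tau>', (1 / a) *s z')"
  have "(?X * (?eA * ?eB) * eta \<tau> powi h) * eta \<tau>' powi h = (?X * ?eA * eta \<tau>' powi h) * (?eB * eta \<tau> powi h)"
    by (simp only: mult_ac)
  also have "\<dots> = a powi m * eta (moebius A \<tau>') powi h * (\<phi> (\<tau>', z') * ?eB * eta \<tau> powi h)"
    unfolding 1 by (simp only: mult_ac)
  also have "\<dots> = ((a * b) powi m * eta (moebius A \<tau>') powi h * \<phi> (\<tau>, z)) * eta \<tau>' powi h"
    unfolding 2 by (simp add: power_int_mult_distrib mult_ac)
  finally have "?X * (?eA * ?eB) * eta \<tau> powi h = (a * b) powi m * eta (moebius A \<tau>') powi h * \<phi> (\<tau>, z)"
    by simp
  then show "\<phi> (moebius (A ** B) \<tau>, (1 / aut_factor (A ** B) \<tau>) *s z) *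
      ee (- of_int ((A ** B)$2$1) * half_norm A2 z / aut_factor (A ** B) \<tau>) * eta \<tau> powi h =
      aut_factor (A ** B) \<tau> powi m * eta (moebius (A ** B) \<tau>) powi h * \<phi> (\<tau>, z)"
    unfolding AB z H_def[symmetric] e moebius_mult[OF d] \<tau>'_def[symmetric] .
qed

lemma jacobi_law_metaplectic:
  assumes "(A, w) \<in> Mp2Z"
  shows "X * e * (w \<tau> powi (- (h + 2 * m))) = eps (A, w) powi h * Y \<longleftrightarrow>
    X * e * eta \<tau> powi h = aut_factor A \<tau> powi m * eta (moebius A \<tau>) powi h * Y"
proof -
  have w2: "w \<tau> ^ 2 = aut_factor A \<tau>" and "det A = 1" using assms by (auto simp: Mp2Z_def)
  then have w0: "w \<tau> \<noteq> 0" using aut_factor_nonzero[of A \<tau>] by auto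
  define W where "W = w \<tau>"
  define a b where "a = eta \<tau> powi h" and "b = eta (moebius A \<tau>) powi h"
  have n: "W powi h \<noteq> 0" "a \<noteq> 0" "aut_factor A \<tau> powi m \<noteq> 0"
    using w0 \<open>det A = 1\<close> by (simp_all add: W_def a_def)
  have "W powi (2 * m) = aut_factor A \<tau> powi m" using w2 by (simp add: W_def power_int_mult)
  then have 1: "W powi (- (h + 2 * m)) = inverse (W powi h * aut_factor A \<tau> powi m)"
    using w0 by (subst power_int_minus) (simp add: power_int_add W_def)
  have 2: "eps (A, w) powi h = b / (a * W powi h)"
    by (simp add: eps_eq[OF assms, of \<tau>] power_int_divide_distrib power_int_mult_distrib a_def b_def W_def)
  have "X * e * inverse (u * v) = b / (a * u) * Y \<longleftrightarrow> X * e * a = v * b * Y" if "u \<noteq> 0" "v \<noteq> 0" for u v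
    using that n(2) by (simp add: field_simps)
  from this[OF n(1,3)] show ?thesis
    unfolding W_def[symmetric] a_def[symmetric] b_def[symmetric] 1 2 .
qed

lemma jacobi_formsI:
  assumes "holomorphic_uhp \<phi>" "jacobi_law m h \<phi> S_mat" "\<And>n. jacobi_law m h \<phi> (T_mat n)"
    and ell: "\<And>(x :: int^2) (y :: int^2) \<tau> z. \<phi> (\<tau>, z + of_uhp \<tau> *s of_int_vec x + of_int_vec y) *
          ee (of_uhp \<tau> * half_norm A2 (of_int_vec x) + bil A2 (of_int_vec x) z) = \<phi> (\<tau>, z)"
    and four: "\<exists>c :: rat \<Rightarrow> rat^2 \<Rightarrow> complex. \<forall>\<tau> z.
        ((\<lambda>(m, r). c m r * qpow (of_rat m) \<tau> * ee (bil A2 z (of_rat_vec r))) has_sum \<phi> (\<tau>, z))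
          {(m, r). m - of_int h / 24 \<in> \<int> \<and> r \<in> shadow A2 \<and> m \<ge> half_norm A2 r}"
  shows "\<phi> \<in> jacobi_forms A2 (of_int h / 2 + of_int m) h"
proof -
  have k: "2 * (of_int h / 2 + of_int m) = (of_int (h + 2 * m) :: rat)" by simp
  have fl: "\<lfloor>2 * (of_int h / 2 + of_int m) :: rat\<rfloor> = h + 2 * m" unfolding k by (rule floor_of_int)
  have law: "jacobi_law m h \<phi> A" if "det A = 1" for A
    using that by (induction rule: modular_group_induct) (use assms(2,3) jacobi_law_mult in auto)
  have i: "\<phi> (moebius A \<tau>, (1 / aut_factor A \<tau>) *s z) * ee (- of_int (A$2$1) * half_norm A2 z / aut_factor A \<tau>) * (w \<tau> powi (- (h + 2 * m))) =
        (eps (A, w) powi h) * \<phi> (\<tau>, z)" if "(A, w) \<in> Mp2Z" for A w \<tau> z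
    unfolding jacobi_law_metaplectic[OF that] using law[of A] that by (auto simp: jacobi_law_def Mp2Z_def)
  have "ee (half_norm A2 (of_int_vec (x + y))) = 1" for x y :: "int^2" by (rule ee_Ints) (rule half_norm_of_int_vec)
  then show ?thesis unfolding jacobi_forms_def mem_Collect_eq fl
    using assms(1) i ell four by (auto simp: k simp del: distrib_left_numeral)
qed

lemma jacobi_forms_law:
  assumes "\<phi> \<in> jacobi_forms A2 (of_int h / 2 + of_int m) h" and "(A, w) \<in> Mp2Z"
  shows "jacobi_law m h \<phi> A"
proof -
  have k: "2 * (of_int h / 2 + of_int m) = (of_int (h + 2 * m) :: rat)" by simp
  have fl: "\<lfloor>2 * (of_int h / 2 + of_int m) :: rat\<rfloor> = h + 2 * m" unfolding k by (rule floor_of_int)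
  have "\<forall>(A, w) \<in> Mp2Z. \<forall>\<tau> z.
        \<phi> (moebius A \<tau>, (1 / aut_factor A \<tau>) *s z) *
          ee (- of_int (A$2$1) * half_norm A2 z / aut_factor A \<tau>) * (w \<tau> powi (- (h + 2 * m))) =
        (eps (A, w) powi h) * \<phi> (\<tau>, z)"
    using assms(1) unfolding jacobi_forms_def mem_Collect_eq fl by blast
  with assms(2) have "\<phi> (moebius A \<tau>, (1 / aut_factor A \<tau>) *s z) *
          ee (- of_int (A$2$1) * half_norm A2 z / aut_factor A \<tau>) * (w \<tau> powi (- (h + 2 * m))) =
        (eps (A, w) powi h) * \<phi> (\<tau>, z)" for \<tau> z
    by blast
  then show ?thesis unfolding jacobi_law_def jacobi_law_metaplectic[OF assms(2)] by blast
qed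

lemma metaplectic_S: "(S_mat, \<lambda>\<tau>. csqrt (of_uhp \<tau>)) \<in> Mp2Z"
proof -
  have "(\<lambda>t. csqrt (of_uhp (to_uhp t))) holomorphic_on {t. Im t > 0} \<longleftrightarrow> csqrt holomorphic_on {t. Im t > 0}"
    by (rule holomorphic_cong) (auto simp: of_uhp_to_uhp)
  moreover have "csqrt holomorphic_on {t. Im t > 0}"
    by (intro holomorphic_on_csqrt') (auto simp: complex_nonpos_Reals_iff)
  ultimately show ?thesis by (simp add: Mp2Z_def moebius_S)
qed

lemma eps_24: "(A, w) \<in> Mp2Z \<Longrightarrow> eps (A, w) powi (h + 24) = eps (A, w) powi h"
proof -
  assume Aw: "(A, w) \<in> Mp2Z"
  define \<tau> where "\<tau> = to_uhp \<i>"
  have w2: "w \<tau> ^ 2 = aut_factor A \<tau>" and A: "det A = 1" using Aw by (auto simp: Mp2Z_def)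
  have "w \<tau> ^ 24 = (w \<tau> ^ 2) ^ 12" by (simp flip: power_mult)
  then have e: "eps (A, w) ^ 24 = 1" using aut_factor_nonzero[OF A, of \<tau>]
    by (simp add: eps_eq[OF Aw, of \<tau>] power_divide power_mult_distrib eta_24_moebius[OF A] w2)
  then have "eps (A, w) \<noteq> 0" by auto
  then have "eps (A, w) powi (h + 24) = eps (A, w) powi h * eps (A, w) powi 24" by (simp add: power_int_add)
  also have "eps (A, w) powi 24 = 1" using e by simp
  finally show ?thesis by simp
qed

lemma jacobi_forms_mod_24: "jacobi_forms A2 k (h mod 24) = jacobi_forms A2 k h"
proof -
  have *: "jacobi_forms A2 k (h + 24) = jacobi_forms A2 k h" for h
  proof -
    have "(x - of_int (h + 24) / 24 \<in> \<int>) = (x - of_int h / 24 \<in> \<int>)" for x :: rat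
    proof -
      have "x - of_int h / 24 = x - of_int (h + 24) / 24 + 1" by (simp add: field_simps)
      then show ?thesis by (metis Ints_1 Ints_add Ints_diff add_diff_cancel_right')
    qed
    moreover have "(\<forall>(A, w) \<in> Mp2Z. \<forall>\<tau> z. X A w \<tau> z = (eps (A, w) powi (h + 24)) * Y \<tau> z) \<longleftrightarrow>
        (\<forall>(A, w) \<in> Mp2Z. \<forall>\<tau> z. X A w \<tau> z = (eps (A, w) powi h) * Y \<tau> z)" for X and Y :: "uhp \<Rightarrow> complex^2 \<Rightarrow> complex"
      by (intro ball_cong refl) (auto simp: eps_24)
    ultimately show ?thesis unfolding jacobi_forms_def by simp
  qed
  have **: "jacobi_forms A2 k (h' + 24 * j) = jacobi_forms A2 k h'" for h' j
  proof (induction j rule: int_induct[where k = 0])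
    case (step1 i)
    then show ?case using *[of "h' + 24 * i"] by (simp add: algebra_simps)
  next
    case (step2 i)
    then show ?case using *[of "h' + 24 * (i - 1)"] by (simp add: algebra_simps)
  qed simp
  show ?thesis using **[of "h mod 24" "h div 24"] by simp
qed

text \<open>For real \<open>z\<close> the theta series are absolutely convergent Fourier series.\<close>

lemma theta2_unique:
  assumes "tame2 a" "tame2 b" "Im t > 0" "\<And>z. theta2 a t z = theta2 b t z"
  shows "a p = b p"
proof -
  define c where "c p = (a p - b p) * ee (of_int (qf p) / 3 * t)" for p
  have "((\<lambda>(k, l). c (k, l) * ee (of_int k * of_real x + of_int l * of_real y)) has_sum 0) UNIV" for x y :: real
  proof -
    let ?z = "vector [of_real x, of_real y] :: complex^2"
    let ?e = "\<lambda>p. ee (of_int (qf p) / 3 * t + pairing p ?z)"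
    have "((\<lambda>p. a p * ?e p - b p * ?e p) has_sum (theta2 a t ?z - theta2 b t ?z)) UNIV"
      by (intro has_sum_minus theta2_has_sum assms)
    moreover have "(\<lambda>p. a p * ?e p - b p * ?e p) = (\<lambda>(k, l). c (k, l) * ee (of_int k * of_real x + of_int l * of_real y))"
      by (auto simp: fun_eq_iff c_def pairing_def ee_add algebra_simps)
    ultimately show ?thesis by (simp add: assms(4))
  qed
  from fourier_unique2[of c, OF this, of "fst p" "snd p"] show ?thesis by (simp add: c_def)
qed

lemma combine_classes:
  assumes "Im t > 0"
  shows "u * Th0 t z + v * ThP t z = theta2 (\<lambda>p. u * class0 p + v * classP p) t z"
proof -
  have "tame2 (\<lambda>p. u * class0 p)" "tame2 (\<lambda>p. v * classP p)"
    by (rule tame2_bounded[of _ "norm u"], simp add: class0_def, rule tame2_bounded[of _ "norm v"], simp add: classP_def)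
  from theta2_add[OF this assms] show ?thesis
    by (simp add: theta2_cmult)
qed

lemma tame2_classes: "tame2 (\<lambda>p. u * class0 p + v * classP p)"
proof (rule tame2_bounded)
  show "norm (u * class0 p + v * classP p) \<le> norm u + norm v" for p
    by (rule order_trans[OF norm_triangle_ineq]) (auto simp: class0_def classP_def norm_mult)
qed

lemma Th0_ThP_independent:
  assumes "Im t > 0" "\<And>z. u * Th0 t z + v * ThP t z = u' * Th0 t z + v' * ThP t z"
  shows "u = u'" "v = v'"
proof -
  have e: "u * class0 p + v * classP p = u' * class0 p + v' * classP p" for p
    by (rule theta2_unique[OF tame2_classes tame2_classes assms(1)])
       (use assms(2) in \<open>simp add: combine_classes[OF assms(1), symmetric]\<close>)
  show "u = u'" "v = v'" using e[of "(0,0)"] e[of "(1,0)"] by (simp_all add: class0_def classP_def)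
qed

lemma ThN_not_zero:
  assumes "Im t > 0"
  obtains z where "ThN t z \<noteq> 0"
proof (rule ccontr)
  assume "\<not> thesis"
  then have "ThN t z = 0" for z
    using that by blast
  moreover have "tame2 (\<lambda>_. 0)" by (rule tame2_bounded[of _ 0]) simp
  ultimately have "classN (1, 0) = 0"
    using theta2_unique[OF tame2_classN _ assms, of "\<lambda>_. 0" "(1, 0)"] by (simp add: theta2_def)
  then show False
    by (simp add: classN_def)
qed

text \<open>
  The terms of the product are indexed by \<open>(n, p)\<close>; the pair \<open>(m, r)\<close> of exponents determines \<open>(n, p)\<close>,
  since \<open>r\<close> determines \<open>p\<close>.
\<close>

lemma theta_product_fourier:
  fixes x :: rat
  assumes f: "q_series (of_rat x) P f" and x: "x \<ge> 0" and a: "tame2 a"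
    and supp: "\<And>p. a p \<noteq> 0 \<Longrightarrow> x + of_int (qf p) / 3 - of_int h / 24 \<in> \<int>"
  shows "\<exists>c. \<forall>\<tau> z. ((\<lambda>(m, r). c m r * qpow (of_rat m) \<tau> * ee (bil A2 z (of_rat_vec r))) has_sum
      f (of_uhp \<tau>) * theta2 a (of_uhp \<tau>) z)
    {(m, r). m - of_int h / 24 \<in> \<int> \<and> r \<in> shadow A2 \<and> m \<ge> half_norm A2 r}"
proof -
  define d where "d n = (deriv ^^ n) P 0 / fact n" for n
  let ?T = "{(m, r). m - of_int h / 24 \<in> \<int> \<and> r \<in> shadow A2 \<and> m \<ge> half_norm A2 r}"
  define g where "g = (\<lambda>(n :: nat, p). (x + of_nat n + of_int (qf p) / 3, dual_point p))"
  have inj: "inj g"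
  proof (rule injI)
    fix u v assume e: "g u = g v"
    then have "snd u = snd v"
      using bij_betw_imp_inj_on[OF bij_dual_point] by (auto simp: g_def inj_def split: prod.splits)
    with e show "u = v" by (auto simp: g_def prod_eq_iff split: prod.splits)
  qed
  define c where "c m r = (if (m, r) \<in> range g then d (fst (inv_into UNIV g (m, r))) * a (snd (inv_into UNIV g (m, r))) else 0)" for m r
  have cg: "c (fst (g u)) (snd (g u)) = d (fst u) * a (snd u)" for u
    using inv_f_f[OF inj, of u] by (simp add: c_def)
  show ?thesis
  proof (intro exI[of _ c] allI)
    fix \<tau> and z :: "complex^2"
    have t: "Im (of_uhp \<tau>) > 0" by simp
    let ?F = "\<lambda>(m, r). c m r * qpow (of_rat m) \<tau> * ee (bil A2 z (of_rat_vec r))"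
    have "((\<lambda>(n, p). (d n * ee ((of_real (of_rat x) + of_nat n) * of_uhp \<tau>)) *
        (a p * ee (of_int (qf p) / 3 * of_uhp \<tau> + pairing p z))) has_sum f (of_uhp \<tau>) * theta2 a (of_uhp \<tau>) z) (UNIV \<times> UNIV)"
      unfolding d_def by (intro has_sum_product_complex q_series_has_sum[OF f t] theta2_has_sum[OF a t])
    also have "(\<lambda>(n, p). (d n * ee ((of_real (of_rat x) + of_nat n) * of_uhp \<tau>)) *
        (a p * ee (of_int (qf p) / 3 * of_uhp \<tau> + pairing p z))) = ?F \<circ> g"
    proof
      fix u :: "nat \<times> int \<times> int"
      obtain n p where u: "u = (n, p)" by (cases u)
      have r: "complex_of_real (of_rat x) = of_rat x" by (cases x) (simp add: of_rat_rat)
      have "ee ((of_real (of_rat x) + of_nat n) * of_uhp \<tau>) * ee (of_int (qf p) / 3 * of_uhp \<tau> + pairing p z)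
          = ee (of_rat (x + of_nat n + of_int (qf p) / 3) * of_uhp \<tau>) * ee (pairing p z)"
        unfolding ee_add[symmetric] r by (rule arg_cong[of _ _ ee]) (simp add: of_rat_add of_rat_divide algebra_simps)
      then show "(case u of (n, p) \<Rightarrow> (d n * ee ((of_real (of_rat x) + of_nat n) * of_uhp \<tau>)) *
        (a p * ee (of_int (qf p) / 3 * of_uhp \<tau> + pairing p z))) = (?F \<circ> g) u"
        using cg[of u] by (simp add: u g_def qpow_def bil_dual_point mult_ac)
    qed
    finally have "(?F has_sum f (of_uhp \<tau>) * theta2 a (of_uhp \<tau>) z) (range g)"
      unfolding has_sum_reindex[OF inj] UNIV_Times_UNIV .
    also have "?this \<longleftrightarrow> (?F has_sum f (of_uhp \<tau>) * theta2 a (of_uhp \<tau>) z) ?T"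
    proof (rule has_sum_cong_neutral)
      fix y assume "y \<in> ?T - range g"
      then show "?F y = 0" by (auto simp: c_def)
    next
      fix y assume y: "y \<in> range g - ?T"
      then obtain n p where np: "y = g (n, p)" by auto
      have "a p = 0"
      proof (rule ccontr)
        assume "a p \<noteq> 0"
        from supp[OF this] have "x + of_int (qf p) / 3 - of_int h / 24 + of_nat n \<in> \<int>"
          by (intro Ints_add) auto
        then have "g (n, p) \<in> ?T"
          using x bij_betw_apply[OF bij_dual_point, of p] by (auto simp: g_def shadow_A2 half_norm_dual_point algebra_simps)
        with y np show False
          by simp
      qed
      then show "?F y = 0" using cg[of "(n, p)"] by (simp add: np g_def)
    qed auto
    finally show "(?F has_sum f (of_uhp \<tau>) * theta2 a (of_uhp \<tau>) z) ?T" .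
  qed
qed

lemma holomorphic_uhp_theta_product:
  assumes f: "f holomorphic_on {t. Im t > 0}" and a: "tame2 a"
  shows "holomorphic_uhp (\<lambda>(\<tau>, z). f (of_uhp \<tau>) * theta2 a (of_uhp \<tau>) z)"
  unfolding holomorphic_uhp_def
proof (intro allI)
  fix \<tau> and z :: "complex^2"
  define t where "t = of_uhp \<tau>"
  have t: "Im t > 0" by (simp add: t_def)
  obtain D where D: "((\<lambda>p. theta2 a (fst p) (snd p)) has_derivative D) (at (t, z))"
    and lin: "\<forall>c s v. D (c * s, c *s v) = c * D (s, v)"
    using theta2_has_derivative_linear[OF a t] by blast
  have "(f has_field_derivative deriv f t) (at t)"
    using f t by (intro holomorphic_derivI[of f "{t. Im t > 0}"] open_halfspace_Im_gt) auto
  then have f': "(f has_derivative (\<lambda>s. deriv f t * s)) (at t)" by (simp add: has_field_derivative_def)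
  have "((\<lambda>p. f (fst p)) has_derivative (\<lambda>p. deriv f t * fst p)) (at (t, z))"
    by (rule has_derivative_compose[where f = fst and g = f and g' = "\<lambda>s. deriv f t * s" and f' = fst and s = UNIV, simplified])
       (use f' in \<open>auto intro: has_derivative_fst\<close>)
  from has_derivative_mult[OF this D]
  have 1: "((\<lambda>p. f (fst p) * theta2 a (fst p) (snd p)) has_derivative
      (\<lambda>p. f t * D p + deriv f t * fst p * theta2 a t z)) (at (t, z))"
    by simp
  have "((\<lambda>(s, v). case (to_uhp s, v) of (\<tau>, z) \<Rightarrow> f (of_uhp \<tau>) * theta2 a (of_uhp \<tau>) z) has_derivative
      (\<lambda>p. f t * D p + deriv f t * fst p * theta2 a t z)) (at (t, z))"
  proof (rule has_derivative_transform_within_open[OF 1])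
    show "open ({t. Im t > 0} \<times> (UNIV :: (complex^2) set))"
      by (intro open_Times open_halfspace_Im_gt open_UNIV)
  qed (use t in \<open>auto simp: of_uhp_to_uhp\<close>)
  then show "\<exists>D. ((\<lambda>(s, v). (case (to_uhp s, v) of (\<tau>, z) \<Rightarrow> f (of_uhp \<tau>) * theta2 a (of_uhp \<tau>) z)) has_derivative D) (at (of_uhp \<tau>, z)) \<and>
      (\<forall>c s v. D (c * s, c *s v) = c * D (s, v))"
    unfolding t_def[symmetric]
    by (intro exI[of _ "\<lambda>p. f t * D p + deriv f t * fst p * theta2 a t z"] conjI) (use lin in \<open>auto simp: algebra_simps\<close>)
qed

lemma holomorphic_uhp_add:
  assumes "holomorphic_uhp \<phi>" "holomorphic_uhp \<psi>"
  shows "holomorphic_uhp (\<lambda>p. \<phi> p + \<psi> p)"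
  unfolding holomorphic_uhp_def
proof (intro allI)
  fix \<tau> z
  obtain D where D: "((\<lambda>(t, v). \<phi> (to_uhp t, v)) has_derivative D) (at (of_uhp \<tau>, z))" "\<forall>c t v. D (c * t, c *s v) = c * D (t, v)"
    using assms(1) unfolding holomorphic_uhp_def by blast
  obtain D' where D': "((\<lambda>(t, v). \<psi> (to_uhp t, v)) has_derivative D') (at (of_uhp \<tau>, z))" "\<forall>c t v. D' (c * t, c *s v) = c * D' (t, v)"
    using assms(2) unfolding holomorphic_uhp_def by blast
  have "((\<lambda>(t, v). \<phi> (to_uhp t, v) + \<psi> (to_uhp t, v)) has_derivative (\<lambda>p. D p + D' p)) (at (of_uhp \<tau>, z))"
    using has_derivative_add[OF D(1) D'(1)] by (simp add: case_prod_unfold)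
  then show "\<exists>D. ((\<lambda>(t, v). \<phi> (to_uhp t, v) + \<psi> (to_uhp t, v)) has_derivative D) (at (of_uhp \<tau>, z)) \<and> (\<forall>c t v. D (c * t, c *s v) = c * D (t, v))"
    by (intro exI[of _ "\<lambda>p. D p + D' p"] conjI) (use D(2) D'(2) in \<open>auto simp: algebra_simps\<close>)
qed

text \<open>
  A combination of theta series with power series in \<open>q\<close> as coefficients is a Jacobi form as soon as the
  exponents fit and the law under the inversion holds. The conditions of integrality
  fix the behaviour under translation.
\<close>

definition theta_form :: "(int \<times> int \<Rightarrow> complex) \<Rightarrow> int \<Rightarrow> int \<Rightarrow> (uhp \<times> (complex^2) \<Rightarrow> complex) \<Rightarrow> bool" where
  "theta_form a m h \<phi> \<longleftrightarrow> (\<exists>x y P Q f g. q_series (of_rat x) P f \<and> q_series (of_rat y) Q g \<and>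
     x \<ge> 0 \<and> y \<ge> 0 \<and> x - of_int h / 24 \<in> \<int> \<and> y + 1 / 3 - of_int h / 24 \<in> \<int> \<and>
     \<phi> = (\<lambda>(\<tau>, z). f (of_uhp \<tau>) * Th0 (of_uhp \<tau>) z + g (of_uhp \<tau>) * theta2 a (of_uhp \<tau>) z)) \<and>
   jacobi_law m h \<phi> S_mat"

lemma ee_cong_Ints: "x - y \<in> \<int> \<Longrightarrow> ee x = ee y"
proof -
  assume "x - y \<in> \<int>"
  then have "ee (x - y + y) = ee y" by (subst ee_add) (simp add: ee_Ints)
  then show ?thesis by simp
qed

lemma of_rat_Ints: "x \<in> \<int> \<Longrightarrow> (of_rat x :: complex) \<in> \<int>" by (auto elim!: Ints_cases)

lemma theta_form_jacobi:
  assumes a: "a = classP \<or> a = classN" and \<phi>: "theta_form a m h \<phi>"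
  shows "\<phi> \<in> jacobi_forms A2 (of_int h / 2 + of_int m) h"
proof -
  from \<phi> obtain x y P Q f g where q: "q_series (of_rat x) P f" "q_series (of_rat y) Q g" and xy: "x \<ge> 0" "y \<ge> 0"
    and cx: "x - of_int h / 24 \<in> \<int>" and cy: "y + 1 / 3 - of_int h / 24 \<in> \<int>"
    and e: "\<phi> = (\<lambda>(\<tau>, z). f (of_uhp \<tau>) * Th0 (of_uhp \<tau>) z + g (of_uhp \<tau>) * theta2 a (of_uhp \<tau>) z)"
    and S: "jacobi_law m h \<phi> S_mat"
    unfolding theta_form_def by blast
  have ta: "tame2 a" using a tame2_classP tame2_classN by blast
  have tr: "theta2 a (t + 1) z = ee (1 / 3) * theta2 a t z" for t z
    using a ThP_translate ThN_translate by blast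
  have per: "a (fst p + u, snd p + v) = a p" if "3 dvd u + v" for p u v
    using a class_periodic[OF that] by blast
  have sup: "[qf p = 1] (mod 3)" if "a p \<noteq> 0" for p
  proof (rule qf_class1)
    show "(fst p + snd p) mod 3 \<noteq> 0"
      using a that by (elim disjE) (simp_all add: classP_def classN_def dvd_eq_mod_eq_0 split: if_splits)
  qed
  show ?thesis
  proof (rule jacobi_formsI)
    show "holomorphic_uhp \<phi>"
      using holomorphic_uhp_add[OF holomorphic_uhp_theta_product[OF q_series_holomorphic[OF q(1)] tame2_class0]
          holomorphic_uhp_theta_product[OF q_series_holomorphic[OF q(2)] ta]]
      by (simp add: e case_prod_unfold)
    show "jacobi_law m h \<phi> S_mat" by (rule S)
    show "jacobi_law m h \<phi> (T_mat n)" for n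
      unfolding jacobi_law_def
    proof (intro allI)
      fix \<tau> and z :: "complex^2"
      let ?F = "\<lambda>t. (f t * Th0 t z + g t * theta2 a t z) * ceta t powi (- h)"
      have r: "complex_of_real (of_rat x) = of_rat x" for x :: rat
        by (cases x) (simp add: of_rat_rat)
      have step: "?F (t + 1) = ?F t" if "Im t > 0" for t
      proof -
        have "of_rat x - of_int h / 24 = (of_rat (x - of_int h / 24) :: complex)"
          "of_rat y + 1 / 3 - of_int h / 24 = (of_rat (y + 1 / 3 - of_int h / 24) :: complex)"
          by (simp_all add: of_rat_diff of_rat_divide of_rat_add)
        then have "ee (of_rat x) = ee (of_int h / 24)" "ee (of_rat y + 1 / 3) = ee (of_int h / 24)"
          using of_rat_Ints[OF cx] of_rat_Ints[OF cy] by (intro ee_cong_Ints; simp)+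
        then have 1: "f (t + 1) = ee (of_int h / 24) * f t" "g (t + 1) * theta2 a (t + 1) z = ee (of_int h / 24) * (g t * theta2 a t z)"
          using q_series_translate[OF q(1) that] q_series_translate[OF q(2) that] by (simp_all add: r tr ee_add mult_ac)
        have p: "ee x powi h = ee (of_int h * x)" for x
          by (cases h rule: int_cases2) (simp_all add: power_int_minus ee_mult_of_nat ee_minus)
        have "ceta (t + 1) powi (- h) = ee (- (of_int h / 24)) * ceta t powi (- h)"
          unfolding ceta_translate[OF that] power_int_mult_distrib power_int_minus p by (simp add: ee_minus)
        then show ?thesis unfolding 1 Th0_translate by (simp add: ee_minus algebra_simps)
      qed
      from translate_of_int[of ?F, OF step, of "of_uhp \<tau>" n]
      have "?F (of_uhp \<tau> + of_int n) = ?F (of_uhp \<tau>)" by simp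
      then show "\<phi> (moebius (T_mat n) \<tau>, (1 / aut_factor (T_mat n) \<tau>) *s z) *
           ee (- of_int (T_mat n$2$1) * half_norm A2 z / aut_factor (T_mat n) \<tau>) * eta \<tau> powi h =
         aut_factor (T_mat n) \<tau> powi m * eta (moebius (T_mat n) \<tau>) powi h * \<phi> (\<tau>, z)"
        by (simp add: e moebius_T eta_eq power_int_minus field_simps)
    qed
    show "\<phi> (\<tau>, z + of_uhp \<tau> *s of_int_vec x + of_int_vec y) *
          ee (of_uhp \<tau> * half_norm A2 (of_int_vec x) + bil A2 (of_int_vec x) z) = \<phi> (\<tau>, z)" for x y :: "int^2" and \<tau> z
      unfolding e using theta2_elliptic[of class0, OF class_periodic(1), of "of_uhp \<tau>" z x y] theta2_elliptic[of a, OF per, of "of_uhp \<tau>" z x y]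
      by (simp add: distrib_right mult.assoc)
    let ?T = "{(m, r). m - of_int h / 24 \<in> \<int> \<and> r \<in> shadow A2 \<and> m \<ge> half_norm A2 r}"
    have "x + of_int (qf p) / 3 - of_int h / 24 \<in> \<int>" if p: "class0 p \<noteq> 0" for p
    proof -
      obtain j where "qf p = 3 * j" using qf_class0[OF p] by (auto simp: cong_0_iff)
      then have "x + of_int (qf p) / 3 - of_int h / 24 = (x - of_int h / 24) + of_int j" by simp
      then show ?thesis using cx by (metis Ints_add Ints_of_int)
    qed
    from theta_product_fourier[OF q(1) xy(1) tame2_class0 this] obtain c1 where
      c1: "\<forall>\<tau> z. ((\<lambda>(m, r). c1 m r * qpow (of_rat m) \<tau> * ee (bil A2 z (of_rat_vec r))) has_sum f (of_uhp \<tau>) * Th0 (of_uhp \<tau>) z) ?T"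
      by blast
    have "y + of_int (qf p) / 3 - of_int h / 24 \<in> \<int>" if p: "a p \<noteq> 0" for p
    proof -
      obtain j where j: "qf p = 1 + 3 * j" using sup[OF p] by (metis cong_iff_lin cong_sym)
      then have "y + of_int (qf p) / 3 - of_int h / 24 = (y + 1 / 3 - of_int h / 24) + of_int j"
        by (simp add: field_simps)
      then show ?thesis using cy by (metis Ints_add Ints_of_int)
    qed
    from theta_product_fourier[OF q(2) xy(2) ta this] obtain c2 where
      c2: "\<forall>\<tau> z. ((\<lambda>(m, r). c2 m r * qpow (of_rat m) \<tau> * ee (bil A2 z (of_rat_vec r))) has_sum g (of_uhp \<tau>) * theta2 a (of_uhp \<tau>) z) ?T"
      by blast
    show "\<exists>c. \<forall>\<tau> z. ((\<lambda>(m, r). c m r * qpow (of_rat m) \<tau> * ee (bil A2 z (of_rat_vec r))) has_sum \<phi> (\<tau>, z)) ?T"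
    proof (intro exI[of _ "\<lambda>m r. c1 m r + c2 m r"] allI)
      fix \<tau> z
      show "((\<lambda>(m, r). (c1 m r + c2 m r) * qpow (of_rat m) \<tau> * ee (bil A2 z (of_rat_vec r))) has_sum \<phi> (\<tau>, z)) ?T"
        using has_sum_add[OF c1[rule_format, of \<tau> z] c2[rule_format, of \<tau> z]]
        by (simp add: e case_prod_unfold distrib_right)
    qed
  qed
qed

lemma theta_form_mult:
  assumes \<phi>: "theta_form a m h \<phi>" and F: "q_series (of_rat v) P F" "v \<ge> 0" "v - of_int j / 24 \<in> \<int>"
    and inv: "\<And>t. Im t > 0 \<Longrightarrow> F (- 1 / t) * ceta t powi j = t powi n * ceta (- 1 / t) powi j * F t"
  shows "theta_form a (m + n) (h + j) ((\<lambda>\<tau>. F (of_uhp \<tau>)) \<odot> \<phi>)"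
proof -
  from \<phi> obtain x y R Q f g where q: "q_series (of_rat x) R f" "q_series (of_rat y) Q g" and xy: "x \<ge> 0" "y \<ge> 0"
    and cx: "x - of_int h / 24 \<in> \<int>" and cy: "y + 1 / 3 - of_int h / 24 \<in> \<int>"
    and e: "\<phi> = (\<lambda>(\<tau>, z). f (of_uhp \<tau>) * Th0 (of_uhp \<tau>) z + g (of_uhp \<tau>) * theta2 a (of_uhp \<tau>) z)"
    and S: "jacobi_law m h \<phi> S_mat"
    unfolding theta_form_def by blast
  have 1: "v + x - of_int (h + j) / 24 \<in> \<int>" "v + y + 1 / 3 - of_int (h + j) / 24 \<in> \<int>"
    using Ints_add[OF F(3) cx] Ints_add[OF F(3) cy] by (simp_all add: add_divide_distrib algebra_simps)
  have 2: "q_series (of_rat (v + x)) (\<lambda>w. P w * R w) (\<lambda>t. F t * f t)" "q_series (of_rat (v + y)) (\<lambda>w. P w * Q w) (\<lambda>t. F t * g t)"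
    using q_series_mult[OF F(1) q(1)] q_series_mult[OF F(1) q(2)] by (simp_all add: of_rat_add)
  have 3: "(\<lambda>\<tau>. F (of_uhp \<tau>)) \<odot> \<phi> = (\<lambda>(\<tau>, z). F (of_uhp \<tau>) * f (of_uhp \<tau>) * Th0 (of_uhp \<tau>) z +
      F (of_uhp \<tau>) * g (of_uhp \<tau>) * theta2 a (of_uhp \<tau>) z)"
    by (simp add: act_def e fun_eq_iff algebra_simps)
  have "jacobi_law (m + n) (h + j) ((\<lambda>\<tau>. F (of_uhp \<tau>)) \<odot> \<phi>) S_mat"
    unfolding jacobi_law_def
  proof (intro allI)
    fix \<tau> and z :: "complex^2"
    define t where "t = of_uhp \<tau>"
    have t: "Im t > 0" by (simp add: t_def)
    then have t0: "t \<noteq> 0" by auto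
    have L: "\<phi> (moebius S_mat \<tau>, (1 / t) *s z) * ee (- half_norm A2 z / t) * ceta t powi h = t powi m * ceta (- 1 / t) powi h * \<phi> (\<tau>, z)"
      using S unfolding jacobi_law_def by (simp add: moebius_S eta_eq t_def)
    have p: "ceta s powi (h + j) = ceta s powi h * ceta s powi j" for s
      by (simp add: power_int_add)
    have tp: "t powi (m + n) = t powi m * t powi n" using t0 by (simp add: power_int_add)
    have "F (- 1 / t) * \<phi> (moebius S_mat \<tau>, (1 / t) *s z) * ee (- half_norm A2 z / t) * (ceta t powi h * ceta t powi j)
       = (F (- 1 / t) * ceta t powi j) * (\<phi> (moebius S_mat \<tau>, (1 / t) *s z) * ee (- half_norm A2 z / t) * ceta t powi h)"
      by (simp only: mult_ac)
    also have "\<dots> = (t powi m * t powi n) * (ceta (- 1 / t) powi h * ceta (- 1 / t) powi j) * (F t * \<phi> (\<tau>, z))"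
      unfolding L inv[OF t] by (simp only: mult_ac)
    finally show "((\<lambda>\<tau>. F (of_uhp \<tau>)) \<odot> \<phi>) (moebius S_mat \<tau>, (1 / aut_factor S_mat \<tau>) *s z) *
           ee (- of_int (S_mat$2$1) * half_norm A2 z / aut_factor S_mat \<tau>) * eta \<tau> powi (h + j) =
         aut_factor S_mat \<tau> powi (m + n) * eta (moebius S_mat \<tau>) powi (h + j) * ((\<lambda>\<tau>. F (of_uhp \<tau>)) \<odot> \<phi>) (\<tau>, z)"
      by (simp add: act_def moebius_S eta_eq t_def[symmetric] p tp)
  qed
  moreover have "v + x \<ge> 0" "v + y \<ge> 0" using xy F(2) by simp_all
  ultimately show ?thesis unfolding theta_form_def using 1 2 3 by blast
qed

section \<open>The generators\<close>

text \<open>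
  The values of \<open>Th0\<close> and \<open>ThP\<close> at \<open>z = 0\<close>, and their derivatives up to the factor \<open>2 \<pi> i\<close>. They are the
  sums over \<open>s\<close> in \<open>E28\<close> and \<open>E48\<close>.
\<close>

definition A0 :: "complex \<Rightarrow> complex" where "A0 t = Th0 t 0"
definition A1 :: "complex \<Rightarrow> complex" where "A1 t = ThP t 0"
definition B0 :: "complex \<Rightarrow> complex" where "B0 t = theta2 (\<lambda>p. of_int (qf p) / 3 * class0 p) t 0"
definition B1 :: "complex \<Rightarrow> complex" where "B1 t = theta2 (\<lambda>p. of_int (qf p) / 3 * classP p) t 0"

lemma A_has_derivative:
  assumes "Im t > 0"
  shows "(A0 has_field_derivative i2pi * B0 t) (at t)"
    "(A1 has_field_derivative i2pi * B1 t) (at t)"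
  unfolding A0_def[abs_def] A1_def[abs_def] B0_def B1_def
  by (rule DERIV_theta2[OF tame2_class0 assms], rule DERIV_theta2[OF tame2_classP assms])

lemma A_inversion:
  assumes "Im t > 0"
  shows "A0 (- 1 / t) = - kap * t * (A0 t + A1 t)" "A1 (- 1 / t) = kap * t * (A1 t - 2 * A0 t)"
  using Th0_inversion[OF assms, of 0] ThP_inversion[OF assms, of 0] by (simp_all add: A0_def A1_def bq_def)

text \<open>This gives the law of the derivatives \<open>B0\<close>, \<open>B1\<close>, with a term of lower order in \<open>t\<close>.\<close>

lemma derivative_inversion:
  assumes f: "\<And>t. Im t > 0 \<Longrightarrow> (f has_field_derivative f' t) (at t)"
    and g: "\<And>t. Im t > 0 \<Longrightarrow> (g has_field_derivative g' t) (at t)"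
    and eq: "\<And>t. Im t > 0 \<Longrightarrow> f (- 1 / t) = c * t * g t" and t: "Im t > 0"
  shows "f' (- 1 / t) = c * (t ^ 2 * g t + t ^ 3 * g' t)"
proof -
  have t0: "t \<noteq> 0" using t by auto
  have i: "((\<lambda>t. - 1 / t) has_field_derivative 1 / t ^ 2) (at t)"
    using t0 by (auto intro!: derivative_eq_intros simp: power2_eq_square field_simps)
  have "((\<lambda>t. f (- 1 / t)) has_field_derivative f' (- 1 / t) * (1 / t ^ 2)) (at t)"
    by (rule DERIV_chain2[OF f[OF Im_inversion[OF t]] i])
  moreover have "((\<lambda>t. c * t * g t) has_field_derivative c * (g t + t * g' t)) (at t)"
    using g[OF t] by (auto intro!: derivative_eq_intros simp: algebra_simps)
  then have "((\<lambda>t. f (- 1 / t)) has_field_derivative c * (g t + t * g' t)) (at t)"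
    by (rule has_field_derivative_transform_within_open[OF _ open_halfspace_Im_gt[of 0]]) (use t eq in simp_all)
  ultimately have "f' (- 1 / t) * (1 / t ^ 2) = c * (g t + t * g' t)" by (rule DERIV_unique)
  then have "f' (- 1 / t) = c * (g t + t * g' t) * t ^ 2" using t0 by (simp add: field_simps)
  then show ?thesis by (simp add: algebra_simps power2_eq_square power3_eq_cube)
qed

definition twopii :: complex where
  "twopii = i2pi"

lemma twopii_nonzero: "twopii \<noteq> 0" by (simp add: twopii_def)

lemma B_inversion:
  assumes t: "Im t > 0"
  shows "B0 (- 1 / t) = - kap * (t ^ 3 * (B0 t + B1 t) + t ^ 2 * (A0 t + A1 t) / twopii)"
    "B1 (- 1 / t) = kap * (t ^ 3 * (B1 t - 2 * B0 t) + t ^ 2 * (A1 t - 2 * A0 t) / twopii)"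
proof -
  note A = A_has_derivative[folded twopii_def]
  have "twopii * B0 (- 1 / t) = - kap * (t ^ 2 * (A0 t + A1 t) + t ^ 3 * (twopii * B0 t + twopii * B1 t))"
    by (rule derivative_inversion[of A0 "\<lambda>t. twopii * B0 t", OF A(1) DERIV_add[OF A] A_inversion(1) t])
  then show "B0 (- 1 / t) = - kap * (t ^ 3 * (B0 t + B1 t) + t ^ 2 * (A0 t + A1 t) / twopii)"
    using twopii_nonzero by (simp add: field_simps)
  have "twopii * B1 (- 1 / t) = kap * (t ^ 2 * (A1 t - 2 * A0 t) + t ^ 3 * (twopii * B1 t - 2 * (twopii * B0 t)))"
    by (rule derivative_inversion[of A1 "\<lambda>t. twopii * B1 t", OF A(2) DERIV_diff[OF A(2) DERIV_cmult[OF A(1)]] A_inversion(2) t])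
  then show "B1 (- 1 / t) = kap * (t ^ 3 * (B1 t - 2 * B0 t) + t ^ 2 * (A1 t - 2 * A0 t) / twopii)"
    using twopii_nonzero by (simp add: field_simps)
qed

lemma q_series_theta2_null:
  fixes c :: nat
  assumes a: "tame2 a" and b: "\<And>t z. Im t > 0 \<Longrightarrow> ((\<lambda>p. a p * ee (of_int (qf p) / 3 * t + pairing p z)) has_sum theta2 a t z) UNIV"
    and supp: "\<And>p. a p \<noteq> 0 \<Longrightarrow> \<exists>j :: nat. qf p = int c + 3 * int j"
    and fin: "finite {p. qf p = int c}"
  shows "\<exists>P. q_series (of_nat c / 3) P (\<lambda>t. theta2 a t 0) \<and> P 0 = (\<Sum>p\<in>{p. qf p = int c}. a p)"
proof -
  define n where "n p = nat ((qf p - int c) div 3)" for p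
  have n: "qf p = int c + 3 * int (n p)" if "a p \<noteq> 0" for p
    using supp[OF that] by (auto simp: n_def)
  have "q_series (of_nat c / 3) (\<lambda>w. \<Sum>\<^sub>\<infinity>p. a p * w ^ n p) (\<lambda>t. theta2 a t 0)"
  proof (rule q_series_family)
    fix t :: complex assume t: "Im t > 0"
    have "(\<lambda>p. a p * ee ((of_real (of_nat c / 3) + of_nat (n p)) * t)) = (\<lambda>p. a p * ee (of_int (qf p) / 3 * t + pairing p 0))"
    proof
      fix p
      show "a p * ee ((of_real (of_nat c / 3) + of_nat (n p)) * t) = a p * ee (of_int (qf p) / 3 * t + pairing p 0)"
      proof (cases "a p = 0")
        case False
        have "of_real (of_nat c / 3) + of_nat (n p) = (of_int (qf p) / 3 :: complex)"
          unfolding n[OF False] by (simp add: field_simps)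
        then show ?thesis by (simp only: pairing_def) simp
      qed simp
    qed
    then show "((\<lambda>p. a p * ee ((of_real (of_nat c / 3) + of_nat (n p)) * t)) has_sum theta2 a t 0) UNIV"
      using b[OF t, of 0] by simp
  qed
  moreover have "(\<Sum>\<^sub>\<infinity>p. a p * 0 ^ n p) = (\<Sum>\<^sub>\<infinity>p\<in>{p. qf p = int c}. a p)"
  proof (rule infsum_cong_neutral)
    show "a p * 0 ^ n p = 0" if "p \<in> UNIV - {p. qf p = int c}" for p
      using that n[of p] by (cases "a p = 0") auto
    show "a p * 0 ^ n p = a p" if "p \<in> UNIV \<inter> {p. qf p = int c}" for p
      using that by (simp add: n_def)
  qed auto
  ultimately show ?thesis using fin by auto
qed

lemma qf_0_set: "{p. qf p = int 0} = {(0, 0)}" by (auto simp: qf_eq_0_iff)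

lemma qf_1_set: "{p. qf p = int 1} = {(1, 0), (- 1, 0), (0, 1), (0, - 1), (1, 1), (- 1, - 1)}"
proof (intro equalityI subsetI)
  fix p assume "p \<in> {p. qf p = int 1}"
  then have q: "qf p = 1" by simp
  then have "sq_sum p \<le> 2" using qf_bounds(1)[of p] by simp
  then have "real_of_int ((fst p)\<^sup>2 + (snd p)\<^sup>2) \<le> real_of_int 2" by (simp add: sq_sum_def)
  then have s: "(fst p)\<^sup>2 + (snd p)\<^sup>2 \<le> 2" by (simp only: of_int_le_iff)
  have b: "k = - 1 \<or> k = 0 \<or> k = 1" if "k\<^sup>2 \<le> 2" for k :: int
  proof -
    have "\<bar>k\<bar> < 2" by (rule power2_less_imp_less) (use that in auto)
    then show ?thesis by auto
  qed
  have "(fst p)\<^sup>2 \<le> 2" "(snd p)\<^sup>2 \<le> 2"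
    using s zero_le_power2[of "fst p"] zero_le_power2[of "snd p"] by linarith+
  with b have "fst p = - 1 \<or> fst p = 0 \<or> fst p = 1" "snd p = - 1 \<or> snd p = 0 \<or> snd p = 1" by blast+
  with q show "p \<in> {(1, 0), (- 1, 0), (0, 1), (0, - 1), (1, 1), (- 1, - 1)}" by (cases p) (auto simp: qf_def)
qed (auto simp: qf_def)

lemma null_series:
  obtains P0 P1 Q0 Q1 where "q_series 0 P0 A0" "P0 0 = 1" "q_series (1 / 3) P1 A1"
    "q_series 0 Q0 B0" "Q0 0 = 0" "q_series (1 / 3) Q1 B1" "Q1 0 = 2"
proof -
  have s0: "\<exists>j :: nat. qf p = int 0 + 3 * int j" if "class0 p \<noteq> 0" for p
    using qf_class0[OF that] qf_nonneg[of p] by (auto simp: cong_0_iff elim!: dvdE intro!: exI[of _ "nat (qf p div 3)"])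
  have s1: "\<exists>j :: nat. qf p = int 1 + 3 * int j" if "classP p \<noteq> 0" for p
  proof -
    have "[qf p = 1] (mod 3)" by (rule qf_class1) (use that in \<open>simp add: classP_def dvd_eq_mod_eq_0\<close>)
    then show ?thesis using qf_nonneg[of p] by (intro exI[of _ "nat (qf p div 3)"]) (simp add: cong_def, presburger)
  qed
  have f: "finite {p. qf p = int 0}" "finite {p. qf p = int 1}" unfolding qf_0_set qf_1_set by simp_all
  have tB: "tame2 (\<lambda>p. of_int (qf p) / 3 * class0 p)" "tame2 (\<lambda>p. of_int (qf p) / 3 * classP p)"
  proof -
    have b: "norm (of_int (qf p) / 3 :: complex) \<le> 3 * sq_sum p" for p
      using qf_bounds(2)[of p] qf_nonneg[of p] qf_bounds(1)[of p] by (simp add: norm_divide)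
    show "tame2 (\<lambda>p. of_int (qf p) / 3 * class0 p)" "tame2 (\<lambda>p. of_int (qf p) / 3 * classP p)"
      by (rule tame2_bounded_mult_le[OF _ b, of _ 1], simp add: class0_def classP_def)+
  qed
  have class0_null: "class0 (0, 0) = 1" by (simp add: class0_def)
  obtain P0 where P0: "q_series 0 P0 A0" "P0 0 = 1"
    using q_series_theta2_null[OF tame2_class0 theta2_has_sum[OF tame2_class0] s0 f(1)]
    unfolding qf_0_set by (auto simp: A0_def[abs_def] class0_null)
  obtain P1 where P1: "q_series (1 / 3) P1 A1"
    using q_series_theta2_null[OF tame2_classP theta2_has_sum[OF tame2_classP] s1 f(2)]
    by (auto simp: A1_def[abs_def])
  obtain Q0 where Q0: "q_series 0 Q0 B0" "Q0 0 = 0"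
    using q_series_theta2_null[OF tB(1) theta2_has_sum[OF tB(1)] _ f(1)] s0
    unfolding qf_0_set by (auto simp: B0_def[abs_def] qf_def)
  obtain Q1 where Q1: "q_series (1 / 3) Q1 B1" "Q1 0 = 2"
    using q_series_theta2_null[OF tB(2) theta2_has_sum[OF tB(2)] _ f(2)] s1
    unfolding qf_1_set by (auto simp: B1_def[abs_def] qf_def classP_def)
  show thesis by (rule that[OF P0 P1 Q0 Q1])
qed

text \<open>The coefficients of \<open>E48\<close> with respect to \<open>Th0\<close> and \<open>ThP\<close>; those of \<open>E28\<close> are \<open>- A1\<close> and \<open>A0\<close>.\<close>

definition U0 :: "complex \<Rightarrow> complex" where "U0 t = cE2 t * A1 t - 12 * B1 t"
definition U1 :: "complex \<Rightarrow> complex" where "U1 t = 12 * B0 t - cE2 t * A0 t"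

lemma U_series:
  obtains P0 P1 where "q_series (1 / 3) P0 U0" "q_series 0 P1 U1" "P1 0 = - 1"
proof -
  obtain P0 P1 Q0 Q1 where n: "q_series 0 P0 A0" "P0 0 = 1" "q_series (1 / 3) P1 A1"
    "q_series 0 Q0 B0" "Q0 0 = 0" "q_series (1 / 3) Q1 B1" "Q1 0 = 2"
    by (rule null_series)
  obtain R1 R3 R5 where R: "R1 0 = 1" "R3 0 = 1" "R5 0 = 1"
    "R1 holomorphic_on ball 0 1" "R3 holomorphic_on ball 0 1" "R5 holomorphic_on ball 0 1"
    "q_series 0 (\<lambda>w. 1 - 24 * (w * R1 w)) cE2" "q_series 0 (\<lambda>w. 1 + 240 * (w * R3 w)) cE4"
    "q_series 0 (\<lambda>w. 1 - 504 * (w * R5 w)) cE6"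
    by (rule q_series_eisenstein)
  show thesis
  proof (rule that)
    show "q_series (1 / 3) (\<lambda>w. (1 - 24 * (w * R1 w)) * P1 w - 12 * Q1 w) U0"
      unfolding U0_def[abs_def] using q_series_diff[OF q_series_mult[OF R(7) n(3), simplified] q_series_cmult[OF n(6), of 12]] by simp
    show "q_series 0 (\<lambda>w. 12 * Q0 w - (1 - 24 * (w * R1 w)) * P0 w) U1"
      unfolding U1_def[abs_def] using q_series_diff[OF q_series_cmult[OF n(4), of 12] q_series_mult[OF R(7) n(1), simplified]] by simp
  qed (simp add: n)
qed

text \<open>The anomaly of \<open>E2\<close> cancels that of the derivatives.\<close>

lemma U_inversion:
  assumes t: "Im t > 0"
  shows "U0 (- 1 / t) = kap * t ^ 3 * (U0 t + 2 * U1 t)" "U1 (- 1 / t) = - kap * t ^ 3 * (U1 t - U0 t)"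
proof -
  have e: "6 * t / (of_real pi * \<i>) = 12 * t / twopii" by (simp add: twopii_def)
  show "U0 (- 1 / t) = kap * t ^ 3 * (U0 t + 2 * U1 t)" "U1 (- 1 / t) = - kap * t ^ 3 * (U1 t - U0 t)"
    unfolding U0_def U1_def A_inversion[OF t] B_inversion[OF t] cE2_inversion[OF t] e
    by (simp_all add: algebra_simps power2_eq_square power3_eq_cube add_divide_distrib diff_divide_distrib)
qed

text \<open>The pairs \<open>(X0, X1)\<close> and \<open>(Th0, ThP)\<close> are multiplied by the same matrix, up to scalars. Its determinant \<open>- 3\<close>
  is cancelled by the square of \<open>kap\<close>.\<close>

lemma theta_determinant_inversion:
  assumes t: "Im t > 0" and X: "X0' = - kap * s * (X0 + X1)" "X1' = kap * s * (X1 - 2 * X0)"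
  shows "X0' * ThP (- 1 / t) ((1 / t) *s z) - X1' * Th0 (- 1 / t) ((1 / t) *s z)
    = ee (bq z / t) * (s * t) * (X0 * ThP t z - X1 * Th0 t z)"
proof -
  have "X0' * ThP (- 1 / t) ((1 / t) *s z) - X1' * Th0 (- 1 / t) ((1 / t) *s z)
      = (kap * kap) * (ee (bq z / t) * (s * t)) * (- (X0 + X1) * (ThP t z - 2 * Th0 t z) + (X1 - 2 * X0) * (Th0 t z + ThP t z))"
    unfolding X Th0_inversion[OF t] ThP_inversion[OF t] by (simp add: algebra_simps)
  then show ?thesis unfolding kap_square by (simp add: algebra_simps)
qed

definition cE28 :: "complex \<Rightarrow> complex^2 \<Rightarrow> complex" where
  "cE28 t z = A0 t * ThP t z - A1 t * Th0 t z"

definition cE48 :: "complex \<Rightarrow> complex^2 \<Rightarrow> complex" where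
  "cE48 t z = U1 t * ThP t z + U0 t * Th0 t z"

lemma cE28_inversion:
  assumes t: "Im t > 0"
  shows "cE28 (- 1 / t) ((1 / t) *s z) = ee (bq z / t) * t powi 2 * cE28 t z"
  unfolding cE28_def by (subst theta_determinant_inversion[OF t A_inversion[OF t]]) (simp add: power2_eq_square)

lemma cE48_inversion:
  assumes t: "Im t > 0"
  shows "cE48 (- 1 / t) ((1 / t) *s z) = ee (bq z / t) * t powi 4 * cE48 t z"
proof -
  have "U1 (- 1 / t) * ThP (- 1 / t) ((1 / t) *s z) - (- U0 (- 1 / t)) * Th0 (- 1 / t) ((1 / t) *s z)
      = ee (bq z / t) * (t ^ 3 * t) * (U1 t * ThP t z - (- U0 t) * Th0 t z)"
    by (rule theta_determinant_inversion[OF t]) (simp_all only: U_inversion[OF t], simp_all add: algebra_simps)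
  then show ?thesis by (simp add: cE48_def power_int_def power3_eq_cube power4_eq_xxxx)
qed

lemma infsum_dual_pairs:
  assumes "((\<lambda>(p, q). F (dual_point p) (dual_point q)) has_sum S) UNIV"
  shows "(\<Sum>\<^sub>\<infinity>(s, r)\<in>A2_dual \<times> A2_dual. F s r) = S"
proof -
  have "bij_betw (map_prod dual_point dual_point) (UNIV \<times> UNIV) (A2_dual \<times> A2_dual)"
    by (intro bij_betw_map_prod bij_dual_point)
  then have "(\<Sum>\<^sub>\<infinity>x\<in>UNIV \<times> UNIV. (\<lambda>(s, r). F s r) (map_prod dual_point dual_point x)) = (\<Sum>\<^sub>\<infinity>(s, r)\<in>A2_dual \<times> A2_dual. F s r)"
    by (rule infsum_reindex_bij_betw)
  moreover have "(\<lambda>x. (\<lambda>(s, r). F s r) (map_prod dual_point dual_point x)) = (\<lambda>(p, q). F (dual_point p) (dual_point q))"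
    by (auto simp: fun_eq_iff)
  ultimately show ?thesis using infsumI[OF assms] by simp
qed

lemma kappa_dual_point: "kappa (dual_point p) (dual_point q) = class0 p * classP q - classP p * class0 q"
  by (simp add: kappa_def dual_point_in_lattice class0_def classP_def)

lemma qpow_dual_points:
  "qpow (of_rat (half_norm A2 (dual_point p) + half_norm A2 (dual_point q))) \<tau> * ee (bil A2 (of_rat_vec (dual_point q)) z)
   = ee (of_int (qf p) / 3 * of_uhp \<tau> + pairing p 0) * ee (of_int (qf q) / 3 * of_uhp \<tau> + pairing q z)"
  unfolding qpow_def half_norm_dual_point bil_dual_point ee_add[symmetric]
  by (rule arg_cong[of _ _ ee]) (simp add: of_rat_add of_rat_divide pairing_def algebra_simps)

lemma E28_eq: "E28 (\<tau>, z) = cE28 (of_uhp \<tau>) z"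
proof -
  have t: "Im (of_uhp \<tau>) > 0" by simp
  let ?e = "\<lambda>p z. ee (of_int (qf p) / 3 * of_uhp \<tau> + pairing p z)"
  have "((\<lambda>(p, q). (class0 p * ?e p 0) * (classP q * ?e q z)) has_sum A0 (of_uhp \<tau>) * ThP (of_uhp \<tau>) z) (UNIV \<times> UNIV)"
    "((\<lambda>(p, q). (classP p * ?e p 0) * (class0 q * ?e q z)) has_sum A1 (of_uhp \<tau>) * Th0 (of_uhp \<tau>) z) (UNIV \<times> UNIV)"
    unfolding A0_def A1_def by (intro has_sum_product_complex theta2_has_sum tame2_class0 tame2_classP t)+
  from has_sum_minus[OF this]
  have "((\<lambda>(p, q). kappa (dual_point p) (dual_point q) * (?e p 0 * ?e q z)) has_sum cE28 (of_uhp \<tau>) z) UNIV"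
    unfolding cE28_def UNIV_Times_UNIV kappa_dual_point by (simp add: case_prod_unfold algebra_simps)
  then show ?thesis unfolding E28_def prod.case
    by (intro infsum_dual_pairs) (simp only: mult.assoc qpow_dual_points)
qed

lemma E48_eq: "E48 (\<tau>, z) = cE48 (of_uhp \<tau>) z"
proof -
  have t: "Im (of_uhp \<tau>) > 0" by simp
  let ?e = "\<lambda>p z. ee (of_int (qf p) / 3 * of_uhp \<tau> + pairing p z)"
  have "((\<lambda>(p, q). (of_int (qf p) / 3 * class0 p * ?e p 0) * (classP q * ?e q z)) has_sum B0 (of_uhp \<tau>) * ThP (of_uhp \<tau>) z) (UNIV \<times> UNIV)"
    "((\<lambda>(p, q). (of_int (qf p) / 3 * classP p * ?e p 0) * (class0 q * ?e q z)) has_sum B1 (of_uhp \<tau>) * Th0 (of_uhp \<tau>) z) (UNIV \<times> UNIV)"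
    unfolding B0_def B1_def
    by (rule has_sum_product_complex[OF theta2_deriv_has_sum[OF tame2_class0 t] theta2_has_sum[OF tame2_classP t]],
        rule has_sum_product_complex[OF theta2_deriv_has_sum[OF tame2_classP t] theta2_has_sum[OF tame2_class0 t]])
  from has_sum_minus[OF this]
  have *: "((\<lambda>(p, q). kappa (dual_point p) (dual_point q) * of_rat (half_norm A2 (dual_point p)) * (?e p 0 * ?e q z)) has_sum
      B0 (of_uhp \<tau>) * ThP (of_uhp \<tau>) z - B1 (of_uhp \<tau>) * Th0 (of_uhp \<tau>) z) UNIV"
    unfolding UNIV_Times_UNIV kappa_dual_point half_norm_dual_point
    by (simp add: case_prod_unfold of_rat_divide algebra_simps)
  have e: "(\<Sum>\<^sub>\<infinity>(s, r)\<in>A2_dual \<times> A2_dual. kappa s r * of_rat (half_norm A2 s) *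
       qpow (of_rat (half_norm A2 s + half_norm A2 r)) \<tau> * ee (bil A2 (of_rat_vec r) z))
      = B0 (of_uhp \<tau>) * ThP (of_uhp \<tau>) z - B1 (of_uhp \<tau>) * Th0 (of_uhp \<tau>) z"
    by (rule infsum_dual_pairs) (use * in \<open>simp only: mult.assoc qpow_dual_points\<close>)
  then show ?thesis
    unfolding E48_def prod.case e by (simp add: E28_eq E2_eq cE28_def cE48_def U0_def U1_def algebra_simps)
qed

lemma E40_eq: "E40 (\<tau>, z) = (cE6 (of_uhp \<tau>) * cE28 (of_uhp \<tau>) z + cE4 (of_uhp \<tau>) * cE48 (of_uhp \<tau>) z) / ceta (of_uhp \<tau>) ^ 8"
  by (simp add: E40_def E28_eq E48_eq E4_eq E6_eq eta_eq)

lemma E60_eq: "E60 (\<tau>, z) = (cE4 (of_uhp \<tau>) ^ 2 * cE28 (of_uhp \<tau>) z + cE6 (of_uhp \<tau>) * cE48 (of_uhp \<tau>) z) / ceta (of_uhp \<tau>) ^ 8"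
  by (simp add: E60_def E28_eq E48_eq E4_eq E6_eq eta_eq)

lemma ceta_inversion_powi:
  assumes t: "Im t > 0"
  shows "ceta (- 1 / t) powi (8 * j) = t powi (4 * j) * ceta t powi (8 * j)"
proof -
  have "ceta (- 1 / t) powi (8 * j) = (ceta (- 1 / t) ^ 8) powi j" by (simp add: power_int_mult)
  also have "\<dots> = t powi (4 * j) * ceta t powi (8 * j)"
    unfolding ceta_inversion[OF t] by (simp add: power_int_mult_distrib power_int_mult)
  finally show ?thesis .
qed

lemma jacobi_law_SI:
  assumes "\<And>\<tau> z. \<phi> (moebius S_mat \<tau>, (1 / of_uhp \<tau>) *s z) = ee (bq z / of_uhp \<tau>) * of_uhp \<tau> powi n * \<phi> (\<tau>, z)"
  shows "jacobi_law (n - 4 * j) (8 * j) \<phi> S_mat"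
  unfolding jacobi_law_def
proof (intro allI)
  fix \<tau> and z :: "complex^2"
  define t where "t = of_uhp \<tau>"
  have t: "Im t > 0" by (simp add: t_def)
  then have t0: "t \<noteq> 0" by auto
  have 1: "ceta (- 1 / t) powi (8 * j) = t powi (4 * j) * ceta t powi (8 * j)" by (rule ceta_inversion_powi[OF t])
  have 2: "t powi (n - 4 * j) * t powi (4 * j) = t powi n" using t0 by (simp flip: power_int_add)
  have 3: "ee (bq z / t) * ee (- half_norm A2 z / t) = 1" by (simp add: bq_eq_half_norm flip: ee_add)
  have "\<phi> (moebius S_mat \<tau>, (1 / t) *s z) * ee (- half_norm A2 z / t) * ceta t powi (8 * j)
      = (ee (bq z / t) * ee (- half_norm A2 z / t)) * (t powi n * ceta t powi (8 * j) * \<phi> (\<tau>, z))"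
    unfolding assms[of \<tau> z, folded t_def] by (simp only: mult_ac)
  also have "\<dots> = t powi (n - 4 * j) * ceta (- 1 / t) powi (8 * j) * \<phi> (\<tau>, z)"
    unfolding 3 1 2[symmetric] by (simp only: mult_ac mult_1)
  finally show "\<phi> (moebius S_mat \<tau>, (1 / aut_factor S_mat \<tau>) *s z) *
         ee (- of_int (S_mat$2$1) * half_norm A2 z / aut_factor S_mat \<tau>) * eta \<tau> powi (8 * j) =
       aut_factor S_mat \<tau> powi (n - 4 * j) * eta (moebius S_mat \<tau>) powi (8 * j) * \<phi> (\<tau>, z)"
    by (simp add: moebius_S eta_eq t_def[symmetric])
qed

lemma theta_formI:
  assumes q: "q_series (of_rat x) P f" "q_series (of_rat y) Q g" and xy: "x \<ge> 0" "y \<ge> 0"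
    and cx: "x - of_int (8 * j) / 24 \<in> \<int>" and cy: "y + 1 / 3 - of_int (8 * j) / 24 \<in> \<int>"
    and \<phi>: "\<And>\<tau> z. \<phi> (\<tau>, z) = C (of_uhp \<tau>) z"
    and C: "\<And>t z. Im t > 0 \<Longrightarrow> C t z = f t * Th0 t z + g t * theta2 a t z"
    and inv: "\<And>t z. Im t > 0 \<Longrightarrow> C (- 1 / t) ((1 / t) *s z) = ee (bq z / t) * t powi n * C t z"
    and m: "m = n - 4 * j" "h = 8 * j"
  shows "theta_form a m h \<phi>"
proof -
  have "jacobi_law m h \<phi> S_mat"
    unfolding m by (rule jacobi_law_SI) (simp only: \<phi> moebius_S inv[OF Im_of_uhp])
  moreover have "\<phi> = (\<lambda>(\<tau>, z). f (of_uhp \<tau>) * Th0 (of_uhp \<tau>) z + g (of_uhp \<tau>) * theta2 a (of_uhp \<tau>) z)"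
    by (auto simp: fun_eq_iff \<phi> C)
  ultimately show ?thesis unfolding theta_form_def using q xy cx cy m by blast
qed

lemma theta_form_ThN: "theta_form classN (- 3) 8 (\<lambda>(\<tau>, z). ThN (of_uhp \<tau>) z)"
proof (rule theta_formI[where x = "1 / 3" and y = 0 and j = 1 and n = 1 and C = ThN])
  show "q_series (of_rat (1 / 3)) (\<lambda>_. 0) (\<lambda>_. 0)" by (simp add: q_series_def)
  show "q_series (of_rat 0) (\<lambda>_. 1) (\<lambda>_. 1)" by (simp add: q_series_def)
qed (simp_all only: ThN_inversion, simp_all)

lemma theta_form_E28: "theta_form classP (- 2) 8 E28"
proof -
  obtain P0 P1 Q0 Q1 where n: "q_series 0 P0 A0" "P0 0 = 1" "q_series (1 / 3) P1 A1"
    "q_series 0 Q0 B0" "Q0 0 = 0" "q_series (1 / 3) Q1 B1" "Q1 0 = 2"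
    by (rule null_series)
  show ?thesis
  proof (rule theta_formI[where x = "1 / 3" and y = 0 and j = 1 and n = 2 and C = cE28 and a = classP and g = A0])
    show "q_series (of_rat (1 / 3)) (\<lambda>w. - 1 * P1 w) (\<lambda>t. - 1 * A1 t)"
      using q_series_cmult[OF n(3), of "- 1"] by (simp add: of_rat_divide)
    show "q_series (of_rat 0) P0 A0" using n(1) by simp
  qed (simp_all only: E28_eq cE28_inversion, simp_all add: cE28_def)
qed

lemma theta_form_E48: "theta_form classP 0 8 E48"
proof -
  obtain P0 P1 where n: "q_series (1 / 3) P0 U0" "q_series 0 P1 U1" "P1 0 = - 1" by (rule U_series)
  show ?thesis
  proof (rule theta_formI[where x = "1 / 3" and y = 0 and j = 1 and n = 4 and C = cE48 and a = classP and f = U0 and g = U1])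
    show "q_series (of_rat (1 / 3)) P0 U0" using n(1) by (simp add: of_rat_divide)
    show "q_series (of_rat 0) P1 U1" using n(2) by simp
  qed (simp_all only: E48_eq cE48_inversion, simp_all add: cE48_def)
qed

text \<open>
  The numerator is divisible by \<open>eta ^ 8\<close>: its coefficient at \<open>Th0\<close> starts with the exponent \<open>1/3\<close>, and in
  that at \<open>ThP\<close> the constant terms cancel.
\<close>

lemma theta_form_quotient:
  assumes x: "q_series 0 X x" "weight (n + 2) x" and y: "q_series 0 Y y" "weight n y" and eq: "X 0 = Y 0"
    and \<phi>: "\<And>\<tau> z. \<phi> (\<tau>, z) = (x (of_uhp \<tau>) * cE28 (of_uhp \<tau>) z + y (of_uhp \<tau>) * cE48 (of_uhp \<tau>) z) / ceta (of_uhp \<tau>) ^ 8"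
  shows "theta_form classP n 0 \<phi>"
proof -
  obtain P0 P1 Q0 Q1 where n: "q_series 0 P0 A0" "P0 0 = 1" "q_series (1 / 3) P1 A1"
    "q_series 0 Q0 B0" "Q0 0 = 0" "q_series (1 / 3) Q1 B1" "Q1 0 = 2"
    by (rule null_series)
  obtain R0 R1 where r: "q_series (1 / 3) R0 U0" "q_series 0 R1 U1" "R1 0 = - 1" by (rule U_series)
  obtain E where E: "q_series (1 / 24) E ceta" "E 0 = 1" "\<forall>w. E w \<noteq> 0" by (rule q_series_ceta)
  have E8: "q_series (- (1 / 3)) (\<lambda>w. inverse (E w ^ 8)) (\<lambda>t. inverse (ceta t ^ 8))"
    using q_series_inverse[OF q_series_power[OF E(1), of 8]] E(3) by simp
  let ?f = "\<lambda>t. (y t * U0 t - x t * A1 t) * inverse (ceta t ^ 8)"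
  let ?g = "\<lambda>t. (x t * A0 t + y t * U1 t) * inverse (ceta t ^ 8)"
  have f: "q_series 0 (\<lambda>w. (Y w * R0 w - X w * P1 w) * inverse (E w ^ 8)) ?f"
    using q_series_mult[OF q_series_diff[OF q_series_mult[OF y(1) r(1), simplified] q_series_mult[OF x(1) n(3), simplified]] E8]
    by simp
  have "q_series 0 (\<lambda>w. X w * P0 w + Y w * R1 w) (\<lambda>t. x t * A0 t + y t * U1 t)"
    using q_series_add[OF q_series_mult[OF x(1) n(1)] q_series_mult[OF y(1) r(2)]] by simp
  then obtain G where "q_series (0 + 1) G (\<lambda>t. x t * A0 t + y t * U1 t)"
    by (rule q_series_Suc) (simp add: n r eq)
  from q_series_mult[OF this E8] have g: "q_series (2 / 3) (\<lambda>w. G w * inverse (E w ^ 8)) ?g"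
    by simp
  let ?C = "\<lambda>t z. (x t * cE28 t z + y t * cE48 t z) / ceta t ^ 8"
  show ?thesis
  proof (rule theta_formI[where x = 0 and y = "2 / 3" and j = 0 and n = n and C = ?C and a = classP and f = ?f and g = ?g])
    show "q_series (of_rat 0) (\<lambda>w. (Y w * R0 w - X w * P1 w) * inverse (E w ^ 8)) ?f" using f by simp
    show "q_series (of_rat (2 / 3)) (\<lambda>w. G w * inverse (E w ^ 8)) ?g" using g by (simp add: of_rat_divide)
    show "\<phi> (\<tau>, z) = ?C (of_uhp \<tau>) z" for \<tau> z
      by (rule \<phi>)
    show "?C t z = ?f t * Th0 t z + ?g t * ThP t z" if "Im t > 0" for t z
      by (simp add: cE28_def cE48_def field_simps)
    show "?C (- 1 / t) ((1 / t) *s z) = ee (bq z / t) * t powi n * ?C t z" if t: "Im t > 0" for t z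
    proof -
      have t0: "t \<noteq> 0" using t by auto
      have p: "t powi (n + 2) * t powi 2 = t ^ 4 * t powi n" "t powi n * t powi 4 = t ^ 4 * t powi n"
        using t0 by (simp_all add: power_int_add[of t n 2] power4_eq_xxxx power2_eq_square)
      have "x (- 1 / t) * cE28 (- 1 / t) ((1 / t) *s z) = ee (bq z / t) * (t powi (n + 2) * t powi 2) * (x t * cE28 t z)"
        unfolding weightD[OF x(2) t] cE28_inversion[OF t] by (simp only: mult_ac)
      moreover have "y (- 1 / t) * cE48 (- 1 / t) ((1 / t) *s z) = ee (bq z / t) * (t powi n * t powi 4) * (y t * cE48 t z)"
        unfolding weightD[OF y(2) t] cE48_inversion[OF t] by (simp only: mult_ac)
      ultimately have "x (- 1 / t) * cE28 (- 1 / t) ((1 / t) *s z) + y (- 1 / t) * cE48 (- 1 / t) ((1 / t) *s z)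
          = t ^ 4 * (ee (bq z / t) * t powi n * (x t * cE28 t z + y t * cE48 t z))"
        unfolding p by (simp only: distrib_left mult_ac)
      then show ?thesis unfolding ceta_inversion[OF t] using t0 by simp
    qed
  qed simp_all
qed

lemma theta_form_E40: "theta_form classP 4 0 E40" and theta_form_E60: "theta_form classP 6 0 E60"
proof -
  obtain P4 P6 where E: "mform 4 P4 cE4" "P4 0 = 1" "mform 6 P6 cE6" "P6 0 = 1" by (rule mform_eisenstein)
  show "theta_form classP 4 0 E40"
    by (rule theta_form_quotient[of P6 cE6 4 P4 cE4]) (use E in \<open>simp_all add: mform_def E40_eq\<close>)
  have "mform 8 (\<lambda>w. P4 w ^ 2) (\<lambda>t. cE4 t ^ 2)" using mform_power[OF E(1), of 2] by simp
  then show "theta_form classP 6 0 E60"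
    by (intro theta_form_quotient[of "\<lambda>w. P4 w ^ 2" "\<lambda>t. cE4 t ^ 2" 6 P6 cE6]) (use E in \<open>simp_all add: mform_def E60_eq\<close>)
qed

lemma Legendre_3: "[n = 1] (mod 3) \<Longrightarrow> Legendre n 3 = 1" "[n = 2] (mod 3) \<Longrightarrow> Legendre n 3 = - 1"
  "[n = 0] (mod 3) \<Longrightarrow> Legendre n 3 = 0"
proof -
  show "Legendre n 3 = 1" if "[n = 1] (mod 3)"
  proof -
    have "QuadRes 3 n" unfolding QuadRes_def by (rule exI[of _ 1]) (use that in \<open>simp add: cong_def\<close>)
    moreover have "\<not> [n = 0] (mod 3)" using that by (simp add: cong_def)
    ultimately show ?thesis by (simp add: Legendre_def)
  qed
  show "Legendre n 3 = - 1" if n: "[n = 2] (mod 3)"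
  proof -
    have "\<not> QuadRes 3 n"
    proof
      assume "QuadRes 3 n"
      then obtain y where y: "[y\<^sup>2 = n] (mod 3)" unfolding QuadRes_def by blast
      show False
      proof (cases "y mod 3 = 0")
        case True
        then have "y\<^sup>2 mod 3 = 0" by (simp add: power2_eq_square mod_eq_0_iff_dvd)
        then show False
          using y n by (simp add: cong_def)
      next
        case False
        then show False
          using y n square_mod_3[OF False] by (simp add: cong_def)
      qed
    qed
    moreover have "\<not> [n = 0] (mod 3)" using n by (simp add: cong_def)
    ultimately show ?thesis by (simp add: Legendre_def)
  qed
  show "Legendre n 3 = 0" if "[n = 0] (mod 3)" using that by (simp add: Legendre_def)
qed

text \<open>An automorphism of \<open>\<int>/3\<int>\<close> changes the Legendre symbol at most by a sign.\<close>

lemma theta_A2_eq: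
  assumes \<psi>: "A2_identification \<psi>"
  obtains s :: complex where "s = 1 \<or> s = - 1" "\<And>\<tau> z. theta_A2 \<psi> (\<tau>, z) = s * ThN (of_uhp \<tau>) z"
proof -
  define G where "G p = \<psi> (dual_point p)" for p
  have D: "dual_point p \<in> A2_dual" for p
    using bij_betw_apply[OF bij_dual_point, of p] by simp
  have add: "dual_point p + dual_point q = dual_point (fst p + fst q, snd p + snd q)" for p q
    by (simp add: vec_eq_iff forall_2 add_divide_distrib[symmetric])
  have G: "[G (fst p + fst q, snd p + snd q) = G p + G q] (mod 3)" for p q
    unfolding G_def using \<psi> D[of p] D[of q] by (simp add: A2_identification_def flip: add)
  have G0: "[G p = 0] (mod 3) \<longleftrightarrow> 3 dvd fst p + snd p" for p
    unfolding G_def dual_point_in_lattice[symmetric] using \<psi> D[of p] by (simp add: A2_identification_def)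
  define e where "e = G (1, 0)"
  have "\<not> [e = 0] (mod 3)" unfolding e_def G0 by simp
  then have e: "e mod 3 = 1 \<or> e mod 3 = 2" unfolding cong_def by presburger
  have G2: "[G (2, 0) = e + e] (mod 3)" using G[of "(1, 0)" "(1, 0)"] by (simp add: e_def)
  have c1: "G p mod 3 = e mod 3" if "(fst p + snd p) mod 3 = 1" for p
  proof -
    have "3 dvd (fst p + 2) + snd p" using that by presburger
    then have "[G (fst p + 2, snd p) = 0] (mod 3)" by (simp add: G0)
    moreover have "[G (fst p + 2, snd p) = G p + G (2, 0)] (mod 3)" using G[of p "(2, 0)"] by simp
    ultimately have "[G p + (e + e) = 0] (mod 3)"
      using cong_add[OF cong_refl G2, of "G p"] by (metis cong_sym cong_trans)
    then have "(g + (e + e)) mod 3 = 0" if "g = G p" for g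
      using that by (simp add: cong_def)
    moreover have "g mod 3 = e mod 3" if "(g + (e + e)) mod 3 = 0" for g :: int
      using that by presburger
    ultimately show ?thesis by blast
  qed
  have c2: "G p mod 3 = (2 * e) mod 3" if "(fst p + snd p) mod 3 = 2" for p
  proof -
    have "3 dvd (fst p + 1) + snd p" using that by presburger
    then have "[G (fst p + 1, snd p) = 0] (mod 3)" by (simp add: G0)
    moreover have "[G (fst p + 1, snd p) = G p + e] (mod 3)" using G[of p "(1, 0)"] by (simp add: e_def)
    ultimately have z: "(G p + e) mod 3 = 0" by (metis cong_def cong_sym cong_trans mod_0)
    have aux: "g mod 3 = (2 * e) mod 3" if "(g + e) mod 3 = 0" for g :: int
      using that by presburger
    show ?thesis by (rule aux[OF z])
  qed
  define s :: complex where "s = of_int (Legendre e 3)"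
  have s: "s = 1 \<or> s = - 1" using e Legendre_3(1,2)[of e] by (auto simp: s_def cong_def)
  have L: "of_int (Legendre (G p) 3) = s * classN p" for p
  proof -
    have "(fst p + snd p) mod 3 = 0 \<or> (fst p + snd p) mod 3 = 1 \<or> (fst p + snd p) mod 3 = 2" by presburger
    then consider "(fst p + snd p) mod 3 = 0" | "(fst p + snd p) mod 3 = 1" | "(fst p + snd p) mod 3 = 2"
      by blast
    then show ?thesis
    proof cases
      case 1
      then have "[G p = 0] (mod 3)" unfolding G0 by presburger
      then show ?thesis using 1 Legendre_3(3)[of "G p"] by (simp add: classN_def)
    next
      case 2
      from e show ?thesis
      proof
        assume "e mod 3 = 1"
        then have "[e = 1] (mod 3)" "[G p = 1] (mod 3)" using c1[OF 2] by (simp_all add: cong_def)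
        then show ?thesis using 2 by (simp add: Legendre_3(1) s_def classN_def)
      next
        assume "e mod 3 = 2"
        then have "[e = 2] (mod 3)" "[G p = 2] (mod 3)" using c1[OF 2] by (simp_all add: cong_def)
        then show ?thesis using 2 by (simp add: Legendre_3(2) s_def classN_def)
      qed
    next
      case 3
      have "(2 * e) mod 3 = 2 * (e mod 3) mod 3" by presburger
      from e show ?thesis
      proof
        assume "e mod 3 = 1"
        then have "[e = 1] (mod 3)" "[G p = 2] (mod 3)"
          using c2[OF 3] \<open>(2 * e) mod 3 = 2 * (e mod 3) mod 3\<close> by (simp_all add: cong_def)
        then show ?thesis using 3 by (simp add: Legendre_3(1,2) s_def classN_def)
      next
        assume "e mod 3 = 2"
        then have "[e = 2] (mod 3)" "[G p = 1] (mod 3)"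
          using c2[OF 3] \<open>(2 * e) mod 3 = 2 * (e mod 3) mod 3\<close> by (simp_all add: cong_def)
        then show ?thesis using 3 by (simp add: Legendre_3(1,2) s_def classN_def)
      qed
    qed
  qed
  have "theta_A2 \<psi> (\<tau>, z) = s * ThN (of_uhp \<tau>) z" for \<tau> z
  proof -
    let ?F = "\<lambda>r. of_int (Legendre (\<psi> r) 3) * qpow (of_rat (half_norm A2 r)) \<tau> * ee (bil A2 (of_rat_vec r) z)"
    have "theta_A2 \<psi> (\<tau>, z) = infsum ?F A2_dual" by (simp add: theta_A2_def)
    also have "\<dots> = (\<Sum>\<^sub>\<infinity>p. ?F (dual_point p))"
      by (rule infsum_reindex_bij_betw[OF bij_dual_point, symmetric])
    also have "\<dots> = (\<Sum>\<^sub>\<infinity>p. s * (classN p * ee (of_int (qf p) / 3 * of_uhp \<tau> + pairing p z)))"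
      by (rule infsum_cong)
         (simp add: G_def[symmetric] L half_norm_dual_point bil_dual_point qpow_def of_rat_divide ee_add)
    also have "\<dots> = s * ThN (of_uhp \<tau>) z" unfolding theta2_def by (rule infsum_cmult_right')
    finally show ?thesis .
  qed
  with s show thesis by (rule that)
qed

section \<open>The theta decomposition of Jacobi forms\<close>

text \<open>
  The elliptic law makes the coefficients of \<open>ee (pairing p z)\<close> periodic, up to the factor
  \<open>ee (qf p / 3 * t)\<close>. So a Jacobi form is a theta series, whose coefficients at a given \<open>\<tau>\<close> depend only
  on the class of \<open>p\<close> in the discriminant group.
\<close>

lemma frac_rat_cases:
  fixes v :: rat
  assumes "y - v \<in> \<int>" "y \<ge> 0"
  obtains n :: nat where "y = frac v + of_nat n"
proof -
  from assms(1) obtain j where j: "y - v = of_int j" by (auto elim: Ints_cases)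
  define n where "n = j + \<lfloor>v\<rfloor>"
  have y: "y = frac v + of_int n" using j by (simp add: frac_def n_def)
  have "frac v < 1" by (rule frac_lt_1)
  with y assms(2) have "of_int n > (- 1 :: rat)"
    by linarith
  then have "n \<ge> 0"
    by (metis int_one_le_iff_zero_less less_add_one linorder_not_less of_int_less_iff of_int_minus of_int_1 uminus_add_conv_diff add.inverse_inverse le_minus_one_simps(3) not_less zle_diff1_eq diff_0)
  with y have "y = frac v + of_nat (nat n)" by simp
  then show thesis by (rule that)
qed

lemma theta_decomposition:
  assumes \<phi>: "\<phi> \<in> jacobi_forms A2 k h"
  obtains f g g' P Q Q' where
    "q_series (of_rat (frac (of_int h / 24))) P f"
    "q_series (of_rat (frac (of_int h / 24 - 1 / 3))) Q g" "q_series (of_rat (frac (of_int h / 24 - 1 / 3))) Q' g'"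
    "\<And>\<tau> z. \<phi> (\<tau>, z) = theta2 (\<lambda>p. if (fst p + snd p) mod 3 = 0 then f (of_uhp \<tau>) else
        if (fst p + snd p) mod 3 = 1 then g (of_uhp \<tau>) else g' (of_uhp \<tau>)) (of_uhp \<tau>) z"
proof -
  let ?T = "{(m, r). m - of_int h / 24 \<in> \<int> \<and> r \<in> A2_dual \<and> m \<ge> half_norm A2 r}"
  from \<phi> obtain c where c: "\<And>\<tau> z. ((\<lambda>(m, r). c m r * qpow (of_rat m) \<tau> * ee (bil A2 z (of_rat_vec r))) has_sum \<phi> (\<tau>, z)) ?T"
    unfolding jacobi_forms_def mem_Collect_eq shadow_A2 by blast
  have ell: "\<phi> (\<tau>, z + of_uhp \<tau> *s of_int_vec x) * ee (of_uhp \<tau> * half_norm A2 (of_int_vec x) + bil A2 (of_int_vec x) z) = \<phi> (\<tau>, z)"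
    for x :: "int^2" and \<tau> z
  proof -
    have "\<forall>(x :: int^2) (y :: int^2) \<tau> z.
        \<phi> (\<tau>, z + of_uhp \<tau> *s of_int_vec x + of_int_vec y) *
          ee (of_uhp \<tau> * half_norm A2 (of_int_vec x) + bil A2 (of_int_vec x) z) =
        ee (half_norm A2 (of_int_vec (x + y))) * \<phi> (\<tau>, z)"
      using \<phi> unfolding jacobi_forms_def mem_Collect_eq by blast
    note e = this[rule_format, of \<tau> z x 0]
    have z0: "of_int_vec (0 :: int^2) = (0 :: complex^2)" by (simp add: of_int_vec_def vec_eq_iff)
    show ?thesis using e ee_Ints[OF half_norm_of_int_vec, of x] by (simp add: z0)
  qed
  define M where "M p = {m :: rat. m - of_int h / 24 \<in> \<int> \<and> m \<ge> of_int (qf p) / 3}" for p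
  define C where "C t p = (\<Sum>\<^sub>\<infinity>m\<in>M p. c m (dual_point p) * ee (of_rat m * t))" for t p
  have bij: "bij_betw (\<lambda>(p, m). (m, dual_point p)) (Sigma UNIV M) ?T"
  proof (rule bij_betw_imageI)
    show "inj_on (\<lambda>(p, m). (m, dual_point p)) (Sigma UNIV M)"
      using bij_betw_imp_inj_on[OF bij_dual_point] by (auto simp: inj_on_def)
    show "(\<lambda>(p, m). (m, dual_point p)) ` Sigma UNIV M = ?T"
    proof (intro equalityI subsetI)
      fix y assume "y \<in> (\<lambda>(p, m). (m, dual_point p)) ` Sigma UNIV M"
      then show "y \<in> ?T" using bij_betw_apply[OF bij_dual_point] by (auto simp: M_def half_norm_dual_point)
    next
      fix y assume y: "y \<in> ?T"
      then have "snd y \<in> range dual_point"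
        using bij_betw_imp_surj_on[OF bij_dual_point] by (simp add: case_prod_unfold)
      then obtain p where "snd y = dual_point p" by blast
      then have "y = (\<lambda>(p, m). (m, dual_point p)) (p, fst y)" "(p, fst y) \<in> Sigma UNIV M"
        using y by (auto simp: M_def case_prod_unfold half_norm_dual_point prod_eq_iff)
      then show "y \<in> (\<lambda>(p, m). (m, dual_point p)) ` Sigma UNIV M" by blast
    qed
  qed
  have sum: "((\<lambda>(p, m). c m (dual_point p) * ee (of_rat m * of_uhp \<tau>) * ee (pairing p z)) has_sum \<phi> (\<tau>, z)) (Sigma UNIV M)" for \<tau> z
    using c[of \<tau> z] unfolding has_sum_reindex_bij_betw[OF bij, symmetric]
    by (simp add: case_prod_unfold qpow_def bil_dual_point)
  have Cs: "((\<lambda>m. c m (dual_point p) * ee (of_rat m * t)) has_sum C t p) (M p)" if t: "Im t > 0" for t p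
  proof -
    have "(\<lambda>(p, m). c m (dual_point p) * ee (of_rat m * t) * ee (pairing p 0)) summable_on (Sigma UNIV M)"
      using sum[of "to_uhp t" 0] t by (auto simp: of_uhp_to_uhp summable_on_def)
    then have "(\<lambda>m. c m (dual_point p) * ee (of_rat m * t) * ee (pairing p 0)) summable_on M p"
      by (rule summable_on_SigmaD1) simp
    then show ?thesis unfolding C_def by (intro has_sum_infsum) (simp add: pairing_def)
  qed
  have Cz: "((\<lambda>p. C (of_uhp \<tau>) p * ee (pairing p z)) has_sum \<phi> (\<tau>, z)) UNIV" for \<tau> z
    by (rule has_sum_SigmaD[OF sum]) (use has_sum_cmult_left[OF Cs[of "of_uhp \<tau>"], of _ "ee (pairing _ z)"] in simp)
  define a where "a t p = C t p * ee (- (of_int (qf p) / 3 * t))" for t p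
  have C_eq: "C t p = a t p * ee (of_int (qf p) / 3 * t)" for t p
    by (simp add: a_def ee_minus)
  have az: "((\<lambda>p. a (of_uhp \<tau>) p * ee (of_int (qf p) / 3 * of_uhp \<tau> + pairing p z)) has_sum \<phi> (\<tau>, z)) UNIV" for \<tau> z
    using Cz[of \<tau> z] by (simp add: C_eq ee_add mult.assoc)
  have shift: "a t (fst p + (2 * x + y), snd p + (x + 2 * y)) = a t p" if t: "Im t > 0" for t p x y
  proof -
    define \<tau> where "\<tau> = to_uhp t"
    have \<tau>: "of_uhp \<tau> = t" using t by (simp add: \<tau>_def of_uhp_to_uhp)
    let ?x = "vector [x, y] :: int^2"
    let ?g = "\<lambda>p. (fst p + (2 * x + y), snd p + (x + 2 * y))"
    have g: "bij_betw ?g UNIV UNIV"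
      by (rule bij_betwI[where g = "\<lambda>p. (fst p - (2 * x + y), snd p - (x + 2 * y))"]) auto
    have shifted: "a t p * ee (of_int (qf p) / 3 * t + pairing p (z + t *s of_int_vec ?x)) *
        ee (t * half_norm A2 (of_int_vec ?x) + bil A2 (of_int_vec ?x) z)
      = a t p * ee (of_int (qf (?g p)) / 3 * t + pairing (?g p) z)" for p z
      unfolding mult.assoc ee_add[symmetric] by (rule arg_cong[of _ _ "\<lambda>v. _ * ee v"])
         (simp add: pairing_def qf_def half_norm_A2 bil_A2 of_int_vec_def power2_eq_square field_simps)
    have 1: "((\<lambda>p. a t p * ee (of_int (qf (?g p)) / 3 * t + pairing (?g p) z)) has_sum \<phi> (\<tau>, z)) UNIV" for z
      using has_sum_cmult_left[OF az[of \<tau> "z + t *s of_int_vec ?x"], of "ee (t * half_norm A2 (of_int_vec ?x) + bil A2 (of_int_vec ?x) z)"]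
      unfolding \<tau> shifted ell[of \<tau> z ?x, unfolded \<tau>] .
    have 2: "((\<lambda>p. a t (?g p) * ee (of_int (qf (?g p)) / 3 * t + pairing (?g p) z)) has_sum \<phi> (\<tau>, z)) UNIV" for z
      unfolding has_sum_reindex_bij_betw[OF g, of "\<lambda>p. a t p * ee (of_int (qf p) / 3 * t + pairing p z)"] using az[of \<tau> z] by (simp add: \<tau>)
    let ?b = "\<lambda>p. (a t (?g p) - a t p) * ee (of_int (qf (?g p)) / 3 * t)"
    have 3: "((\<lambda>(k, l). ?b (k, l) * ee (of_int k * of_real u + of_int l * of_real v)) has_sum 0) UNIV" for u v :: real
    proof -
      let ?z = "vector [of_real u, of_real v] :: complex^2"
      let ?w = "of_int (2 * x + y) * of_real u + of_int (x + 2 * y) * of_real v :: complex"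
      have e: "((a t (?g p) * ee (of_int (qf (?g p)) / 3 * t + pairing (?g p) ?z)) - (a t p * ee (of_int (qf (?g p)) / 3 * t + pairing (?g p) ?z))) * ee (- ?w)
         = ?b p * ee (of_int (fst p) * of_real u + of_int (snd p) * of_real v)" for p
      proof -
        have X: "ee (of_int (qf (?g p)) / 3 * t + pairing (?g p) ?z)
            = ee (of_int (qf (?g p)) / 3 * t) * ee (of_int (fst p) * of_real u + of_int (snd p) * of_real v) * ee ?w"
          unfolding ee_add[symmetric] by (rule arg_cong[of _ _ ee]) (simp add: pairing_def algebra_simps)
        have "(A * (q * l * w) - B * (q * l * w)) * inverse w = (A - B) * q * l" if "w \<noteq> 0" for A B q l w :: complex
          using that by (simp add: field_simps)
        note cancel = this
        show ?thesis unfolding X ee_minus by (rule cancel[OF ee_nonzero])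
      qed
      have "((\<lambda>p. ((a t (?g p) * ee (of_int (qf (?g p)) / 3 * t + pairing (?g p) ?z)) - (a t p * ee (of_int (qf (?g p)) / 3 * t + pairing (?g p) ?z))) * ee (- ?w)) has_sum (\<phi> (\<tau>, ?z) - \<phi> (\<tau>, ?z)) * ee (- ?w)) UNIV"
        by (intro has_sum_cmult_left has_sum_minus 1 2)
      then show ?thesis unfolding e by (simp add: case_prod_unfold)
    qed
    have "?b (fst p, snd p) = 0" by (rule fourier_unique2[of ?b, OF 3])
    then show ?thesis by simp
  qed
  have per: "a t p = a t (if (fst p + snd p) mod 3 = 0 then (0, 0) else if (fst p + snd p) mod 3 = 1 then (1, 0) else (- 1, 0))"
    if t: "Im t > 0" for t p
  proof -
    have *: "a t p = a t q" if d: "3 dvd (fst p - fst q) + (snd p - snd q)" for q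
    proof -
      from d obtain j where j: "(fst p - fst q) + (snd p - snd q) = 3 * j" ..
      let ?x = "(fst p - fst q) - j" and ?y = "(snd p - snd q) - j"
      have "p = (fst q + (2 * ?x + ?y), snd q + (?x + 2 * ?y))" using j by (simp add: prod_eq_iff)
      then show ?thesis using shift[OF t, of q ?x ?y] by metis
    qed
    show ?thesis
    proof (rule *)
      show "3 dvd (fst p - fst (if (fst p + snd p) mod 3 = 0 then (0, 0) else if (fst p + snd p) mod 3 = 1 then (1, 0) else (- 1, 0))) +
          (snd p - snd (if (fst p + snd p) mod 3 = 0 then (0, 0) else if (fst p + snd p) mod 3 = 1 then (1, 0) else (- 1, 0 :: int)))"
        by (simp; presburger)
    qed
  qed
  have q: "\<exists>P. q_series (of_rat (frac (of_int h / 24 - of_int (qf p) / 3))) P (\<lambda>t. a t p)" for p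
  proof -
    define x :: rat where "x = frac (of_int h / 24 - of_int (qf p) / 3)"
    define n where "n m = nat \<lfloor>m - of_int (qf p) / 3 - x\<rfloor>" for m
    have n: "m - of_int (qf p) / 3 = x + of_nat (n m)" if "m \<in> M p" for m
    proof -
      have "(m - of_int (qf p) / 3) - (of_int h / 24 - of_int (qf p) / 3) \<in> \<int>" "m - of_int (qf p) / 3 \<ge> 0"
        using that by (simp_all add: M_def)
      then obtain i :: nat where i: "m - of_int (qf p) / 3 = x + of_nat i" unfolding x_def by (rule frac_rat_cases)
      then have "n m = i" by (simp add: n_def)
      with i show ?thesis by simp
    qed
    have "q_series (of_rat x) (\<lambda>w. \<Sum>\<^sub>\<infinity>m\<in>M p. c m (dual_point p) * w ^ n m) (\<lambda>t. a t p)"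
    proof (rule q_series_family)
      fix t :: complex assume t: "Im t > 0"
      have r: "complex_of_real (of_rat x) = of_rat x" by (cases x) (simp add: of_rat_rat)
      have "((\<lambda>m. c m (dual_point p) * ee (of_rat m * t) * ee (- (of_int (qf p) / 3 * t))) has_sum a t p) (M p)"
        unfolding a_def by (intro has_sum_cmult_left Cs t)
      also have "?this \<longleftrightarrow> ((\<lambda>m. c m (dual_point p) * ee ((of_real (of_rat x) + of_nat (n m)) * t)) has_sum a t p) (M p)"
      proof (rule has_sum_cong)
        fix m assume "m \<in> M p"
        from arg_cong[OF n[OF this], of of_rat]
        have "(of_rat m :: complex) - of_int (qf p) / 3 = of_rat x + of_nat (n m)"
          by (simp add: of_rat_diff of_rat_add of_rat_divide)
        then have "of_rat m * t + - (of_int (qf p) / 3 * t) = (of_real (of_rat x) + of_nat (n m)) * t"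
          unfolding r by (metis (no_types, lifting) diff_conv_add_uminus left_diff_distrib)
        then show "c m (dual_point p) * ee (of_rat m * t) * ee (- (of_int (qf p) / 3 * t)) = c m (dual_point p) * ee ((of_real (of_rat x) + of_nat (n m)) * t)"
          unfolding mult.assoc ee_add[symmetric] by simp
      qed
      finally show "((\<lambda>m. c m (dual_point p) * ee ((of_real (of_rat x) + of_nat (n m)) * t)) has_sum a t p) (M p)" .
    qed
    then show ?thesis unfolding x_def by blast
  qed
  obtain P where P: "q_series (of_rat (frac (of_int h / 24))) P (\<lambda>t. a t (0, 0))"
    using q[of "(0, 0)"] by (auto simp: qf_def)
  obtain Q where Q: "q_series (of_rat (frac (of_int h / 24 - 1 / 3))) Q (\<lambda>t. a t (1, 0))"
    using q[of "(1, 0)"] by (auto simp: qf_def)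
  obtain Q' where Q': "q_series (of_rat (frac (of_int h / 24 - 1 / 3))) Q' (\<lambda>t. a t (- 1, 0))"
    using q[of "(- 1, 0)"] by (auto simp: qf_def)
  show thesis
  proof (rule that[OF P Q Q'])
    fix \<tau> z
    have t: "Im (of_uhp \<tau>) > 0" by simp
    have "(\<lambda>p. if (fst p + snd p) mod 3 = 0 then a (of_uhp \<tau>) (0, 0) else if (fst p + snd p) mod 3 = 1 then a (of_uhp \<tau>) (1, 0)
        else a (of_uhp \<tau>) (- 1, 0)) = a (of_uhp \<tau>)"
      by (rule ext) (subst (4) per[OF t], simp)
    then show "\<phi> (\<tau>, z) = theta2 (\<lambda>p. if (fst p + snd p) mod 3 = 0 then a (of_uhp \<tau>) (0, 0) else
        if (fst p + snd p) mod 3 = 1 then a (of_uhp \<tau>) (1, 0) else a (of_uhp \<tau>) (- 1, 0)) (of_uhp \<tau>) z"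
      using infsumI[OF az[of \<tau> z]] by (simp add: theta2_def)
  qed
qed

lemma jacobi_forms_S:
  assumes "\<phi> \<in> jacobi_forms A2 (of_int h / 2 + of_int m) h"
  shows "\<phi> (moebius S_mat \<tau>, (1 / of_uhp \<tau>) *s z) * eta \<tau> powi h
    = ee (bq z / of_uhp \<tau>) * of_uhp \<tau> powi m * eta (moebius S_mat \<tau>) powi h * \<phi> (\<tau>, z)"
proof -
  have "\<phi> (moebius S_mat \<tau>, (1 / of_uhp \<tau>) *s z) * ee (- (bq z / of_uhp \<tau>)) * eta \<tau> powi h
      = of_uhp \<tau> powi m * eta (moebius S_mat \<tau>) powi h * \<phi> (\<tau>, z)"
    using jacobi_forms_law[OF assms metaplectic_S] unfolding jacobi_law_def by (simp add: moebius_S bq_eq_half_norm)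
  then show ?thesis unfolding ee_minus by (simp add: field_simps)
qed

text \<open>The square of the inversion acts on the Jacobi variable by \<open>- 1\<close>.\<close>

lemma jacobi_forms_uminus:
  assumes "\<phi> \<in> jacobi_forms A2 (of_int h / 2 + of_int m) h"
  shows "\<phi> (\<tau>, - z) = (- 1) powi m * \<phi> (\<tau>, z)"
proof -
  define \<tau>' t where "\<tau>' = moebius S_mat \<tau>" and "t = of_uhp \<tau>"
  have "Im t > 0" by (simp add: t_def)
  then have t0: "t \<noteq> 0" by auto
  have t': "of_uhp \<tau>' = - 1 / t" by (simp add: \<tau>'_def moebius_S t_def)
  have "of_uhp (moebius S_mat \<tau>') = t" using t0 by (simp add: moebius_S t')
  then have SS: "moebius S_mat \<tau>' = \<tau>" by (intro of_uhp_eqD) (simp add: t_def)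
  let ?z = "(1 / t) *s z"
  have z: "(1 / of_uhp \<tau>') *s ?z = - z" using t0 by (simp add: t' vec_eq_iff)
  have b: "bq ?z / of_uhp \<tau>' = - (bq z / t)" using t0 by (simp add: t' bq_def field_simps power2_eq_square)
  have 1: "\<phi> (\<tau>', ?z) * eta \<tau> powi h = ee (bq z / t) * t powi m * eta \<tau>' powi h * \<phi> (\<tau>, z)"
    using jacobi_forms_S[OF assms, of \<tau> z] by (simp add: \<tau>'_def t_def)
  have 2: "\<phi> (\<tau>, - z) * eta \<tau>' powi h = ee (- (bq z / t)) * (- 1 / t) powi m * eta \<tau> powi h * \<phi> (\<tau>', ?z)"
    using jacobi_forms_S[OF assms, of \<tau>' ?z] unfolding SS z b unfolding t' .
  have "\<phi> (\<tau>, - z) * eta \<tau>' powi h = ee (- (bq z / t)) * (- 1 / t) powi m * (\<phi> (\<tau>', ?z) * eta \<tau> powi h)"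
    unfolding 2 by (simp only: mult_ac)
  also have "\<dots> = (ee (- (bq z / t)) * ee (bq z / t)) * ((- 1 / t) powi m * t powi m) * eta \<tau>' powi h * \<phi> (\<tau>, z)"
    unfolding 1 by (simp only: mult_ac)
  also have "ee (- (bq z / t)) * ee (bq z / t) = 1" by (simp flip: ee_add)
  also have "(- 1 / t) powi m * t powi m = (- 1) powi m" using t0 by (simp flip: power_int_mult_distrib)
  finally show ?thesis by simp
qed

lemma theta_decomposition_parity:
  assumes \<phi>: "\<phi> \<in> jacobi_forms A2 (of_int h / 2 + of_int m) h"
  obtains f g P Q where
    "q_series (of_rat (frac (of_int h / 24))) P f" "q_series (of_rat (frac (of_int h / 24 - 1 / 3))) Q g"
    "\<And>\<tau> z. \<phi> (\<tau>, z) = f (of_uhp \<tau>) * Th0 (of_uhp \<tau>) z + g (of_uhp \<tau>) * theta2 (if even m then classP else classN) (of_uhp \<tau>) z"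
    "\<And>t. odd m \<Longrightarrow> Im t > 0 \<Longrightarrow> f t = 0"
proof -
  obtain f g g' P Q Q' where q: "q_series (of_rat (frac (of_int h / 24))) P f"
    "q_series (of_rat (frac (of_int h / 24 - 1 / 3))) Q g" "q_series (of_rat (frac (of_int h / 24 - 1 / 3))) Q' g'"
    and e: "\<And>\<tau> z. \<phi> (\<tau>, z) = theta2 (\<lambda>p. if (fst p + snd p) mod 3 = 0 then f (of_uhp \<tau>) else
        if (fst p + snd p) mod 3 = 1 then g (of_uhp \<tau>) else g' (of_uhp \<tau>)) (of_uhp \<tau>) z"
    by (rule theta_decomposition[OF \<phi>]) blast
  define a where "a t p = (if (fst p + snd p) mod 3 = 0 then f t else if (fst p + snd p) mod 3 = 1 then g t else g' t)" for t and p :: "int \<times> int"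
  have ta: "tame2 (\<lambda>p. c * a t p)" "tame2 (\<lambda>p. c * a t (- fst p, - snd p))" for c t
    by (rule tame2_bounded[of _ "norm c * (norm (f t) + norm (g t) + norm (g' t))"],
        simp add: a_def norm_mult mult_left_mono)+
  have e': "\<phi> (\<tau>, z) = theta2 (a (of_uhp \<tau>)) (of_uhp \<tau>) z" for \<tau> z
    unfolding e a_def[abs_def] by (rule refl)
  have par: "1 * a t (- fst p, - snd p) = (- 1) powi m * a t p" if t: "Im t > 0" for t p
  proof (rule theta2_unique[OF ta(2) ta(1) t])
    fix z
    have "theta2 (\<lambda>p. a t (- fst p, - snd p)) t z = theta2 (a t) t (- z)" by (rule theta2_uminus[symmetric])
    also have "\<dots> = (- 1) powi m * theta2 (a t) t z"
      using jacobi_forms_uminus[OF \<phi>, of "to_uhp t" z] t by (simp add: e' of_uhp_to_uhp)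
    finally show "theta2 (\<lambda>p. 1 * a t (- fst p, - snd p)) t z = theta2 (\<lambda>p. (- 1) powi m * a t p) t z"
      by (simp add: theta2_cmult)
  qed
  have f0: "f t = 0" if "odd m" "Im t > 0" for t
    using par[OF that(2), of "(0, 0)"] that(1) by (simp add: a_def power_int_minus_left_odd)
  have g': "g' t = (if even m then g t else - g t)" if "Im t > 0" for t
    using par[OF that, of "(1, 0)"] by (simp add: a_def power_int_minus_left_odd power_int_minus_left_even)
  show thesis
  proof (rule that[OF q(1,2) _ f0])
    fix \<tau> z
    define t where "t = of_uhp \<tau>"
    have t: "Im t > 0" by (simp add: t_def)
    show "\<phi> (\<tau>, z) = f (of_uhp \<tau>) * Th0 (of_uhp \<tau>) z + g (of_uhp \<tau>) * theta2 (if even m then classP else classN) (of_uhp \<tau>) z"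
    proof (cases "even m")
      case True
      have "a t = (\<lambda>p. f t * class0 p + g t * classP p)"
        using True g'[OF t] by (auto simp: a_def fun_eq_iff class0_def classP_def dvd_eq_mod_eq_0)
      then show ?thesis using True by (simp add: e' combine_classes t_def[symmetric] t)
    next
      case False
      have "a t = (\<lambda>p. g t * classN p)"
        using False g'[OF t] f0[OF False t] by (auto simp: a_def fun_eq_iff classN_def)
      then show ?thesis using False f0[OF False t] by (simp add: e' theta2_cmult t_def[symmetric])
    qed
  qed
qed

lemma level_one_subset: "level_one \<subseteq> modular_ring"
proof
  fix f assume "f \<in> level_one"
  then show "f \<in> modular_ring" unfolding modular_ring_def by induction (blast intro: generated_algebra.intros)+
qed

lemma modular_ring_const: "(\<lambda>_. c) \<in> modular_ring"
  and modular_ring_add: "f \<in> modular_ring \<Longrightarrow> g \<in> modular_ring \<Longrightarrow> f + g \<in> modular_ring"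
  and modular_ring_mult: "f \<in> modular_ring \<Longrightarrow> g \<in> modular_ring \<Longrightarrow> f * g \<in> modular_ring"
  and modular_ring_power: "f \<in> modular_ring \<Longrightarrow> f ^ n \<in> modular_ring"
  and modular_ring_0: "0 \<in> modular_ring"
  and modular_ring_uminus: "f \<in> modular_ring \<Longrightarrow> - f \<in> modular_ring"
  unfolding modular_ring_def
  by (fact generated_algebra.const generated_algebra.add generated_algebra.mult generated_algebra_power
      generated_algebra_zero generated_algebra_uminus)+

lemma modular_ring_gens: "E4 \<in> modular_ring" "E6 \<in> modular_ring" "eta \<in> modular_ring"
  unfolding modular_ring_def by (rule generated_algebra.gen; simp)+

lemma eta_power_mult_modular: "f \<in> level_one \<Longrightarrow> eta ^ s * f \<in> modular_ring"
  by (intro modular_ring_mult modular_ring_power modular_ring_gens subsetD[OF level_one_subset])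

lemma q_series_ceta_inverse_power:
  obtains E where "\<And>s. q_series (- (of_nat s / 24)) (\<lambda>w. inverse (E w ^ s)) (\<lambda>t. inverse (ceta t ^ s))" "E 0 = 1"
proof -
  obtain E where E: "q_series (1 / 24) E ceta" "E 0 = 1" "\<forall>w. E w \<noteq> 0" by (rule q_series_ceta)
  show thesis
  proof (rule that)
    show "q_series (- (of_nat s / 24)) (\<lambda>w. inverse (E w ^ s)) (\<lambda>t. inverse (ceta t ^ s))" for s
      using q_series_inverse[OF q_series_power[OF E(1), of s]] E(3) by simp
  qed (rule E)
qed

lemma frac_exponents:
  fixes h :: int
  assumes "0 \<le> h" "h \<le> 23"
  shows "frac (of_int h / 24 :: rat) = of_int h / 24"
    "h \<ge> 8 \<Longrightarrow> frac (of_int h / 24 - 1 / 3 :: rat) = of_int (h - 8) / 24"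
    "h < 8 \<Longrightarrow> frac (of_int h / 24 - 1 / 3 :: rat) = of_int (h + 16) / 24"
proof -
  show "frac (of_int h / 24 :: rat) = of_int h / 24" using assms by (subst frac_eq) auto
  show "frac (of_int h / 24 - 1 / 3 :: rat) = of_int (h - 8) / 24" if "h \<ge> 8"
    unfolding frac_unique_iff using assms that by (simp add: field_simps)
  show "frac (of_int h / 24 - 1 / 3 :: rat) = of_int (h + 16) / 24" if "h < 8"
  proof -
    have "of_int h / 24 - 1 / 3 - of_int (h + 16) / 24 = (of_int (- 1) :: rat)" by (simp add: field_simps)
    then show ?thesis unfolding frac_unique_iff using assms that by (simp only: Ints_of_int) simp
  qed
qed

text \<open>
  The coefficient of \<open>ThN\<close> starts with an exponent in \<open>h/24 - 1/3 + \<int>\<close>. Dividing by the power of \<open>eta\<close>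
  with the least nonnegative one leaves a form of even weight and level one.
\<close>

lemma jacobi_odd_decomposition:
  assumes \<phi>: "\<phi> \<in> jacobi_forms A2 (of_int h / 2 + of_int m) h" and m: "odd m" and h: "0 \<le> h" "h \<le> 23"
  shows "\<exists>f\<in>modular_ring. \<phi> = f \<odot> (\<lambda>(\<tau>, z). ThN (of_uhp \<tau>) z)"
proof -
  obtain f g P Q where q: "q_series (of_rat (frac (of_int h / 24 - 1 / 3))) Q g"
    and e: "\<And>\<tau> z. \<phi> (\<tau>, z) = f (of_uhp \<tau>) * Th0 (of_uhp \<tau>) z + g (of_uhp \<tau>) * theta2 (if even m then classP else classN) (of_uhp \<tau>) z"
    and f0: "\<And>t. odd m \<Longrightarrow> Im t > 0 \<Longrightarrow> f t = 0"
    by (rule theta_decomposition_parity[OF \<phi>]) blast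
  have e': "\<phi> (\<tau>, z) = g (of_uhp \<tau>) * ThN (of_uhp \<tau>) z" for \<tau> z
    using m by (simp add: e f0)
  obtain s :: nat and j :: int where sj: "h = int s + 8 * j" and fr: "frac (of_int h / 24 - 1 / 3 :: rat) = of_nat s / 24"
  proof (cases "h \<ge> 8")
    case True
    show thesis by (rule that[of "nat (h - 8)" 1]) (use True frac_exponents(2)[OF h True] in auto)
  next
    case False
    show thesis by (rule that[of "nat (h + 16)" "- 2"]) (use False h frac_exponents(3)[OF h] in auto)
  qed
  obtain E where E: "\<And>s. q_series (- (of_nat s / 24)) (\<lambda>w. inverse (E w ^ s)) (\<lambda>t. inverse (ceta t ^ s))" "E 0 = 1"
    by (rule q_series_ceta_inverse_power) blast
  let ?G = "\<lambda>t. g t * inverse (ceta t ^ s)"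
  have "q_series (of_nat s / 24) Q g" using q by (simp add: fr of_rat_divide)
  from q_series_mult[OF this E(1)[of s]] have qG: "q_series 0 (\<lambda>w. Q w * inverse (E w ^ s)) ?G"
    by simp
  have "weight (m - 1 + 4 * j) ?G" unfolding weight_def
  proof (intro allI impI)
    fix t :: complex assume t: "Im t > 0"
    then have t0: "t \<noteq> 0" by auto
    obtain z where z: "ThN t z \<noteq> 0" using ThN_not_zero[OF t] by blast
    have "g (- 1 / t) * (ee (bq z / t) * t * ThN t z) * ceta t powi h
        = ee (bq z / t) * t powi m * ceta (- 1 / t) powi h * (g t * ThN t z)"
      using jacobi_forms_S[OF \<phi>, of "to_uhp t" z] t ThN_inversion[OF t, of z]
      by (simp add: e' moebius_S of_uhp_to_uhp eta_eq)
    then have "(g (- 1 / t) * t * ceta t powi h) * (ee (bq z / t) * ThN t z) = (t powi m * ceta (- 1 / t) powi h * g t) * (ee (bq z / t) * ThN t z)"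
      by (simp only: mult_ac)
    then have 1: "g (- 1 / t) * t * ceta t powi h = t powi m * ceta (- 1 / t) powi h * g t" using z by simp
    define u v C where "u = ceta t ^ s" and "v = ceta (- 1 / t) ^ s" and "C = ceta t powi (8 * j)"
    have n: "u \<noteq> 0" "v \<noteq> 0" "C \<noteq> 0" by (simp_all add: u_def v_def C_def)
    have "ceta t powi h = u * C" "ceta (- 1 / t) powi h = v * (t powi (4 * j) * C)"
      by (simp_all only: sj power_int_add[OF disjI1[OF ceta_nonzero]] ceta_inversion_powi[OF t] power_int_of_nat u_def v_def C_def)
    with 1 have "(g (- 1 / t) * t * u) * C = (t powi m * v * t powi (4 * j) * g t) * C" by (simp only: mult_ac)
    then have 2: "g (- 1 / t) * t * u = t powi m * v * t powi (4 * j) * g t" using n by simp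
    have "t powi (m - 1 + 4 * j) * t = t powi m * t powi (4 * j)" using t0 by (simp add: power_int_add power_int_diff)
    then have "(g (- 1 / t) * inverse v) * (t * u * v) = (t powi (m - 1 + 4 * j) * (g t * inverse u)) * (t * u * v)"
      using 2 n t0 by (simp add: field_simps)
    then show "g (- 1 / t) * inverse (ceta (- 1 / t) ^ s) = t powi (m - 1 + 4 * j) * (g t * inverse (ceta t ^ s))"
      unfolding u_def[symmetric] v_def[symmetric] using n t0 by simp
  qed
  with qG have "mform (m - 1 + 4 * j) (\<lambda>w. Q w * inverse (E w ^ s)) ?G" by (simp add: mform_def)
  then have "(\<lambda>\<tau>. ?G (of_uhp \<tau>)) \<in> level_one" by (rule mform_in_level_one) (use m in simp)
  then have 1: "eta ^ s * (\<lambda>\<tau>. ?G (of_uhp \<tau>)) \<in> modular_ring" by (rule eta_power_mult_modular)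
  have "(eta ^ s * (\<lambda>\<tau>. ?G (of_uhp \<tau>))) \<tau> = g (of_uhp \<tau>)" for \<tau>
    by (simp add: fun_power_apply eta_eq)
  then have "\<phi> = (eta ^ s * (\<lambda>\<tau>. ?G (of_uhp \<tau>))) \<odot> (\<lambda>(\<tau>, z). ThN (of_uhp \<tau>) z)"
    by (auto simp: act_def fun_eq_iff e')
  with 1 show ?thesis by blast
qed

text \<open>The value of \<open>E48\<close> at \<open>z = 0\<close> has no zeros, being a multiple of \<open>eta ^ 8\<close>.\<close>

lemma wronskian: "Im t > 0 \<Longrightarrow> U1 t * A1 t + U0 t * A0 t = - 24 * ceta t ^ 8"
proof -
  obtain P0 P1 Q0 Q1 where n: "q_series 0 P0 A0" "P0 0 = 1" "q_series (1 / 3) P1 A1"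
    "q_series 0 Q0 B0" "Q0 0 = 0" "q_series (1 / 3) Q1 B1" "Q1 0 = 2"
    by (rule null_series)
  obtain E where E: "\<And>s. q_series (- (of_nat s / 24)) (\<lambda>w. inverse (E w ^ s)) (\<lambda>t. inverse (ceta t ^ s))" "E 0 = 1"
    by (rule q_series_ceta_inverse_power) blast
  let ?W = "\<lambda>t. B0 t * A1 t - B1 t * A0 t"
  have W: "U1 t * A1 t + U0 t * A0 t = 12 * ?W t" for t
    by (simp add: U0_def U1_def algebra_simps)
  have "q_series (1 / 3) (\<lambda>w. Q0 w * P1 w - Q1 w * P0 w) ?W"
    using q_series_diff[OF q_series_mult[OF n(4,3), simplified] q_series_mult[OF n(6,1), simplified]] .
  from q_series_mult[OF this E(1)[of 8]]
  have "q_series 0 (\<lambda>w. (Q0 w * P1 w - Q1 w * P0 w) * inverse (E w ^ 8)) (\<lambda>t. ?W t * inverse (ceta t ^ 8))"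
    by simp
  moreover have "weight 4 ?W" unfolding weight_def
  proof (intro allI impI)
    fix t :: complex assume t: "Im t > 0"
    have "cE48 (- 1 / t) 0 = t ^ 4 * cE48 t 0" using cE48_inversion[OF t, of 0] by (simp add: bq_def)
    moreover have "cE48 t 0 = 12 * ?W t" for t
      by (simp only: W[symmetric]) (simp only: cE48_def A0_def A1_def)
    ultimately have "12 * ?W (- 1 / t) = t ^ 4 * (12 * ?W t)" by (simp only:)
    then have "12 * ?W (- 1 / t) = 12 * (t ^ 4 * ?W t)" by (simp only: mult.left_commute)
    then have "?W (- 1 / t) = t ^ 4 * ?W t" by (rule mult_left_cancel[THEN iffD1, rotated]) simp
    then show "?W (- 1 / t) = t powi 4 * ?W t" by (simp only: power_int_numeral)
  qed
  from weight_mult[OF this weight_inverse[OF weight_ceta8]]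
  have "weight 0 (\<lambda>t. ?W t * inverse (ceta t ^ 8))" by simp
  ultimately have "mform 0 (\<lambda>w. (Q0 w * P1 w - Q1 w * P0 w) * inverse (E w ^ 8)) (\<lambda>t. ?W t * inverse (ceta t ^ 8))"
    by (simp add: mform_def)
  from mform_0_const(2)[OF this]
  have *: "?W t * inverse (ceta t ^ 8) = - 2" if "Im t > 0" using that by (simp add: n E)
  show "U1 t * A1 t + U0 t * A0 t = - 24 * ceta t ^ 8" if "Im t > 0"
  proof -
    have "?W t = - 2 * ceta t ^ 8" using *[OF that] by (simp add: field_simps)
    then show ?thesis unfolding W by simp
  qed
qed

text \<open>
  Every even Jacobi form is \<open>f E28 + g E48\<close>, where \<open>f\<close> and \<open>g\<close> are found by Cramer's rule; the determinant
  is a multiple of \<open>eta ^ 8\<close>. Multiplied by \<open>eta ^ (8 - h)\<close> they are modular forms of level one, whose constant terms agree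
  if \<open>h < 8\<close>.
\<close>

lemma jacobi_even_decomposition:
  assumes \<phi>: "\<phi> \<in> jacobi_forms A2 (of_int h / 2 + of_int m) h" and m: "even m" and h: "0 \<le> h" "h \<le> 23"
  shows "\<exists>f1\<in>modular_ring. \<exists>f2\<in>modular_ring. \<exists>f3\<in>modular_ring. \<exists>f4\<in>modular_ring.
    \<phi> = f1 \<odot> E28 + f2 \<odot> E48 + f3 \<odot> E40 + f4 \<odot> E60"
proof -
  obtain f g P Q where q0: "q_series (of_rat (frac (of_int h / 24))) P f" "q_series (of_rat (frac (of_int h / 24 - 1 / 3))) Q g"
    and e: "\<And>\<tau> z. \<phi> (\<tau>, z) = f (of_uhp \<tau>) * Th0 (of_uhp \<tau>) z + g (of_uhp \<tau>) * theta2 (if even m then classP else classN) (of_uhp \<tau>) z"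
    by (rule theta_decomposition_parity[OF \<phi>]) blast
  have e': "\<phi> (\<tau>, z) = f (of_uhp \<tau>) * Th0 (of_uhp \<tau>) z + g (of_uhp \<tau>) * ThP (of_uhp \<tau>) z" for \<tau> z
    using m by (simp add: e)
  define s where "s = nat h"
  have hs: "h = int s" using h by (simp add: s_def)
  \<comment> \<open>The exponents of \<open>f\<close> and \<open>g\<close> start at \<open>h/24\<close> and at \<open>h/24 + j - 1/3\<close>.\<close>
  define j :: nat where "j = (if h \<ge> 8 then 0 else 1)"
  have q: "q_series (of_nat s / 24) P f" "q_series (of_nat s / 24 + of_nat j - 1 / 3) Q g"
  proof -
    have "real_of_rat (frac (of_int h / 24)) = of_nat s / 24"
      unfolding frac_exponents(1)[OF h] by (simp add: of_rat_divide hs)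
    from q0(1)[unfolded this] show "q_series (of_nat s / 24) P f" .
    have "real_of_rat (frac (of_int h / 24 - 1 / 3)) = of_nat s / 24 + of_nat j - 1 / 3"
    proof (cases "h \<ge> 8")
      case True
      then show ?thesis
        unfolding frac_exponents(2)[OF h True] by (simp add: of_rat_divide of_rat_diff hs j_def field_simps)
    next
      case False
      then have "h < 8" by simp
      then show ?thesis
        unfolding frac_exponents(3)[OF h \<open>h < 8\<close>] using False by (simp add: of_rat_divide of_rat_add hs j_def field_simps)
    qed
    then show "q_series (of_nat s / 24 + of_nat j - 1 / 3) Q g" using q0(2) by simp
  qed
  obtain E where E: "\<And>s. q_series (- (of_nat s / 24)) (\<lambda>w. inverse (E w ^ s)) (\<lambda>t. inverse (ceta t ^ s))" "E 0 = 1"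
    by (rule q_series_ceta_inverse_power) blast
  obtain P0 P1 Q0 Q1 where n: "q_series 0 P0 A0" "P0 0 = 1" "q_series (1 / 3) P1 A1"
    "q_series 0 Q0 B0" "Q0 0 = 0" "q_series (1 / 3) Q1 B1" "Q1 0 = 2"
    by (rule null_series)
  obtain R0 R1 where r: "q_series (1 / 3) R0 U0" "q_series 0 R1 U1" "R1 0 = - 1" by (rule U_series)
  let ?F = "\<lambda>t. (f t * U1 t - g t * U0 t) * inverse (ceta t ^ s)"
  let ?G = "\<lambda>t. (f t * A0 t + g t * A1 t) * inverse (ceta t ^ s)"
  have prod: "q_series (of_nat s / 24) (\<lambda>w. w ^ j * (Q w * X w)) (\<lambda>t. g t * x t)" if "q_series (1 / 3) X x" for X x
    using q_series_shift[OF q_series_mult[OF q(2) that], of j] by simp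
  have qF: "q_series 0 (\<lambda>w. (P w * R1 w - w ^ j * (Q w * R0 w)) * inverse (E w ^ s)) ?F"
    using q_series_mult[OF q_series_diff[OF q_series_mult[OF q(1) r(2), simplified] prod[OF r(1)]] E(1)[of s]] by simp
  have qG: "q_series 0 (\<lambda>w. (P w * P0 w + w ^ j * (Q w * P1 w)) * inverse (E w ^ s)) ?G"
    using q_series_mult[OF q_series_add[OF q_series_mult[OF q(1) n(1), simplified] prod[OF n(3)]] E(1)[of s]] by simp
  have law: "(f (- 1 / t) * U1 (- 1 / t) - g (- 1 / t) * U0 (- 1 / t)) * ceta t ^ s = t powi (m + 2) * ceta (- 1 / t) ^ s * (f t * U1 t - g t * U0 t)"
    "(f (- 1 / t) * A0 (- 1 / t) + g (- 1 / t) * A1 (- 1 / t)) * ceta t ^ s = t powi m * ceta (- 1 / t) ^ s * (f t * A0 t + g t * A1 t)"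
    if t: "Im t > 0" for t
  proof -
    have t0: "t \<noteq> 0" using t by auto
    define c c' f' g' X Y where "c = ceta t ^ s" and "c' = ceta (- 1 / t) ^ s" and "f' = f (- 1 / t)" and "g' = g (- 1 / t)"
      and "X = kap * t * (- f' - 2 * g')" and "Y = kap * t * (g' - f')"
    have "(c * X) * Th0 t z + (c * Y) * ThP t z = (t powi m * c' * f t) * Th0 t z + (t powi m * c' * g t) * ThP t z" for z
    proof -
      have "ceta u powi h = ceta u ^ s" for u
        by (simp add: hs)
      then have "(f' * Th0 (- 1 / t) ((1 / t) *s z) + g' * ThP (- 1 / t) ((1 / t) *s z)) * c
          = ee (bq z / t) * t powi m * c' * (f t * Th0 t z + g t * ThP t z)"
        using jacobi_forms_S[OF \<phi>, of "to_uhp t" z] t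
        by (simp add: e' moebius_S of_uhp_to_uhp eta_eq c_def c'_def f'_def g'_def)
      then have "ee (bq z / t) * ((c * X) * Th0 t z + (c * Y) * ThP t z)
          = ee (bq z / t) * ((t powi m * c' * f t) * Th0 t z + (t powi m * c' * g t) * ThP t z)"
        unfolding Th0_inversion[OF t] ThP_inversion[OF t] X_def Y_def by (simp add: algebra_simps)
      then show ?thesis by simp
    qed
    from Th0_ThP_independent[OF t this]
    have XY: "c * X = t powi m * c' * f t" "c * Y = t powi m * c' * g t" by blast+
    have "(f' * A0 (- 1 / t) + g' * A1 (- 1 / t)) * c = (c * X) * A0 t + (c * Y) * A1 t"
      unfolding A_inversion[OF t] X_def Y_def by (simp add: algebra_simps)
    then show "(f (- 1 / t) * A0 (- 1 / t) + g (- 1 / t) * A1 (- 1 / t)) * ceta t ^ s = t powi m * ceta (- 1 / t) ^ s * (f t * A0 t + g t * A1 t)"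
      unfolding XY by (simp add: c_def c'_def f'_def g'_def algebra_simps)
    have "(f' * U1 (- 1 / t) - g' * U0 (- 1 / t)) * c = t ^ 2 * ((c * X) * U1 t - (c * Y) * U0 t)"
      unfolding U_inversion[OF t] X_def Y_def by (simp add: algebra_simps power2_eq_square power3_eq_cube)
    also have "\<dots> = (t powi m * t ^ 2) * c' * (f t * U1 t - g t * U0 t)"
      unfolding XY by (simp add: algebra_simps)
    also have "t powi m * t ^ 2 = t powi (m + 2)" using t0 by (simp add: power_int_add)
    finally show "(f (- 1 / t) * U1 (- 1 / t) - g (- 1 / t) * U0 (- 1 / t)) * ceta t ^ s = t powi (m + 2) * ceta (- 1 / t) ^ s * (f t * U1 t - g t * U0 t)"
      unfolding c_def c'_def f'_def g'_def .
  qed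
  have cancel: "x * inverse v = p * (y * inverse u)" if "x * u = p * v * y" "u \<noteq> 0" "v \<noteq> 0" for x y u v p :: complex
    using that by (simp add: field_simps)
  have F: "mform (m + 2) (\<lambda>w. (P w * R1 w - w ^ j * (Q w * R0 w)) * inverse (E w ^ s)) ?F"
    unfolding mform_def weight_def by (intro conjI qF allI impI cancel[OF law(1)]) simp_all
  have G: "mform m (\<lambda>w. (P w * P0 w + w ^ j * (Q w * P1 w)) * inverse (E w ^ s)) ?G"
    unfolding mform_def weight_def by (intro conjI qG allI impI cancel[OF law(2)]) simp_all
  let ?f = "\<lambda>\<tau>. ?F (of_uhp \<tau>)" and ?g = "\<lambda>\<tau>. - ?G (of_uhp \<tau>)"
  have comb: "24 * eta \<tau> ^ 8 * \<phi> (\<tau>, z) = eta \<tau> ^ s * (?f \<tau> * E28 (\<tau>, z) + ?g \<tau> * E48 (\<tau>, z))" for \<tau> z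
  proof -
    define t where "t = of_uhp \<tau>"
    have t: "Im t > 0" by (simp add: t_def)
    have W: "24 * ceta t ^ 8 = - (U1 t * A1 t + U0 t * A0 t)" using wronskian[OF t] by simp
    have "ceta t ^ s * (?F t * cE28 t z + - ?G t * cE48 t z)
        = (f t * U1 t - g t * U0 t) * cE28 t z - (f t * A0 t + g t * A1 t) * cE48 t z"
      by (simp add: field_simps)
    also have "\<dots> = 24 * ceta t ^ 8 * (f t * Th0 t z + g t * ThP t z)"
      unfolding W cE28_def cE48_def by (simp add: algebra_simps)
    finally show ?thesis by (simp add: e' E28_eq E48_eq eta_eq t_def)
  qed
  have divide24: "x = 1 / 24 * y" if "24 * x = y" for x y :: complex
    using that by auto
  let ?k = "\<lambda>_ :: uhp. 1 / 24 :: complex"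
  have k: "?k * x \<in> modular_ring" if "x \<in> modular_ring" for x
    by (intro modular_ring_mult modular_ring_const that)
  show ?thesis
  proof (cases "h \<ge> 8")
    case True
    then obtain i where i: "s = 8 + i" by (metis hs int_ops(3) le_iff_add of_nat_le_iff of_nat_numeral)
    have f: "?f \<in> level_one" by (rule mform_in_level_one[OF F]) (use m in simp)
    have g: "?g \<in> level_one"
      using generated_algebra_uminus[OF mform_in_level_one[OF G m]] by (simp add: fun_Compl_def)
    have mem: "?k * (eta ^ i * ?f) \<in> modular_ring" "?k * (eta ^ i * ?g) \<in> modular_ring" "0 \<in> modular_ring"
      by (intro k eta_power_mult_modular f g modular_ring_0)+
    have "\<phi> = (?k * (eta ^ i * ?f)) \<odot> E28 + (?k * (eta ^ i * ?g)) \<odot> E48 + 0 \<odot> E40 + 0 \<odot> E60"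
    proof
      fix x :: "uhp \<times> (complex^2)" obtain \<tau> z where x: "x = (\<tau>, z)"
        by (cases x)
      have "eta \<tau> ^ 8 * (24 * \<phi> (\<tau>, z)) = eta \<tau> ^ 8 * (eta \<tau> ^ i * (?f \<tau> * E28 (\<tau>, z) + ?g \<tau> * E48 (\<tau>, z)))"
        using comb[of \<tau> z] unfolding i power_add by (simp only: mult_ac)
      then have "24 * \<phi> (\<tau>, z) = eta \<tau> ^ i * (?f \<tau> * E28 (\<tau>, z) + ?g \<tau> * E48 (\<tau>, z))"
        by simp
      then have "\<phi> (\<tau>, z) = 1 / 24 * (eta \<tau> ^ i * (?f \<tau> * E28 (\<tau>, z) + ?g \<tau> * E48 (\<tau>, z)))"
        by (rule divide24)
      then show "\<phi> x = ((?k * (eta ^ i * ?f)) \<odot> E28 + (?k * (eta ^ i * ?g)) \<odot> E48 + 0 \<odot> E40 + 0 \<odot> E60) x"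
        by (simp only: x act_def plus_fun_apply times_fun_apply fun_power_apply zero_fun_apply prod.case mult_zero_left add_0_right distrib_left mult.assoc)
    qed
    with mem show ?thesis by blast
  next
    case False
    then have j: "j = 1" by (simp add: j_def)
    have G': "mform m (\<lambda>w. - 1 * ((P w * P0 w + w ^ j * (Q w * P1 w)) * inverse (E w ^ s))) (\<lambda>t. - 1 * ?G t)"
      by (rule mform_cmult[OF G])
    obtain u v F1 G1 where uv: "u \<in> level_one" "v \<in> level_one" "F1 \<in> level_one" "G1 \<in> level_one"
      and uvF: "(\<lambda>\<tau>. ?F (of_uhp \<tau>)) = u * E6 + v * E4 ^ 2 + eta ^ 24 * F1"
      and uvG: "(\<lambda>\<tau>. - 1 * ?G (of_uhp \<tau>)) = u * E4 + v * E6 + eta ^ 24 * G1"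
      using mform_pair[OF F G' m] by (auto simp: j r n E)
    have f: "?f \<tau> = u \<tau> * E6 \<tau> + v \<tau> * E4 \<tau> ^ 2 + eta \<tau> ^ 24 * F1 \<tau>" for \<tau>
      using fun_cong[OF uvF, of \<tau>] by (simp only: plus_fun_apply times_fun_apply fun_power_apply)
    have g: "?g \<tau> = u \<tau> * E4 \<tau> + v \<tau> * E6 \<tau> + eta \<tau> ^ 24 * G1 \<tau>" for \<tau>
      using fun_cong[OF uvG, of \<tau>] by (simp only: plus_fun_apply times_fun_apply fun_power_apply mult_minus1)
    let ?i = "s + 16"
    have mem: "?k * (eta ^ ?i * F1) \<in> modular_ring" "?k * (eta ^ ?i * G1) \<in> modular_ring"
      "?k * (eta ^ s * u) \<in> modular_ring" "?k * (eta ^ s * v) \<in> modular_ring"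
      by (intro k eta_power_mult_modular uv)+
    have "\<phi> = (?k * (eta ^ ?i * F1)) \<odot> E28 + (?k * (eta ^ ?i * G1)) \<odot> E48 + (?k * (eta ^ s * u)) \<odot> E40 + (?k * (eta ^ s * v)) \<odot> E60"
    proof
      fix x :: "uhp \<times> (complex^2)" obtain \<tau> z where x: "x = (\<tau>, z)"
        by (cases x)
      define H where "H = eta \<tau>"
      have H: "H \<noteq> 0" by (simp add: H_def)
      have H40: "E6 \<tau> * E28 (\<tau>, z) + E4 \<tau> * E48 (\<tau>, z) = H ^ 8 * E40 (\<tau>, z)"
        and H60: "E4 \<tau> ^ 2 * E28 (\<tau>, z) + E6 \<tau> * E48 (\<tau>, z) = H ^ 8 * E60 (\<tau>, z)"
        by (simp_all add: E40_def E60_def H_def)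
      have p: "H ^ 24 = H ^ 8 * H ^ 16" by (simp flip: power_add)
      have "24 * H ^ 8 * \<phi> (\<tau>, z) = H ^ s * (u \<tau> * (E6 \<tau> * E28 (\<tau>, z) + E4 \<tau> * E48 (\<tau>, z)) +
          v \<tau> * (E4 \<tau> ^ 2 * E28 (\<tau>, z) + E6 \<tau> * E48 (\<tau>, z)) + H ^ 24 * (F1 \<tau> * E28 (\<tau>, z) + G1 \<tau> * E48 (\<tau>, z)))"
        unfolding comb[of \<tau> z, folded H_def] f g by (simp add: H_def[symmetric] algebra_simps)
      also have "\<dots> = H ^ 8 * (H ^ s * (u \<tau> * E40 (\<tau>, z) + v \<tau> * E60 (\<tau>, z)) + H ^ ?i * (F1 \<tau> * E28 (\<tau>, z) + G1 \<tau> * E48 (\<tau>, z)))"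
        unfolding H40 H60 p power_add by (simp add: algebra_simps)
      finally have "H ^ 8 * (24 * \<phi> (\<tau>, z)) = H ^ 8 * (H ^ s * (u \<tau> * E40 (\<tau>, z) + v \<tau> * E60 (\<tau>, z)) + H ^ ?i * (F1 \<tau> * E28 (\<tau>, z) + G1 \<tau> * E48 (\<tau>, z)))"
        by (simp only: mult_ac)
      then have "24 * \<phi> (\<tau>, z) = H ^ s * (u \<tau> * E40 (\<tau>, z) + v \<tau> * E60 (\<tau>, z)) + H ^ ?i * (F1 \<tau> * E28 (\<tau>, z) + G1 \<tau> * E48 (\<tau>, z))"
        using H by simp
      then have "\<phi> (\<tau>, z) = 1 / 24 * (H ^ s * (u \<tau> * E40 (\<tau>, z) + v \<tau> * E60 (\<tau>, z)) + H ^ ?i * (F1 \<tau> * E28 (\<tau>, z) + G1 \<tau> * E48 (\<tau>, z)))"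
        by (rule divide24)
      then have "\<phi> (\<tau>, z) = 1 / 24 * (H ^ ?i * F1 \<tau>) * E28 (\<tau>, z) + 1 / 24 * (H ^ ?i * G1 \<tau>) * E48 (\<tau>, z) +
          1 / 24 * (H ^ s * u \<tau>) * E40 (\<tau>, z) + 1 / 24 * (H ^ s * v \<tau>) * E60 (\<tau>, z)"
        by (simp only: distrib_left mult_ac add_ac)
      then show "\<phi> x = ((?k * (eta ^ ?i * F1)) \<odot> E28 + (?k * (eta ^ ?i * G1)) \<odot> E48 + (?k * (eta ^ s * u)) \<odot> E40 + (?k * (eta ^ s * v)) \<odot> E60) x"
        by (simp only: x act_def plus_fun_apply times_fun_apply fun_power_apply prod.case H_def)
    qed
    with mem show ?thesis by blast
  qed
qed

section \<open>The structure of the ring of modular forms over the subring of level one\<close>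

text \<open>
  The ring is free over the forms of level one with basis \<open>1, eta, \<dots>, eta ^ 23\<close>: the powers of
  \<open>eta\<close> are eigenfunctions of the translation for different eigenvalues.
\<close>

definition eta_sums :: "nat \<Rightarrow> (uhp \<Rightarrow> complex) set" where
  "eta_sums n = {\<Sum>j<n. eta ^ j * g j | g. \<forall>j. g j \<in> level_one}"

lemma level_one_0: "0 \<in> level_one" by (rule generated_algebra_zero)

lemma eta_sumsI: "(\<And>j. g j \<in> level_one) \<Longrightarrow> (\<Sum>j<n. eta ^ j * g j) \<in> eta_sums n"
  unfolding eta_sums_def by blast

lemma eta_sums_add: "f \<in> eta_sums n \<Longrightarrow> g \<in> eta_sums n \<Longrightarrow> f + g \<in> eta_sums n"
proof -
  assume "f \<in> eta_sums n" "g \<in> eta_sums n"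
  then obtain u v where u: "\<And>j. u j \<in> level_one" "f = (\<Sum>j<n. eta ^ j * u j)" and v: "\<And>j. v j \<in> level_one" "g = (\<Sum>j<n. eta ^ j * v j)"
    unfolding eta_sums_def by blast
  have "f + g = (\<Sum>j<n. eta ^ j * (u j + v j))" by (simp only: u v distrib_left sum.distrib)
  then show ?thesis using eta_sumsI[of "\<lambda>j. u j + v j" n] generated_algebra.add[OF u(1) v(1)] by simp
qed

lemma eta_sums_mult: "f \<in> level_one \<Longrightarrow> g \<in> eta_sums n \<Longrightarrow> f * g \<in> eta_sums n"
proof -
  assume f: "f \<in> level_one" and "g \<in> eta_sums n"
  then obtain v where v: "\<And>j. v j \<in> level_one" "g = (\<Sum>j<n. eta ^ j * v j)"
    unfolding eta_sums_def by blast
  have "f * g = (\<Sum>j<n. eta ^ j * (f * v j))"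
    unfolding v sum_distrib_left by (rule sum.cong) (simp_all only: mult_ac)
  then show ?thesis using eta_sumsI[of "\<lambda>j. f * v j" n] generated_algebra.mult[OF f v(1)] by simp
qed

lemma level_one_eta_sums: "f \<in> level_one \<Longrightarrow> f \<in> eta_sums 24"
proof -
  assume f: "f \<in> level_one"
  have "(\<Sum>j<24. eta ^ j * (if j = 0 then f else 0)) = (\<Sum>j\<in>{0::nat}. eta ^ j * (if j = 0 then f else 0))"
    by (rule sum.mono_neutral_right) auto
  also have "\<dots> = f" by simp
  finally show ?thesis using eta_sumsI[of "\<lambda>j. if j = 0 then f else 0" 24] f level_one_0 by auto
qed

lemma eta_eta_sums: "g \<in> eta_sums 24 \<Longrightarrow> eta * g \<in> eta_sums 24"
proof -
  assume "g \<in> eta_sums 24"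
  then obtain v where v: "\<And>j. v j \<in> level_one" "g = (\<Sum>j<24. eta ^ j * v j)"
    unfolding eta_sums_def by blast
  define w where "w j = (case j of 0 \<Rightarrow> eta ^ 24 * v 23 | Suc i \<Rightarrow> v i)" for j
  have w: "w j \<in> level_one" for j
    unfolding w_def by (cases j) (simp_all add: v generated_algebra.mult Delta_in_level_one)
  have "(\<Sum>j<Suc 23. eta ^ j * w j) = w 0 + (\<Sum>j<23. eta ^ Suc j * w (Suc j))"
    by (subst sum.lessThan_Suc_shift) simp
  also have "\<dots> = eta * (\<Sum>j<Suc 23. eta ^ j * v j)"
  proof -
    have "eta * (\<Sum>j<23. eta ^ j * v j) = (\<Sum>j<23. eta ^ Suc j * v j)"
      unfolding sum_distrib_left by (rule sum.cong) (simp_all only: power_Suc mult.assoc)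
    moreover have "eta * (eta ^ 23 * v 23) = eta ^ 24 * v 23"
      by (simp only: mult.assoc[symmetric] power_Suc[symmetric]) simp
    ultimately show ?thesis unfolding sum.lessThan_Suc distrib_left by (simp add: w_def add.commute)
  qed
  finally have "eta * g = (\<Sum>j<24. eta ^ j * w j)" by (simp add: v(2))
  then show ?thesis using eta_sumsI[OF w] by simp
qed

lemma modular_ring_eta_sums: "f \<in> modular_ring \<Longrightarrow> f \<in> eta_sums 24"
proof -
  assume f: "f \<in> modular_ring"
  have "\<forall>d\<in>eta_sums 24. f * d \<in> eta_sums 24" using f unfolding modular_ring_def
  proof induction
    case (const c)
    show ?case by (intro ballI eta_sums_mult generated_algebra.const)
  next
    case (gen f)
    show ?case
    proof
      fix d assume d: "d \<in> eta_sums 24"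
      consider "f \<in> {E4, E6}" | "f = eta"
        using gen by blast
      then show "f * d \<in> eta_sums 24"
      proof cases
        case 1
        then show ?thesis by (intro eta_sums_mult[OF generated_algebra.gen d])
      next
        case 2
        then show ?thesis using eta_eta_sums[OF d] by (simp only:)
      qed
    qed
  next
    case (add f g)
    then show ?case by (simp only: distrib_right) (blast intro: eta_sums_add)
  next
    case (mult f g)
    then show ?case by (simp only: mult.assoc) blast
  qed
  moreover have "1 \<in> eta_sums 24" by (rule level_one_eta_sums) (simp only: one_fun_def generated_algebra.const)
  ultimately show ?thesis by fastforce
qed

lemma sum_split_nat: "sum f {..<m + n} = sum f {..<m} + (\<Sum>j<n. f (m + j))" for f :: "nat \<Rightarrow> 'a::comm_monoid_add"
  by (induction n) (simp_all add: add.assoc)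

lemma eta_sum_modular: "(\<And>j. g j \<in> level_one) \<Longrightarrow> (\<Sum>j<n. eta ^ j * g j) \<in> modular_ring"
proof (induction n)
  case 0
  show ?case unfolding lessThan_0 sum.empty by (rule modular_ring_0)
next
  case (Suc n)
  show ?case
    unfolding sum.lessThan_Suc by (intro modular_ring_add eta_power_mult_modular Suc.IH[OF Suc.prems] Suc.prems)
qed

lemma eta_sums_split:
  assumes "f \<in> modular_ring"
  obtains a b where "a \<in> eta_sums 8" "b \<in> modular_ring" "f = a + eta ^ 8 * b"
proof -
  obtain g where g: "\<And>j. g j \<in> level_one" "f = (\<Sum>j<24. eta ^ j * g j)"
    using modular_ring_eta_sums[OF assms] unfolding eta_sums_def by blast
  let ?b = "\<Sum>j<16. eta ^ j * g (8 + j)"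
  have "?b \<in> modular_ring" by (rule eta_sum_modular) (rule g(1))
  moreover have e: "f = (\<Sum>j<8. eta ^ j * g j) + eta ^ 8 * ?b"
    using sum_split_nat[of "\<lambda>j. eta ^ j * g j" 8 16]
    by (simp add: g(2) sum_distrib_left power_add mult.assoc del: power_add_numeral power_add_numeral2)
  ultimately show thesis using that[of "\<Sum>j<8. eta ^ j * g j" ?b] eta_sumsI[of g 8] g(1) by metis
qed

abbreviation shift_uhp :: "uhp \<Rightarrow> uhp" where
  "shift_uhp \<equiv> moebius (T_mat 1)"

lemma level_one_periodic:
  assumes "f \<in> level_one"
  shows "f (shift_uhp \<tau>) = f \<tau>"
  using assms
proof induction
  case (gen f)
  obtain P4 P6 where E: "mform 4 P4 cE4" "P4 0 = 1" "mform 6 P6 cE6" "P6 0 = 1" by (rule mform_eisenstein)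
  have "cE4 (of_uhp \<tau> + 1) = cE4 (of_uhp \<tau>)" "cE6 (of_uhp \<tau> + 1) = cE6 (of_uhp \<tau>)"
    using q_series_translate[of 0 P4 cE4 "of_uhp \<tau>"] q_series_translate[of 0 P6 cE6 "of_uhp \<tau>"] E(1,3)
    by (simp_all add: mform_def)
  with gen show ?case by (auto simp: E4_eq E6_eq moebius_T)
qed simp_all

lemma sum_fun_apply: "(\<Sum>j\<in>A. f j) x = (\<Sum>j\<in>A. f j x)" for f :: "'i \<Rightarrow> 'a \<Rightarrow> complex"
  by (induction A rule: infinite_finite_induct) simp_all

lemma eta_sum_zero:
  assumes g: "\<And>j. g j \<in> level_one" and sum: "(\<Sum>j<24. eta ^ j * g j) = 0" and l: "l < 24"
  shows "g l = 0"
proof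
  fix \<tau>
  have eta: "eta ((shift_uhp ^^ n) \<tau>) = ee (of_nat n / 24) * eta \<tau>" and inv: "g j ((shift_uhp ^^ n) \<tau>) = g j \<tau>" for n j
  proof (induction n)
    case (Suc n)
    case 1
    have "eta (shift_uhp ((shift_uhp ^^ n) \<tau>)) = ee (1 / 24) * eta ((shift_uhp ^^ n) \<tau>)"
      by (simp add: eta_eq moebius_T ceta_translate)
    also have "\<dots> = ee (of_nat (Suc n) / 24) * eta \<tau>"
      unfolding Suc(1) mult.assoc[symmetric] ee_add[symmetric] by (simp add: add_divide_distrib)
    finally show ?case by simp
    case 2
    show ?case using Suc(2) by (simp add: level_one_periodic[OF g])
  qed simp_all
  have rel: "(\<Sum>j<24. ee (of_nat (n * j) / 24) * (eta \<tau> ^ j * g j \<tau>)) = 0" for n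
  proof -
    have "(\<Sum>j<24. eta ^ j * g j) ((shift_uhp ^^ n) \<tau>) = 0" by (simp add: sum)
    then have "(\<Sum>j<24. (ee (of_nat n / 24) * eta \<tau>) ^ j * g j \<tau>) = 0"
      unfolding sum_fun_apply times_fun_apply fun_power_apply eta inv .
    also have "(\<Sum>j<24. (ee (of_nat n / 24) * eta \<tau>) ^ j * g j \<tau>) = (\<Sum>j<24. ee (of_nat (n * j) / 24) * (eta \<tau> ^ j * g j \<tau>))"
    proof (rule sum.cong)
      fix j
      have "ee (of_nat n / 24) ^ j = ee (of_nat (n * j) / 24)"
        unfolding ee_mult_of_nat[symmetric] by (rule arg_cong[of _ _ ee]) simp
      then show "(ee (of_nat n / 24) * eta \<tau>) ^ j * g j \<tau> = ee (of_nat (n * j) / 24) * (eta \<tau> ^ j * g j \<tau>)"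
        by (simp only: power_mult_distrib mult.assoc)
    qed simp
    finally show ?thesis .
  qed
  have "0 = (\<Sum>n<24. ee (- (of_nat (n * l) / 24)) * (\<Sum>j<24. ee (of_nat (n * j) / 24) * (eta \<tau> ^ j * g j \<tau>)))"
    by (simp only: rel mult_zero_right sum.neutral_const)
  also have "\<dots> = (\<Sum>n<24. \<Sum>j<24. (eta \<tau> ^ j * g j \<tau>) * ee (of_int (int j - int l) * of_real (real n / real 24)))"
    unfolding sum_distrib_left
  proof (intro sum.cong refl)
    fix n j :: nat
    have "ee (- (of_nat (n * l) / 24)) * ee (of_nat (n * j) / 24) = ee (of_int (int j - int l) * of_real (real n / real 24))"
      unfolding ee_add[symmetric] by (rule arg_cong[of _ _ ee]) (simp add: field_simps)
    then show "ee (- (of_nat (n * l) / 24)) * (ee (of_nat (n * j) / 24) * (eta \<tau> ^ j * g j \<tau>)) =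
      (eta \<tau> ^ j * g j \<tau>) * ee (of_int (int j - int l) * of_real (real n / real 24))"
      by (simp only: mult.assoc[symmetric]) (simp only: mult_ac)
  qed
  also have "\<dots> = (\<Sum>j<24. (eta \<tau> ^ j * g j \<tau>) * (of_nat 24 * of_bool (int 24 dvd int j - int l)))"
    unfolding sum.swap[of _ "{..<24::nat}" "{..<24::nat}"] sum_distrib_left[symmetric] by (subst sum_roots_of_unity) simp_all
  also have "\<dots> = (\<Sum>j\<in>{l}. (eta \<tau> ^ j * g j \<tau>) * (of_nat 24 * of_bool (int 24 dvd int j - int l)))"
  proof (rule sum.mono_neutral_right)
    show "\<forall>j\<in>{..<24} - {l}. (eta \<tau> ^ j * g j \<tau>) * (of_nat 24 * of_bool (int 24 dvd int j - int l)) = 0"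
    proof
      fix j assume "j \<in> {..<24} - {l}"
      then have "\<bar>int j - int l\<bar> < 24" "int j - int l \<noteq> 0" using l by auto
      then have "\<not> int 24 dvd int j - int l"
        using zdvd_not_zless[of "\<bar>int j - int l\<bar>" "int 24"] by auto
      then show "(eta \<tau> ^ j * g j \<tau>) * (of_nat 24 * of_bool (int 24 dvd int j - int l)) = 0" by simp
    qed
  qed (use l in auto)
  finally show "g l \<tau> = 0 \<tau>" by simp
qed

text \<open>
  In a relation \<open>eta ^ 8 y + g = 0\<close> in which \<open>g\<close> has only components of degree below \<open>8\<close>, the components
  of \<open>y\<close> of degree below \<open>16\<close> have no partner and vanish.
\<close>

lemma eta_8_divides:
  assumes y: "y \<in> modular_ring" and g: "g \<in> eta_sums 8" and eq: "eta ^ 8 * y + g = 0"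
  obtains c where "c \<in> modular_ring" "y = eta ^ 16 * c"
proof -
  obtain c where c: "\<And>j. c j \<in> level_one" "y = (\<Sum>j<24. eta ^ j * c j)"
    using modular_ring_eta_sums[OF y] unfolding eta_sums_def by blast
  obtain d where d: "\<And>j. d j \<in> level_one" "g = (\<Sum>j<8. eta ^ j * d j)"
    using g unfolding eta_sums_def by blast
  define e where "e j = (if j < 8 then eta ^ 24 * c (16 + j) + d j else c (j - 8))" for j
  have e: "e j \<in> level_one" for j
    unfolding e_def by (simp add: c d generated_algebra.add generated_algebra.mult Delta_in_level_one del: plus_fun_apply)
  let ?c1 = "\<Sum>j<16. eta ^ j * c j" and ?c2 = "\<Sum>j<8. eta ^ j * c (16 + j)"
  have y2: "y = ?c1 + eta ^ 16 * ?c2" using sum_split_nat[of "\<lambda>j. eta ^ j * c j" 16 8]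
    by (simp add: c(2) sum_distrib_left power_add mult.assoc del: power_add_numeral power_add_numeral2)
  have "(\<Sum>j<8 + 16. eta ^ j * e j) = (\<Sum>j<8. eta ^ j * (eta ^ 24 * c (16 + j) + d j)) + (\<Sum>j<16. eta ^ (8 + j) * c j)"
    unfolding sum_split_nat[of _ 8 16] by (intro arg_cong2[of _ _ _ _ "(+)"] sum.cong refl) (simp_all add: e_def)
  also have "(\<Sum>j<8. eta ^ j * (eta ^ 24 * c (16 + j) + d j)) = eta ^ 24 * ?c2 + g"
    by (simp only: distrib_left sum.distrib d(2) sum_distrib_left mult.left_commute)
  also have "(\<Sum>j<16. eta ^ (8 + j) * c j) = eta ^ 8 * ?c1" by (simp only: power_add sum_distrib_left mult.assoc)
  also have "eta ^ 24 * ?c2 + g + eta ^ 8 * ?c1 = eta ^ 8 * y + g"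
  proof -
    have "eta ^ 24 = eta ^ 8 * eta ^ 16" by (simp flip: power_add)
    then show ?thesis unfolding y2 by (simp only: distrib_left mult.assoc add_ac)
  qed
  finally have "(\<Sum>j<8 + 16. eta ^ j * e j) = eta ^ 8 * y + g" .
  moreover have "8 + 16 = (24 :: nat)" by simp
  ultimately have "(\<Sum>j<24. eta ^ j * e j) = 0" by (simp only: eq)
  from eta_sum_zero[OF e this] have z: "e j = 0" if "j < 24" for j
    using that by blast
  have "c j = 0" if "j < 16" for j
    using z[of "8 + j"] that by (simp add: e_def)
  then have "?c1 = 0" by (intro sum.neutral) simp
  then have y3: "y = eta ^ 16 * ?c2" using y2 by simp
  have "?c2 \<in> modular_ring" by (rule eta_sum_modular) (rule c(1))
  from that[OF this y3] show thesis .
qed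

section \<open>The module of even Jacobi forms\<close>

text \<open>Multiplication by modular forms preserves the direct sums, as it does on the generators of the ring.\<close>

definition theta_span :: "(int \<times> int \<Rightarrow> complex) \<Rightarrow> (int \<Rightarrow> bool) \<Rightarrow> (uhp \<times> (complex^2) \<Rightarrow> complex) set" where
  "theta_span a P = cfun.span {\<phi>. \<exists>m h. P m \<and> theta_form a m h \<phi>}"

lemma theta_span_act:
  assumes P: "P = even \<or> P = odd" and f: "f \<in> modular_ring" and \<phi>: "\<phi> \<in> theta_span a P"
  shows "f \<odot> \<phi> \<in> theta_span a P"
  using f \<phi> unfolding modular_ring_def
proof (induction arbitrary: \<phi>)
  case (const c)
  have "(\<lambda>_. c) \<odot> \<phi> = cscale c \<phi>" by (auto simp: act_def cscale_def)
  with const show ?case unfolding theta_span_def by (simp add: cfun.span_scale)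
next
  case (gen f)
  obtain F v Q j n where F: "f = (\<lambda>\<tau>. F (of_uhp \<tau>))" "q_series (of_rat v) Q F" "v \<ge> 0" "v - of_int j / 24 \<in> \<int>"
    "\<forall>t. Im t > 0 \<longrightarrow> F (- 1 / t) * ceta t powi j = t powi n * ceta (- 1 / t) powi j * F t" "even n"
  proof -
    obtain P4 P6 where E: "mform 4 P4 cE4" "P4 0 = 1" "mform 6 P6 cE6" "P6 0 = 1" by (rule mform_eisenstein)
    obtain R where R: "q_series (1 / 24) R ceta" "R 0 = 1" "\<forall>w. R w \<noteq> 0" by (rule q_series_ceta)
    consider "f = E4" | "f = E6" | "f = eta"
      using gen(1) by blast
    then show thesis
    proof cases
      case 1
      show thesis
        by (rule that[of cE4 0 P4 0 4]) (use E 1 in \<open>auto simp: E4_eq mform_def weight_def simp del: divide_minus_left\<close>)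
    next
      case 2
      show thesis
        by (rule that[of cE6 0 P6 0 6]) (use E 2 in \<open>auto simp: E6_eq mform_def weight_def simp del: divide_minus_left\<close>)
    next
      case 3
      show thesis by (rule that[of ceta "1 / 24" R 1 0]) (use R 3 in \<open>auto simp: eta_eq of_rat_divide\<close>)
    qed
  qed
  from gen(2) show ?case unfolding theta_span_def
  proof (induction rule: cfun.span_induct_alt)
    case base
    have "f \<odot> 0 = 0" by (auto simp: act_def)
    then show ?case using cfun.span_zero by metis
  next
    case (step c \<phi> \<psi>)
    from step(1) obtain m h where "P m" "theta_form a m h \<phi>" by blast
    then have "theta_form a (m + n) (h + j) (f \<odot> \<phi>)" "P (m + n)"
      using theta_form_mult[of a m h \<phi> v Q F j n] F P by auto
    then have "f \<odot> \<phi> \<in> cfun.span {\<phi>. \<exists>m h. P m \<and> theta_form a m h \<phi>}"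
      by (intro cfun.span_base) blast
    moreover have e: "f \<odot> (cscale c \<phi> + \<psi>) = cscale c (f \<odot> \<phi>) + f \<odot> \<psi>"
      by (auto simp: act_def cscale_def algebra_simps)
    ultimately show ?case unfolding e by (intro cfun.span_add cfun.span_scale step(2))
  qed
next
  case (add f g)
  have e: "(f + g) \<odot> \<phi> = f \<odot> \<phi> + g \<odot> \<phi>" by (auto simp: act_def algebra_simps)
  have "f \<odot> \<phi> \<in> theta_span a P" "g \<odot> \<phi> \<in> theta_span a P" using add by blast+
  then show ?case unfolding theta_span_def e by (rule cfun.span_add)
next
  case (mult f g)
  have e: "(f * g) \<odot> \<phi> = f \<odot> (g \<odot> \<phi>)" by (auto simp: act_def mult.assoc)
  show ?case unfolding e by (intro mult)
qed

lemma theta_span_subset: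
  assumes P: "P = even \<or> P = odd" and a: "a = classP \<or> a = classN"
  shows "theta_span a P \<subseteq> jacobi_parity P A2"
  unfolding theta_span_def
proof (rule cfun.span_minimal)
  show "cfun.subspace (jacobi_parity P A2)" unfolding jacobi_parity_def by (rule cfun.subspace_span)
  show "{\<phi>. \<exists>m h. P m \<and> theta_form a m h \<phi>} \<subseteq> jacobi_parity P A2"
  proof
    fix \<phi> assume "\<phi> \<in> {\<phi>. \<exists>m h. P m \<and> theta_form a m h \<phi>}"
    then obtain m h where m: "P m" and "theta_form a m h \<phi>" by blast
    then have "\<phi> \<in> jacobi_forms A2 (of_int h / 2 + of_int m) h" using theta_form_jacobi[OF a] by blast
    then have \<phi>: "\<phi> \<in> jacobi_forms A2 (of_int h / 2 + of_int m) (h mod 24)"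
      by (simp only: jacobi_forms_mod_24)
    have "of_int (x + 24 * y) / 2 + of_int m - of_int x / 2 = (of_int (m + 12 * y) :: rat)" for x y
      by (simp add: field_simps)
    from this[of "h mod 24" "h div 24"]
    have "of_int h / 2 + of_int m - of_int (h mod 24) / 2 = (of_int (m + 12 * (h div 24)) :: rat)"
      by (simp only: mod_mult_div_eq)
    moreover have "P (m + 12 * (h div 24))" using m P by auto
    ultimately have "\<phi> \<in> jacobi_parity_char P A2 (h mod 24)"
      unfolding jacobi_parity_char_def using \<phi> by (intro cfun.span_base) blast
    moreover have "h mod 24 \<in> {0..23}" using pos_mod_bound[of 24 h] pos_mod_sign[of 24 h] by auto
    ultimately show "\<phi> \<in> jacobi_parity P A2" unfolding jacobi_parity_def by (intro cfun.span_base) blast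
  qed
qed

lemma jacobi_parity_subset:
  assumes R: "cfun.subspace R"
    and J: "\<And>m h \<phi>. P m \<Longrightarrow> 0 \<le> h \<Longrightarrow> h \<le> 23 \<Longrightarrow> \<phi> \<in> jacobi_forms A2 (of_int h / 2 + of_int m) h \<Longrightarrow> \<phi> \<in> R"
  shows "jacobi_parity P A2 \<subseteq> R"
  unfolding jacobi_parity_def
proof (rule cfun.span_minimal[OF _ R], rule UN_least)
  fix h :: int assume h: "h \<in> {0..23}"
  show "jacobi_parity_char P A2 h \<subseteq> R" unfolding jacobi_parity_char_def
  proof (rule cfun.span_minimal[OF _ R], rule subsetI)
    fix \<phi> assume "\<phi> \<in> \<Union>{jacobi_forms A2 k h | k. \<exists>m. k - of_int h / 2 = of_int m \<and> P m}"
    then obtain k m where k: "\<phi> \<in> jacobi_forms A2 k h" "k - of_int h / 2 = of_int m" "P m" by blast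
    then have "k = of_int h / 2 + of_int m" by (simp add: algebra_simps)
    with k h show "\<phi> \<in> R"
      by (intro J[of m h]) auto
  qed
qed

lemma jacobi_odd:
  assumes "A2_identification \<psi>"
  shows "jacobi_parity odd A2 = {f \<odot> theta_A2 \<psi> | f. f \<in> modular_ring}"
proof -
  let ?N = "\<lambda>(\<tau>, z). ThN (of_uhp \<tau>) z"
  obtain s :: complex where s: "s = 1 \<or> s = - 1" "\<And>\<tau> z. theta_A2 \<psi> (\<tau>, z) = s * ThN (of_uhp \<tau>) z"
    by (rule theta_A2_eq[OF assms]) blast
  have eq: "f \<odot> theta_A2 \<psi> = ((\<lambda>_. s) * f) \<odot> ?N" "f \<odot> ?N = ((\<lambda>_. s) * f) \<odot> theta_A2 \<psi>" for f
    using s(1) by (auto simp: act_def s(2) fun_eq_iff)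
  have *: "{f \<odot> theta_A2 \<psi> | f. f \<in> modular_ring} = {f \<odot> ?N | f. f \<in> modular_ring}"
  proof (intro equalityI subsetI)
    fix x assume "x \<in> {f \<odot> theta_A2 \<psi> | f. f \<in> modular_ring}"
    then show "x \<in> {f \<odot> ?N | f. f \<in> modular_ring}"
      using eq(1) modular_ring_mult[OF modular_ring_const] by blast
  next
    fix x assume "x \<in> {f \<odot> ?N | f. f \<in> modular_ring}"
    then show "x \<in> {f \<odot> theta_A2 \<psi> | f. f \<in> modular_ring}"
      using eq(2) modular_ring_mult[OF modular_ring_const] by blast
  qed
  have "jacobi_parity odd A2 \<subseteq> {f \<odot> ?N | f. f \<in> modular_ring}"
  proof (rule jacobi_parity_subset)
    show "cfun.subspace {f \<odot> ?N | f. f \<in> modular_ring}"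
    proof (rule cfun.subspaceI)
      have "0 = 0 \<odot> ?N" by (auto simp: act_def fun_eq_iff)
      then show "0 \<in> {f \<odot> ?N | f. f \<in> modular_ring}" using modular_ring_0 by blast
    next
      fix x y assume "x \<in> {f \<odot> ?N | f. f \<in> modular_ring}" "y \<in> {f \<odot> ?N | f. f \<in> modular_ring}"
      then obtain f g where "x = f \<odot> ?N" "y = g \<odot> ?N" "f \<in> modular_ring" "g \<in> modular_ring"
        by blast
      moreover have "f \<odot> ?N + g \<odot> ?N = (f + g) \<odot> ?N"
        by (auto simp: act_def fun_eq_iff algebra_simps)
      ultimately show "x + y \<in> {f \<odot> ?N | f. f \<in> modular_ring}" using modular_ring_add by blast
    next
      fix c x assume "x \<in> {f \<odot> ?N | f. f \<in> modular_ring}"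
      then obtain f where "x = f \<odot> ?N" "f \<in> modular_ring" by blast
      moreover have "cscale c (f \<odot> ?N) = ((\<lambda>_. c) * f) \<odot> ?N"
        by (auto simp: act_def fun_eq_iff cscale_def)
      ultimately show "cscale c x \<in> {f \<odot> ?N | f. f \<in> modular_ring}"
        using modular_ring_mult[OF modular_ring_const] by blast
    qed
  next
    fix m h \<phi>
    assume "odd m" "0 \<le> h" "h \<le> 23" "\<phi> \<in> jacobi_forms A2 (of_int h / 2 + of_int m) h"
    then show "\<phi> \<in> {f \<odot> ?N | f. f \<in> modular_ring}"
      using jacobi_odd_decomposition[of \<phi> h m] by blast
  qed
  moreover have "{f \<odot> ?N | f. f \<in> modular_ring} \<subseteq> jacobi_parity odd A2"
  proof
    have N: "?N \<in> theta_span classN odd" unfolding theta_span_def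
      by (rule cfun.span_base, rule CollectI, rule exI[of _ "- 3"], rule exI[of _ 8], rule conjI[OF _ theta_form_ThN]) simp
    fix x assume "x \<in> {f \<odot> ?N | f. f \<in> modular_ring}"
    then obtain f where f: "x = f \<odot> ?N" "f \<in> modular_ring" by blast
    show "x \<in> jacobi_parity odd A2" unfolding f(1)
      by (rule subsetD[OF theta_span_subset[OF disjI2[OF refl] disjI2[OF refl]] theta_span_act[OF disjI2[OF refl] f(2) N]])
  qed
  ultimately show ?thesis unfolding * by (rule equalityI)
qed

lemma vector_4:
  "(vector [x, y, z, w] :: ('a::zero)^4)$1 = x" "(vector [x, y, z, w] :: ('a::zero)^4)$2 = y"
  "(vector [x, y, z, w] :: ('a::zero)^4)$3 = z" "(vector [x, y, z, w] :: ('a::zero)^4)$4 = w"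
proof -
  have "card (UNIV :: 4 set) = 4" by simp
  then have "distinct [1, 2, 3, 4 :: 4]" unfolding UNIV_4 by (intro card_distinct) simp
  then have "(2 :: 4) \<noteq> 1" "(3 :: 4) \<noteq> 1" "(3 :: 4) \<noteq> 2" "(4 :: 4) \<noteq> 1" "(4 :: 4) \<noteq> 2" "(4 :: 4) \<noteq> 3"
    by auto
  then show "(vector [x, y, z, w] :: ('a::zero)^4)$1 = x" "(vector [x, y, z, w] :: ('a::zero)^4)$2 = y"
    "(vector [x, y, z, w] :: ('a::zero)^4)$3 = z" "(vector [x, y, z, w] :: ('a::zero)^4)$4 = w"
    unfolding vector_def by auto
qed

lemma times_E_eq: "times_E x = x$1 \<odot> E28 + x$2 \<odot> E48 + x$3 \<odot> E40 + x$4 \<odot> E60"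
  unfolding times_E_def E_column_def sum_4 vector_4 by (rule refl)

lemma times_E_vector: "f1 \<odot> E28 + f2 \<odot> E48 + f3 \<odot> E40 + f4 \<odot> E60 = times_E (vector [f1, f2, f3, f4])"
  unfolding times_E_eq vector_4 by (rule refl)

lemma modular_ring4_vector: "vector [f1, f2, f3, f4] \<in> modular_ring4 \<longleftrightarrow>
    f1 \<in> modular_ring \<and> f2 \<in> modular_ring \<and> f3 \<in> modular_ring \<and> f4 \<in> modular_ring"
  unfolding modular_ring4_def mem_Collect_eq forall_4 vector_4 by (rule refl)

lemma times_E_image: "times_E ` modular_ring4 = {f1 \<odot> E28 + f2 \<odot> E48 + f3 \<odot> E40 + f4 \<odot> E60 | f1 f2 f3 f4.
    f1 \<in> modular_ring \<and> f2 \<in> modular_ring \<and> f3 \<in> modular_ring \<and> f4 \<in> modular_ring}"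
proof (intro equalityI subsetI)
  fix y assume "y \<in> times_E ` modular_ring4"
  then obtain x where "x \<in> modular_ring4" "y = times_E x" by blast
  then show "y \<in> {f1 \<odot> E28 + f2 \<odot> E48 + f3 \<odot> E40 + f4 \<odot> E60 | f1 f2 f3 f4.
    f1 \<in> modular_ring \<and> f2 \<in> modular_ring \<and> f3 \<in> modular_ring \<and> f4 \<in> modular_ring}"
    unfolding times_E_eq modular_ring4_def by blast
next
  fix y assume "y \<in> {f1 \<odot> E28 + f2 \<odot> E48 + f3 \<odot> E40 + f4 \<odot> E60 | f1 f2 f3 f4.
    f1 \<in> modular_ring \<and> f2 \<in> modular_ring \<and> f3 \<in> modular_ring \<and> f4 \<in> modular_ring}"
  then show "y \<in> times_E ` modular_ring4" unfolding times_E_vector using modular_ring4_vector by blast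
qed

lemma jacobi_even: "jacobi_parity even A2 = times_E ` modular_ring4"
proof
  show "jacobi_parity even A2 \<subseteq> times_E ` modular_ring4"
  proof (rule jacobi_parity_subset)
    show "cfun.subspace (times_E ` modular_ring4)"
    proof (rule cfun.subspaceI)
      have "0 \<in> modular_ring4" "times_E 0 = 0"
        by (simp_all add: modular_ring4_def modular_ring_0 times_E_eq act_def fun_eq_iff)
      then show "0 \<in> times_E ` modular_ring4" by force
    next
      fix x y assume "x \<in> times_E ` modular_ring4" "y \<in> times_E ` modular_ring4"
      then obtain u v where "x = times_E u" "y = times_E v" "u \<in> modular_ring4" "v \<in> modular_ring4" by blast
      moreover have "times_E u + times_E v = times_E (u + v)"
        by (auto simp: times_E_eq act_def fun_eq_iff algebra_simps)
      moreover have "u + v \<in> modular_ring4" if "u \<in> modular_ring4" "v \<in> modular_ring4"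
        using that modular_ring_add by (simp add: modular_ring4_def)
      ultimately show "x + y \<in> times_E ` modular_ring4" by blast
    next
      fix c x assume "x \<in> times_E ` modular_ring4"
      then obtain u where "x = times_E u" "u \<in> modular_ring4" by blast
      moreover have "cscale c (times_E u) = times_E (\<chi> i. (\<lambda>_. c) * u$i)"
        by (auto simp: times_E_eq act_def fun_eq_iff cscale_def algebra_simps)
      moreover have "(\<chi> i. (\<lambda>_. c) * u$i) \<in> modular_ring4" if "u \<in> modular_ring4"
        using that modular_ring_mult[OF modular_ring_const] by (simp add: modular_ring4_def)
      ultimately show "cscale c x \<in> times_E ` modular_ring4" by blast
    qed
  next
    fix m h \<phi>
    assume "even m" "0 \<le> h" "h \<le> 23" "\<phi> \<in> jacobi_forms A2 (of_int h / 2 + of_int m) h"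
    then show "\<phi> \<in> times_E ` modular_ring4"
      unfolding times_E_image using jacobi_even_decomposition[of \<phi> h m] by blast
  qed
  have gens: "E28 \<in> theta_span classP even" "E48 \<in> theta_span classP even" "E40 \<in> theta_span classP even" "E60 \<in> theta_span classP even"
  proof -
    have gen: "\<phi> \<in> theta_span classP even" if "theta_form classP m h \<phi>" "even m" for m h \<phi>
      unfolding theta_span_def using that by (intro cfun.span_base) blast
    show "E28 \<in> theta_span classP even" by (rule gen[OF theta_form_E28]) simp
    show "E48 \<in> theta_span classP even" by (rule gen[OF theta_form_E48]) simp
    show "E40 \<in> theta_span classP even" by (rule gen[OF theta_form_E40]) simp
    show "E60 \<in> theta_span classP even" by (rule gen[OF theta_form_E60]) simp
  qed
  show "times_E ` modular_ring4 \<subseteq> jacobi_parity even A2"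
  proof
    fix y assume "y \<in> times_E ` modular_ring4"
    then obtain x where x: "x \<in> modular_ring4" "y = times_E x" by blast
    have a: "f \<odot> \<phi> \<in> theta_span classP even" if "f \<in> modular_ring" "\<phi> \<in> theta_span classP even" for f \<phi>
      using that by (intro theta_span_act) simp_all
    have p: "f + g \<in> theta_span classP even" if "f \<in> theta_span classP even" "g \<in> theta_span classP even" for f g
      using that unfolding theta_span_def by (rule cfun.span_add)
    have "y \<in> theta_span classP even"
      unfolding x(2) times_E_eq using x(1) unfolding modular_ring4_def by (intro p a gens) blast+
    then show "y \<in> jacobi_parity even A2" using theta_span_subset[of even classP] by blast
  qed
qed

lemma times_B_nth:
  "times_B x$1 = E6 * x$1 + E4 ^ 2 * x$2 + 12 ^ 3 * eta ^ 16 * x$3"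
  "times_B x$2 = E4 * x$1 + E6 * x$2 + 12 ^ 3 * eta ^ 16 * x$4"
  "times_B x$3 = - (eta ^ 8) * x$1 + E6 * x$3 - E4 ^ 2 * x$4"
  "times_B x$4 = - (eta ^ 8) * x$2 - E4 * x$3 + E6 * x$4"
  by (simp_all add: times_B_def vector_matrix_mult_def B_matrix_def sum_4 vector_4)

lemma times_E_apply:
  "eta \<tau> ^ 8 * times_E y (\<tau>, z) =
     (eta \<tau> ^ 8 * (y$1) \<tau> + (y$3) \<tau> * E6 \<tau> + (y$4) \<tau> * E4 \<tau> ^ 2) * E28 (\<tau>, z) +
     (eta \<tau> ^ 8 * (y$2) \<tau> + (y$3) \<tau> * E4 \<tau> + (y$4) \<tau> * E6 \<tau>) * E48 (\<tau>, z)"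
proof -
  have "eta \<tau> ^ 8 * E40 (\<tau>, z) = E6 \<tau> * E28 (\<tau>, z) + E4 \<tau> * E48 (\<tau>, z)"
    "eta \<tau> ^ 8 * E60 (\<tau>, z) = E4 \<tau> ^ 2 * E28 (\<tau>, z) + E6 \<tau> * E48 (\<tau>, z)"
    by (simp_all add: E40_def E60_def)
  moreover have "eta \<tau> ^ 8 * times_E y (\<tau>, z) = eta \<tau> ^ 8 * (y$1) \<tau> * E28 (\<tau>, z) + eta \<tau> ^ 8 * (y$2) \<tau> * E48 (\<tau>, z)
      + (y$3) \<tau> * (eta \<tau> ^ 8 * E40 (\<tau>, z)) + (y$4) \<tau> * (eta \<tau> ^ 8 * E60 (\<tau>, z))"
    by (simp add: times_E_eq act_def algebra_simps)
  ultimately show ?thesis by (simp add: algebra_simps)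
qed

lemma E28_E48_independent:
  assumes "\<And>z. u * E28 (\<tau>, z) + v * E48 (\<tau>, z) = 0"
  shows "u = 0" "v = 0"
proof -
  define t where "t = of_uhp \<tau>"
  have t: "Im t > 0" by (simp add: t_def)
  have "(v * U0 t - u * A1 t) * Th0 t z + (u * A0 t + v * U1 t) * ThP t z = 0 * Th0 t z + 0 * ThP t z" for z
    using assms[of z] by (simp add: E28_eq E48_eq cE28_def cE48_def t_def[symmetric] algebra_simps)
  from Th0_ThP_independent[OF t this]
  have 1: "v * U0 t - u * A1 t = 0" "u * A0 t + v * U1 t = 0" by blast+
  have W: "U1 t * A1 t + U0 t * A0 t \<noteq> 0" using wronskian[OF t] by simp
  have e: "u * (U1 t * A1 t + U0 t * A0 t) = U0 t * (u * A0 t + v * U1 t) - U1 t * (v * U0 t - u * A1 t)"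
    "v * (U1 t * A1 t + U0 t * A0 t) = A1 t * (u * A0 t + v * U1 t) + A0 t * (v * U0 t - u * A1 t)"
    by (simp_all add: algebra_simps)
  have "u * (U1 t * A1 t + U0 t * A0 t) = 0" "v * (U1 t * A1 t + U0 t * A0 t) = 0" unfolding e 1 by simp_all
  with W show "u = 0" "v = 0" by (simp_all only: mult_eq_0_iff simp_thms)
qed

lemma times_E_zero_iff:
  "times_E y = 0 \<longleftrightarrow> eta ^ 8 * y$1 + y$3 * E6 + y$4 * E4 ^ 2 = 0 \<and> eta ^ 8 * y$2 + y$3 * E4 + y$4 * E6 = 0"
  (is "?L \<longleftrightarrow> ?a = 0 \<and> ?b = 0")
proof
  assume L: ?L
  have "?a \<tau> * E28 (\<tau>, z) + ?b \<tau> * E48 (\<tau>, z) = 0" for \<tau> z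
    using times_E_apply[of \<tau> y z] L by (simp add: fun_power_apply)
  from E28_E48_independent[OF this] show "?a = 0 \<and> ?b = 0"
    by (simp add: fun_eq_iff del: plus_fun_apply)
next
  assume R: "?a = 0 \<and> ?b = 0"
  have "times_E y (\<tau>, z) = 0" for \<tau> z
  proof -
    have "eta \<tau> ^ 8 * times_E y (\<tau>, z) = ?a \<tau> * E28 (\<tau>, z) + ?b \<tau> * E48 (\<tau>, z)"
      unfolding times_E_apply by (simp add: fun_power_apply)
    then show ?thesis using R by simp
  qed
  then show ?L
    by (auto simp: fun_eq_iff)
qed

lemma eta_cancel: "eta ^ n * f = eta ^ n * g \<Longrightarrow> f = g"
proof
  fix \<tau> assume "eta ^ n * f = eta ^ n * g"
  then have "(eta ^ n * f) \<tau> = (eta ^ n * g) \<tau>" by simp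
  then show "f \<tau> = g \<tau>" by (simp add: fun_power_apply)
qed

lemma Delta_ring: "E4 ^ 3 = E6 ^ 2 + 12 ^ 3 * eta ^ 24"
proof -
  have "(12 :: uhp \<Rightarrow> complex) ^ 3 = 1728" by simp
  then show ?thesis using E4_E6_discriminant by (simp add: algebra_simps)
qed

text \<open>
  The first two rows of \<open>B\<close> reduce the last two components of a relation modulo \<open>eta ^ 8\<close>. By
  \<open>eta_8_divides\<close> the first two are then divisible by \<open>eta ^ 16\<close>, and the relation is a combination of the last two
  rows, found by inverting the matrix of \<open>(E6, E4\<^sup>2)\<close> and \<open>(E4, E6)\<close>, whose determinant is \<open>- 12\<^sup>3 eta ^ 24\<close>.
\<close>

lemma times_B_exact: "times_B ` modular_ring4 = {y \<in> modular_ring4. times_E y = 0}"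
proof (intro equalityI subsetI)
  fix y assume "y \<in> times_B ` modular_ring4"
  then obtain x where x: "\<And>i. x$i \<in> modular_ring" "y = times_B x" unfolding modular_ring4_def by blast
  have num: "12 \<in> modular_ring" unfolding numeral_fun by (rule modular_ring_const)
  have "y \<in> modular_ring4"
    unfolding modular_ring4_def mem_Collect_eq forall_4 x(2) times_B_nth diff_conv_add_uminus
    by (intro conjI modular_ring_add modular_ring_mult modular_ring_power modular_ring_uminus modular_ring_gens x num)
  moreover have "times_E y = 0" unfolding times_E_zero_iff x(2) times_B_nth
  proof
    have e: "(eta :: uhp \<Rightarrow> complex) ^ 24 = eta ^ 8 * eta ^ 16" by (simp flip: power_add)
    have d: "E4 * E4 ^ 2 = E6 * E6 + 12 ^ 3 * (eta ^ 8 * eta ^ 16)"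
      using Delta_ring unfolding e by (simp add: power2_eq_square power3_eq_cube mult.assoc)
    show "eta ^ 8 * (E6 * x$1 + E4\<^sup>2 * x$2 + 12 ^ 3 * eta ^ 16 * x$3) + (- (eta ^ 8) * x$1 + E6 * x$3 - E4\<^sup>2 * x$4) * E6 +
      (- (eta ^ 8) * x$2 - E4 * x$3 + E6 * x$4) * E4\<^sup>2 = 0"
    proof -
      have "eta ^ 8 * (E6 * x$1 + E4\<^sup>2 * x$2 + 12 ^ 3 * eta ^ 16 * x$3) + (- (eta ^ 8) * x$1 + E6 * x$3 - E4\<^sup>2 * x$4) * E6 +
        (- (eta ^ 8) * x$2 - E4 * x$3 + E6 * x$4) * E4\<^sup>2 = x$3 * (E6 * E6 + 12 ^ 3 * (eta ^ 8 * eta ^ 16) - E4 * E4 ^ 2)"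
        by (simp only: ring_distribs mult_ac add_ac diff_conv_add_uminus minus_mult_left minus_add_distrib minus_minus) (simp add: mult_ac)
      then show ?thesis unfolding d by simp
    qed
    show "eta ^ 8 * (E4 * x$1 + E6 * x$2 + 12 ^ 3 * eta ^ 16 * x$4) + (- (eta ^ 8) * x$1 + E6 * x$3 - E4\<^sup>2 * x$4) * E4 +
      (- (eta ^ 8) * x$2 - E4 * x$3 + E6 * x$4) * E6 = 0"
    proof -
      have "eta ^ 8 * (E4 * x$1 + E6 * x$2 + 12 ^ 3 * eta ^ 16 * x$4) + (- (eta ^ 8) * x$1 + E6 * x$3 - E4\<^sup>2 * x$4) * E4 +
        (- (eta ^ 8) * x$2 - E4 * x$3 + E6 * x$4) * E6 = x$4 * (E6 * E6 + 12 ^ 3 * (eta ^ 8 * eta ^ 16) - E4 * E4 ^ 2)"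
        by (simp only: ring_distribs mult_ac add_ac diff_conv_add_uminus minus_mult_left minus_add_distrib minus_minus) (simp add: mult_ac)
      then show ?thesis unfolding d by simp
    qed
  qed
  ultimately show "y \<in> {y \<in> modular_ring4. times_E y = 0}" by blast
next
  fix y assume "y \<in> {y \<in> modular_ring4. times_E y = 0}"
  then have y: "\<And>i. y$i \<in> modular_ring"
    and y1: "eta ^ 8 * y$1 + y$3 * E6 + y$4 * E4 ^ 2 = 0" and y2: "eta ^ 8 * y$2 + y$3 * E4 + y$4 * E6 = 0"
    unfolding modular_ring4_def mem_Collect_eq times_E_zero_iff by blast+
  obtain a a' where a: "a \<in> eta_sums 8" "a' \<in> modular_ring" "y$3 = a + eta ^ 8 * a'"
    by (rule eta_sums_split[OF y[of 3]])
  obtain b b' where b: "b \<in> eta_sums 8" "b' \<in> modular_ring" "y$4 = b + eta ^ 8 * b'"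
    by (rule eta_sums_split[OF y[of 4]])
  have l: "E4 \<in> level_one" "E6 \<in> level_one" "E4 ^ 2 \<in> level_one"
    by (intro generated_algebra_power generated_algebra.gen; simp)+
  let ?u = "y$1 + E6 * a' + E4 ^ 2 * b'" and ?v = "y$2 + E4 * a' + E6 * b'"
  have eu: "eta ^ 8 * ?u + (E6 * a + E4 ^ 2 * b) = 0" using y1 unfolding a(3) b(3) by (simp add: algebra_simps)
  have ev: "eta ^ 8 * ?v + (E4 * a + E6 * b) = 0" using y2 unfolding a(3) b(3) by (simp add: algebra_simps)
  have mem: "?u \<in> modular_ring" "?v \<in> modular_ring"
    by (intro modular_ring_add modular_ring_mult modular_ring_power modular_ring_gens y a b)+
  have mem8: "E6 * a + E4 ^ 2 * b \<in> eta_sums 8" "E4 * a + E6 * b \<in> eta_sums 8"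
    by (intro eta_sums_add eta_sums_mult a b l)+
  obtain c where c: "c \<in> modular_ring" "?u = eta ^ 16 * c" by (rule eta_8_divides[OF mem(1) mem8(1) eu])
  obtain d where d: "d \<in> modular_ring" "?v = eta ^ 16 * d" by (rule eta_8_divides[OF mem(2) mem8(2) ev])
  have e: "(eta :: uhp \<Rightarrow> complex) ^ 24 = eta ^ 8 * eta ^ 16" by (simp flip: power_add)
  have 1: "E6 * a + E4 ^ 2 * b = - (eta ^ 24 * c)" "E4 * a + E6 * b = - (eta ^ 24 * d)"
    using eu ev unfolding c(2) d(2) e by (simp_all add: eq_neg_iff_add_eq_0 add.commute mult.assoc)
  have "eta ^ 24 * (12 ^ 3 * a) = eta ^ 24 * (E6 * c - E4 ^ 2 * d)"
  proof -
    have "eta ^ 24 * (12 ^ 3 * a) = (E4 ^ 3 - E6 ^ 2) * a" unfolding Delta_ring by (simp add: mult_ac)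
    also have "\<dots> = E4 ^ 2 * (E4 * a + E6 * b) - E6 * (E6 * a + E4 ^ 2 * b)"
      by (simp add: algebra_simps power2_eq_square power3_eq_cube)
    also have "\<dots> = eta ^ 24 * (E6 * c - E4 ^ 2 * d)" unfolding 1 by (simp add: algebra_simps)
    finally show ?thesis .
  qed
  then have A: "12 ^ 3 * a = E6 * c - E4 ^ 2 * d" by (rule eta_cancel)
  have "eta ^ 24 * (12 ^ 3 * b) = eta ^ 24 * (E6 * d - E4 * c)"
  proof -
    have "eta ^ 24 * (12 ^ 3 * b) = (E4 ^ 3 - E6 ^ 2) * b" unfolding Delta_ring by (simp add: mult_ac)
    also have "\<dots> = E4 * (E6 * a + E4 ^ 2 * b) - E6 * (E4 * a + E6 * b)"
      by (simp add: algebra_simps power2_eq_square power3_eq_cube)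
    also have "\<dots> = eta ^ 24 * (E6 * d - E4 * c)" unfolding 1 by (simp add: algebra_simps)
    finally show ?thesis .
  qed
  then have B: "12 ^ 3 * b = E6 * d - E4 * c" by (rule eta_cancel)
  define k :: "uhp \<Rightarrow> complex" where "k = (\<lambda>_. 1 / 12 ^ 3)"
  have k: "12 ^ 3 * k = 1" "k \<in> modular_ring"
    using modular_ring_const by (auto simp: k_def fun_eq_iff fun_power_apply)
  let ?x = "vector [- a', - b', k * c, k * d] :: (uhp \<Rightarrow> complex)^4"
  have "?x \<in> modular_ring4"
    unfolding modular_ring4_vector by (intro conjI modular_ring_mult modular_ring_uminus a b c d k)
  moreover have "times_B ?x = y"
  proof -
    have kk: "12 ^ 3 * eta ^ 16 * (k * f) = eta ^ 16 * f" for f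
    proof -
      have "12 ^ 3 * eta ^ 16 * (k * f) = (12 ^ 3 * k) * (eta ^ 16 * f)" by (simp only: mult_ac)
      then show ?thesis by (simp only: k mult_1)
    qed
    have ka: "k * (12 ^ 3 * f) = f" for f
      by (simp only: mult.assoc[symmetric] mult.commute[of k] k mult_1)
    have "times_B ?x$1 = y$1" unfolding times_B_nth vector_4 kk c(2)[symmetric] by simp
    moreover have "times_B ?x$2 = y$2" unfolding times_B_nth vector_4 kk d(2)[symmetric] by simp
    moreover have "times_B ?x$3 = y$3"
    proof -
      have "times_B ?x$3 = eta ^ 8 * a' + k * (E6 * c - E4 ^ 2 * d)"
        unfolding times_B_nth vector_4 by (simp add: algebra_simps)
      then show ?thesis unfolding A[symmetric] ka a(3) by (simp only: add.commute)
    qed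
    moreover have "times_B ?x$4 = y$4"
    proof -
      have "times_B ?x$4 = eta ^ 8 * b' + k * (E6 * d - E4 * c)"
        unfolding times_B_nth vector_4 by (simp add: algebra_simps)
      then show ?thesis unfolding B[symmetric] ka b(3) by (simp only: add.commute)
    qed
    ultimately show ?thesis by (simp add: vec_eq_iff forall_4)
  qed
  ultimately show "y \<in> times_B ` modular_ring4" by blast
qed

theorem theorem5p2:
  fixes \<psi> :: "rat^2 \<Rightarrow> int"
  assumes "A2_identification \<psi>"
  shows "jacobi_parity odd A2 = {f \<odot> theta_A2 \<psi> | f. f \<in> modular_ring} \<and>
         jacobi_parity even A2 =
           {f1 \<odot> E28 + f2 \<odot> E48 + f3 \<odot> E40 + f4 \<odot> E60 | f1 f2 f3 f4.
              f1 \<in> modular_ring \<and> f2 \<in> modular_ring \<and> f3 \<in> modular_ring \<and> f4 \<in> modular_ring} \<and>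
         exact_at modular_ring4 times_B modular_ring4 times_E (jacobi_parity even A2) \<and>
         exact_at modular_ring4 times_E (jacobi_parity even A2)
           (\<lambda>_. 0 :: uhp \<times> (complex^2) \<Rightarrow> complex) {0}"
proof (intro conjI)
  show "jacobi_parity odd A2 = {f \<odot> theta_A2 \<psi> | f. f \<in> modular_ring}" by (rule jacobi_odd[OF assms])
  show "jacobi_parity even A2 =
           {f1 \<odot> E28 + f2 \<odot> E48 + f3 \<odot> E40 + f4 \<odot> E60 | f1 f2 f3 f4.
              f1 \<in> modular_ring \<and> f2 \<in> modular_ring \<and> f3 \<in> modular_ring \<and> f4 \<in> modular_ring}"
    unfolding jacobi_even by (rule times_E_image)
  show "exact_at modular_ring4 times_B modular_ring4 times_E (jacobi_parity even A2)"
    unfolding exact_at_def jacobi_even using times_B_exact by blast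
  show "exact_at modular_ring4 times_E (jacobi_parity even A2)
           (\<lambda>_. 0 :: uhp \<times> (complex^2) \<Rightarrow> complex) {0}"
    unfolding exact_at_def jacobi_even by auto
qed

end
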